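(* Let $1 \le p \le \infty$, and let $k, m$ be integers such that $k \ge 1$ and $0 \le m \le k$. Then there exists a constant $C$, depending only on $k$ and $p$ (in particular, independent of the geometry of the triangle), such that for every triangle $K \subset \mathbb{R}^2$ and every $v \in W^{k+1,p}(K)$, $$|v - \mathcal{I}_K^k v|_{m,p,K} \le C \left(\frac{R_K}{h_K}\right)^m h_K^{k+1-m}\, |v|_{k+1,p,K} = C R_K^m h_K^{k+1-2m}\, |v|_{k+1,p,K},$$ where $h_K$ is the length of the longest edge of $K$, $R_K$ is the circumradius of $K$, and $\mathcal{I}_K^k$ is the $k$th-order Lagrange interpolation on $K$.
   Context: Triangles are nondegenerate. $W^{k,p}(K)$ is the usual Sobolev space on (the interior of) $K$, with semi-norms $|v|_{j,p,K} := \bigl(\sum_{|\delta|=j} \|\partial^\delta v\|_{L^p(K)}^p\bigr)^{1/p}$ for $1 \le p < \infty$ and $|v|_{j,\infty,K} := \max_{|\delta|=j} \operatorname{ess\,sup}_{K} |\partial^\delta v|$, where $\delta \in \mathbb{N}_0^2$ is a multi-index; for $j=0$ this is the $L^p(K)$ norm. Since $k+1 \ge 2$, one has the continuous imbedding $W^{k+1,p}(K) \subset C^0(\overline{K})$ for all $1 \le p \le \infty$, so point values of $v \in W^{k+1,p}(K)$ are those of its continuous representative. Let notation be as follows: $x_1, x_2, x_3$ are the vertices of $K$, and points of $K$ are described by barycentric coordinates $(\lambda_1,\lambda_2,\lambda_3)$ with respect to $x_1,x_2,x_3$. Define $$\Sigma^k(K) := \left\{\left(\tfrac{a_1}{k},\tfrac{a_2}{k},\tfrac{a_3}{k}\right)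 \in K \;\Big|\; a_i \in \mathbb{N}_0,\ 0 \le a_i \le k,\ a_1+a_2+a_3 = k\right\}$$ (in barycentric coordinates). Let $\mathcal{P}_k$ be the set of polynomials in two variables of degree at most $k$. For $v \in C^0(\overline{K})$, the $k$th-order Lagrange interpolation $\mathcal{I}_K^k v \in \mathcal{P}_k$ is the unique element of $\mathcal{P}_k$ with $(\mathcal{I}_K^k v)(x) = v(x)$ for all $x \in \Sigma^k(K)$. *)

theory Defs
  imports "HOL-Analysis.Analysis" "HOL-Probability.Essential_Supremum"
begin

section \<open>Test functions and weak derivatives\<close>

definition partial :: "2 \<Rightarrow> (real^2 \<Rightarrow> real) \<Rightarrow> real^2 \<Rightarrow> real" where
  "partial i f x = frechet_derivative f (at x) (axis i 1)"

text \<open>A multi-index \<open>\<delta>\<close> is a pair \<open>(\<delta>\<^sub>1, \<delta>\<^sub>2)\<close> of natural numbers.\<close>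

definition mi_order :: "nat \<times> nat \<Rightarrow> nat" where
  "mi_order \<delta> = fst \<delta> + snd \<delta>"

definition multi_partial :: "nat \<times> nat \<Rightarrow> (real^2 \<Rightarrow> real) \<Rightarrow> real^2 \<Rightarrow> real" where
  "multi_partial \<delta> f = (partial 1 ^^ fst \<delta>) ((partial 2 ^^ snd \<delta>) f)"

text \<open>All iterated partial derivatives, in any order of differentiation, exist and are
  differentiable (hence continuous).\<close>

definition smooth :: "(real^2 \<Rightarrow> real) \<Rightarrow> bool" where
  "smooth f \<longleftrightarrow> (\<forall>is. foldr partial is f differentiable_on UNIV)"

definition test_function :: "(real^2) set \<Rightarrow> (real^2 \<Rightarrow> real) \<Rightarrow> bool" where
  "test_function \<Omega> \<phi> \<longleftrightarrow>
     smooth \<phi> \<and> (\<exists>S. compact S \<and> S \<subseteq> \<Omega> \<and> (\<forall>x. x \<notin> S \<longrightarrow> \<phi> x = 0))"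

definition locally_integrable :: "(real^2) set \<Rightarrow> (real^2 \<Rightarrow> real) \<Rightarrow> bool" where
  "locally_integrable \<Omega> u \<longleftrightarrow>
     (\<forall>S. compact S \<and> S \<subseteq> \<Omega> \<longrightarrow> set_integrable lebesgue S u)"

definition has_weak_deriv ::
  "(real^2) set \<Rightarrow> nat \<times> nat \<Rightarrow> (real^2 \<Rightarrow> real) \<Rightarrow> (real^2 \<Rightarrow> real) \<Rightarrow> bool" where
  "has_weak_deriv \<Omega> \<delta> u w \<longleftrightarrow>
     locally_integrable \<Omega> u \<and> locally_integrable \<Omega> w \<and>
     (\<forall>\<phi>. test_function \<Omega> \<phi> \<longrightarrow>
        (LINT x:\<Omega>|lebesgue. u x * multi_partial \<delta> \<phi> x)
          = (-1) ^ mi_order \<delta> * (LINT x:\<Omega>|lebesgue. w x * \<phi> x))"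

text \<open>Weak derivatives on an open set are unique up to null sets; only their \<open>L\<^sup>p\<close> norms,
  which do not depend on the chosen representative, are used.\<close>

definition weak_deriv ::
  "(real^2) set \<Rightarrow> nat \<times> nat \<Rightarrow> (real^2 \<Rightarrow> real) \<Rightarrow> real^2 \<Rightarrow> real" where
  "weak_deriv \<Omega> \<delta> u = (SOME w. has_weak_deriv \<Omega> \<delta> u w)"

section \<open>Lebesgue and Sobolev spaces\<close>

text \<open>The exponent is an extended real \<open>p \<ge> 1\<close>. The real-valued norms below are meaningful for
  members of the corresponding space only.\<close>

definition Lp_space :: "ereal \<Rightarrow> (real^2) set \<Rightarrow> (real^2 \<Rightarrow> real) set" where
  "Lp_space p \<Omega> = {f \<in> borel_measurable (lebesgue_on \<Omega>).
     if p = \<infinity> then esssup (lebesgue_on \<Omega>) (\<lambda>x. ereal \<bar>f x\<bar>) < \<infinity>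
     else integrable (lebesgue_on \<Omega>) (\<lambda>x. \<bar>f x\<bar> powr real_of_ereal p)}"

definition Lp_norm :: "ereal \<Rightarrow> (real^2) set \<Rightarrow> (real^2 \<Rightarrow> real) \<Rightarrow> real" where
  "Lp_norm p \<Omega> f =
     (if p = \<infinity> then real_of_ereal (esssup (lebesgue_on \<Omega>) (\<lambda>x. ereal \<bar>f x\<bar>))
      else (LINT x|lebesgue_on \<Omega>. \<bar>f x\<bar> powr real_of_ereal p) powr (1 / real_of_ereal p))"

definition sobolev_space :: "nat \<Rightarrow> ereal \<Rightarrow> (real^2) set \<Rightarrow> (real^2 \<Rightarrow> real) set" where
  "sobolev_space n p \<Omega> = {v \<in> Lp_space p \<Omega>.
     \<forall>\<delta>. mi_order \<delta> \<le> n \<longrightarrow> (\<exists>w \<in> Lp_space p \<Omega>. has_weak_deriv \<Omega> \<delta> v w)}"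

definition sobolev_seminorm :: "nat \<Rightarrow> ereal \<Rightarrow> (real^2) set \<Rightarrow> (real^2 \<Rightarrow> real) \<Rightarrow> real" where
  "sobolev_seminorm j p \<Omega> v =
     (if p = \<infinity> then Max ((\<lambda>\<delta>. Lp_norm p \<Omega> (weak_deriv \<Omega> \<delta> v)) ` {\<delta>. mi_order \<delta> = j})
      else (\<Sum>\<delta> | mi_order \<delta> = j. Lp_norm p \<Omega> (weak_deriv \<Omega> \<delta> v) powr real_of_ereal p)
             powr (1 / real_of_ereal p))"

text \<open>Elements of Sobolev spaces are represented by functions defined everywhere, so that point
  values have to be taken from the continuous representative on the closed set \<open>K\<close>. If \<open>K\<close> is
  the closure of its interior, this function is uniquely determined on \<open>K\<close> when it exists.\<close>

definition continuous_rep :: "(real^2) set \<Rightarrow> (real^2 \<Rightarrow> real) \<Rightarrow> real^2 \<Rightarrow> real" where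
  "continuous_rep K v =
     (SOME u. continuous_on K u \<and> (AE x in lebesgue_on (interior K). u x = v x))"

section \<open>Triangles\<close>

text \<open>A triangle is given by its vertices and is nondegenerate iff these are not collinear.\<close>

definition closed_triangle :: "real^2 \<Rightarrow> real^2 \<Rightarrow> real^2 \<Rightarrow> (real^2) set" where
  "closed_triangle x1 x2 x3 = convex hull {x1, x2, x3}"

definition longest_edge :: "real^2 \<Rightarrow> real^2 \<Rightarrow> real^2 \<Rightarrow> real" where
  "longest_edge x1 x2 x3 = Max {dist x1 x2, dist x2 x3, dist x3 x1}"

definition circumradius :: "real^2 \<Rightarrow> real^2 \<Rightarrow> real^2 \<Rightarrow> real" where
  "circumradius x1 x2 x3 =
     (THE r. \<exists>c. dist c x1 = r \<and> dist c x2 = r \<and> dist c x3 = r)"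

section \<open>Lagrange interpolation\<close>

definition poly_space :: "nat \<Rightarrow> (real^2 \<Rightarrow> real) set" where
  "poly_space k =
     {q. \<exists>c. \<forall>x. q x = (\<Sum>\<delta> | mi_order \<delta> \<le> k. c \<delta> * (x $ 1) ^ fst \<delta> * (x $ 2) ^ snd \<delta>)}"

definition lagrange_nodes :: "nat \<Rightarrow> real^2 \<Rightarrow> real^2 \<Rightarrow> real^2 \<Rightarrow> (real^2) set" where
  "lagrange_nodes k x1 x2 x3 =
     {(real a1 / real k) *\<^sub>R x1 + (real a2 / real k) *\<^sub>R x2 + (real a3 / real k) *\<^sub>R x3
      | a1 a2 a3 :: nat. a1 + a2 + a3 = k}"

definition lagrange_interp ::
  "nat \<Rightarrow> real^2 \<Rightarrow> real^2 \<Rightarrow> real^2 \<Rightarrow> (real^2 \<Rightarrow> real) \<Rightarrow> real^2 \<Rightarrow> real" where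
  "lagrange_interp k x1 x2 x3 v =
     (THE q. q \<in> poly_space k \<and> (\<forall>x \<in> lagrange_nodes k x1 x2 x3. q x = v x))"

definition sobolev_interp ::
  "nat \<Rightarrow> real^2 \<Rightarrow> real^2 \<Rightarrow> real^2 \<Rightarrow> (real^2 \<Rightarrow> real) \<Rightarrow> real^2 \<Rightarrow> real" where
  "sobolev_interp k x1 x2 x3 v =
     lagrange_interp k x1 x2 x3 (continuous_rep (closed_triangle x1 x2 x3) v)"

end

theory Submission
  imports Defs
begin

text \<open>
  Choose the numbering so that \<open>x\<^sub>1\<close> is opposite to the longest edge, and put
  \<open>u = x\<^sub>2 - x\<^sub>1\<close>, \<open>w = x\<^sub>3 - x\<^sub>1\<close>. Pulled back to the reference triangle, an error
  \<open>e = v - Iv\<close> vanishes at the nodes. Its divided differences of order \<open>(a, b)\<close> at the lattice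
  points are iterated averages of the mixed derivative \<open>\<partial>\<^sub>u\<^sup>a \<partial>\<^sub>w\<^sup>b e\<close>, so these
  averages vanish for \<open>a + b \<le> k\<close>, and a Poincare inequality bounds \<open>\<partial>\<^sub>u\<^sup>a \<partial>\<^sub>w\<^sup>b e\<close> by
  \<open>\<partial>\<^sub>u\<^sup>a\<^sup>+\<^sup>1 \<partial>\<^sub>w\<^sup>b e\<close> and \<open>\<partial>\<^sub>u\<^sup>a \<partial>\<^sub>w\<^sup>b\<^sup>+\<^sup>1 e\<close>. Downward induction reaches the order \<open>k + 1\<close>, where \<open>Iv\<close>
  has disappeared, and every derivative that is lost costs a factor \<open>|u|\<close> or \<open>|w|\<close>, at most \<open>h\<close>.
  It is essential that only mixed derivatives above \<open>(a, b)\<close> occur: the estimate in the directions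
  \<open>u\<close> and \<open>w\<close> is then free of any shape constant. Expressing the coordinate directions by the unit
  vectors along \<open>u\<close> and \<open>w\<close> costs at most \<open>|u| |w| / |det(u, w)| = 2 R / h\<close> for each of the \<open>m\<close>
  derivatives, which produces \<open>(R / h)\<^sup>m\<close>.

  Sobolev functions are approximated, up to the boundary, by convolutions that contract the triangle
  towards an interior point. All constants in the \<open>L\<^sup>q\<close> estimates are \<open>q\<close>-th powers of constants
  independent of \<open>q\<close>, so that \<open>p = \<infinity>\<close> follows by letting \<open>q \<rightarrow> \<infinity>\<close>.
\<close>

section \<open>Powers of absolute values\<close>

text \<open>One constant has to serve for all finite exponents \<open>q\<close>, so compactness
  arguments are avoided: each Poincare inequality is derived by integrating along segments, with an
  explicit constant. Values in the extended nonnegative reals spare all integrability conditions.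
  The reason for admitting only orders above \<open>(a, b)\<close>: passing to unit directions
  divides the left side by |u|^a |w|^b, while a term of order (x, y) on the right carries |u|^x
  |w|^y. If x >= a and y >= b, the quotient is a product of k + 1 - m edge lengths; otherwise a
  ratio of the two lengths would remain, which is a shape factor. The regularized function is
  interpolated itself, and the limit is taken in the finished estimate. This needs convergence of
  one derivative almost everywhere along a subsequence, an upper bound for the top derivatives, and
  convergence of the values at the nodes. The last point rests on an embedding whose constant
  depends on the triangle; that is harmless, because the embedding only identifies the continuous
  representative and never enters the estimate.\<close>

definition qpow :: "real \<Rightarrow> real \<Rightarrow> ennreal" where
  "qpow q x = ennreal (\<bar>x\<bar> powr q)"

lemma qpow_measurable [measurable]: "qpow q \<in> borel_measurable borel"
  unfolding qpow_def[abs_def] by measurable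

lemma qpow_minus [simp]: "qpow q (- x) = qpow q x"
  by (simp add: qpow_def)

lemma qpow_mono: "\<bar>x\<bar> \<le> \<bar>y\<bar> \<Longrightarrow> 0 \<le> q \<Longrightarrow> qpow q x \<le> qpow q y"
  unfolding qpow_def by (intro ennreal_leI powr_mono2) auto

lemma qpow_mult: "qpow q (x * y) = qpow q x * qpow q y"
  by (simp add: qpow_def abs_mult powr_mult ennreal_mult)

lemma qpow_ge_1: "1 \<le> c \<Longrightarrow> 0 \<le> q \<Longrightarrow> 1 \<le> qpow q c"
  unfolding qpow_def by (simp add: ge_one_powr_ge_zero)

text \<open>Absorbs a counting factor, such as a number of summands, into a \<open>q\<close>-th
  power, so that constants keep the form \<open>qpow q C\<close>.\<close>

lemma qpow_le_self: "1 \<le> c \<Longrightarrow> 1 \<le> q \<Longrightarrow> ennreal c \<le> qpow q c"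
  unfolding qpow_def using powr_mono[of 1 q c] by (intro ennreal_leI) auto

text \<open>The larger of |x| and |y| is at least half of |x + y|. Convexity would give the exponent
  q - 1 on \<open>2\<close>; this weaker bound is already a \<open>q\<close>-th power.\<close>

lemma qpow_add:
  assumes "1 \<le> q"
  shows "qpow q (x + y) \<le> qpow q 2 * (qpow q x + qpow q y)"
proof -
  have "qpow q (x + y) \<le> qpow q (2 * max \<bar>x\<bar> \<bar>y\<bar>)"
    using assms by (intro qpow_mono) auto
  also have "\<dots> = qpow q 2 * qpow q (max \<bar>x\<bar> \<bar>y\<bar>)" by (rule qpow_mult)
  also have "qpow q (max \<bar>x\<bar> \<bar>y\<bar>) \<le> qpow q x + qpow q y"
    by (cases "\<bar>x\<bar> \<le> \<bar>y\<bar>") (auto simp: max_def qpow_def)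
  finally show ?thesis by (simp add: mult_left_mono)
qed

text \<open>A convex function lies above its tangent, here at \<open>c\<close>. The endpoint
  \<open>t = 0\<close> is treated apart, where the inequality reduces to 1 <= q.\<close>

lemma powr_ge_tangent:
  fixes c t q :: real
  assumes q: "1 \<le> q" and c: "0 < c" and t: "0 \<le> t"
  shows "c powr q + q * c powr (q - 1) * (t - c) \<le> t powr q"
proof (cases "t = 0")
  case True
  have "q * c powr (q - 1) * (t - c) = - (q * c powr q)"
    using True c by (simp add: powr_diff)
  moreover have "1 * c powr q \<le> q * c powr q"
    using q by (intro mult_right_mono) auto
  ultimately show ?thesis using True c by (simp add: powr_diff)
next
  case False
  have "q * c powr (q - 1) * (t - c) \<le> t powr q - c powr q"
    by (rule convex_on_imp_above_tangent[OF powr_convex[OF q]])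
       (use False t c in \<open>auto intro!: derivative_eq_intros simp: interior_open\<close>)
  then show ?thesis by linarith
qed

text \<open>Jensen's inequality, from integrating the tangent at the mean \<open>A\<close> of |f|. A
  total mass below 1 does no harm: the missing mass enters with the nonnegative factor q -
  1.\<close>

lemma qpow_integral_le:
  assumes q: "1 \<le> q" and M: "emeasure M (space M) \<le> 1" and f: "integrable M f"
  shows "qpow q (\<integral>x. f x \<partial>M) \<le> (\<integral>\<^sup>+x. qpow q (f x) \<partial>M)"
proof -
  define A where "A = (\<integral>x. \<bar>f x\<bar> \<partial>M)"
  have A0: "0 \<le> A" unfolding A_def by simp
  have le: "\<bar>\<integral>x. f x \<partial>M\<bar> \<le> A" unfolding A_def by simp
  interpret finite_measure M
    using M by (intro finite_measureI) (auto simp: top_unique)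
  have m1: "measure M (space M) \<le> 1"
    using M by (simp add: emeasure_eq_measure)
  \<comment> \<open>If \<open>A\<close> is positive and the right side is finite, |f|^q is
    integrable and Bochner integrals can be compared; the two remaining cases are trivial.\<close>
  show ?thesis
  proof (cases "A = 0 \<or> (\<integral>\<^sup>+x. qpow q (f x) \<partial>M) = \<infinity>")
    case True
    then show ?thesis
    proof
      assume "A = 0"
      with le q show ?thesis by (simp add: qpow_def)
    qed simp
  next
    case False
    then have Ap: "A > 0" using A0 by simp
    have int: "integrable M (\<lambda>x. \<bar>f x\<bar> powr q)"
      using False f by (intro integrableI_nonneg) (auto simp: qpow_def less_top)
    have "A powr q \<le> A powr q * measure M (space M) + q * A powr q * (1 - measure M (space M))"
    proof -
      have "0 \<le> (q - 1) * (A powr q * (1 - measure M (space M)))"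
        using q m1 by (intro mult_nonneg_nonneg) auto
      then show ?thesis by (simp add: algebra_simps)
    qed
    also have "\<dots> = A powr q * measure M (space M) + q * A powr (q - 1) * (A - A * measure M (space M))"
      using Ap by (simp add: powr_diff field_simps)
    also have "\<dots> = (\<integral>x. A powr q + q * A powr (q - 1) * (\<bar>f x\<bar> - A) \<partial>M)"
      using f by (simp add: A_def[symmetric] mult.commute)
    also have "\<dots> \<le> (\<integral>x. \<bar>f x\<bar> powr q \<partial>M)"
      using f int by (intro integral_mono powr_ge_tangent[OF q Ap]) auto
    finally have "qpow q A \<le> ennreal (\<integral>x. \<bar>f x\<bar> powr q \<partial>M)"
      using A0 by (simp add: qpow_def ennreal_leI)
    also have "\<dots> = (\<integral>\<^sup>+x. qpow q (f x) \<partial>M)"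
      unfolding qpow_def using int by (intro nn_integral_eq_integral[symmetric]) auto
    finally show ?thesis
      using qpow_mono[of "\<integral>x. f x \<partial>M" A q] le q by (meson abs_ge_self order.trans zero_le_one)
  qed
qed

text \<open>Lebesgue measure on an interval of length at most 1 has mass at most 1, so Jensen
  applies and no power of the length appears.\<close>

lemma qpow_integral_interval:
  fixes f :: "real \<Rightarrow> real"
  assumes q: "1 \<le> q" and ab: "b \<le> a + 1" and f: "continuous_on {a..b} f"
  shows "qpow q (integral {a..b} f) \<le> (\<integral>\<^sup>+x. qpow q (f x) * indicator {a..b} x \<partial>lborel)"
proof -
  let ?M = "restrict_space lborel {a..b}"
  have si: "set_integrable lborel {a..b} f"
    by (rule borel_integrable_atLeastAtMost') (rule f)
  have "qpow q (\<integral>x. f x \<partial>?M) \<le> (\<integral>\<^sup>+x. qpow q (f x) \<partial>?M)"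
  proof (rule qpow_integral_le[OF q])
    show "emeasure ?M (space ?M) \<le> 1"
      using ab by (simp add: emeasure_restrict_space space_restrict_space emeasure_lborel_Icc_eq)
    show "integrable ?M f"
      using si by (simp add: integrable_restrict_space set_integrable_def)
  qed
  also have "(\<integral>x. f x \<partial>?M) = integral {a..b} f"
    using set_borel_integral_eq_integral(2)[OF si]
    by (simp add: integral_restrict_space set_lebesgue_integral_def)
  finally show ?thesis
    by (simp add: nn_integral_restrict_space)
qed

lemma qpow_ftc:
  fixes h h' :: "real \<Rightarrow> real"
  assumes q: "1 \<le> q" and ab: "a \<le> b" "b \<le> a + 1"
    and h: "\<And>x. (h has_real_derivative h' x) (at x)" and c: "continuous_on UNIV h'"
  shows "qpow q (h b - h a) \<le> (\<integral>\<^sup>+x. qpow q (h' x) * indicator {a..b} x \<partial>lborel)"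
proof -
  have "(h' has_integral h b - h a) {a..b}"
    using ab(1) h by (intro fundamental_theorem_of_calculus)
      (auto simp: has_real_derivative_iff_has_vector_derivative[symmetric] intro: DERIV_subset)
  then have "h b - h a = integral {a..b} h'" by (simp add: integral_unique)
  then show ?thesis
    using qpow_integral_interval[OF q ab(2) continuous_on_subset[OF c]] by simp
qed

section \<open>Iterated averages and differences\<close>

text \<open>The segment from \<open>x\<close> to \<open>x + v\<close> is parametrized over
  \<open>{0..1}\<close>, so this is the average along it, without a factor for the length of
  \<open>v\<close>.\<close>

definition mean_along :: "'a::euclidean_space \<Rightarrow> ('a \<Rightarrow> real) \<Rightarrow> 'a \<Rightarrow> real" where
  "mean_along v g x = integral {0..1} (\<lambda>\<sigma>. g (x + \<sigma> *\<^sub>R v))"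

definition diff_along :: "'a::euclidean_space \<Rightarrow> ('a \<Rightarrow> real) \<Rightarrow> 'a \<Rightarrow> real" where
  "diff_along v g x = g (x + v) - g x"

definition nn_mean_along :: "'a::euclidean_space \<Rightarrow> ('a \<Rightarrow> ennreal) \<Rightarrow> 'a \<Rightarrow> ennreal" where
  "nn_mean_along v \<phi> x = (\<integral>\<^sup>+\<sigma>. \<phi> (x + \<sigma> *\<^sub>R v) * indicator {0..1} \<sigma> \<partial>lborel)"

lemma continuous_on_line:
  fixes x v :: "'a::euclidean_space"
  assumes "continuous_on UNIV g"
  shows "continuous_on S (\<lambda>\<sigma>. g (x + \<sigma> *\<^sub>R v))"
  by (rule continuous_on_compose2[OF assms]) (intro continuous_intros, simp)

lemma continuous_mean_along:
  assumes "continuous_on UNIV g"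
  shows "continuous_on UNIV (mean_along v g)"
proof -
  have "continuous_on UNIV (\<lambda>x. integral (cbox 0 1) (\<lambda>\<sigma>. g (x + \<sigma> *\<^sub>R v)))"
  proof (rule integral_continuous_on_param)
    show "continuous_on (UNIV \<times> cbox 0 1) (\<lambda>(x, \<sigma>). g (x + \<sigma> *\<^sub>R v))"
      unfolding case_prod_unfold
      by (rule continuous_on_compose2[OF assms]) (intro continuous_intros, simp)
  qed
  then show ?thesis by (simp add: mean_along_def[abs_def])
qed

lemma continuous_mean_along_funpow:
  "continuous_on UNIV g \<Longrightarrow> continuous_on UNIV ((mean_along v ^^ n) g)"
  by (induction n) (auto intro: continuous_mean_along)

lemma mean_along_integrable:
  fixes x v :: "'a::euclidean_space" and g :: "'a \<Rightarrow> real"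
  assumes "continuous_on UNIV g"
  shows "(\<lambda>\<sigma>. g (x + \<sigma> *\<^sub>R v)) integrable_on {0..1}"
  using integrable_continuous_real[OF continuous_on_line[OF assms]] .

lemma mean_along_diff_along:
  assumes "continuous_on UNIV g"
  shows "mean_along v (diff_along w g) = diff_along w (mean_along v g)"
proof
  fix x
  show "mean_along v (diff_along w g) x = diff_along w (mean_along v g) x"
    using integral_diff[OF mean_along_integrable[OF assms, of "x + w" v] mean_along_integrable[OF assms, of x v]]
    by (simp add: mean_along_def diff_along_def algebra_simps)
qed

lemma continuous_diff_along:
  assumes "continuous_on UNIV g"
  shows "continuous_on UNIV (diff_along v g)"
proof -
  have "continuous_on UNIV (\<lambda>x. g (x + v))"
    by (rule continuous_on_compose2[OF assms]) (intro continuous_intros, simp)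
  then show ?thesis
    unfolding diff_along_def[abs_def] using assms by (rule continuous_on_diff)
qed

lemma mean_along_funpow_diff_along:
  assumes "continuous_on UNIV g"
  shows "(mean_along v ^^ n) (diff_along w g) = diff_along w ((mean_along v ^^ n) g)"
  using assms
  by (induction n) (simp_all add: mean_along_diff_along continuous_mean_along_funpow)

lemma mean_along_funpow_diff_along_funpow:
  assumes "continuous_on UNIV g"
  shows "(mean_along v ^^ n) ((diff_along w ^^ m) g) = (diff_along w ^^ m) ((mean_along v ^^ n) g)"
proof (induction m)
  case (Suc m)
  have "continuous_on UNIV ((diff_along w ^^ m) g)"
    using assms by (induction m) (auto intro: continuous_diff_along)
  then show ?case using Suc by (simp add: mean_along_funpow_diff_along)
qed simp

lemma mean_along_cmult: "mean_along v (\<lambda>x. c * g x) = (\<lambda>x. c * mean_along v g x)"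
  by (simp add: mean_along_def[abs_def])

lemma mean_along_funpow_cmult: "(mean_along v ^^ n) (\<lambda>x. c * g x) = (\<lambda>x. c * (mean_along v ^^ n) g x)"
  by (induction n) (simp_all add: mean_along_cmult)

lemma diff_along_cmult: "diff_along v (\<lambda>x. c * g x) = (\<lambda>x. c * diff_along v g x)"
  by (simp add: diff_along_def[abs_def] algebra_simps)

lemma diff_along_funpow_cmult: "(diff_along v ^^ n) (\<lambda>x. c * g x) = (\<lambda>x. c * (diff_along v ^^ n) g x)"
  by (induction n) (simp_all add: diff_along_cmult)

text \<open>Averages reproduce constants; this is what lets a vanishing average of \<open>g\<close>
  detect the constant \<open>c\<close> in \<open>g - c\<close>.\<close>

lemma mean_along_funpow_minus_const:
  assumes "continuous_on UNIV g"
  shows "(mean_along v ^^ n) (\<lambda>x. g x - c) = (\<lambda>x. (mean_along v ^^ n) g x - c)"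
proof (induction n)
  case (Suc n)
  have "mean_along v (\<lambda>x. (mean_along v ^^ n) g x - c) x = mean_along v ((mean_along v ^^ n) g) x - c" for x
  proof -
    have "(\<lambda>\<sigma>. (mean_along v ^^ n) g (x + \<sigma> *\<^sub>R v)) integrable_on {0..1}"
      by (intro mean_along_integrable continuous_mean_along_funpow assms)
    from integral_diff[OF this integrable_const_ivl[of c 0 "1::real"]] show ?thesis
      by (simp add: mean_along_def[of v "\<lambda>x. (mean_along v ^^ n) g x - c"]
          mean_along_def[of v "(mean_along v ^^ n) g"])
  qed
  then show ?case using Suc by auto
qed simp

text \<open>The fundamental theorem of calculus along the segment. Iterated, it turns averages of
  mixed derivatives into differences between lattice points.\<close>

lemma mean_along_deriv:
  assumes g: "\<And>x. ((\<lambda>\<sigma>. g (x + \<sigma> *\<^sub>R v)) has_real_derivative g' x) (at 0)"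
  shows "mean_along v g' = diff_along v g"
proof
  fix x
  have d: "((\<lambda>\<sigma>. g (x + \<sigma> *\<^sub>R v)) has_real_derivative g' (x + \<tau> *\<^sub>R v)) (at \<tau>)" for \<tau>
  proof -
    have "((\<lambda>\<sigma>. g ((x + \<tau> *\<^sub>R v) + (\<sigma> - \<tau>) *\<^sub>R v)) has_real_derivative g' (x + \<tau> *\<^sub>R v) * (1 - 0)) (at \<tau>)"
      using g[of "x + \<tau> *\<^sub>R v"]
      by (intro DERIV_chain2[where f="\<lambda>\<sigma>. g ((x + \<tau> *\<^sub>R v) + \<sigma> *\<^sub>R v)"] derivative_intros) auto
    then show ?thesis by (simp add: algebra_simps)
  qed
  have "((\<lambda>\<sigma>. g' (x + \<sigma> *\<^sub>R v)) has_integral g (x + 1 *\<^sub>R v) - g (x + 0 *\<^sub>R v)) {0..1}"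
    using d by (intro fundamental_theorem_of_calculus)
      (auto simp: has_real_derivative_iff_has_vector_derivative[symmetric] intro: DERIV_subset)
  then show "mean_along v g' x = diff_along v g x"
    by (simp add: mean_along_def diff_along_def integral_unique)
qed

lemma qpow_mean_along:
  assumes q: "1 \<le> q" and "continuous_on UNIV g"
  shows "qpow q (mean_along v g x) \<le> nn_mean_along v (\<lambda>y. qpow q (g y)) x"
  unfolding mean_along_def nn_mean_along_def
  by (rule qpow_integral_interval[OF q]) (simp_all add: continuous_on_line[OF assms(2)])

lemma nn_mean_along_mono:
  "(\<And>x. \<phi> x \<le> \<psi> x) \<Longrightarrow> nn_mean_along v \<phi> x \<le> nn_mean_along v \<psi> x"
  unfolding nn_mean_along_def by (intro nn_integral_mono mult_right_mono) auto

lemma nn_mean_along_funpow_mono: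
  "(\<And>x. \<phi> x \<le> \<psi> x) \<Longrightarrow> (nn_mean_along v ^^ n) \<phi> x \<le> (nn_mean_along v ^^ n) \<psi> x"
  by (induction n arbitrary: x) (auto intro: nn_mean_along_mono)

lemma qpow_mean_along_funpow:
  assumes q: "1 \<le> q" and c: "continuous_on UNIV g"
  shows "qpow q ((mean_along v ^^ n) g x) \<le> (nn_mean_along v ^^ n) (\<lambda>y. qpow q (g y)) x"
proof (induction n arbitrary: x)
  case (Suc n)
  have "qpow q ((mean_along v ^^ Suc n) g x) \<le> nn_mean_along v (\<lambda>y. qpow q ((mean_along v ^^ n) g y)) x"
    using qpow_mean_along[OF q continuous_mean_along_funpow[OF c]] by simp
  also have "\<dots> \<le> nn_mean_along v ((nn_mean_along v ^^ n) (\<lambda>y. qpow q (g y))) x"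
    by (intro nn_mean_along_mono Suc)
  finally show ?case by simp
qed simp

text \<open>The iterate averages against the density of a sum of \<open>Suc n\<close> independent
  uniform variables on \<open>{0..1}\<close>, a B-spline. That density is at most 1 and is supported
  in \<open>{0..real (Suc n)}\<close>.\<close>

lemma nn_mean_along_funpow_le:
  assumes [measurable]: "\<phi> \<in> borel_measurable borel"
  shows "(nn_mean_along v ^^ Suc n) \<phi> x
    \<le> (\<integral>\<^sup>+\<tau>. \<phi> (x + \<tau> *\<^sub>R v) * indicator {0..real (Suc n)} \<tau> \<partial>lborel)"
proof (induction n arbitrary: x)
  case 0
  then show ?case by (simp add: nn_mean_along_def)
next
  case (Suc n)
  let ?I = "\<integral>\<^sup>+\<tau>. \<phi> (x + \<tau> *\<^sub>R v) * indicator {0..real (Suc (Suc n))} \<tau> \<partial>lborel"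
  have "(nn_mean_along v ^^ Suc (Suc n)) \<phi> x = nn_mean_along v ((nn_mean_along v ^^ Suc n) \<phi>) x"
    by simp
  also have "\<dots> \<le> nn_mean_along v (\<lambda>y. \<integral>\<^sup>+\<tau>. \<phi> (y + \<tau> *\<^sub>R v) * indicator {0..real (Suc n)} \<tau> \<partial>lborel) x"
    by (intro nn_mean_along_mono Suc)
  also have "\<dots> \<le> (\<integral>\<^sup>+(\<sigma>::real). ?I * indicator {0..1} \<sigma> \<partial>lborel)"
    unfolding nn_mean_along_def
  proof (intro nn_integral_mono)
    fix \<sigma> :: real
    have "(\<integral>\<^sup>+\<tau>. \<phi> (x + \<sigma> *\<^sub>R v + \<tau> *\<^sub>R v) * indicator {0..real (Suc n)} \<tau> \<partial>lborel) \<le> ?I"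
      if "\<sigma> \<in> {0..1}"
    proof -
      \<comment> \<open>Translation by \<open>\<sigma>\<close> moves the interval of length
        \<open>Suc n\<close> into the one of length \<open>Suc (Suc n)\<close>.\<close>
      have "?I = (\<integral>\<^sup>+\<tau>. \<phi> (x + (\<sigma> + 1 * \<tau>) *\<^sub>R v) * indicator {0..real (Suc (Suc n))} (\<sigma> + 1 * \<tau>) \<partial>lborel)"
        by (subst nn_integral_real_affine[where c=1 and t=\<sigma>]) auto
      also have "\<dots> \<ge> (\<integral>\<^sup>+\<tau>. \<phi> (x + \<sigma> *\<^sub>R v + \<tau> *\<^sub>R v) * indicator {0..real (Suc n)} \<tau> \<partial>lborel)"
        using that by (intro nn_integral_mono) (auto simp: algebra_simps split: split_indicator)
      finally show ?thesis .
    qed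
    then show "(\<integral>\<^sup>+\<tau>. \<phi> (x + \<sigma> *\<^sub>R v + \<tau> *\<^sub>R v) * indicator {0..real (Suc n)} \<tau> \<partial>lborel) * indicator {0..1} \<sigma>
      \<le> ?I * indicator {0..1} \<sigma>"
      by (auto split: split_indicator)
  qed
  also have "\<dots> = ?I" by (simp add: nn_integral_cmult_indicator)
  finally show ?case .
qed

section \<open>A Poincare inequality on the reference triangle\<close>

definition ref_triangle :: "(real \<times> real) set" where
  "ref_triangle = {(s, r). 0 \<le> s \<and> 0 \<le> r \<and> s + r \<le> 1}"

text \<open>Any two points of this square are joined inside it by a horizontal segment followed by a
  vertical one; in the triangle such a path may leave.\<close>

definition half_square :: "(real \<times> real) set" where
  "half_square = {0..1/2} \<times> {0..1/2}"

text \<open>The integral along horizontal lines is innermost, which is the form in which bounds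
  along such lines are inserted. Vertical bounds are reached by exchanging the coordinates.\<close>

definition iter_integral :: "(real \<times> real) set \<Rightarrow> (real \<times> real \<Rightarrow> ennreal) \<Rightarrow> ennreal" where
  "iter_integral A \<phi> = (\<integral>\<^sup>+r. \<integral>\<^sup>+s. \<phi> (s, r) * indicator A (s, r) \<partial>lborel \<partial>lborel)"

lemma ref_triangle_measurable [measurable]: "ref_triangle \<in> sets borel"
proof -
  have "closed {x::real\<times>real. 0 \<le> fst x}" "closed {x::real\<times>real. 0 \<le> snd x}"
    "closed {x::real\<times>real. fst x + snd x \<le> 1}"
    by (intro closed_Collect_le continuous_intros)+
  then have "closed ({x::real\<times>real. 0 \<le> fst x} \<inter> {x. 0 \<le> snd x} \<inter> {x. fst x + snd x \<le> 1})"
    by auto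
  moreover have "ref_triangle = {x::real\<times>real. 0 \<le> fst x} \<inter> {x. 0 \<le> snd x} \<inter> {x. fst x + snd x \<le> 1}"
    by (auto simp: ref_triangle_def)
  ultimately show ?thesis by (simp add: borel_closed)
qed

lemma half_square_measurable [measurable]: "half_square \<in> sets borel"
  unfolding half_square_def by (intro borel_closed closed_Times) auto

lemma half_square_subset: "half_square \<subseteq> ref_triangle"
  by (auto simp: half_square_def ref_triangle_def)

lemma measurable_pair1:
  fixes f :: "real \<times> real \<Rightarrow> 'b::topological_space"
  shows "f \<in> borel_measurable borel \<Longrightarrow> (\<lambda>s. f (s, r)) \<in> borel_measurable borel"
  by (rule measurable_compose[where g=f and f="\<lambda>s. (s, r)"]) (simp_all add: borel_prod[symmetric])

lemma tonelli_swap: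
  fixes f :: "'a::euclidean_space \<times> 'b::euclidean_space \<Rightarrow> ennreal"
  assumes "f \<in> borel_measurable borel"
  shows "(\<integral>\<^sup>+y. \<integral>\<^sup>+x. f (x, y) \<partial>lborel \<partial>lborel) = (\<integral>\<^sup>+x. \<integral>\<^sup>+y. f (x, y) \<partial>lborel \<partial>lborel)"
  using lborel_pair.Fubini'[of "\<lambda>x y. f (x, y)"] assms
  by (simp add: lborel_prod case_prod_unfold)

lemma nn_inner_measurable:
  fixes f :: "'a::euclidean_space \<times> 'b::euclidean_space \<Rightarrow> ennreal"
  assumes "f \<in> borel_measurable borel"
  shows "(\<lambda>y. \<integral>\<^sup>+x. f (x, y) \<partial>lborel) \<in> borel_measurable borel"
    "(\<lambda>x. \<integral>\<^sup>+y. f (x, y) \<partial>lborel) \<in> borel_measurable borel"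
proof -
  have [measurable]: "f \<in> borel_measurable (lborel \<Otimes>\<^sub>M lborel)"
    using assms by (simp add: lborel_prod)
  have "(\<lambda>y. \<integral>\<^sup>+x. f (x, y) \<partial>lborel) \<in> borel_measurable lborel"
    "(\<lambda>x. \<integral>\<^sup>+y. f (x, y) \<partial>lborel) \<in> borel_measurable lborel"
    by measurable
  then show "(\<lambda>y. \<integral>\<^sup>+x. f (x, y) \<partial>lborel) \<in> borel_measurable borel"
    "(\<lambda>x. \<integral>\<^sup>+y. f (x, y) \<partial>lborel) \<in> borel_measurable borel" by simp_all
qed

lemma iter_integral_mono:
  "(\<And>x. x \<in> A \<Longrightarrow> \<phi> x \<le> \<psi> x) \<Longrightarrow> iter_integral A \<phi> \<le> iter_integral A \<psi>"
  unfolding iter_integral_def by (intro nn_integral_mono) (auto split: split_indicator)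

lemma iter_integral_mono_set:
  "A \<subseteq> A' \<Longrightarrow> iter_integral A \<phi> \<le> iter_integral A' \<phi>"
  unfolding iter_integral_def by (intro nn_integral_mono) (auto split: split_indicator)

lemma iter_integral_eq_nn_integral:
  assumes [measurable]: "\<phi> \<in> borel_measurable borel" "A \<in> sets borel"
  shows "iter_integral A \<phi> = (\<integral>\<^sup>+x. \<phi> x * indicator A x \<partial>lborel)"
proof -
  have "(\<lambda>x. \<phi> x * indicator A x) \<in> borel_measurable (lborel \<Otimes>\<^sub>M lborel)"
    by (simp add: lborel_prod)
  from lborel_pair.nn_integral_snd[OF this] show ?thesis
    by (simp add: iter_integral_def lborel_prod case_prod_unfold)
qed

lemma iter_integral_add:
  assumes [measurable]: "\<phi> \<in> borel_measurable borel" "\<psi> \<in> borel_measurable borel" "A \<in> sets borel"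
  shows "iter_integral A (\<lambda>x. \<phi> x + \<psi> x) = iter_integral A \<phi> + iter_integral A \<psi>"
  by (simp add: iter_integral_eq_nn_integral distrib_right nn_integral_add)

lemma iter_integral_cmult:
  assumes [measurable]: "\<phi> \<in> borel_measurable borel" "A \<in> sets borel"
  shows "iter_integral A (\<lambda>x. c * \<phi> x) = c * iter_integral A \<phi>"
  by (simp add: iter_integral_eq_nn_integral mult.assoc nn_integral_cmult)

lemma iter_integral_union_le:
  assumes [measurable]: "\<phi> \<in> borel_measurable borel" "A \<in> sets borel" "A' \<in> sets borel"
    and "B \<in> sets borel" "B \<subseteq> A \<union> A'"
  shows "iter_integral B \<phi> \<le> iter_integral A \<phi> + iter_integral A' \<phi>"
proof -
  have "iter_integral B \<phi> \<le> (\<integral>\<^sup>+x. \<phi> x * indicator A x + \<phi> x * indicator A' x \<partial>lborel)"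
    using assms(4,5) by (simp add: iter_integral_eq_nn_integral)
      (intro nn_integral_mono, auto split: split_indicator)
  also have "\<dots> = iter_integral A \<phi> + iter_integral A' \<phi>"
    by (simp add: iter_integral_eq_nn_integral nn_integral_add)
  finally show ?thesis .
qed

lemma iter_integral_swap:
  assumes [measurable]: "\<phi> \<in> borel_measurable borel" "A \<in> sets borel"
    and sym: "\<And>s r. (s, r) \<in> A \<longleftrightarrow> (r, s) \<in> A"
  shows "iter_integral A (\<lambda>x. \<phi> (snd x, fst x)) = iter_integral A \<phi>"
proof -
  have "iter_integral A (\<lambda>x. \<phi> (snd x, fst x)) = (\<integral>\<^sup>+r. \<integral>\<^sup>+s. \<phi> (r, s) * indicator A (r, s) \<partial>lborel \<partial>lborel)"
    unfolding iter_integral_def using sym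
    by (intro nn_integral_cong) (auto split: split_indicator)
  also have "\<dots> = iter_integral A \<phi>"
    unfolding iter_integral_def
    using tonelli_swap[of "\<lambda>x. \<phi> x * indicator A x"] by simp
  finally show ?thesis .
qed

locale C1_plane =
  fixes g gs gr :: "real \<times> real \<Rightarrow> real"
  assumes deriv: "(g has_derivative (\<lambda>h. fst h * gs x + snd h * gr x)) (at x)"
    and cont_gs: "continuous_on UNIV gs" and cont_gr: "continuous_on UNIV gr"
begin

lemma cont_g: "continuous_on UNIV g"
  using deriv by (meson continuous_at_imp_continuous_on has_derivative_continuous)

lemma borel_measurable_components [measurable]:
  "g \<in> borel_measurable borel" "gs \<in> borel_measurable borel" "gr \<in> borel_measurable borel"
  using cont_g cont_gs cont_gr by (simp_all add: borel_measurable_continuous_onI)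

lemma line_deriv:
  "((\<lambda>\<sigma>. g (s + \<sigma> * a, r + \<sigma> * b)) has_real_derivative
     a * gs (s + \<tau> * a, r + \<tau> * b) + b * gr (s + \<tau> * a, r + \<tau> * b)) (at \<tau>)"
proof -
  have "((\<lambda>\<sigma>. (s + \<sigma> * a, r + \<sigma> * b)) has_derivative (\<lambda>h. (h * a, h * b))) (at \<tau>)"
    by (auto intro!: derivative_eq_intros)
  from has_derivative_compose[OF this deriv] show ?thesis
    unfolding has_field_derivative_def
    by (rule has_derivative_eq_rhs) (auto simp: algebra_simps)
qed

lemma deriv_s: "((\<lambda>\<sigma>. g (\<sigma>, r)) has_real_derivative gs (s, r)) (at s)"
  using line_deriv[of 0 1 r 0 s] by simp

lemma minus_const: "C1_plane (\<lambda>x. g x - c) gs gr"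
  using deriv cont_gs cont_gr by unfold_locales (auto intro!: derivative_eq_intros)

text \<open>Carries estimates in \<open>s\<close> over to \<open>r\<close>; the triangle and the
  half square are symmetric under the exchange.\<close>

lemma swap: "C1_plane (\<lambda>x. g (snd x, fst x)) (\<lambda>x. gr (snd x, fst x)) (\<lambda>x. gs (snd x, fst x))"
proof
  fix x :: "real \<times> real"
  have "((\<lambda>x. (snd x, fst x)) has_derivative (\<lambda>h. (snd h, fst h))) (at x)"
    by (auto intro!: derivative_eq_intros)
  from has_derivative_compose[OF this deriv[of "(snd x, fst x)"]]
  show "((\<lambda>x. g (snd x, fst x)) has_derivative (\<lambda>h. fst h * gr (snd x, fst x) + snd h * gs (snd x, fst x))) (at x)"
    by (simp add: add.commute)
qed (auto intro!: continuous_intros continuous_on_compose2[OF cont_gs] continuous_on_compose2[OF cont_gr])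

lemma qpow_s:
  assumes q: "1 \<le> q" and "\<bar>s - s'\<bar> \<le> 1" "{min s s'..max s s'} \<subseteq> I"
  shows "qpow q (g (s, r) - g (s', r)) \<le> (\<integral>\<^sup>+\<sigma>. qpow q (gs (\<sigma>, r)) * indicator I \<sigma> \<partial>lborel)"
proof -
  have c: "continuous_on UNIV (\<lambda>\<sigma>. gs (\<sigma>, r))"
    by (rule continuous_on_compose2[OF cont_gs]) (auto intro: continuous_intros)
  have *: "qpow q (g (max s s', r) - g (min s s', r)) \<le>
     (\<integral>\<^sup>+\<sigma>. qpow q (gs (\<sigma>, r)) * indicator {min s s'..max s s'} \<sigma> \<partial>lborel)"
    by (rule qpow_ftc[OF q _ _ deriv_s c]) (use assms(2) in auto)
  have "qpow q (g (s, r) - g (s', r)) = qpow q (g (max s s', r) - g (min s s', r))"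
    by (auto simp: max_def min_def qpow_def abs_minus_commute)
  also note *
  also have "(\<integral>\<^sup>+\<sigma>. qpow q (gs (\<sigma>, r)) * indicator {min s s'..max s s'} \<sigma> \<partial>lborel)
    \<le> (\<integral>\<^sup>+\<sigma>. qpow q (gs (\<sigma>, r)) * indicator I \<sigma> \<partial>lborel)"
    using assms(3) by (intro nn_integral_mono mult_left_mono) (auto split: split_indicator)
  finally show ?thesis .
qed

end

lemma (in C1_plane) qpow_r:
  assumes q: "1 \<le> q" and "\<bar>r - r'\<bar> \<le> 1" "{min r r'..max r r'} \<subseteq> I"
  shows "qpow q (g (s, r) - g (s, r')) \<le> (\<integral>\<^sup>+\<sigma>. qpow q (gr (s, \<sigma>)) * indicator I \<sigma> \<partial>lborel)"
proof -
  interpret S: C1_plane "\<lambda>x. g (snd x, fst x)" "\<lambda>x. gr (snd x, fst x)" "\<lambda>x. gs (snd x, fst x)"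
    by (rule swap)
  show ?thesis using S.qpow_s[OF assms, of s] by simp
qed

section \<open>Oscillation on the half square and passage to the triangle\<close>

abbreviation tri_int :: "(real \<times> real \<Rightarrow> ennreal) \<Rightarrow> ennreal" where
  "tri_int \<equiv> iter_integral ref_triangle"

abbreviation sq_int :: "(real \<times> real \<Rightarrow> ennreal) \<Rightarrow> ennreal" where
  "sq_int \<equiv> iter_integral half_square"

lemma indicator_half_square:
  "(indicator half_square (s, r) :: ennreal) = indicator {0..1/2} s * indicator {0..1/2} r"
  by (auto simp: half_square_def split: split_indicator)

lemma emeasure_half_le: "emeasure lborel {0..1/2::real} \<le> 1"
proof -
  have "emeasure lborel {0..1/2::real} = ennreal (1/2)" by (subst emeasure_lborel_Icc) auto
  also have "\<dots> \<le> 1" by (subst ennreal_le_1) simp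
  finally show ?thesis .
qed

lemma sq_int_snd_le: "sq_int (\<lambda>x. P (snd x)) \<le> (\<integral>\<^sup>+r. P r * indicator {0..1/2} r \<partial>lborel)"
  unfolding iter_integral_def
proof (rule nn_integral_mono)
  fix r :: real
  have "(\<integral>\<^sup>+s. P (snd (s, r)) * indicator half_square (s, r) \<partial>lborel)
      = (\<integral>\<^sup>+s. (P r * indicator {0..1/2} r) * indicator {0..1/2::real} s \<partial>lborel)"
    by (simp add: indicator_half_square ac_simps)
  also have "\<dots> = (P r * indicator {0..1/2} r) * emeasure lborel {0..1/2::real}"
    by (subst nn_integral_cmult_indicator) auto
  also have "\<dots> \<le> (P r * indicator {0..1/2} r) * 1"
    by (intro mult_left_mono emeasure_half_le) auto
  finally show "(\<integral>\<^sup>+s. P (snd (s, r)) * indicator half_square (s, r) \<partial>lborel) \<le> P r * indicator {0..1/2} r"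
    by simp
qed

lemma sq_int_fst_le: "sq_int (\<lambda>x. P (fst x)) \<le> (\<integral>\<^sup>+s. P s * indicator {0..1/2} s \<partial>lborel)"
proof -
  have "sq_int (\<lambda>x. P (fst x)) =
    (\<integral>\<^sup>+(r::real). (\<integral>\<^sup>+s. P s * indicator {0..1/2} s \<partial>lborel) * indicator {0..1/2} r \<partial>lborel)"
    unfolding iter_integral_def
    by (intro nn_integral_cong) (auto simp: indicator_half_square split: split_indicator)
  also have "\<dots> = (\<integral>\<^sup>+s. P s * indicator {0..1/2} s \<partial>lborel) * emeasure lborel {0..1/2::real}"
    by (subst nn_integral_cmult_indicator) auto
  also have "\<dots> \<le> (\<integral>\<^sup>+s. P s * indicator {0..1/2} s \<partial>lborel) * 1"
    by (intro mult_left_mono emeasure_half_le) auto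
  finally show ?thesis by simp
qed

lemma sq_int_const_le: "sq_int (\<lambda>x. c) \<le> c"
proof -
  have "sq_int (\<lambda>x. c) \<le> (\<integral>\<^sup>+(s::real). c * indicator {0..1/2} s \<partial>lborel)"
    by (rule sq_int_fst_le)
  also have "\<dots> = c * emeasure lborel {0..1/2::real}"
    by (subst nn_integral_cmult_indicator) auto
  also have "\<dots> \<le> c * 1"
    by (intro mult_left_mono emeasure_half_le) auto
  finally show ?thesis by simp
qed

context C1_plane
begin

text \<open>From \<open>x\<close> to \<open>x'\<close> the path runs horizontally, then vertically.
  The horizontal integral \<open>P\<close> depends only on the ordinate of \<open>x\<close>, the
  vertical integral \<open>Q\<close> only on the abscissa of \<open>x'\<close>; each is therefore
  integrated once over its own variable, and the remaining variables contribute mass at most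
  1.\<close>

lemma sq_int_diff:
  assumes q: "1 \<le> q"
  shows "sq_int (\<lambda>x'. sq_int (\<lambda>x. qpow q (g x - g x')))
    \<le> qpow q 2 * (tri_int (\<lambda>x. qpow q (gs x)) + tri_int (\<lambda>x. qpow q (gr x)))"
proof -
  define P where "P r = (\<integral>\<^sup>+\<sigma>. qpow q (gs (\<sigma>, r)) * indicator {0..1/2} \<sigma> \<partial>lborel)" for r
  define Q where "Q s = (\<integral>\<^sup>+\<rho>. qpow q (gr (s, \<rho>)) * indicator {0..1/2} \<rho> \<partial>lborel)" for s
  have m1: "(\<lambda>x. qpow q (gs x) * indicator {0..1/2} (fst x)) \<in> borel_measurable borel"
    "(\<lambda>x. qpow q (gr x) * indicator {0..1/2} (snd x)) \<in> borel_measurable borel"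
    "(\<lambda>x. qpow q (gr x) * indicator half_square x) \<in> borel_measurable borel"
    by (measurable; simp add: borel_prod[symmetric])+
  have Pm [measurable]: "P \<in> borel_measurable borel"
    using nn_inner_measurable(1)[OF m1(1)] by (simp add: P_def[abs_def])
  have Qm [measurable]: "Q \<in> borel_measurable borel"
    using nn_inner_measurable(2)[OF m1(2)] by (simp add: Q_def[abs_def])
  have [measurable]: "(\<lambda>x::real\<times>real. P (snd x)) \<in> borel_measurable borel"
    "(\<lambda>x::real\<times>real. Q (fst x)) \<in> borel_measurable borel"
    by (simp_all add: borel_prod[symmetric])
  have Pi: "(\<integral>\<^sup>+r. P r * indicator {0..1/2} r \<partial>lborel) = sq_int (\<lambda>x. qpow q (gs x))"
    unfolding iter_integral_def P_def
    by (intro nn_integral_cong) (auto simp: indicator_half_square split: split_indicator)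
  have "(\<integral>\<^sup>+s. Q s * indicator {0..1/2} s \<partial>lborel)
      = (\<integral>\<^sup>+s. \<integral>\<^sup>+r. qpow q (gr (s, r)) * indicator half_square (s, r) \<partial>lborel \<partial>lborel)"
    unfolding Q_def
    by (intro nn_integral_cong) (auto simp: indicator_half_square split: split_indicator)
  also have "\<dots> = sq_int (\<lambda>x. qpow q (gr x))"
    unfolding iter_integral_def using tonelli_swap[OF m1(3)] by simp
  finally have Qi: "(\<integral>\<^sup>+s. Q s * indicator {0..1/2} s \<partial>lborel) = sq_int (\<lambda>x. qpow q (gr x))" .
  let ?S = "tri_int (\<lambda>x. qpow q (gs x))" and ?R = "tri_int (\<lambda>x. qpow q (gr x))"
  have PS: "sq_int (\<lambda>x. P (snd x)) \<le> ?S"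
    using sq_int_snd_le[of P] Pi iter_integral_mono_set[OF half_square_subset] by (metis order.trans)
  have QR: "sq_int (\<lambda>x. Q (fst x)) \<le> ?R"
    using sq_int_fst_le[of Q] Qi iter_integral_mono_set[OF half_square_subset] by (metis order.trans)
  have pw: "qpow q (g x - g x') \<le> qpow q 2 * (P (snd x) + Q (fst x'))"
    if "x \<in> half_square" "x' \<in> half_square" for x x'
  proof -
    obtain s r s' r' where [simp]: "x = (s, r)" "x' = (s', r')" by fastforce
    have "qpow q (g x - g x') = qpow q ((g (s, r) - g (s', r)) + (g (s', r) - g (s', r')))" by simp
    also have "\<dots> \<le> qpow q 2 * (qpow q (g (s, r) - g (s', r)) + qpow q (g (s', r) - g (s', r')))"
      by (rule qpow_add[OF q])
    also have "\<dots> \<le> qpow q 2 * (P r + Q s')"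
      unfolding P_def Q_def using that
      by (intro mult_left_mono add_mono qpow_s[OF q] qpow_r[OF q]) (auto simp: half_square_def)
    finally show ?thesis by simp
  qed
  have "sq_int (\<lambda>x'. sq_int (\<lambda>x. qpow q (g x - g x')))
     \<le> sq_int (\<lambda>x'. qpow q 2 * (?S + Q (fst x')))"
  proof (rule iter_integral_mono)
    fix x' assume x': "x' \<in> half_square"
    have "sq_int (\<lambda>x. qpow q (g x - g x')) \<le> sq_int (\<lambda>x. qpow q 2 * (P (snd x) + Q (fst x')))"
      by (rule iter_integral_mono) (use pw x' in auto)
    also have "\<dots> = qpow q 2 * (sq_int (\<lambda>x. P (snd x)) + sq_int (\<lambda>x. Q (fst x')))"
      by (subst iter_integral_cmult) (simp_all add: iter_integral_add)
    also have "\<dots> \<le> qpow q 2 * (?S + Q (fst x'))"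
      by (intro mult_left_mono add_mono PS sq_int_const_le) auto
    finally show "sq_int (\<lambda>x. qpow q (g x - g x')) \<le> qpow q 2 * (?S + Q (fst x'))" .
  qed
  also have "\<dots> = qpow q 2 * (sq_int (\<lambda>x. ?S) + sq_int (\<lambda>x. Q (fst x)))"
    by (subst iter_integral_cmult) (simp_all add: iter_integral_add)
  also have "\<dots> \<le> qpow q 2 * (?S + ?R)"
    by (intro mult_left_mono add_mono QR sq_int_const_le) auto
  finally show ?thesis .
qed

text \<open>A shift by 1/2 to the left takes this corner into the half square. The change of
  \<open>g\<close> under the shift is bounded by the integral \<open>W\<close> of its horizontal
  derivative along the whole line in the triangle.\<close>

lemma corner_le_half_square:
  assumes q: "1 \<le> q"
  shows "iter_integral {x \<in> ref_triangle. 1/2 \<le> fst x} (\<lambda>x. qpow q (g x))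
    \<le> qpow q 2 * (sq_int (\<lambda>x. qpow q (g x)) + tri_int (\<lambda>x. qpow q (gs x)))"
proof -
  define W where "W r = (\<integral>\<^sup>+\<sigma>. qpow q (gs (\<sigma>, r)) * indicator ref_triangle (\<sigma>, r) \<partial>lborel)" for r
  define T where "T = {x \<in> ref_triangle. 1/2 \<le> fst x}"
  have T [measurable]: "T \<in> sets borel"
  proof -
    have "closed {x::real\<times>real. 1/2 \<le> fst x}" by (intro closed_Collect_le continuous_intros)
    then have "ref_triangle \<inter> {x. 1/2 \<le> fst x} \<in> sets borel" by (intro sets.Int) auto
    moreover have "T = ref_triangle \<inter> {x. 1/2 \<le> fst x}" by (auto simp: T_def)
    ultimately show ?thesis by simp
  qed
  have "(\<lambda>x. qpow q (gs x) * indicator ref_triangle x) \<in> borel_measurable borel" by measurable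
  from nn_inner_measurable(1)[OF this] have Wm [measurable]: "W \<in> borel_measurable borel"
    by (simp add: W_def[abs_def])
  have [measurable]: "(\<lambda>x::real\<times>real. W (snd x)) \<in> borel_measurable borel"
    by (simp add: borel_prod[symmetric])
  have [measurable]: "(\<lambda>x::real\<times>real. g (fst x - 1/2, snd x)) \<in> borel_measurable borel"
  proof -
    have "continuous_on UNIV (\<lambda>x::real\<times>real. g (fst x - 1/2, snd x))"
      by (rule continuous_on_compose2[OF cont_g]) (auto intro!: continuous_intros)
    then show ?thesis by (rule borel_measurable_continuous_onI)
  qed
  have pw: "qpow q (g x) \<le> qpow q 2 * (W (snd x) + qpow q (g (fst x - 1/2, snd x)))"
    if "x \<in> T" for x
  proof -
    obtain s r where x [simp]: "x = (s, r)" by fastforce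
    have "qpow q (g x) = qpow q ((g (s, r) - g (s - 1/2, r)) + g (s - 1/2, r))" by simp
    also have "\<dots> \<le> qpow q 2 * (qpow q (g (s, r) - g (s - 1/2, r)) + qpow q (g (s - 1/2, r)))"
      by (rule qpow_add[OF q])
    also have "qpow q (g (s, r) - g (s - 1/2, r)) \<le> (\<integral>\<^sup>+\<sigma>. qpow q (gs (\<sigma>, r)) * indicator {0..1-r} \<sigma> \<partial>lborel)"
      using that by (intro qpow_s[OF q]) (auto simp: T_def ref_triangle_def)
    also have "\<dots> \<le> W r"
      unfolding W_def using that
      by (intro nn_integral_mono mult_left_mono) (auto simp: T_def ref_triangle_def split: split_indicator)
    finally show ?thesis by (simp add: mult_left_mono)
  qed
  have "iter_integral T (\<lambda>x. qpow q (g x))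
    \<le> iter_integral T (\<lambda>x. qpow q 2 * (W (snd x) + qpow q (g (fst x - 1/2, snd x))))"
    by (rule iter_integral_mono) (rule pw)
  also have "\<dots> = qpow q 2 * (iter_integral T (\<lambda>x. W (snd x)) + iter_integral T (\<lambda>x. qpow q (g (fst x - 1/2, snd x))))"
    by (subst iter_integral_cmult) (simp_all add: iter_integral_add)
  also have "iter_integral T (\<lambda>x. W (snd x)) \<le> tri_int (\<lambda>x. qpow q (gs x))"
  proof -
    have "iter_integral T (\<lambda>x. W (snd x)) \<le> (\<integral>\<^sup>+r. \<integral>\<^sup>+s. W r * indicator {0..1::real} s \<partial>lborel \<partial>lborel)"
      unfolding iter_integral_def
      by (intro nn_integral_mono) (auto simp: T_def ref_triangle_def split: split_indicator)
    also have "\<dots> = (\<integral>\<^sup>+r. W r \<partial>lborel)"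
      by (simp add: nn_integral_cmult_indicator)
    finally show ?thesis by (simp add: W_def iter_integral_def)
  qed
  also have "iter_integral T (\<lambda>x. qpow q (g (fst x - 1/2, snd x))) \<le> sq_int (\<lambda>x. qpow q (g x))"
    unfolding iter_integral_def
  proof (rule nn_integral_mono)
    fix r :: real
    have [measurable]: "(\<lambda>s. g (s, r)) \<in> borel_measurable borel" "(\<lambda>s. indicator half_square (s, r) :: ennreal) \<in> borel_measurable borel"
      by (rule measurable_pair1, simp)+
    have "(\<integral>\<^sup>+s. qpow q (g (s, r)) * indicator half_square (s, r) \<partial>lborel)
      = (\<integral>\<^sup>+s. qpow q (g (-1/2 + 1 * s, r)) * indicator half_square (-1/2 + 1 * s, r) \<partial>lborel)"
      by (subst nn_integral_real_affine[where c=1 and t="-1/2"]) auto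
    also have "\<dots> \<ge> (\<integral>\<^sup>+s. qpow q (g (fst (s, r) - 1 / 2, snd (s, r))) * indicator T (s, r) \<partial>lborel)"
      by (intro nn_integral_mono) (auto simp: T_def ref_triangle_def half_square_def split: split_indicator)
    finally show "(\<integral>\<^sup>+s. qpow q (g (fst (s, r) - 1 / 2, snd (s, r))) * indicator T (s, r) \<partial>lborel)
       \<le> (\<integral>\<^sup>+s. qpow q (g (s, r)) * indicator half_square (s, r) \<partial>lborel)" .
  qed
  finally have "iter_integral T (\<lambda>x. qpow q (g x)) \<le> qpow q 2 *
      (sq_int (\<lambda>x. qpow q (g x)) + tri_int (\<lambda>x. qpow q (gs x)))"
    by (simp add: mult_left_mono add.commute add_mono)
  then show ?thesis unfolding T_def .
qed

end

lemma qpow_ge_2: "1 \<le> q \<Longrightarrow> 2 \<le> qpow q 2"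
  using qpow_le_self[of 2 q] by simp

lemma ref_triangle_sym: "(s, r) \<in> ref_triangle \<longleftrightarrow> (r, s) \<in> ref_triangle"
  by (auto simp: ref_triangle_def)

lemma half_square_sym: "(s, r) \<in> half_square \<longleftrightarrow> (r, s) \<in> half_square"
  by (auto simp: half_square_def)

context C1_plane
begin

text \<open>The triangle is the half square together with two corners, the second being the mirror
  image of the first. Three pieces with the constant \<open>2\<close> each give
  \<open>6\<close>.\<close>

lemma tri_int_le_sq_int:
  assumes q: "1 \<le> q"
  shows "tri_int (\<lambda>x. qpow q (g x))
    \<le> qpow q 6 * (sq_int (\<lambda>x. qpow q (g x)) + (tri_int (\<lambda>x. qpow q (gs x)) + tri_int (\<lambda>x. qpow q (gr x))))"
proof -
  interpret S: C1_plane "\<lambda>x. g (snd x, fst x)" "\<lambda>x. gr (snd x, fst x)" "\<lambda>x. gs (snd x, fst x)"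
    by (rule swap)
  define T1 where "T1 = {x \<in> ref_triangle. 1/2 \<le> fst x}"
  define T2 where "T2 = {x \<in> ref_triangle. 1/2 \<le> snd x}"
  have cl: "closed {x::real\<times>real. 1/2 \<le> fst x}" "closed {x::real\<times>real. 1/2 \<le> snd x}"
    by (intro closed_Collect_le continuous_intros)+
  have "ref_triangle \<inter> {x. 1/2 \<le> fst x} \<in> sets borel" "ref_triangle \<inter> {x. 1/2 \<le> snd x} \<in> sets borel"
    using cl by (auto intro: sets.Int borel_closed)
  moreover have "T1 = ref_triangle \<inter> {x. 1/2 \<le> fst x}" "T2 = ref_triangle \<inter> {x. 1/2 \<le> snd x}"
    by (auto simp: T1_def T2_def)
  ultimately have [measurable]: "T1 \<in> sets borel" "T2 \<in> sets borel" by simp_all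
  let ?g = "\<lambda>x. qpow q (g x)"
  let ?S = "tri_int (\<lambda>x. qpow q (gs x))" and ?R = "tri_int (\<lambda>x. qpow q (gr x))"
  have sw: "tri_int (\<lambda>x. qpow q (gr (snd x, fst x))) = ?R" "sq_int (\<lambda>x. ?g (snd x, fst x)) = sq_int ?g"
    by (auto intro!: iter_integral_swap ref_triangle_sym half_square_sym)
  have "iter_integral T2 ?g = iter_integral T1 (\<lambda>x. ?g (snd x, fst x))"
  proof -
    have m: "(\<lambda>x. ?g x * indicator T2 x) \<in> borel_measurable borel" by measurable
    have "iter_integral T1 (\<lambda>x. ?g (snd x, fst x)) = (\<integral>\<^sup>+r. \<integral>\<^sup>+s. ?g (r, s) * indicator T2 (r, s) \<partial>lborel \<partial>lborel)"
      unfolding iter_integral_def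
      by (intro nn_integral_cong) (auto simp: T1_def T2_def ref_triangle_def split: split_indicator)
    also have "\<dots> = iter_integral T2 ?g"
      unfolding iter_integral_def using tonelli_swap[OF m] by simp
    finally show ?thesis by simp
  qed
  also have "\<dots> \<le> qpow q 2 * (sq_int ?g + ?R)"
    using S.corner_le_half_square[OF q] sw by (simp add: T1_def)
  finally have t2: "iter_integral T2 ?g \<le> qpow q 2 * (sq_int ?g + ?R)" .
  have t1: "iter_integral T1 ?g \<le> qpow q 2 * (sq_int ?g + ?S)"
    using corner_le_half_square[OF q] by (simp add: T1_def)
  have "tri_int ?g \<le> iter_integral (half_square \<union> T1) ?g + iter_integral T2 ?g"
    by (rule iter_integral_union_le) (measurable, auto simp: T1_def T2_def ref_triangle_def half_square_def)
  also have "iter_integral (half_square \<union> T1) ?g \<le> sq_int ?g + iter_integral T1 ?g"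
    by (rule iter_integral_union_le) auto
  finally have "tri_int ?g \<le> sq_int ?g + iter_integral T1 ?g + iter_integral T2 ?g"
    by (simp add: add_mono)
  also have "\<dots> \<le> qpow q 2 * (sq_int ?g + (?S + ?R)) + qpow q 2 * (sq_int ?g + (?S + ?R)) + qpow q 2 * (sq_int ?g + (?S + ?R))"
  proof (intro add_mono)
    have "sq_int ?g = 1 * sq_int ?g" by simp
    also have "\<dots> \<le> qpow q 2 * (sq_int ?g + (?S + ?R))"
      using q by (intro mult_mono qpow_ge_1) auto
    finally show "sq_int ?g \<le> qpow q 2 * (sq_int ?g + (?S + ?R))" .
    show "iter_integral T1 ?g \<le> qpow q 2 * (sq_int ?g + (?S + ?R))"
      by (rule order.trans[OF t1]) (intro mult_left_mono add_mono, auto)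
    show "iter_integral T2 ?g \<le> qpow q 2 * (sq_int ?g + (?S + ?R))"
      by (rule order.trans[OF t2]) (intro mult_left_mono add_mono, auto)
  qed
  also have "\<dots> = 3 * (qpow q 2 * (sq_int ?g + (?S + ?R)))"
    by (metis (no_types, lifting) distrib_right mult_1 numeral_Bit1 numeral_One one_add_one)
  also have "\<dots> \<le> qpow q 3 * (qpow q 2 * (sq_int ?g + (?S + ?R)))"
    using q qpow_le_self[of 3 q] by (intro mult_right_mono) auto
  also have "\<dots> = qpow q 6 * (sq_int ?g + (?S + ?R))"
    using qpow_mult[of q 3 2] by (simp add: mult.assoc)
  finally show ?thesis .
qed

text \<open>\<open>F\<close> says that a linear functional with value \<open>c\<close> on constants and value \<open>0\<close> at \<open>g\<close> is
  bounded, evaluated at \<open>g - c\<close>. Averaging over \<open>c = g x'\<close> then bounds \<open>g\<close> by its oscillation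
  on the half square.\<close>

lemma poincare_of_functional:
  assumes q: "1 \<le> q"
    and F: "\<And>c. qpow q c \<le> qpow q D * (tri_int (\<lambda>x. qpow q (g x - c)) + E)"
    and D: "1 \<le> D"
    and E: "tri_int (\<lambda>x. qpow q (gs x)) + tri_int (\<lambda>x. qpow q (gr x)) \<le> E"
  shows "tri_int (\<lambda>x. qpow q (g x)) \<le> qpow q (288 * D) * E"
proof -
  let ?G = "\<lambda>x'. sq_int (\<lambda>x. qpow q (g x - g x'))"
  have Gm [measurable]: "?G \<in> borel_measurable borel"
  proof -
    have 1: "(\<lambda>z. qpow q (g (fst z) - g (snd z)) * indicator half_square (fst z)) \<in> borel_measurable (borel \<Otimes>\<^sub>M borel)"
      by measurable
    from nn_inner_measurable(1)[of "\<lambda>z. qpow q (g (fst z) - g (snd z)) * indicator half_square (fst z)"] 1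
    have "(\<lambda>x'. \<integral>\<^sup>+x. qpow q (g x - g x') * indicator half_square x \<partial>lborel) \<in> borel_measurable borel"
      by (simp add: borel_prod)
    moreover have "?G = (\<lambda>x'. \<integral>\<^sup>+x. qpow q (g x - g x') * indicator half_square x \<partial>lborel)"
      by (intro ext iter_integral_eq_nn_integral) measurable
    ultimately show ?thesis by simp
  qed
  have fold: "tri_int (\<lambda>x. qpow q (g x - c)) \<le> qpow q 6 * (sq_int (\<lambda>x. qpow q (g x - c)) + E)" for c
  proof -
    interpret M: C1_plane "\<lambda>x. g x - c" gs gr by (rule minus_const)
    show ?thesis
      using M.tri_int_le_sq_int[OF q] E
      by (meson add_left_mono mult_left_mono order.trans zero_le)
  qed
  \<comment> \<open>The distance of \<open>g\<close> from its value at \<open>x'\<close> is reduced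
    to the half square, where \<open>sq_int_diff\<close> can average it over
    \<open>x'\<close>.\<close>
  have pw: "qpow q (g x') \<le> qpow q (6 * D) * (?G x' + 2 * E)" for x'
  proof -
    have "qpow q (g x') \<le> qpow q D * (qpow q 6 * (?G x' + E) + E)"
      by (rule order.trans[OF F]) (intro mult_left_mono add_mono fold, auto)
    also have "\<dots> \<le> qpow q D * (qpow q 6 * (?G x' + E) + qpow q 6 * E)"
      using mult_right_mono[OF qpow_ge_1[of 6 q], of E] q by (intro mult_left_mono add_mono) auto
    also have "\<dots> = qpow q (6 * D) * (?G x' + 2 * E)"
      by (simp add: qpow_mult distrib_left mult_ac mult_2)
    finally show ?thesis .
  qed
  have "sq_int (\<lambda>x. qpow q (g x)) \<le> sq_int (\<lambda>x'. qpow q (6 * D) * (?G x' + 2 * E))"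
    by (intro iter_integral_mono pw)
  also have "\<dots> = qpow q (6 * D) * (sq_int ?G + sq_int (\<lambda>x. 2 * E))"
    by (subst iter_integral_cmult) (simp_all add: iter_integral_add)
  also have "\<dots> \<le> qpow q (6 * D) * (qpow q 2 * E + 2 * E)"
    using E by (intro mult_left_mono add_mono sq_int_const_le order.trans[OF sq_int_diff[OF q]]) auto
  also have "\<dots> \<le> qpow q (6 * D) * (qpow q 2 * E + qpow q 2 * E)"
    using qpow_ge_2[OF q] by (intro mult_left_mono add_mono mult_right_mono) auto
  also have "\<dots> = qpow q (6 * D) * (2 * (qpow q 2 * E))" by (simp add: mult_2)
  also have "\<dots> \<le> qpow q (6 * D) * (qpow q 2 * (qpow q 2 * E))"
    using qpow_ge_2[OF q] by (intro mult_left_mono mult_right_mono) auto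
  also have "\<dots> = qpow q (24 * D) * E"
  proof -
    have "qpow q (24 * D) = qpow q (6 * D) * (qpow q 2 * qpow q 2)"
      by (subst qpow_mult[symmetric])+ (simp add: mult_ac)
    then show ?thesis by (simp add: mult_ac)
  qed
  finally have sq: "sq_int (\<lambda>x. qpow q (g x)) \<le> qpow q (24 * D) * E" .
  \<comment> \<open>The half square was estimated with 24 = 6 * 2 * 2; returning to the triangle
    costs another 6 * 2, which makes 288.\<close>
  have "tri_int (\<lambda>x. qpow q (g x)) \<le> qpow q 6 * (qpow q (24 * D) * E + E)"
    using fold[of 0] sq by simp (meson add_right_mono mult_left_mono order.trans zero_le)
  also have "\<dots> \<le> qpow q 6 * (qpow q (24 * D) * E + qpow q (24 * D) * E)"
    using mult_right_mono[OF qpow_ge_1[of "24 * D" q], of E] D q by (intro mult_left_mono add_mono) auto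
  also have "\<dots> = qpow q 6 * (2 * (qpow q (24 * D) * E))" by (simp add: mult_2)
  also have "\<dots> \<le> qpow q 6 * (qpow q 2 * (qpow q (24 * D) * E))"
    using qpow_ge_2[OF q] by (intro mult_left_mono mult_right_mono) auto
  also have "\<dots> = qpow q (288 * D) * E"
  proof -
    have "qpow q (288 * D) = qpow q 6 * (qpow q 2 * qpow q (24 * D))"
      by (subst qpow_mult[symmetric])+ (simp add: mult_ac)
    then show ?thesis by (simp add: mult_ac)
  qed
  finally show ?thesis .
qed

end

text \<open>The shear \<open>a = 1\<close> moves along the direction \<open>(-1, 1)\<close>, in which the segments starting on
  the right half of the bottom edge stay inside the triangle.\<close>

lemma shear_integral_le:
  assumes \<phi> [measurable]: "\<phi> \<in> borel_measurable borel" and a: "a = 0 \<or> a = (1::real)"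
  shows "(\<integral>\<^sup>+s. (\<integral>\<^sup>+\<tau>. \<phi> (s - a * \<tau>, \<tau>) * indicator {0..1/2} \<tau> \<partial>lborel) * indicator {a/2..(a+1)/2} s \<partial>lborel)
    \<le> tri_int \<phi>"
proof -
  define f where "f = (\<lambda>(s, \<tau>). \<phi> (s - a * \<tau>, \<tau>) * indicator {0..1/2} \<tau> * indicator {a/2..(a+1)/2} s)"
  have "continuous_on UNIV (\<lambda>x::real\<times>real. (fst x - a * snd x, snd x))"
    by (intro continuous_intros)
  then have "(\<lambda>x::real\<times>real. (fst x - a * snd x, snd x)) \<in> borel_measurable borel"
    by (rule borel_measurable_continuous_onI)
  from measurable_compose[OF this \<phi>]
  have [measurable]: "(\<lambda>x. \<phi> (fst x - a * snd x, snd x)) \<in> borel_measurable (borel \<Otimes>\<^sub>M borel)"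
    by (simp add: borel_prod)
  have "f \<in> borel_measurable (borel \<Otimes>\<^sub>M borel)"
    unfolding f_def case_prod_unfold by measurable
  then have fm: "f \<in> borel_measurable borel" by (simp add: borel_prod)
  have "(\<integral>\<^sup>+s. (\<integral>\<^sup>+\<tau>. \<phi> (s - a * \<tau>, \<tau>) * indicator {0..1/2} \<tau> \<partial>lborel) * indicator {a/2..(a+1)/2} s \<partial>lborel)
    = (\<integral>\<^sup>+s. \<integral>\<^sup>+\<tau>. f (s, \<tau>) \<partial>lborel \<partial>lborel)"
    by (intro nn_integral_cong) (auto simp: f_def split: split_indicator)
  also have "\<dots> = (\<integral>\<^sup>+\<tau>. \<integral>\<^sup>+s. f (s, \<tau>) \<partial>lborel \<partial>lborel)"
    using tonelli_swap[OF fm] by simp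
  also have "\<dots> \<le> tri_int \<phi>"
    unfolding iter_integral_def
  proof (rule nn_integral_mono)
    fix \<tau> :: real
    have [measurable]: "(\<lambda>s. f (s, \<tau>)) \<in> borel_measurable borel"
      using fm by (rule measurable_pair1)
    have "(\<integral>\<^sup>+s. f (s, \<tau>) \<partial>lborel) = (\<integral>\<^sup>+s. f (a * \<tau> + 1 * s, \<tau>) \<partial>lborel)"
      by (subst nn_integral_real_affine[where c=1 and t="a * \<tau>"]) auto
    also have "\<dots> \<le> (\<integral>\<^sup>+s. \<phi> (s, \<tau>) * indicator ref_triangle (s, \<tau>) \<partial>lborel)"
      using a by (intro nn_integral_mono)
        (auto simp: f_def ref_triangle_def field_simps split: split_indicator)
    finally show "(\<integral>\<^sup>+s. f (s, \<tau>) \<partial>lborel) \<le> (\<integral>\<^sup>+s. \<phi> (s, \<tau>) * indicator ref_triangle (s, \<tau>) \<partial>lborel)" .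
  qed
  finally show ?thesis .
qed

section \<open>Traces on the edges\<close>

context C1_plane
begin

text \<open>A value on the edge is compared with the values along a segment entering the triangle in
  the direction \<open>(-a, 1)\<close>, and the comparison is averaged over a parameter interval of
  length 1/2. The constant is 2 * 2: one factor from the triangle inequality, one from the
  averaging.\<close>

lemma trace_half:
  assumes q: "1 \<le> q" and a: "a = 0 \<or> a = (1::real)"
  shows "(\<integral>\<^sup>+s. qpow q (g (s, 0)) * indicator {a/2..(a+1)/2} s \<partial>lborel)
    \<le> qpow q 4 * (tri_int (\<lambda>x. qpow q (g x)) + tri_int (\<lambda>x. qpow q (gr x - a * gs x)))"
proof -
  define P where "P s = (\<integral>\<^sup>+\<tau>. qpow q (g (s - a * \<tau>, \<tau>)) * indicator {0..1/2} \<tau> \<partial>lborel)" for s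
  define Q where "Q s = (\<integral>\<^sup>+\<tau>. qpow q (gr (s - a * \<tau>, \<tau>) - a * gs (s - a * \<tau>, \<tau>)) * indicator {0..1/2} \<tau> \<partial>lborel)" for s
  have sh: "continuous_on S (\<lambda>x::real\<times>real. (fst x - a * snd x, snd x))" for S
    by (intro continuous_intros)
  have m0: "(\<lambda>x. qpow q (f (fst x - a * snd x, snd x)) * indicator {0..1/2} (snd x)) \<in> borel_measurable borel"
    if f: "continuous_on UNIV f" for f :: "real \<times> real \<Rightarrow> real"
  proof -
    have "continuous_on UNIV (\<lambda>x. f (fst x - a * snd x, snd x))"
      by (rule continuous_on_compose2[OF f sh]) simp
    then have [measurable]: "(\<lambda>x. f (fst x - a * snd x, snd x)) \<in> borel_measurable (borel \<Otimes>\<^sub>M borel)"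
      by (simp add: borel_prod borel_measurable_continuous_onI)
    have "(\<lambda>x. qpow q (f (fst x - a * snd x, snd x)) * indicator {0..1/2} (snd x)) \<in> borel_measurable (borel \<Otimes>\<^sub>M borel)"
      by measurable
    then show ?thesis by (simp add: borel_prod)
  qed
  have cd: "continuous_on UNIV (\<lambda>x. gr x - a * gs x)"
    by (intro continuous_intros cont_gs cont_gr)
  have Pm [measurable]: "P \<in> borel_measurable borel"
    using nn_inner_measurable(2)[OF m0[OF cont_g]] by (simp add: P_def[abs_def])
  have Qm [measurable]: "Q \<in> borel_measurable borel"
    using nn_inner_measurable(2)[OF m0[OF cd]] by (simp add: Q_def[abs_def])
  have "P \<in> borel_measurable lborel" "Q \<in> borel_measurable lborel" by simp_all
  have step: "qpow q (g (s, 0)) \<le> qpow q 2 * (qpow q (g (s - a * \<tau>, \<tau>)) + Q s)"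
    if "\<tau> \<in> {0..1/2}" for s \<tau>
  proof -
    have d: "((\<lambda>\<sigma>. g (s - a * \<sigma>, \<sigma>)) has_real_derivative gr (s - a * \<rho>, \<rho>) - a * gs (s - a * \<rho>, \<rho>)) (at \<rho>)" for \<rho>
      using line_deriv[of s "-a" 0 1 \<rho>] by (simp add: algebra_simps)
    have "qpow q (g (s - a * \<tau>, \<tau>) - g (s - a * 0, 0)) \<le>
      (\<integral>\<^sup>+\<rho>. qpow q (gr (s - a * \<rho>, \<rho>) - a * gs (s - a * \<rho>, \<rho>)) * indicator {0..\<tau>} \<rho> \<partial>lborel)"
    proof (rule qpow_ftc[OF q _ _ d])
      show "continuous_on UNIV (\<lambda>\<rho>. gr (s - a * \<rho>, \<rho>) - a * gs (s - a * \<rho>, \<rho>))"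
        by (rule continuous_on_compose2[OF cd]) (auto intro!: continuous_intros)
    qed (use that in auto)
    also have "\<dots> \<le> Q s"
      unfolding Q_def using that by (intro nn_integral_mono mult_left_mono) (auto split: split_indicator)
    finally have *: "qpow q (g (s - a * \<tau>, \<tau>) - g (s, 0)) \<le> Q s" by simp
    have "qpow q (g (s, 0)) = qpow q (g (s - a * \<tau>, \<tau>) + - (g (s - a * \<tau>, \<tau>) - g (s, 0)))" by simp
    also have "\<dots> \<le> qpow q 2 * (qpow q (g (s - a * \<tau>, \<tau>)) + qpow q (- (g (s - a * \<tau>, \<tau>) - g (s, 0))))"
      by (rule qpow_add[OF q])
    also have "\<dots> \<le> qpow q 2 * (qpow q (g (s - a * \<tau>, \<tau>)) + Q s)"
      unfolding qpow_minus by (intro mult_left_mono add_left_mono *) auto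
    finally show ?thesis .
  qed
  have half: "emeasure lborel {0..1/2::real} = ennreal (1/2)"
    by (subst emeasure_lborel_Icc) auto
  have pw: "qpow q (g (s, 0)) \<le> qpow q 4 * (P s + Q s)" for s
  proof -
    have m: "(\<lambda>\<tau>. qpow q (g (s - a * \<tau>, \<tau>))) \<in> borel_measurable lborel"
    proof -
      have "continuous_on UNIV (\<lambda>\<tau>. g (s - a * \<tau>, \<tau>))"
        by (rule continuous_on_compose2[OF cont_g]) (auto intro!: continuous_intros)
      then have "(\<lambda>\<tau>. g (s - a * \<tau>, \<tau>)) \<in> borel_measurable borel" by (rule borel_measurable_continuous_onI)
      then show ?thesis by measurable
    qed
    have "qpow q (g (s, 0)) * ennreal (1/2) = (\<integral>\<^sup>+\<tau>. qpow q (g (s, 0)) * indicator {0..1/2::real} \<tau> \<partial>lborel)"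
      by (subst nn_integral_cmult_indicator) (auto simp: half)
    also have "\<dots> \<le> (\<integral>\<^sup>+\<tau>. qpow q 2 * (qpow q (g (s - a * \<tau>, \<tau>)) * indicator {0..1/2} \<tau> + Q s * indicator {0..1/2} \<tau>) \<partial>lborel)"
      using step by (intro nn_integral_mono) (auto split: split_indicator)
    also have "\<dots> = qpow q 2 * (P s + Q s * ennreal (1/2))"
      using m by (subst nn_integral_cmult) (auto simp: nn_integral_add P_def nn_integral_cmult_indicator half)
    also have "\<dots> \<le> qpow q 2 * (P s + Q s * 1)"
      by (intro mult_left_mono add_left_mono) (simp_all add: ennreal_le_1 del: ennreal_half)
    finally have *: "qpow q (g (s, 0)) * ennreal (1/2) \<le> qpow q 2 * (P s + Q s)" by simp
    have "qpow q (g (s, 0)) = 2 * (qpow q (g (s, 0)) * ennreal (1/2))"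
    proof -
      have "(2::ennreal) * ennreal (1/2) = 1"
        by (metis ennreal_1 ennreal_mult' ennreal_numeral mult.commute nonzero_eq_divide_eq zero_le_numeral zero_neq_numeral)
      then show ?thesis by (metis mult.left_commute mult.right_neutral)
    qed
    also have "\<dots> \<le> qpow q 2 * (qpow q 2 * (P s + Q s))"
      by (intro mult_mono[OF qpow_ge_2[OF q] *]) auto
    also have "\<dots> = qpow q 4 * (P s + Q s)"
      using qpow_mult[of q 2 2] by (simp add: mult.assoc)
    finally show ?thesis .
  qed
  have "(\<integral>\<^sup>+s. qpow q (g (s, 0)) * indicator {a/2..(a+1)/2} s \<partial>lborel)
    \<le> (\<integral>\<^sup>+s. qpow q 4 * (P s * indicator {a/2..(a+1)/2} s + Q s * indicator {a/2..(a+1)/2} s) \<partial>lborel)"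
    using pw by (intro nn_integral_mono) (auto split: split_indicator)
  also have "\<dots> = qpow q 4 * ((\<integral>\<^sup>+s. P s * indicator {a/2..(a+1)/2} s \<partial>lborel) + (\<integral>\<^sup>+s. Q s * indicator {a/2..(a+1)/2} s \<partial>lborel))"
    by (subst nn_integral_cmult) (auto simp: nn_integral_add)
  also have "\<dots> \<le> qpow q 4 * (tri_int (\<lambda>x. qpow q (g x)) + tri_int (\<lambda>x. qpow q (gr x - a * gs x)))"
    unfolding P_def Q_def
    using shear_integral_le[OF _ a, of "\<lambda>x. qpow q (g x)"] shear_integral_le[OF _ a, of "\<lambda>x. qpow q (gr x - a * gs x)"]
    by (intro mult_left_mono add_mono) auto
  finally show ?thesis .
qed

text \<open>Each half of the edge has its own direction in \<open>trace_half\<close>. The constant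
  is 4 * 2 * 2, from \<open>trace_half\<close>, from splitting \<open>gr x - a * gs x\<close>, and
  from adding the halves.\<close>

lemma trace:
  assumes q: "1 \<le> q"
  shows "(\<integral>\<^sup>+s. qpow q (g (s, 0)) * indicator {0..1} s \<partial>lborel)
    \<le> qpow q 16 * (tri_int (\<lambda>x. qpow q (g x)) + (tri_int (\<lambda>x. qpow q (gs x)) + tri_int (\<lambda>x. qpow q (gr x))))"
proof -
  let ?G = "tri_int (\<lambda>x. qpow q (g x))"
  let ?S = "tri_int (\<lambda>x. qpow q (gs x))" and ?R = "tri_int (\<lambda>x. qpow q (gr x))"
  have d: "tri_int (\<lambda>x. qpow q (gr x - a * gs x)) \<le> qpow q 2 * (?S + ?R)" if "a = 0 \<or> a = (1::real)" for a
  proof -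
    have "tri_int (\<lambda>x. qpow q (gr x - a * gs x)) \<le> tri_int (\<lambda>x. qpow q 2 * (qpow q (gs x) + qpow q (gr x)))"
    proof (rule iter_integral_mono)
      fix x
      have "qpow q (gr x + - (a * gs x)) \<le> qpow q 2 * (qpow q (gr x) + qpow q (- (a * gs x)))"
        by (rule qpow_add[OF q])
      also have "\<dots> \<le> qpow q 2 * (qpow q (gr x) + qpow q (gs x))"
        using that q by (intro mult_left_mono add_left_mono qpow_mono) auto
      finally show "qpow q (gr x - a * gs x) \<le> qpow q 2 * (qpow q (gs x) + qpow q (gr x))"
        by (simp add: add.commute)
    qed
    also have "\<dots> = qpow q 2 * (?S + ?R)"
      by (subst iter_integral_cmult) (simp_all add: iter_integral_add)
    finally show ?thesis .
  qed
  have h: "(\<integral>\<^sup>+s. qpow q (g (s, 0)) * indicator {a/2..(a+1)/2} s \<partial>lborel) \<le> qpow q 8 * (?G + (?S + ?R))"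
    if a: "a = 0 \<or> a = (1::real)" for a
  proof -
    have "?G \<le> qpow q 2 * ?G"
      using mult_right_mono[OF qpow_ge_1[of 2 q], of ?G] q by simp
    then have "qpow q 4 * (?G + tri_int (\<lambda>x. qpow q (gr x - a * gs x))) \<le> qpow q 4 * (qpow q 2 * ?G + qpow q 2 * (?S + ?R))"
      by (intro mult_left_mono add_mono d a) auto
    also have "\<dots> = qpow q 8 * (?G + (?S + ?R))"
      using qpow_mult[of q 4 2] by (simp add: mult.assoc distrib_left)
    finally show ?thesis using trace_half[OF q a] by (meson order.trans)
  qed
  have [measurable]: "(\<lambda>s. g (s, 0)) \<in> borel_measurable borel"
    by (rule measurable_pair1) simp
  have "(\<integral>\<^sup>+s. qpow q (g (s, 0)) * indicator {0..1} s \<partial>lborel)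
    \<le> (\<integral>\<^sup>+s. qpow q (g (s, 0)) * indicator {0/2..(0+1)/2} s + qpow q (g (s, 0)) * indicator {1/2..(1+1)/2} s \<partial>lborel)"
    by (intro nn_integral_mono) (auto split: split_indicator)
  also have "\<dots> \<le> qpow q 8 * (?G + (?S + ?R)) + qpow q 8 * (?G + (?S + ?R))"
    using h[of 0] h[of 1] by (subst nn_integral_add) (auto intro: add_mono)
  also have "\<dots> = 2 * (qpow q 8 * (?G + (?S + ?R)))" by (simp add: mult_2)
  also have "\<dots> \<le> qpow q 2 * (qpow q 8 * (?G + (?S + ?R)))"
    using qpow_ge_2[OF q] by (intro mult_right_mono) auto
  also have "\<dots> = qpow q 16 * (?G + (?S + ?R))"
    using qpow_mult[of q 2 8] by (simp add: mult.assoc)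
  finally show ?thesis .
qed

end

section \<open>Iterated averages as functionals on the triangle\<close>

lemma nn_mean_s_le:
  fixes \<phi> :: "real \<times> real \<Rightarrow> ennreal"
  assumes \<phi> [measurable]: "\<phi> \<in> borel_measurable borel" and k: "1 \<le> k"
  shows "(nn_mean_along (1 / real k, 0) ^^ Suc n) \<phi> (0, r)
    \<le> ennreal k * (\<integral>\<^sup>+s. \<phi> (s, r) * indicator {0..real (Suc n) / real k} s \<partial>lborel)"
proof -
  have [measurable]: "(\<lambda>s. \<phi> (s, r)) \<in> borel_measurable borel"
    using \<phi> by (rule measurable_pair1)
  have "ennreal k * (\<integral>\<^sup>+s. \<phi> (s, r) * indicator {0..real (Suc n) / real k} s \<partial>lborel)
     = ennreal k * (ennreal (1 / k) * (\<integral>\<^sup>+\<tau>. \<phi> (0 + 1 / k * \<tau>, r) * indicator {0..real (Suc n) / real k} (0 + 1 / k * \<tau>) \<partial>lborel))"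
    using k by (subst nn_integral_real_affine[where c="1 / real k" and t=0]) auto
  also have "\<dots> = (\<integral>\<^sup>+\<tau>. \<phi> (0 + 1 / k * \<tau>, r) * indicator {0..real (Suc n) / real k} (0 + 1 / k * \<tau>) \<partial>lborel)"
    using k by (simp add: mult.assoc[symmetric] ennreal_mult[symmetric] del: of_nat_Suc)
  also have "\<dots> = (\<integral>\<^sup>+\<tau>. \<phi> ((0, r) + \<tau> *\<^sub>R (1 / real k, 0)) * indicator {0..real (Suc n)} \<tau> \<partial>lborel)"
    using k by (intro nn_integral_cong) (auto simp: field_simps split: split_indicator)
  finally show ?thesis using nn_mean_along_funpow_le[OF \<phi>, of n "(1 / real k, 0)" "(0, r)"] by simp
qed

lemma nn_mean_r_le:
  fixes \<phi> :: "real \<times> real \<Rightarrow> ennreal"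
  assumes \<phi> [measurable]: "\<phi> \<in> borel_measurable borel" and k: "1 \<le> k"
  shows "(nn_mean_along (0, 1 / real k) ^^ Suc n) \<phi> (s, 0)
    \<le> ennreal k * (\<integral>\<^sup>+r. \<phi> (s, r) * indicator {0..real (Suc n) / real k} r \<partial>lborel)"
proof -
  have "ennreal k * (\<integral>\<^sup>+r. \<phi> (s, r) * indicator {0..real (Suc n) / real k} r \<partial>lborel)
     = ennreal k * (ennreal (1 / k) * (\<integral>\<^sup>+\<tau>. \<phi> (s, 0 + 1 / k * \<tau>) * indicator {0..real (Suc n) / real k} (0 + 1 / k * \<tau>) \<partial>lborel))"
    using k by (subst nn_integral_real_affine[where c="1 / real k" and t=0]) auto
  also have "\<dots> = (\<integral>\<^sup>+\<tau>. \<phi> (s, 0 + 1 / k * \<tau>) * indicator {0..real (Suc n) / real k} (0 + 1 / k * \<tau>) \<partial>lborel)"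
    using k by (simp add: mult.assoc[symmetric] ennreal_mult[symmetric] del: of_nat_Suc)
  also have "\<dots> = (\<integral>\<^sup>+\<tau>. \<phi> ((s, 0) + \<tau> *\<^sub>R (0, 1 / real k)) * indicator {0..real (Suc n)} \<tau> \<partial>lborel)"
    using k by (intro nn_integral_cong) (auto simp: field_simps split: split_indicator)
  finally show ?thesis using nn_mean_along_funpow_le[OF \<phi>, of n "(0, 1 / real k)" "(s, 0)"] by simp
qed

text \<open>The averages reach at most the rectangle with sides \<open>Suc a / k\<close> and
  \<open>Suc b / k\<close>, whose far corner lies in the triangle because
  \<open>Suc a + Suc b \<le> k\<close>. Each direction contributes a factor \<open>k\<close> from
  rescaling the parameter.\<close>

lemma nn_mean_sr_le:
  fixes \<phi> :: "real \<times> real \<Rightarrow> ennreal"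
  assumes \<phi> [measurable]: "\<phi> \<in> borel_measurable borel" and k: "Suc a + Suc b \<le> k"
  shows "(nn_mean_along (0, 1 / real k) ^^ Suc b) ((nn_mean_along (1 / real k, 0) ^^ Suc a) \<phi>) (0, 0)
    \<le> ennreal (real k * real k) * tri_int \<phi>"
proof -
  have k1: "1 \<le> k" using k by simp
  define \<Psi> where "\<Psi> x = (\<integral>\<^sup>+\<tau>. \<phi> (x + \<tau> *\<^sub>R (1 / real k, 0)) * indicator {0..real (Suc a)} \<tau> \<partial>lborel)" for x
  have "continuous_on UNIV (\<lambda>z::(real\<times>real)\<times>real. fst z + snd z *\<^sub>R (1 / real k, 0))"
    by (intro continuous_intros)
  from measurable_compose[OF borel_measurable_continuous_onI[OF this] \<phi>]
  have [measurable]: "(\<lambda>z. \<phi> (fst z + snd z *\<^sub>R (1 / real k, 0))) \<in> borel_measurable (borel \<Otimes>\<^sub>M borel)"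
    by (simp add: borel_prod)
  have "(\<lambda>z. \<phi> (fst z + snd z *\<^sub>R (1 / real k, 0)) * indicator {0..real (Suc a)} (snd z)) \<in> borel_measurable (borel \<Otimes>\<^sub>M borel)"
    by measurable
  from nn_inner_measurable(2)[OF this[unfolded borel_prod]]
  have [measurable]: "\<Psi> \<in> borel_measurable borel" by (simp add: \<Psi>_def[abs_def] del: of_nat_Suc)
  have \<Psi>0: "\<Psi> (0, r) = ennreal k * (\<integral>\<^sup>+s. \<phi> (s, r) * indicator {0..real (Suc a) / real k} s \<partial>lborel)" for r
  proof -
    have [measurable]: "(\<lambda>s. \<phi> (s, r)) \<in> borel_measurable borel"
      using \<phi> by (rule measurable_pair1)
    have "ennreal k * (\<integral>\<^sup>+s. \<phi> (s, r) * indicator {0..real (Suc a) / real k} s \<partial>lborel)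
       = ennreal k * (ennreal (1 / k) * (\<integral>\<^sup>+\<tau>. \<phi> (0 + 1 / k * \<tau>, r) * indicator {0..real (Suc a) / real k} (0 + 1 / k * \<tau>) \<partial>lborel))"
      using k by (subst nn_integral_real_affine[where c="1 / real k" and t=0]) auto
    also have "\<dots> = (\<integral>\<^sup>+\<tau>. \<phi> (0 + 1 / k * \<tau>, r) * indicator {0..real (Suc a) / real k} (0 + 1 / k * \<tau>) \<partial>lborel)"
      using k by (simp add: mult.assoc[symmetric] ennreal_mult[symmetric] del: of_nat_Suc)
    also have "\<dots> = \<Psi> (0, r)" unfolding \<Psi>_def
      using k by (intro nn_integral_cong) (auto simp: field_simps split: split_indicator)
    finally show ?thesis by simp
  qed
  have "(nn_mean_along (0, 1 / real k) ^^ Suc b) ((nn_mean_along (1 / real k, 0) ^^ Suc a) \<phi>) (0, 0)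
    \<le> (nn_mean_along (0, 1 / real k) ^^ Suc b) \<Psi> (0, 0)"
    unfolding \<Psi>_def by (rule nn_mean_along_funpow_mono) (rule nn_mean_along_funpow_le[OF \<phi>])
  also have "\<dots> \<le> ennreal k * (\<integral>\<^sup>+r. \<Psi> (0, r) * indicator {0..real (Suc b) / real k} r \<partial>lborel)"
    by (rule nn_mean_r_le[OF _ k1]) simp
  also have "\<dots> \<le> ennreal k * (\<integral>\<^sup>+r. ennreal k * (\<integral>\<^sup>+s. \<phi> (s, r) * indicator ref_triangle (s, r) \<partial>lborel) \<partial>lborel)"
  proof (intro mult_left_mono nn_integral_mono)
    fix r :: real
    have "(\<integral>\<^sup>+s. \<phi> (s, r) * indicator {0..real (Suc a) / real k} s \<partial>lborel) * indicator {0..real (Suc b) / real k} r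
      \<le> (\<integral>\<^sup>+s. \<phi> (s, r) * indicator ref_triangle (s, r) \<partial>lborel)"
    proof (cases "r \<in> {0..real (Suc b) / real k}")
      case True
      have "s + r \<le> 1" if "s \<le> real (Suc a) / real k" for s
      proof -
        have "s + r \<le> real (Suc a) / real k + real (Suc b) / real k" using True that by simp
        also have "\<dots> = real (Suc a + Suc b) / real k" by (simp add: add_divide_distrib)
        also have "\<dots> \<le> 1" using k k1 by (simp add: divide_le_eq_1 del: of_nat_Suc of_nat_add)
        finally show ?thesis .
      qed
      then show ?thesis using True
        by (auto intro!: nn_integral_mono simp: ref_triangle_def split: split_indicator)
    qed simp
    then show "\<Psi> (0, r) * indicator {0..real (Suc b) / real k} r
      \<le> ennreal k * (\<integral>\<^sup>+s. \<phi> (s, r) * indicator ref_triangle (s, r) \<partial>lborel)"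
      unfolding \<Psi>0 by (simp add: mult.assoc mult_left_mono)
  qed auto
  also have "\<dots> = ennreal k * (ennreal k * tri_int \<phi>)"
    unfolding iter_integral_def
    using nn_inner_measurable(1)[of "\<lambda>x. \<phi> x * indicator ref_triangle x"]
    by (subst nn_integral_cmult) auto
  also have "\<dots> = ennreal (real k * real k) * tri_int \<phi>"
    by (simp add: ennreal_mult mult.assoc)
  finally show ?thesis .
qed

context C1_plane
begin

text \<open>If both orders are positive, the functional averages over an area in the triangle and
  \<open>g\<close> alone bounds it. If one order is 0, it averages along an edge, and the trace
  inequality brings in the first derivatives. The constant majorizes both 16 k and k^2.\<close>

lemma functional_bound:
  fixes k a b :: nat
  assumes q: "1 \<le> q" and ab: "1 \<le> a + b" "a + b \<le> k"
  shows "qpow q ((mean_along (0, 1 / real k) ^^ b) ((mean_along (1 / real k, 0) ^^ a) g) (0, 0))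
    \<le> qpow q (64 * (real k * real k)) * (tri_int (\<lambda>x. qpow q (g x)) + (tri_int (\<lambda>x. qpow q (gs x)) + tri_int (\<lambda>x. qpow q (gr x))))"
    (is "?L \<le> _ * (?G + (?S + ?R))")
proof -
  let ?v = "(1 / real k, 0)" and ?w = "(0, 1 / real k)"
  have k: "1 \<le> k" using ab by simp
  have kk: "1 \<le> real k * real k" "real k \<le> real k * real k" using k mult_mono[of 1 "real k" 1 "real k"] mult_mono[of 1 "real k" "real k" "real k"] by auto
  have qk: "ennreal k \<le> qpow q k" using k q by (intro qpow_le_self) auto
  have le: "?L \<le> (nn_mean_along ?w ^^ b) ((nn_mean_along ?v ^^ a) (\<lambda>x. qpow q (g x))) (0, 0)"
    by (rule order.trans[OF qpow_mean_along_funpow[OF q continuous_mean_along_funpow[OF cont_g]]])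
       (intro nn_mean_along_funpow_mono qpow_mean_along_funpow q cont_g)
  interpret W: C1_plane "\<lambda>x. g (snd x, fst x)" "\<lambda>x. gr (snd x, fst x)" "\<lambda>x. gs (snd x, fst x)"
    by (rule swap)
  have sw: "tri_int (\<lambda>x. qpow q (g (snd x, fst x))) = ?G" "tri_int (\<lambda>x. qpow q (gs (snd x, fst x))) = ?S"
     "tri_int (\<lambda>x. qpow q (gr (snd x, fst x))) = ?R"
    by (auto intro!: iter_integral_swap ref_triangle_sym)
  have line: "X \<le> qpow q (64 * (real k * real k)) * (?G + (?S + ?R))"
    if "X \<le> ennreal k * Y" "Y \<le> qpow q 16 * (?G + (?S + ?R))" for X Y
  proof -
    have "X \<le> qpow q k * (qpow q 16 * (?G + (?S + ?R)))"
      using that qk by (meson mult_mono order.trans zero_le)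
    also have "\<dots> = qpow q (16 * k) * (?G + (?S + ?R))"
      by (simp add: qpow_mult mult_ac)
    also have "\<dots> \<le> qpow q (64 * (real k * real k)) * (?G + (?S + ?R))"
      using q kk by (intro mult_right_mono qpow_mono) auto
    finally show ?thesis .
  qed
  show ?thesis
  proof (cases a)
    case 0
    then obtain b' where b: "b = Suc b'" using ab by (cases b) auto
    show ?thesis
    proof (rule line)
      show "?L \<le> ennreal k * (\<integral>\<^sup>+r. qpow q (g (0, r)) * indicator {0..1} r \<partial>lborel)"
      proof -
        have "?L \<le> ennreal k * (\<integral>\<^sup>+r. qpow q (g (0, r)) * indicator {0..real (Suc b') / real k} r \<partial>lborel)"
          using le nn_mean_r_le[OF _ k, of "\<lambda>x. qpow q (g x)" b' 0] 0 b
          by (simp del: of_nat_Suc)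
        also have "\<dots> \<le> ennreal k * (\<integral>\<^sup>+r. qpow q (g (0, r)) * indicator {0..1} r \<partial>lborel)"
          using ab b k order.trans by (intro mult_left_mono nn_integral_mono)
            (auto split: split_indicator simp: divide_le_eq_1 del: of_nat_Suc intro: order.trans)
        finally show ?thesis .
      qed
      show "(\<integral>\<^sup>+r. qpow q (g (0, r)) * indicator {0..1} r \<partial>lborel) \<le> qpow q 16 * (?G + (?S + ?R))"
        using W.trace[OF q] by (simp add: sw add.commute)
    qed
  next
    case a: (Suc a')
    show ?thesis
    proof (cases b)
      case 0
      show ?thesis
      proof (rule line)
        show "?L \<le> ennreal k * (\<integral>\<^sup>+r. qpow q (g (r, 0)) * indicator {0..1} r \<partial>lborel)"
        proof -
          have "?L \<le> ennreal k * (\<integral>\<^sup>+r. qpow q (g (r, 0)) * indicator {0..real (Suc a') / real k} r \<partial>lborel)"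
            using le nn_mean_s_le[OF _ k, of "\<lambda>x. qpow q (g x)" a' 0] 0 a
            by (simp del: of_nat_Suc)
          also have "\<dots> \<le> ennreal k * (\<integral>\<^sup>+r. qpow q (g (r, 0)) * indicator {0..1} r \<partial>lborel)"
            using ab a k order.trans by (intro mult_left_mono nn_integral_mono)
              (auto split: split_indicator simp: divide_le_eq_1 del: of_nat_Suc intro: order.trans)
          finally show ?thesis .
        qed
        show "(\<integral>\<^sup>+r. qpow q (g (r, 0)) * indicator {0..1} r \<partial>lborel) \<le> qpow q 16 * (?G + (?S + ?R))"
          by (rule trace[OF q])
      qed
    next
      case b: (Suc b')
      have "?L \<le> ennreal (real k * real k) * ?G"
        using le nn_mean_sr_le[of "\<lambda>x. qpow q (g x)" a' b' k] ab a b by simp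
      also have "\<dots> \<le> qpow q (64 * (real k * real k)) * (?G + (?S + ?R))"
      proof (intro mult_mono)
        have "ennreal (real k * real k) \<le> qpow q (real k * real k)"
          using kk q by (intro qpow_le_self) auto
        also have "\<dots> \<le> qpow q (64 * (real k * real k))"
          using kk q by (intro qpow_mono) auto
        finally show "ennreal (real k * real k) \<le> qpow q (64 * (real k * real k))" .
      qed auto
      finally show ?thesis .
    qed
  qed
qed

text \<open>The functional reproduces constants, so at \<open>g - c\<close> it takes the value -c.
  Order 0 is excluded since the functional would then be a point value.\<close>

lemma poincare_mean:
  fixes k a b :: nat
  assumes q: "1 \<le> q" and ab: "1 \<le> a + b" "a + b \<le> k"
    and z: "(mean_along (0, 1 / real k) ^^ b) ((mean_along (1 / real k, 0) ^^ a) g) (0, 0) = 0"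
  shows "tri_int (\<lambda>x. qpow q (g x))
    \<le> qpow q (288 * (64 * (real k * real k))) * (tri_int (\<lambda>x. qpow q (gs x)) + tri_int (\<lambda>x. qpow q (gr x)))"
proof (rule poincare_of_functional[OF q])
  fix c
  interpret M: C1_plane "\<lambda>x. g x - c" gs gr by (rule minus_const)
  have "qpow q c = qpow q ((mean_along (0, 1 / real k) ^^ b) ((mean_along (1 / real k, 0) ^^ a) (\<lambda>x. g x - c)) (0, 0))"
    using z by (simp add: mean_along_funpow_minus_const continuous_mean_along_funpow cont_g)
  then show "qpow q c \<le> qpow q (64 * (real k * real k)) * (tri_int (\<lambda>x. qpow q (g x - c)) +
      (tri_int (\<lambda>x. qpow q (gs x)) + tri_int (\<lambda>x. qpow q (gr x))))"
    using M.functional_bound[OF q ab] by simp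
next
  have "1 \<le> k" using ab by simp
  then have "1 \<le> real k * real k" using mult_mono[of 1 "real k" 1 "real k"] by simp
  then show "1 \<le> 64 * (real k * real k)" by simp
qed simp

end

text \<open>The value at the corner differs from the values along the bottom edge by integrals of
  \<open>gs\<close> over that edge. The trace inequality bounds both edge integrals; applied to
  \<open>gs\<close> it costs one more derivative.\<close>

lemma point_bound:
  assumes q: "1 \<le> q" and g: "C1_plane g gs gr" and gs: "C1_plane gs gss gsr"
  shows "qpow q (g (0, 0)) \<le> qpow q 64 * (tri_int (\<lambda>x. qpow q (g x)) +
    (tri_int (\<lambda>x. qpow q (gs x)) + tri_int (\<lambda>x. qpow q (gr x)) +
     (tri_int (\<lambda>x. qpow q (gss x)) + tri_int (\<lambda>x. qpow q (gsr x)))))"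
    (is "_ \<le> _ * (?G + (?S + ?R + (?SS + ?SR)))")
proof -
  interpret g: C1_plane g gs gr by fact
  interpret gs: C1_plane gs gss gsr by fact
  define J where "J = (\<integral>\<^sup>+\<sigma>. qpow q (gs (\<sigma>, 0)) * indicator {0..1} \<sigma> \<partial>lborel)"
  have step: "qpow q (g (0, 0)) \<le> qpow q 2 * (qpow q (g (s, 0)) + J)" if "s \<in> {0..1}" for s
  proof -
    have "qpow q (g (0, 0)) = qpow q (g (s, 0) + (g (0, 0) - g (s, 0)))" by simp
    also have "\<dots> \<le> qpow q 2 * (qpow q (g (s, 0)) + qpow q (g (0, 0) - g (s, 0)))"
      by (rule qpow_add[OF q])
    also have "\<dots> \<le> qpow q 2 * (qpow q (g (s, 0)) + J)"
      unfolding J_def using that by (intro mult_left_mono add_left_mono g.qpow_s q) auto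
    finally show ?thesis .
  qed
  have [measurable]: "(\<lambda>s. g (s, 0)) \<in> borel_measurable borel" by (rule measurable_pair1) simp
  have "qpow q (g (0, 0)) = (\<integral>\<^sup>+(s::real). qpow q (g (0, 0)) * indicator {0..1} s \<partial>lborel)"
    by (simp add: nn_integral_cmult_indicator)
  also have "\<dots> \<le> (\<integral>\<^sup>+s. qpow q 2 * (qpow q (g (s, 0)) * indicator {0..1} s + J * indicator {0..1} s) \<partial>lborel)"
    using step by (intro nn_integral_mono) (auto split: split_indicator)
  also have "\<dots> = qpow q 2 * ((\<integral>\<^sup>+s. qpow q (g (s, 0)) * indicator {0..1} s \<partial>lborel) + J)"
    by (subst nn_integral_cmult) (auto simp: nn_integral_add nn_integral_cmult_indicator)
  also have "\<dots> \<le> qpow q 2 * (qpow q 16 * (?G + (?S + ?R)) + qpow q 16 * (?S + (?SS + ?SR)))"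
    unfolding J_def by (intro mult_left_mono add_mono g.trace gs.trace q) auto
  also have "\<dots> \<le> qpow q 2 * (qpow q 16 * (?G + (?S + ?R + (?SS + ?SR))) + qpow q 16 * (?G + (?S + ?R + (?SS + ?SR))))"
  proof -
    have A: "?G + (?S + ?R) \<le> ?G + (?S + ?R + (?SS + ?SR))"
      by (intro add_left_mono add_increasing2) auto
    have "?S + (?SS + ?SR) \<le> ?S + ?R + (?SS + ?SR)"
      by (intro add_right_mono add_increasing2) auto
    then have B: "?S + (?SS + ?SR) \<le> ?G + (?S + ?R + (?SS + ?SR))"
      by (rule add_increasing[rotated]) simp
    show ?thesis
      by (intro mult_left_mono[of _ _ "qpow q 2"] add_mono[OF mult_left_mono[OF A] mult_left_mono[OF B]]) auto
  qed
  also have "\<dots> = qpow q 2 * (2 * (qpow q 16 * (?G + (?S + ?R + (?SS + ?SR)))))" by (simp add: mult_2)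
  also have "\<dots> \<le> qpow q 2 * (qpow q 2 * (qpow q 16 * (?G + (?S + ?R + (?SS + ?SR)))))"
    by (intro mult_left_mono mult_right_mono qpow_ge_2[OF q]) auto
  also have "\<dots> = qpow q 64 * (?G + (?S + ?R + (?SS + ?SR)))"
  proof -
    have "qpow q 64 = qpow q 2 * (qpow q 2 * qpow q 16)"
      by (subst qpow_mult[symmetric])+ simp
    then show ?thesis by (simp add: mult_ac)
  qed
  finally show ?thesis .
qed

lemma poincare_point:
  assumes q: "1 \<le> q" and g: "C1_plane g gs gr" and gs: "C1_plane gs gss gsr" and z: "g (0, 0) = 0"
  shows "tri_int (\<lambda>x. qpow q (g x)) \<le> qpow q (288 * 64) *
    (tri_int (\<lambda>x. qpow q (gs x)) + tri_int (\<lambda>x. qpow q (gr x)) +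
     (tri_int (\<lambda>x. qpow q (gss x)) + tri_int (\<lambda>x. qpow q (gsr x))))"
proof -
  interpret g: C1_plane g gs gr by fact
  show ?thesis
  proof (rule g.poincare_of_functional[OF q])
    fix c
    show "qpow q c \<le> qpow q 64 * (tri_int (\<lambda>x. qpow q (g x - c)) + (tri_int (\<lambda>x. qpow q (gs x)) + tri_int (\<lambda>x. qpow q (gr x)) +
     (tri_int (\<lambda>x. qpow q (gss x)) + tri_int (\<lambda>x. qpow q (gsr x)))))"
      using point_bound[OF q g.minus_const gs, of c] z by simp
  qed auto
qed

section \<open>Functions vanishing at the lattice points\<close>

text \<open>A difference of order \<open>(a, b)\<close> at the lattice point \<open>(i, j)\<close>
  involves only lattice points up to \<open>(i + a, j + b)\<close>, and these are still
  nodes.\<close>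

lemma diff_along_funpow_nodes:
  fixes f :: "real \<times> real \<Rightarrow> real"
  assumes z: "\<And>i j. i + j \<le> k \<Longrightarrow> f (real i / real k, real j / real k) = 0"
  shows "i + j + (a + b) \<le> k \<Longrightarrow>
    (diff_along (1 / real k, 0) ^^ a) ((diff_along (0, 1 / real k) ^^ b) f) (real i / real k, real j / real k) = 0"
proof (induction a arbitrary: i)
  case 0
  then show ?case
  proof (induction b arbitrary: j)
    case 0
    then show ?case using z[of i j] by simp
  next
    case (Suc b)
    have "(diff_along (0, 1 / real k) ^^ b) f (real i / real k, real (Suc j) / real k) = 0"
      "(diff_along (0, 1 / real k) ^^ b) f (real i / real k, real j / real k) = 0"
      using Suc.IH[of "Suc j"] Suc.IH[of j] Suc.prems by simp_all
    then show ?case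
      by (simp add: diff_along_def[where g="(diff_along (0, 1 / real k) ^^ b) f"] add_divide_distrib add.commute)
  qed
next
  case (Suc a)
  let ?h = "(diff_along (1 / real k, 0) ^^ a) ((diff_along (0, 1 / real k) ^^ b) f)"
  have "?h (real (Suc i) / real k, real j / real k) = 0" "?h (real i / real k, real j / real k) = 0"
    using Suc.IH[of "Suc i"] Suc.IH[of i] Suc.prems by simp_all
  then show ?case by (simp add: diff_along_def[where g="?h"] add_divide_distrib add.commute)
qed

text \<open>\<open>d a b\<close> is the mixed derivative of order \<open>(a, b)\<close> of \<open>d 0 0\<close>.\<close>

locale deriv_family =
  fixes d :: "nat \<Rightarrow> nat \<Rightarrow> real \<times> real \<Rightarrow> real" and k :: nat
  assumes k: "1 \<le> k"
    and deriv: "\<And>a b x. (d a b has_derivative (\<lambda>h. fst h * d (Suc a) b x + snd h * d a (Suc b) x)) (at x)"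
    and nodes: "\<And>i j. i + j \<le> k \<Longrightarrow> d 0 0 (real i / real k, real j / real k) = 0"
begin

lemma cont: "continuous_on UNIV (d a b)"
  using deriv by (meson continuous_at_imp_continuous_on has_derivative_continuous)

lemma C1: "C1_plane (d a b) (d (Suc a) b) (d a (Suc b))"
  by unfold_locales (rule deriv cont)+

lemma mean_s: "mean_along (1 / real k, 0) (d (Suc a) b) = (\<lambda>x. real k * diff_along (1 / real k, 0) (d a b) x)"
proof -
  interpret C1_plane "d a b" "d (Suc a) b" "d a (Suc b)" by (rule C1)
  have "mean_along (1 / real k, 0) (\<lambda>x. (1 / real k) * d (Suc a) b x) = diff_along (1 / real k, 0) (d a b)"
  proof (rule mean_along_deriv)
    fix x :: "real \<times> real"
    show "((\<lambda>\<sigma>. d a b (x + \<sigma> *\<^sub>R (1 / real k, 0))) has_real_derivative 1 / real k * d (Suc a) b x) (at 0)"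
      using line_deriv[of "fst x" "1 / real k" "snd x" 0 0] by (cases x) simp
  qed
  then show ?thesis using k unfolding mean_along_cmult by (auto simp: fun_eq_iff field_simps)
qed

lemma mean_r: "mean_along (0, 1 / real k) (d a (Suc b)) = (\<lambda>x. real k * diff_along (0, 1 / real k) (d a b) x)"
proof -
  interpret C1_plane "d a b" "d (Suc a) b" "d a (Suc b)" by (rule C1)
  have "mean_along (0, 1 / real k) (\<lambda>x. (1 / real k) * d a (Suc b) x) = diff_along (0, 1 / real k) (d a b)"
  proof (rule mean_along_deriv)
    fix x :: "real \<times> real"
    show "((\<lambda>\<sigma>. d a b (x + \<sigma> *\<^sub>R (0, 1 / real k))) has_real_derivative 1 / real k * d a (Suc b) x) (at 0)"
      using line_deriv[of "fst x" 0 "snd x" "1 / real k" 0] by (cases x) simp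
  qed
  then show ?thesis using k unfolding mean_along_cmult by (auto simp: fun_eq_iff field_simps)
qed

lemma mean_s_funpow:
  "(mean_along (1 / real k, 0) ^^ a) (d a b) = (\<lambda>x. real k ^ a * (diff_along (1 / real k, 0) ^^ a) (d 0 b) x)"
proof (induction a)
  case (Suc a)
  have "(mean_along (1 / real k, 0) ^^ Suc a) (d (Suc a) b) = (mean_along (1 / real k, 0) ^^ a) (mean_along (1 / real k, 0) (d (Suc a) b))"
    by (simp add: funpow_swap1)
  also have "\<dots> = (\<lambda>x. real k * diff_along (1 / real k, 0) ((mean_along (1 / real k, 0) ^^ a) (d a b)) x)"
    by (simp add: mean_s mean_along_funpow_cmult mean_along_funpow_diff_along cont)
  finally show ?case by (simp add: Suc diff_along_cmult mult_ac)
qed simp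

lemma mean_r_funpow:
  "(mean_along (0, 1 / real k) ^^ b) (d a b) = (\<lambda>x. real k ^ b * (diff_along (0, 1 / real k) ^^ b) (d a 0) x)"
proof (induction b)
  case (Suc b)
  have "(mean_along (0, 1 / real k) ^^ Suc b) (d a (Suc b)) = (mean_along (0, 1 / real k) ^^ b) (mean_along (0, 1 / real k) (d a (Suc b)))"
    by (simp add: funpow_swap1)
  also have "\<dots> = (\<lambda>x. real k * diff_along (0, 1 / real k) ((mean_along (0, 1 / real k) ^^ b) (d a b)) x)"
    by (simp add: mean_r mean_along_funpow_cmult mean_along_funpow_diff_along cont)
  finally show ?case by (simp add: Suc diff_along_cmult mult_ac)
qed simp

text \<open>Averages in one direction commute with differences in the other, so the functional
  equals k^(a + b) times a pure difference of node values.\<close>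

lemma functional_zero:
  assumes "a + b \<le> k"
  shows "(mean_along (0, 1 / real k) ^^ b) ((mean_along (1 / real k, 0) ^^ a) (d a b)) (0, 0) = 0"
proof -
  have "(mean_along (0, 1 / real k) ^^ b) ((mean_along (1 / real k, 0) ^^ a) (d a b)) (0, 0)
    = real k ^ a * (real k ^ b * (diff_along (1 / real k, 0) ^^ a) ((diff_along (0, 1 / real k) ^^ b) (d 0 0)) (0, 0))"
    by (simp add: mean_s_funpow mean_along_funpow_cmult mean_along_funpow_diff_along_funpow cont
        mean_r_funpow diff_along_funpow_cmult)
  also have "\<dots> = 0"
    using diff_along_funpow_nodes[of k "d 0 0" 0 0 a b, OF nodes] assms by simp
  finally show ?thesis .
qed

definition energy :: "real \<Rightarrow> nat \<Rightarrow> nat \<Rightarrow> ennreal" where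
  "energy q a b = tri_int (\<lambda>x. qpow q (d a b x))"

text \<open>The restriction to orders that are componentwise at least \<open>(a, b)\<close> is kept
  in the definition, because the later normalization by the two edge lengths depends on it.\<close>

definition top_energy :: "real \<Rightarrow> nat \<Rightarrow> nat \<Rightarrow> ennreal" where
  "top_energy q a b = (\<Sum>(x, y) | a \<le> x \<and> b \<le> y \<and> x + y = Suc k. energy q x y)"

lemma top_energy_mono:
  assumes "a \<le> a'" "b \<le> b'"
  shows "top_energy q a' b' \<le> top_energy q a b"
  unfolding top_energy_def
proof (rule sum_mono2)
  show "finite {(x, y). a \<le> x \<and> b \<le> y \<and> x + y = Suc k}"
    by (rule finite_subset[of _ "{..Suc k} \<times> {..Suc k}"]) auto
qed (use assms in auto)

text \<open>For \<open>a + b = 0\<close> the vanishing functional is the value at a vertex, which is not bounded by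
  first derivatives alone when \<open>q \<le> 2\<close>: this case uses second derivatives and goes down two
  steps at once.\<close>

lemma energy_le_top_energy:
  assumes q: "1 \<le> q"
  shows "a + b + n = Suc k \<Longrightarrow> energy q a b \<le> qpow q ((4 * (288 * (64 * (real k * real k)))) ^ n) * top_energy q a b"
proof (induction n arbitrary: a b rule: less_induct)
  case (less n)
  let ?D = "288 * (64 * (real k * real k))"
  have D: "1 \<le> ?D" "288 * 64 \<le> ?D" using k mult_mono[of 1 "real k" 1 "real k"] by auto
  show ?case
  proof (cases n)
    case 0
    then have "{(x, y). a \<le> x \<and> b \<le> y \<and> x + y = Suc k} = {(a, b)}" using less.prems by auto
    then show ?thesis using 0 by (simp add: top_energy_def qpow_def)
  next
    case (Suc m)
    let ?c = "(4 * ?D) ^ m"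
    have IH: "energy q a' b' \<le> qpow q ?c * top_energy q a b"
      if "a \<le> a'" "b \<le> b'" "a + b < a' + b'" "a' + b' \<le> Suc k" for a' b'
    proof -
      define n' where "n' = Suc k - (a' + b')"
      have n': "n' < n" "a' + b' + n' = Suc k" using that less.prems by (auto simp: n'_def)
      have "energy q a' b' \<le> qpow q ((4 * ?D) ^ n') * top_energy q a' b'"
        by (rule less.IH[OF n'])
      also have "\<dots> \<le> qpow q ?c * top_energy q a b"
      proof (intro mult_mono top_energy_mono qpow_mono)
        have "(4 * ?D) ^ n' \<le> ?c" using n' Suc D by (intro power_increasing) auto
        then show "\<bar>(4 * ?D) ^ n'\<bar> \<le> \<bar>?c\<bar>" using D by (simp only: abs_of_nonneg zero_le_power)
      qed (use that q in auto)
      finally show ?thesis .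
    qed
    let ?X = "qpow q ?c * top_energy q a b"
    \<comment> \<open>Both cases are padded to four terms, so that one factor 4 serves for every
      step of the induction.\<close>
    have "energy q a b \<le> qpow q ?D * (?X + ?X + (?X + ?X))"
    proof (cases "a + b = 0")
      case True
      then have [simp]: "a = 0" "b = 0" by auto
      \<comment> \<open>The vanishing functional is here the value at \<open>(0, 0)\<close>, the
        node with \<open>i = j = 0\<close>.\<close>
      have "energy q a b \<le> qpow q (288 * 64) * (energy q 1 0 + energy q 0 1 + (energy q 2 0 + energy q 1 1))"
        using poincare_point[OF q C1[of 0 0] C1[of 1 0, simplified]] nodes[of 0 0]
        by (simp add: energy_def numeral_2_eq_2)
      also have "\<dots> \<le> qpow q ?D * (?X + ?X + (?X + ?X))"
        using k D q by (intro mult_mono add_mono IH qpow_mono) auto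
      finally show ?thesis .
    next
      case False
      interpret C1_plane "d a b" "d (Suc a) b" "d a (Suc b)" by (rule C1)
      have "energy q a b \<le> qpow q ?D * (energy q (Suc a) b + energy q a (Suc b))"
        unfolding energy_def using False less.prems Suc functional_zero[of a b]
        by (intro poincare_mean[OF q, of a b]) auto
      also have "\<dots> \<le> qpow q ?D * (?X + ?X)"
        using less.prems Suc by (intro mult_left_mono add_mono IH) auto
      also have "\<dots> \<le> qpow q ?D * (?X + ?X + (?X + ?X))"
        by (intro mult_left_mono) (auto simp: add_increasing2)
      finally show ?thesis .
    qed
    also have "?X + ?X + (?X + ?X) = 4 * ?X"
      by (simp add: mult_2[symmetric] mult.assoc[symmetric] distrib_right[symmetric])
    also have "\<dots> \<le> qpow q 4 * ?X"
      using qpow_le_self[of 4 q] q by (intro mult_right_mono) auto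
    also have "qpow q ?D * (qpow q 4 * ?X) = qpow q ((4 * ?D) ^ n) * top_energy q a b"
    proof -
      have "qpow q ((4 * ?D) ^ n) = qpow q ?D * (qpow q 4 * qpow q ?c)"
        unfolding Suc by (subst qpow_mult[symmetric])+ (simp add: mult_ac)
      then show ?thesis by (simp add: mult_ac)
    qed
    finally show ?thesis by (simp add: mult_left_mono)
  qed
qed

text \<open>A member of the family whose two derivatives vanish is constant, and the functional of
  its order forces this constant to be 0. Applied to polynomials, this yields the uniqueness of
  interpolation.\<close>

lemma zero_of_top_zero:
  assumes top: "\<And>a b x. a + b = Suc k \<Longrightarrow> d a b x = 0"
  shows "a + b + n = Suc k \<Longrightarrow> d a b x = 0"
proof (induction n arbitrary: a b x)
  case 0
  then show ?case using top by simp
next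
  case (Suc n)
  have "d (Suc a) b y = 0" "d a (Suc b) y = 0" for y
    using Suc.IH[of "Suc a" b y] Suc.IH[of a "Suc b" y] Suc.prems by simp_all
  then have "(d a b has_derivative (\<lambda>h. 0)) (at y)" for y
    using deriv[of a b y] by simp
  then obtain c where c: "d a b y = c" for y
    using has_derivative_zero_constant[of UNIV "d a b"] by auto
  then have dc: "d a b = (\<lambda>y. c)" by auto
  have "(mean_along v ^^ m) (\<lambda>y. c) = (\<lambda>y. c)" for m and v :: "real \<times> real"
    by (induction m) (simp_all add: mean_along_def[abs_def])
  then have "c = 0" using functional_zero[of a b] Suc.prems dc by simp
  then show ?case using c by simp
qed

end

section \<open>Smooth functions on the plane\<close>

text \<open>Derivatives along the edges are needed besides the coordinate ones; with the encoding of
  \<open>partial\<close>, the latter become a special case.\<close>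

definition dird :: "real^2 \<Rightarrow> (real^2 \<Rightarrow> real) \<Rightarrow> real^2 \<Rightarrow> real" where
  "dird d f x = frechet_derivative f (at x) d"

lemma partial_eq_dird: "partial i = dird (axis i 1)"
  by (simp add: fun_eq_iff partial_def dird_def)

lemma dird_eq: "(f has_derivative f') (at x) \<Longrightarrow> dird d f x = f' d"
  by (simp add: dird_def frechet_derivative_at[symmetric])

lemma smooth_partial: "smooth f \<Longrightarrow> smooth (partial i f)"
  unfolding smooth_def
proof
  fix js assume "\<forall>is. foldr partial is f differentiable_on UNIV"
  then have "foldr partial (js @ [i]) f differentiable_on UNIV" by blast
  then show "foldr partial js (partial i f) differentiable_on UNIV" by simp
qed

lemma smooth_differentiable: "smooth f \<Longrightarrow> f differentiable (at x)"
  unfolding smooth_def differentiable_on_def by (metis UNIV_I foldr_Nil id_apply)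

lemma smooth_has_derivative: "smooth f \<Longrightarrow> (f has_derivative (\<lambda>d. dird d f x)) (at x)"
  using smooth_differentiable frechet_derivative_works unfolding dird_def[abs_def] by (metis eta_contract_eq)

lemma smooth_continuous: "smooth f \<Longrightarrow> continuous_on S f"
  by (meson continuous_at_imp_continuous_on differentiable_imp_continuous_within smooth_differentiable)

text \<open>Smoothness speaks about all words of partial derivatives. A set of differentiable
  functions that is closed under \<open>partial\<close> contains all these words.\<close>

lemma smooth_coinduct:
  assumes "f \<in> X" and X: "\<And>g x. g \<in> X \<Longrightarrow> g differentiable (at x)" "\<And>g i. g \<in> X \<Longrightarrow> partial i g \<in> X"
  shows "smooth f"
proof -
  have "foldr partial is f \<in> X" for "is"
    by (induction "is") (use assms in auto)
  then show ?thesis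
    unfolding smooth_def differentiable_on_def using X(1) by (simp add: differentiable_at_withinI)
qed

inductive_set generated_algebra :: "(real^2 \<Rightarrow> real) set \<Rightarrow> (real^2 \<Rightarrow> real) set" for B where
  base: "f \<in> B \<Longrightarrow> f \<in> generated_algebra B"
| const: "(\<lambda>x. c) \<in> generated_algebra B"
| add: "f \<in> generated_algebra B \<Longrightarrow> g \<in> generated_algebra B \<Longrightarrow> (\<lambda>x. f x + g x) \<in> generated_algebra B"
| mult: "f \<in> generated_algebra B \<Longrightarrow> g \<in> generated_algebra B \<Longrightarrow> (\<lambda>x. f x * g x) \<in> generated_algebra B"

lemma has_derivative_dird: "f differentiable (at x) \<Longrightarrow> (f has_derivative (\<lambda>d. dird d f x)) (at x)"
  using frechet_derivative_works unfolding dird_def[abs_def] by (metis eta_contract_eq)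

lemma dird_const [simp]: "dird d (\<lambda>x. c) = (\<lambda>x. 0)"
  by (rule ext, rule dird_eq[of _ "\<lambda>_. 0"]) simp

lemma dird_add:
  assumes "\<And>x. f differentiable (at x)" "\<And>x. g differentiable (at x)"
  shows "dird d (\<lambda>x. f x + g x) = (\<lambda>x. dird d f x + dird d g x)"
  by (rule ext, rule dird_eq[where f'="\<lambda>d. dird d f _ + dird d g _"])
     (intro has_derivative_add has_derivative_dird assms)

lemma dird_mult:
  assumes "\<And>x. f differentiable (at x)" "\<And>x. g differentiable (at x)"
  shows "dird d (\<lambda>x. f x * g x) = (\<lambda>x. f x * dird d g x + dird d f x * g x)"
  by (rule ext, rule dird_eq[where f'="\<lambda>d. f _ * dird d g _ + dird d f _ * g _"])
     (intro has_derivative_mult has_derivative_dird assms)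

text \<open>By the Leibniz rule the generated algebra is closed under partial derivatives as soon as
  it contains those of its generators. This reduces smoothness to one derivative of each
  generator.\<close>

lemma generated_algebra_smooth:
  assumes f: "f \<in> generated_algebra B"
    and B: "\<And>b x. b \<in> B \<Longrightarrow> b differentiable (at x)" "\<And>b i. b \<in> B \<Longrightarrow> partial i b \<in> generated_algebra B"
  shows "smooth f"
proof (rule smooth_coinduct[OF f])
  have diff: "g differentiable (at x)" if "g \<in> generated_algebra B" for g x
    using that by (induction) (auto intro: B differentiable_add differentiable_mult)
  then show "\<And>g x. g \<in> generated_algebra B \<Longrightarrow> g differentiable (at x)" .
  fix g i assume "g \<in> generated_algebra B"
  then show "partial i g \<in> generated_algebra B"
  proof induction
    case (base f)
    then show ?case using B by blast
  next
    case (const c)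
    then show ?case by (auto simp: partial_eq_dird intro: generated_algebra.const)
  next
    case (add f g)
    then show ?case by (simp add: partial_eq_dird dird_add diff generated_algebra.add)
  next
    case (mult f g)
    then show ?case by (simp add: partial_eq_dird dird_mult diff generated_algebra.add generated_algebra.mult)
  qed
qed

lemma smooth_closure:
  assumes "f \<in> generated_algebra (Collect smooth)"
  shows "smooth f"
  by (rule generated_algebra_smooth[OF assms])
     (auto intro: smooth_differentiable smooth_partial generated_algebra.base)

lemma smooth_const [intro, simp]: "smooth (\<lambda>x. c)"
  by (rule smooth_closure) (rule generated_algebra.const)

lemma smooth_add [intro]: "smooth f \<Longrightarrow> smooth g \<Longrightarrow> smooth (\<lambda>x. f x + g x)"
  by (rule smooth_closure) (simp add: generated_algebra.base generated_algebra.add)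

lemma smooth_mult [intro]: "smooth f \<Longrightarrow> smooth g \<Longrightarrow> smooth (\<lambda>x. f x * g x)"
  by (rule smooth_closure) (simp add: generated_algebra.base generated_algebra.mult)

lemma smooth_cmult [intro]: "smooth f \<Longrightarrow> smooth (\<lambda>x. c * f x)"
  by (rule smooth_mult) auto

lemma smooth_minus [intro]: "smooth f \<Longrightarrow> smooth g \<Longrightarrow> smooth (\<lambda>x. f x - g x)"
  using smooth_add[of f "\<lambda>x. -1 * g x"] smooth_cmult[of g "-1"] by simp

lemma smooth_sum [intro]: "(\<And>i. i \<in> I \<Longrightarrow> smooth (f i)) \<Longrightarrow> smooth (\<lambda>x. \<Sum>i\<in>I. f i x)"
  by (induction I rule: infinite_finite_induct) auto

lemma smooth_prod [intro]: "(\<And>i. i \<in> I \<Longrightarrow> smooth (f i)) \<Longrightarrow> smooth (\<lambda>x. \<Prod>i\<in>I. f i x)"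
  by (induction I rule: infinite_finite_induct) auto

lemma smooth_power [intro]: "smooth f \<Longrightarrow> smooth (\<lambda>x. f x ^ n)"
  by (induction n) auto

lemma smooth_inner [intro]: "smooth (\<lambda>x. l \<bullet> x)"
proof (rule generated_algebra_smooth[of _ "{\<lambda>x. l \<bullet> x}"])
  have d: "((\<lambda>x. l \<bullet> x) has_derivative (\<lambda>h. l \<bullet> h)) (at x)" for x :: "real^2"
    by (auto intro!: derivative_eq_intros)
  then show "b differentiable (at x)" if "b \<in> {\<lambda>x. l \<bullet> x}" for b x
    using that by (auto simp: differentiable_def)
  have "dird v (\<lambda>x. l \<bullet> x) = (\<lambda>x. l \<bullet> v)" for v
    by (rule ext, rule dird_eq[OF d])
  then show "partial i b \<in> generated_algebra {\<lambda>x. l \<bullet> x}" if "b \<in> {\<lambda>x. l \<bullet> x}" for b i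
    using that by (auto simp: partial_eq_dird intro: generated_algebra.const)
qed (auto intro: generated_algebra.base)

lemma smooth_component [intro]: "smooth (\<lambda>x. x $ i)"
  using smooth_inner[of "axis i 1"] by (simp add: inner_axis' )

lemma dird_coords:
  assumes "smooth f"
  shows "dird d f = (\<lambda>x. d $ 1 * partial 1 f x + d $ 2 * partial 2 f x)"
proof
  fix x
  interpret linear "\<lambda>d. dird d f x"
    using smooth_has_derivative[OF assms] by (rule has_derivative_linear)
  have "d = (d $ 1) *\<^sub>R axis 1 1 + (d $ 2) *\<^sub>R axis 2 1"
    by (simp add: vec_eq_iff forall_2 axis_def)
  then have "dird d f x = dird ((d $ 1) *\<^sub>R axis 1 1 + (d $ 2) *\<^sub>R axis 2 1) f x" by simp
  then show "dird d f x = d $ 1 * partial 1 f x + d $ 2 * partial 2 f x"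
    by (simp only: add scaleR partial_eq_dird real_scaleR_def)
qed

lemma dird_linear:
  assumes "smooth f"
  shows "dird (a *\<^sub>R u + b *\<^sub>R w) f = (\<lambda>x. a * dird u f x + b * dird w f x)"
  by (simp add: dird_coords[OF assms] fun_eq_iff algebra_simps)

lemma smooth_dird [intro]: "smooth f \<Longrightarrow> smooth (dird d f)"
  by (subst dird_coords) (auto intro!: smooth_partial)

lemma smooth_dird_funpow [intro]: "smooth f \<Longrightarrow> smooth ((dird d ^^ n) f)"
  by (induction n) auto

lemma dird_smooth_add: "smooth f \<Longrightarrow> smooth g \<Longrightarrow> dird d (\<lambda>x. f x + g x) = (\<lambda>x. dird d f x + dird d g x)"
  by (rule dird_add) (auto intro: smooth_differentiable)

lemma dird_smooth_cmult: "smooth f \<Longrightarrow> dird d (\<lambda>x. c * f x) = (\<lambda>x. c * dird d f x)"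
  by (subst dird_mult) (auto intro: smooth_differentiable)

lemma dird_smooth_minus: "smooth f \<Longrightarrow> smooth g \<Longrightarrow> dird d (\<lambda>x. f x - g x) = (\<lambda>x. dird d f x - dird d g x)"
  using dird_smooth_add[of f "\<lambda>x. -1 * g x" d] dird_smooth_cmult[of g d "-1"] smooth_cmult[of g "-1"] by simp

lemma dird_smooth_sum:
  "(\<And>i. i \<in> I \<Longrightarrow> smooth (f i)) \<Longrightarrow> dird d (\<lambda>x. \<Sum>i\<in>I. f i x) = (\<lambda>x. \<Sum>i\<in>I. dird d (f i) x)"
  by (induction I rule: infinite_finite_induct) (auto simp: dird_smooth_add smooth_sum)

lemma dird_funpow_minus:
  "smooth f \<Longrightarrow> smooth g \<Longrightarrow> (dird d ^^ n) (\<lambda>x. f x - g x) = (\<lambda>x. (dird d ^^ n) f x - (dird d ^^ n) g x)"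
  by (induction n) (auto simp: dird_smooth_minus smooth_dird_funpow)

lemma dird_funpow_cmult:
  "smooth f \<Longrightarrow> (dird d ^^ n) (\<lambda>x. c * f x) = (\<lambda>x. c * (dird d ^^ n) f x)"
  by (induction n) (auto simp: dird_smooth_cmult smooth_dird_funpow)

lemma dird_funpow_sum:
  "(\<And>i. i \<in> I \<Longrightarrow> smooth (f i)) \<Longrightarrow>
   (dird d ^^ n) (\<lambda>x. \<Sum>i\<in>I. f i x) = (\<lambda>x. \<Sum>i\<in>I. (dird d ^^ n) (f i) x)"
  by (induction n) (auto simp: dird_smooth_sum smooth_dird_funpow)

lemma dird_scaleR: "smooth f \<Longrightarrow> dird (c *\<^sub>R u) f = (\<lambda>x. c * dird u f x)"
  using dird_linear[of f c u 0 0] by simp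

lemma dird_scaleR_funpow: "smooth f \<Longrightarrow> (dird (c *\<^sub>R u) ^^ n) f = (\<lambda>x. c ^ n * (dird u ^^ n) f x)"
  by (induction n) (auto simp: dird_scaleR dird_smooth_cmult smooth_dird_funpow smooth_cmult)

lemma line_has_derivative:
  assumes "smooth f"
  shows "((\<lambda>t. f (x + t *\<^sub>R u)) has_real_derivative dird u f (x + t *\<^sub>R u)) (at t)"
proof -
  have "((\<lambda>t. x + t *\<^sub>R u) has_derivative (\<lambda>h. h *\<^sub>R u)) (at t)"
    by (auto intro!: derivative_eq_intros)
  from has_derivative_compose[OF this smooth_has_derivative[OF assms]]
  have "((\<lambda>t. f (x + t *\<^sub>R u)) has_derivative (\<lambda>h. dird (h *\<^sub>R u) f (x + t *\<^sub>R u))) (at t)" .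
  then show ?thesis
    unfolding has_field_derivative_def dird_scaleR[OF assms] by (simp add: mult.commute[of _ "dird u f _"])
qed

text \<open>The mean value theorem twice: first along \<open>u\<close> for the difference in the
  direction \<open>w\<close>, then along \<open>w\<close> for the derivative in the direction
  \<open>u\<close>.\<close>

lemma second_difference:
  assumes f: "smooth f" and h: "0 < h"
  shows "\<exists>\<theta> \<theta>'. 0 < \<theta> \<and> \<theta> < h \<and> 0 < \<theta>' \<and> \<theta>' < h \<and>
    f (x + h *\<^sub>R u + h *\<^sub>R w) - f (x + h *\<^sub>R u) - f (x + h *\<^sub>R w) + f x
      = h * h * dird w (dird u f) (x + \<theta> *\<^sub>R u + \<theta>' *\<^sub>R w)"
proof -
  define g where "g s = f ((x + h *\<^sub>R w) + s *\<^sub>R u) - f (x + s *\<^sub>R u)" for s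
  have "(g has_real_derivative dird u f ((x + h *\<^sub>R w) + s *\<^sub>R u) - dird u f (x + s *\<^sub>R u)) (at s)" for s
    unfolding g_def by (intro DERIV_diff line_has_derivative f)
  from MVT2[OF h this] obtain \<theta> where \<theta>: "0 < \<theta>" "\<theta> < h"
    "g h - g 0 = (h - 0) * (dird u f ((x + h *\<^sub>R w) + \<theta> *\<^sub>R u) - dird u f (x + \<theta> *\<^sub>R u))" by blast
  have "((\<lambda>t. dird u f ((x + \<theta> *\<^sub>R u) + t *\<^sub>R w)) has_real_derivative
      dird w (dird u f) ((x + \<theta> *\<^sub>R u) + t *\<^sub>R w)) (at t)" for t
    by (intro line_has_derivative smooth_dird f)
  from MVT2[OF h this] obtain \<theta>' where \<theta>': "0 < \<theta>'" "\<theta>' < h"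
    "dird u f ((x + \<theta> *\<^sub>R u) + h *\<^sub>R w) - dird u f ((x + \<theta> *\<^sub>R u) + 0 *\<^sub>R w)
      = (h - 0) * dird w (dird u f) ((x + \<theta> *\<^sub>R u) + \<theta>' *\<^sub>R w)" by blast
  show ?thesis
    by (rule exI[of _ \<theta>], rule exI[of _ \<theta>']) (use \<theta> \<theta>' in \<open>simp add: g_def algebra_simps\<close>)
qed

text \<open>The second difference is symmetric in \<open>u\<close> and \<open>w\<close>, so the two
  mixed derivatives agree at intermediate points that tend to \<open>x\<close>; continuity does the
  rest.\<close>

lemma dird_commute:
  assumes f: "smooth f"
  shows "dird u (dird w f) = dird w (dird u f)"
proof
  fix x
  define h where "h n = inverse (real (Suc n))" for n
  have h: "0 < h n" for n by (simp add: h_def)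
  have h0: "h \<longlonglongrightarrow> 0" unfolding h_def by (rule LIMSEQ_inverse_real_of_nat)
  have "\<exists>a b a' b'. 0 < a \<and> a < h n \<and> 0 < b \<and> b < h n \<and> 0 < a' \<and> a' < h n \<and> 0 < b' \<and> b' < h n \<and>
      dird w (dird u f) (x + a *\<^sub>R u + b *\<^sub>R w) = dird u (dird w f) (x + a' *\<^sub>R w + b' *\<^sub>R u)" for n
  proof -
    obtain a b where 1: "0 < a" "a < h n" "0 < b" "b < h n"
      "f (x + h n *\<^sub>R u + h n *\<^sub>R w) - f (x + h n *\<^sub>R u) - f (x + h n *\<^sub>R w) + f x
      = h n * h n * dird w (dird u f) (x + a *\<^sub>R u + b *\<^sub>R w)"
      using second_difference[OF f h] by metis
    obtain a' b' where 2: "0 < a'" "a' < h n" "0 < b'" "b' < h n"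
      "f (x + h n *\<^sub>R w + h n *\<^sub>R u) - f (x + h n *\<^sub>R w) - f (x + h n *\<^sub>R u) + f x
      = h n * h n * dird u (dird w f) (x + a' *\<^sub>R w + b' *\<^sub>R u)"
      using second_difference[OF f h] by metis
    have "h n * h n * dird w (dird u f) (x + a *\<^sub>R u + b *\<^sub>R w) = h n * h n * dird u (dird w f) (x + a' *\<^sub>R w + b' *\<^sub>R u)"
      using 1(5) 2(5) by (simp add: algebra_simps)
    then have "dird w (dird u f) (x + a *\<^sub>R u + b *\<^sub>R w) = dird u (dird w f) (x + a' *\<^sub>R w + b' *\<^sub>R u)"
      using h[of n] by simp
    with 1 2 show ?thesis by blast
  qed
  then obtain a b a' b' where *: "\<And>n. 0 < a n \<and> a n < h n" "\<And>n. 0 < b n \<and> b n < h n"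
     "\<And>n. 0 < a' n \<and> a' n < h n" "\<And>n. 0 < b' n \<and> b' n < h n"
     "\<And>n. dird w (dird u f) (x + a n *\<^sub>R u + b n *\<^sub>R w) = dird u (dird w f) (x + a' n *\<^sub>R w + b' n *\<^sub>R u)"
    by metis
  have z: "c \<longlonglongrightarrow> 0" if "\<And>n. 0 < c n \<and> c n < h n" for c
    by (rule tendsto_sandwich[OF _ _ tendsto_const h0]) (use that in \<open>auto intro!: always_eventually less_imp_le\<close>)
  have lim: "(\<lambda>n. x + c n *\<^sub>R v + c' n *\<^sub>R v') \<longlonglongrightarrow> x"
    if "c \<longlonglongrightarrow> 0" "c' \<longlonglongrightarrow> 0" for c c' v v'
  proof -
    have "(\<lambda>n. x + c n *\<^sub>R v + c' n *\<^sub>R v') \<longlonglongrightarrow> x + 0 *\<^sub>R v + 0 *\<^sub>R v'"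
      by (intro tendsto_intros that)
    then show ?thesis by simp
  qed
  have cont: "isCont (dird w (dird u f)) x" "isCont (dird u (dird w f)) x"
    using smooth_continuous[OF smooth_dird[OF smooth_dird[OF f]], of UNIV]
    by (simp_all add: continuous_on_eq_continuous_at)
  have "(\<lambda>n. dird w (dird u f) (x + a n *\<^sub>R u + b n *\<^sub>R w)) \<longlonglongrightarrow> dird w (dird u f) x"
    by (rule isCont_tendsto_compose[OF cont(1)]) (intro lim z *)
  moreover have "(\<lambda>n. dird u (dird w f) (x + a' n *\<^sub>R w + b' n *\<^sub>R u)) \<longlonglongrightarrow> dird u (dird w f) x"
    by (rule isCont_tendsto_compose[OF cont(2)]) (intro lim z *)
  ultimately show "dird u (dird w f) x = dird w (dird u f) x"
    unfolding *(5) by (rule LIMSEQ_unique[symmetric])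
qed

lemma dird_funpow_commute:
  "smooth f \<Longrightarrow> dird u ((dird w ^^ n) f) = (dird w ^^ n) (dird u f)"
  by (induction n) (auto simp: dird_commute[of _ u w] smooth_dird_funpow)

text \<open>Each letter is expanded in \<open>u\<close> and \<open>w\<close>, and since derivatives
  commute, words are collected by their number of \<open>u\<close>. Every letter offers two choices
  with a coefficient of size at most \<open>M\<close>, hence the factor \<open>2 * M\<close> per
  letter.\<close>

lemma word_expansion:
  assumes f: "smooth f" and ds: "\<And>d. d \<in> set ds \<Longrightarrow> \<exists>a b. d = a *\<^sub>R u + b *\<^sub>R w \<and> \<bar>a\<bar> \<le> M \<and> \<bar>b\<bar> \<le> M"
  shows "\<exists>c. (\<forall>j. \<bar>c j\<bar> \<le> (2 * M) ^ length ds) \<and>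
    foldr dird ds f = (\<lambda>x. \<Sum>j\<le>length ds. c j * (dird u ^^ j) ((dird w ^^ (length ds - j)) f) x)"
  using ds
proof (induction ds)
  case Nil
  show ?case by (rule exI[of _ "\<lambda>_. 1"]) auto
next
  case (Cons d ds)
  let ?n = "length ds"
  let ?T = "\<lambda>j. (dird u ^^ j) ((dird w ^^ (?n - j)) f)"
  let ?T' = "\<lambda>j. (dird u ^^ j) ((dird w ^^ (Suc ?n - j)) f)"
  obtain c where c: "\<And>j. \<bar>c j\<bar> \<le> (2 * M) ^ ?n" "foldr dird ds f = (\<lambda>x. \<Sum>j\<le>?n. c j * ?T j x)"
    using Cons by auto
  obtain a b where d: "d = a *\<^sub>R u + b *\<^sub>R w" and ab: "\<bar>a\<bar> \<le> M" "\<bar>b\<bar> \<le> M"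
    using Cons.prems[of d] by auto
  have M: "0 \<le> M" using ab by linarith
  \<comment> \<open>As in Pascal's rule, the new letter either raises the number of \<open>u\<close>
    by one or leaves it.\<close>
  define c' where "c' j = (case j of 0 \<Rightarrow> 0 | Suc i \<Rightarrow> a * c i) + (if j \<le> ?n then b * c j else 0)" for j
  have "\<bar>c' j\<bar> \<le> (2 * M) ^ Suc ?n" for j
  proof -
    have 1: "\<bar>a * c i\<bar> \<le> M * (2 * M) ^ ?n" "\<bar>b * c i\<bar> \<le> M * (2 * M) ^ ?n" for i
      unfolding abs_mult using c(1) ab M by (intro mult_mono; simp)+
    have 0: "0 \<le> M * (2 * M) ^ ?n" using M by simp
    have "\<bar>c' j\<bar> \<le> \<bar>case j of 0 \<Rightarrow> 0 | Suc i \<Rightarrow> a * c i\<bar> + \<bar>if j \<le> ?n then b * c j else 0\<bar>"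
      unfolding c'_def by (rule abs_triangle_ineq)
    also have "\<dots> \<le> M * (2 * M) ^ ?n + M * (2 * M) ^ ?n"
      using 1 0 by (intro add_mono) (auto split: nat.split simp del: abs_mult)
    finally show ?thesis by (simp add: mult_ac)
  qed
  moreover have "foldr dird (d # ds) f = (\<lambda>x. \<Sum>j\<le>Suc ?n. c' j * ?T' j x)"
  proof
    fix x
    have sT: "smooth (?T j)" for j using f by auto
    have "foldr dird (d # ds) f x = dird d (\<lambda>x. \<Sum>j\<le>?n. c j * ?T j x) x" using c(2) by simp
    also have "\<dots> = (\<Sum>j\<le>?n. c j * dird d (?T j) x)"
      using sT by (subst dird_smooth_sum) (auto simp: dird_smooth_cmult)
    also have "\<dots> = (\<Sum>j\<le>?n. a * c j * ?T' (Suc j) x + b * c j * ?T' j x)"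
    proof (rule sum.cong)
      fix j assume j: "j \<in> {..?n}"
      have "dird w (?T j) = ?T' j"
        using j f by (simp add: dird_funpow_commute smooth_dird_funpow Suc_diff_le)
      moreover have "dird d (?T j) x = a * dird u (?T j) x + b * dird w (?T j) x"
        unfolding d using dird_linear[OF sT] by metis
      ultimately show "c j * dird d (?T j) x = a * c j * ?T' (Suc j) x + b * c j * ?T' j x"
        by (simp add: algebra_simps)
    qed simp
    also have "\<dots> = (\<Sum>j\<le>?n. a * c j * ?T' (Suc j) x) + (\<Sum>j\<le>?n. b * c j * ?T' j x)"
      by (rule sum.distrib)
    also have "(\<Sum>j\<le>?n. a * c j * ?T' (Suc j) x) = (\<Sum>j\<le>Suc ?n. (case j of 0 \<Rightarrow> 0 | Suc i \<Rightarrow> a * c i) * ?T' j x)"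
      by (subst sum.atMost_Suc_shift) simp
    also have "(\<Sum>j\<le>?n. b * c j * ?T' j x) = (\<Sum>j\<le>Suc ?n. (if j \<le> ?n then b * c j else 0) * ?T' j x)"
      by simp
    finally show "foldr dird (d # ds) f x = (\<Sum>j\<le>Suc ?n. c' j * ?T' j x)"
      by (simp only: c'_def sum.distrib[symmetric] distrib_right)
  qed
  ultimately show ?case by (intro exI[of _ c']) simp
qed

section \<open>Test functions\<close>

text \<open>The classical flat function, with negative powers of \<open>y\<close> included so that
  derivatives stay in the linear span of the family.\<close>

definition flat_exp :: "nat \<Rightarrow> real \<Rightarrow> real" where
  "flat_exp n y = (if y > 0 then exp (- 1 / y) / y ^ n else 0)"

lemma flat_exp_tendsto_0: "(flat_exp n \<longlongrightarrow> 0) (at 0)"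
proof (rule filterlim_split_at)
  show "(flat_exp n \<longlongrightarrow> 0) (at_left 0)"
    by (rule tendsto_eventually) (auto simp: flat_exp_def eventually_at_filter)
  have "((\<lambda>x. (inverse x) ^ n / exp (inverse x)) \<longlongrightarrow> (0::real)) (at_right 0)"
    by (rule filterlim_compose[OF tendsto_power_div_exp_0 filterlim_inverse_at_top_right])
  moreover have "eventually (\<lambda>x. (inverse x) ^ n / exp (inverse x) = flat_exp n x) (at_right (0::real))"
    by (auto simp: eventually_at_filter flat_exp_def exp_minus divide_simps power_inverse)
  ultimately show "(flat_exp n \<longlongrightarrow> 0) (at_right 0)"
    by (rule Lim_transform_eventually)
qed

lemma flat_exp_deriv:
  "(flat_exp n has_real_derivative flat_exp (n + 2) y - real n * flat_exp (n + 1) y) (at y)"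
proof -
  consider "y > 0" | "y < 0" | "y = 0" by linarith
  then show ?thesis
  proof cases
    case 1
    have "((\<lambda>y. exp (- 1 / y) / y ^ n) has_real_derivative
        (exp (- 1 / y) * (1 / y\<^sup>2) * y ^ n - exp (- 1 / y) * (real n * y ^ (n - 1))) / (y ^ n * y ^ n)) (at y)"
      using 1 by (auto intro!: derivative_eq_intros simp: power2_eq_square field_simps)
    moreover have "(exp (- 1 / y) * (1 / y\<^sup>2) * y ^ n - exp (- 1 / y) * (real n * y ^ (n - 1))) / (y ^ n * y ^ n)
      = flat_exp (n + 2) y - real n * flat_exp (n + 1) y"
      using 1 by (cases n) (auto simp: flat_exp_def field_simps power2_eq_square power_add)
    ultimately have "((\<lambda>y. exp (- 1 / y) / y ^ n) has_real_derivative flat_exp (n + 2) y - real n * flat_exp (n + 1) y) (at y)"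
      by simp
    then show ?thesis
      by (rule DERIV_cong_ev[THEN iffD1, rotated -1])
         (use 1 in \<open>auto simp: flat_exp_def eventually_nhds intro!: exI[of _ "{0<..}"]\<close>)
  next
    case 2
    have "((\<lambda>y. 0) has_real_derivative 0) (at y)" by simp
    then have "(flat_exp n has_real_derivative 0) (at y)"
      by (rule DERIV_cong_ev[THEN iffD1, rotated -1])
         (use 2 in \<open>auto simp: flat_exp_def eventually_nhds intro!: exI[of _ "{..<0}"]\<close>)
    then show ?thesis using 2 by (simp add: flat_exp_def)
  next
    case 3
    \<comment> \<open>The difference quotient of \<open>flat_exp n\<close> at 0 is
      \<open>flat_exp (Suc n)\<close>, which tends to 0.\<close>
    have "((\<lambda>h. (flat_exp n (0 + h) - flat_exp n 0) / h) \<longlongrightarrow> 0) (at 0)"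
      by (rule Lim_transform_eventually[OF flat_exp_tendsto_0[of "Suc n"]])
         (auto simp: flat_exp_def eventually_at_filter mult.commute)
    then show ?thesis using 3 by (simp add: DERIV_def flat_exp_def)
  qed
qed

lemma smooth_flat_exp [intro]: "smooth (\<lambda>x. flat_exp n (l \<bullet> x + c))"
proof -
  let ?B = "{(\<lambda>x. flat_exp n (l \<bullet> x + c)) | n l c. True} :: (real^2 \<Rightarrow> real) set"
  have d: "((\<lambda>x. flat_exp n (l \<bullet> x + c)) has_derivative
      (\<lambda>h. (flat_exp (n + 2) (l \<bullet> x + c) + (- real n) * flat_exp (n + 1) (l \<bullet> x + c)) * (l \<bullet> h))) (at x)"
    for n l c and x :: "real^2"
  proof -
    have "((\<lambda>x. l \<bullet> x + c) has_derivative (\<lambda>h. l \<bullet> h)) (at x)"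
      by (auto intro!: derivative_eq_intros)
    from has_derivative_compose[OF this flat_exp_deriv[of n "l \<bullet> x + c", unfolded has_field_derivative_def]]
    show ?thesis by simp
  qed
  show ?thesis
  proof (rule generated_algebra_smooth[of _ ?B])
    fix b x assume "b \<in> ?B"
    then obtain n l c where b: "b = (\<lambda>x. flat_exp n (l \<bullet> x + c))" by auto
    show "b differentiable (at x)" unfolding b differentiable_def using d[of n l c x] by blast
  next
    fix b i assume "b \<in> ?B"
    then obtain n l c where b: "b = (\<lambda>x. flat_exp n (l \<bullet> x + c))" by auto
    have "dird v b = (\<lambda>x. (flat_exp (n + 2) (l \<bullet> x + c) + (- real n) * flat_exp (n + 1) (l \<bullet> x + c)) * (l \<bullet> v))" for v
      unfolding b by (rule ext, rule dird_eq[OF d])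
    then show "partial i b \<in> generated_algebra ?B"
      unfolding partial_eq_dird
      by (simp only:) (intro generated_algebra.add generated_algebra.mult generated_algebra.const generated_algebra.base, blast+)
  qed (auto intro!: generated_algebra.base)
qed

definition box_bump :: "real^2 \<Rightarrow> real^2 \<Rightarrow> real^2 \<Rightarrow> real" where
  "box_bump a b x = (\<Prod>i\<in>UNIV. flat_exp 0 (x $ i - a $ i) * flat_exp 0 (b $ i - x $ i))"

lemma smooth_box_bump: "smooth (box_bump a b)"
proof -
  have "smooth (\<lambda>x. flat_exp 0 (x $ i - a $ i) * flat_exp 0 (b $ i - x $ i))" for i
    using smooth_mult[OF smooth_flat_exp[of 0 "axis i 1" "- a $ i"] smooth_flat_exp[of 0 "- axis i 1" "b $ i"]]
    by (simp add: inner_axis' add.commute)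
  then show ?thesis unfolding box_bump_def[abs_def] by auto
qed

lemma box_bump_nonneg: "0 \<le> box_bump a b x"
  by (auto simp: box_bump_def flat_exp_def intro!: prod_nonneg)

lemma box_bump_pos: "x \<in> box a b \<Longrightarrow> 0 < box_bump a b x"
  by (auto simp: box_bump_def flat_exp_def mem_box_cart intro!: prod_pos)

lemma box_bump_zero: "x \<notin> cbox a b \<Longrightarrow> box_bump a b x = 0"
  by (auto simp: box_bump_def flat_exp_def mem_box_cart not_le UNIV_2 forall_2)

section \<open>Compact support and integration by parts\<close>

lemma test_function_smooth: "test_function \<Omega> \<phi> \<Longrightarrow> smooth \<phi>"
  by (simp add: test_function_def)

lemma test_function_borel [measurable]: "test_function \<Omega> \<phi> \<Longrightarrow> \<phi> \<in> borel_measurable borel"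
  by (intro borel_measurable_continuous_onI smooth_continuous test_function_smooth)

lemma dird_zero_outside:
  assumes "closed S" "\<And>x. x \<notin> S \<Longrightarrow> \<phi> x = 0" "x \<notin> S"
  shows "dird d \<phi> x = 0"
proof -
  have "((\<lambda>x. 0) has_derivative (\<lambda>h. 0)) (at x)" by simp
  then have "(\<phi> has_derivative (\<lambda>h. 0)) (at x)"
    by (rule has_derivative_transform_within_open[of _ _ _ _ "- S"]) (use assms in auto)
  then show ?thesis by (rule dird_eq)
qed

lemma test_function_dird: "test_function \<Omega> \<phi> \<Longrightarrow> test_function \<Omega> (dird d \<phi>)"
  unfolding test_function_def using dird_zero_outside[OF compact_imp_closed] by blast

lemma test_function_dird_funpow: "test_function \<Omega> \<phi> \<Longrightarrow> test_function \<Omega> ((dird d ^^ n) \<phi>)"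
  by (induction n) (auto intro: test_function_dird)

lemma test_function_smooth_mult: "smooth f \<Longrightarrow> test_function \<Omega> \<phi> \<Longrightarrow> test_function \<Omega> (\<lambda>x. f x * \<phi> x)"
  unfolding test_function_def by auto

lemma test_function_mono: "test_function \<Omega> \<phi> \<Longrightarrow> \<Omega> \<subseteq> \<Omega>' \<Longrightarrow> test_function \<Omega>' \<phi>"
  unfolding test_function_def by blast

lemma test_function_zero: "test_function \<Omega> \<phi> \<Longrightarrow> x \<notin> \<Omega> \<Longrightarrow> \<phi> x = 0"
  unfolding test_function_def by auto

lemma test_function_integrable:
  assumes "test_function \<Omega> \<phi>"
  shows "integrable lborel \<phi>"
proof -
  obtain S where S: "compact S" "\<And>x. x \<notin> S \<Longrightarrow> \<phi> x = 0" using assms by (auto simp: test_function_def)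
  have "integrable lborel (\<lambda>x. indicator S x *\<^sub>R \<phi> x)"
    by (rule borel_integrable_compact[OF S(1)]) (intro smooth_continuous test_function_smooth[OF assms])
  moreover have "(\<lambda>x. indicator S x *\<^sub>R \<phi> x) = \<phi>" using S(2) by (auto simp: fun_eq_iff indicator_def)
  ultimately show ?thesis by simp
qed

lemma test_function_bounded:
  assumes "test_function \<Omega> \<phi>"
  obtains B where "0 \<le> B" "\<And>x. \<bar>\<phi> x\<bar> \<le> B"
proof -
  obtain S where S: "compact S" "\<And>x. x \<notin> S \<Longrightarrow> \<phi> x = 0" using assms by (auto simp: test_function_def)
  have "compact (\<phi> ` S)"
    by (intro compact_continuous_image smooth_continuous test_function_smooth[OF assms] S)
  then obtain B where B: "\<And>y. y \<in> \<phi> ` S \<Longrightarrow> norm y \<le> B" using compact_imp_bounded bounded_iff by metis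
  have "\<bar>\<phi> x\<bar> \<le> max B 0" for x using B[of "\<phi> x"] S(2)[of x] by (cases "x \<in> S") auto
  then show ?thesis using that[of "max B 0"] by auto
qed

text \<open>Difference quotients have integral 0 by translation invariance, and they converge
  dominatedly to the derivative. Since the steps are at most 1, the quotients vanish outside a ball
  enlarged by the length of \<open>d\<close>.\<close>

lemma integral_dird_test_function:
  assumes \<phi>: "test_function \<Omega> \<phi>"
  shows "(\<integral>x. dird d \<phi> x \<partial>lborel) = 0"
proof -
  obtain S where S: "compact S" "\<And>x. x \<notin> S \<Longrightarrow> \<phi> x = 0" using \<phi> by (auto simp: test_function_def)
  obtain R where "\<And>x. x \<in> S \<Longrightarrow> norm x \<le> R" using compact_imp_bounded[OF S(1)] bounded_iff by metis
  then have R: "S \<subseteq> cball 0 R" by auto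
  obtain B where B: "0 \<le> B" "\<And>x. \<bar>dird d \<phi> x\<bar> \<le> B"
    using test_function_bounded[OF test_function_dird[OF \<phi>]] by metis
  define h where "h n = inverse (real (Suc n))" for n
  have h: "0 < h n" "h n \<le> 1" for n by (auto simp: h_def divide_simps)
  define D where "D n x = (\<phi> (x + h n *\<^sub>R d) - \<phi> x) / h n" for n x
  have int: "integrable lborel \<phi>" by (rule test_function_integrable[OF \<phi>])
  have tr: "integrable lborel (\<lambda>x. \<phi> (x + c))" "(\<integral>x. \<phi> (x + c) \<partial>lborel) = (\<integral>x. \<phi> x \<partial>lborel)" for c
  proof -
    have m: "(+) c \<in> measurable lborel borel" by simp
    have [measurable]: "\<phi> \<in> borel_measurable borel" using \<phi> by simp
    have "integrable (distr lborel borel ((+) c)) \<phi>" using int by (simp add: lborel_distr_plus)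
    then show "integrable lborel (\<lambda>x. \<phi> (x + c))" by (subst (asm) integrable_distr_eq) (auto simp: add.commute)
    have "(\<integral>x. \<phi> x \<partial>distr lborel borel ((+) c)) = (\<integral>x. \<phi> (c + x) \<partial>lborel)"
      by (rule integral_distr) auto
    then show "(\<integral>x. \<phi> (x + c) \<partial>lborel) = (\<integral>x. \<phi> x \<partial>lborel)" by (simp add: lborel_distr_plus add.commute)
  qed
  have D0: "(\<integral>x. D n x \<partial>lborel) = 0" for n
    unfolding D_def using int tr by simp
  have "(\<lambda>n. \<integral>x. D n x \<partial>lborel) \<longlonglongrightarrow> (\<integral>x. dird d \<phi> x \<partial>lborel)"
  proof (rule integral_dominated_convergence[where w="\<lambda>x. B * indicator (cball 0 (R + norm d)) x"])
    show "dird d \<phi> \<in> borel_measurable lborel" using test_function_dird[OF \<phi>] by simp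
    show "D n \<in> borel_measurable lborel" for n
      unfolding D_def[abs_def] using int tr(1) by (intro borel_measurable_divide borel_measurable_diff) auto
    show "integrable lborel (\<lambda>x. B * indicator (cball 0 (R + norm d)) x)"
      by (intro integrable_mult_right integrable_real_indicator emeasure_bounded_finite) auto
    show "AE x in lborel. (\<lambda>n. D n x) \<longlonglongrightarrow> dird d \<phi> x"
    proof (rule AE_I2)
      fix x
      have "((\<lambda>t. \<phi> (x + t *\<^sub>R d)) has_real_derivative dird d \<phi> x) (at 0)"
        using line_has_derivative[OF test_function_smooth[OF \<phi>], of x d 0] by simp
      then have l: "((\<lambda>t. (\<phi> (x + t *\<^sub>R d) - \<phi> x) / t) \<longlongrightarrow> dird d \<phi> x) (at 0)"
        by (simp add: DERIV_def)
      have "filterlim h (at 0) sequentially"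
        unfolding filterlim_at using LIMSEQ_inverse_real_of_nat h(1) by (auto simp: h_def[abs_def] intro!: always_eventually)
      from filterlim_compose[OF l this] show "(\<lambda>n. D n x) \<longlonglongrightarrow> dird d \<phi> x" by (simp add: D_def)
    qed
    show "AE x in lborel. norm (D n x) \<le> B * indicator (cball 0 (R + norm d)) x" for n
    proof (rule AE_I2)
      fix x
      have nd: "norm (h n *\<^sub>R d) \<le> norm d" using h[of n] mult_right_mono[of "h n" 1 "norm d"] by simp
      show "norm (D n x) \<le> B * indicator (cball 0 (R + norm d)) x"
      proof (cases "x \<in> cball 0 (R + norm d)")
        case True
        obtain \<theta> where "\<phi> (x + h n *\<^sub>R d) - \<phi> (x + 0 *\<^sub>R d) = (h n - 0) * dird d \<phi> (x + \<theta> *\<^sub>R d)"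
          using MVT2[OF h(1)[of n] line_has_derivative[OF test_function_smooth[OF \<phi>]]] by metis
        then have "D n x = dird d \<phi> (x + \<theta> *\<^sub>R d)" using h[of n] by (simp add: D_def)
        then show ?thesis using B(2) True by simp
      next
        case False
        then have "norm x > R + norm d" by (simp add: not_le)
        moreover have "norm (x + h n *\<^sub>R d) \<ge> norm x - norm (h n *\<^sub>R d)" by (metis norm_diff_ineq)
        ultimately have "\<not> norm x \<le> R" "\<not> norm (x + h n *\<^sub>R d) \<le> R"
          using nd norm_ge_zero[of d] by linarith+
        then have "x \<notin> S" "x + h n *\<^sub>R d \<notin> S"
          using R by (auto dest!: subsetD)
        then show ?thesis using S(2) False by (simp add: D_def)
      qed
    qed
  qed
  then show ?thesis unfolding D0 by (simp add: LIMSEQ_const_iff)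
qed

lemma integration_by_parts:
  assumes f: "smooth f" and \<phi>: "test_function \<Omega> \<phi>"
  shows "(\<integral>x. f x * dird d \<phi> x \<partial>lborel) = - (\<integral>x. dird d f x * \<phi> x \<partial>lborel)"
proof -
  have "dird d (\<lambda>x. f x * \<phi> x) = (\<lambda>x. f x * dird d \<phi> x + dird d f x * \<phi> x)"
    by (rule dird_mult) (intro smooth_differentiable f test_function_smooth[OF \<phi>])+
  moreover have "integrable lborel (\<lambda>x. f x * dird d \<phi> x)" "integrable lborel (\<lambda>x. dird d f x * \<phi> x)"
    by (intro test_function_integrable[of \<Omega>] test_function_smooth_mult f smooth_dird test_function_dird \<phi>)+
  ultimately show ?thesis
    using integral_dird_test_function[OF test_function_smooth_mult[OF f \<phi>], of d] by simp
qed

lemma integration_by_parts_funpow: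
  "smooth f \<Longrightarrow> test_function \<Omega> \<phi> \<Longrightarrow>
   (\<integral>x. f x * (dird d ^^ n) \<phi> x \<partial>lborel) = (- 1) ^ n * (\<integral>x. (dird d ^^ n) f x * \<phi> x \<partial>lborel)"
proof (induction n arbitrary: f)
  case (Suc n)
  have "(\<integral>x. f x * (dird d ^^ Suc n) \<phi> x \<partial>lborel) = - (\<integral>x. dird d f x * (dird d ^^ n) \<phi> x \<partial>lborel)"
    using integration_by_parts[OF Suc.prems(1) test_function_dird_funpow[OF Suc.prems(2)]] by simp
  also have "\<dots> = - ((- 1) ^ n * (\<integral>x. (dird d ^^ n) (dird d f) x * \<phi> x \<partial>lborel))"
    using Suc by (simp add: smooth_dird)
  finally show ?case by (simp add: funpow_swap1)
qed simp

lemma multi_partial_eq: "multi_partial \<delta> f = (dird (axis 1 1) ^^ fst \<delta>) ((dird (axis 2 1) ^^ snd \<delta>) f)"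
  by (simp add: multi_partial_def[abs_def] partial_eq_dird)

lemma test_function_multi_partial: "test_function \<Omega> \<phi> \<Longrightarrow> test_function \<Omega> (multi_partial \<delta> \<phi>)"
  by (simp add: multi_partial_eq test_function_dird_funpow)

lemma smooth_multi_partial: "smooth f \<Longrightarrow> smooth (multi_partial \<delta> f)"
  by (simp add: multi_partial_eq smooth_dird_funpow)

lemma dird_funpow_funpow_commute:
  "smooth f \<Longrightarrow> (dird u ^^ m) ((dird w ^^ n) f) = (dird w ^^ n) ((dird u ^^ m) f)"
  by (induction m) (auto simp: dird_funpow_commute smooth_dird_funpow)

lemma integration_by_parts_multi:
  assumes f: "smooth f" and \<phi>: "test_function \<Omega> \<phi>"
  shows "(\<integral>x. f x * multi_partial \<delta> \<phi> x \<partial>lborel)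
    = (- 1) ^ mi_order \<delta> * (\<integral>x. multi_partial \<delta> f x * \<phi> x \<partial>lborel)"
proof -
  have "(\<integral>x. f x * multi_partial \<delta> \<phi> x \<partial>lborel)
    = (- 1) ^ fst \<delta> * (\<integral>x. (dird (axis 1 1) ^^ fst \<delta>) f x * (dird (axis 2 1) ^^ snd \<delta>) \<phi> x \<partial>lborel)"
    unfolding multi_partial_eq by (rule integration_by_parts_funpow[OF f test_function_dird_funpow[OF \<phi>]])
  also have "(\<integral>x. (dird (axis 1 1) ^^ fst \<delta>) f x * (dird (axis 2 1) ^^ snd \<delta>) \<phi> x \<partial>lborel)
    = (- 1) ^ snd \<delta> * (\<integral>x. (dird (axis 2 1) ^^ snd \<delta>) ((dird (axis 1 1) ^^ fst \<delta>) f) x * \<phi> x \<partial>lborel)"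
    by (rule integration_by_parts_funpow[OF smooth_dird_funpow[OF f] \<phi>])
  also have "(dird (axis 2 1) ^^ snd \<delta>) ((dird (axis 1 1) ^^ fst \<delta>) f) = multi_partial \<delta> f"
    unfolding multi_partial_eq by (rule dird_funpow_funpow_commute[OF f])
  finally show ?thesis by (simp add: mi_order_def power_add)
qed

lemma exists_mollifier:
  assumes "open \<Omega>" "\<Omega> \<noteq> {}"
  obtains \<eta> where "test_function \<Omega> \<eta>" "\<And>x. 0 \<le> \<eta> x" "(\<integral>x. \<eta> x \<partial>lborel) = 1"
proof -
  obtain x0 where "x0 \<in> \<Omega>" using assms by auto
  from open_contains_cbox[OF assms(1) this]
  obtain a b where ab: "cbox a b \<subseteq> \<Omega>" "x0 \<in> box a b" "\<forall>i\<in>Basis. a \<bullet> i < b \<bullet> i"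
    .
  have t: "test_function \<Omega> (box_bump a b)"
    unfolding test_function_def
    by (intro conjI exI[of _ "cbox a b"] smooth_box_bump compact_cbox ab(1) allI impI box_bump_zero)
  define I where "I = (\<integral>x. box_bump a b x \<partial>lborel)"
  have "I \<noteq> 0"
  proof
    assume "I = 0"
    then have "AE x in lborel. box_bump a b x = 0"
      unfolding I_def using integral_nonneg_eq_0_iff_AE[OF test_function_integrable[OF t]] box_bump_nonneg by simp
    then have "AE x in lborel. x \<notin> box a b" by eventually_elim (metis box_bump_pos less_irrefl)
    then have "emeasure lborel (box a b) = 0" by (subst (asm) AE_iff_measurable[of "box a b"]) auto
    then have "negligible (box a b)" by (simp add: negligible_iff_emeasure0)
    then show False using ab(2) open_not_negligible[OF open_box] by blast
  qed
  moreover have "0 \<le> I" unfolding I_def by (simp add: box_bump_nonneg)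
  ultimately have I: "I > 0" by simp
  show ?thesis
  proof (rule that[of "\<lambda>x. (1 / I) * box_bump a b x"])
    show "test_function \<Omega> (\<lambda>x. (1 / I) * box_bump a b x)" by (rule test_function_smooth_mult[OF smooth_const t])
    show "0 \<le> (1 / I) * box_bump a b x" for x using I box_bump_nonneg by simp
    show "(\<integral>x. (1 / I) * box_bump a b x \<partial>lborel) = 1" using I by (simp add: I_def[symmetric])
  qed
qed

section \<open>Regularization on convex sets\<close>

lemma nn_integral_affine:
  fixes f :: "'a::euclidean_space \<Rightarrow> ennreal"
  assumes [measurable]: "f \<in> borel_measurable borel" and c: "c \<noteq> 0"
  shows "(\<integral>\<^sup>+x. f x \<partial>lborel) = ennreal (\<bar>c\<bar> ^ DIM('a)) * (\<integral>\<^sup>+x. f (b + c *\<^sub>R x) \<partial>lborel)"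
  by (subst lborel_affine[OF c, of b])
     (simp add: nn_integral_density nn_integral_distr nn_integral_cmult)

lemma integrable_affine:
  fixes f :: "'a::euclidean_space \<Rightarrow> real"
  assumes f: "integrable lborel f" and c: "c \<noteq> 0"
  shows "integrable lborel (\<lambda>x. f (b + c *\<^sub>R x))"
proof -
  have [measurable]: "f \<in> borel_measurable borel" using f by auto
  have "(\<integral>\<^sup>+x. ennreal (norm (f x)) \<partial>lborel) < \<infinity>" using f by (simp add: integrable_iff_bounded)
  then have "(\<integral>\<^sup>+x. ennreal (norm (f (b + c *\<^sub>R x))) \<partial>lborel) < \<infinity>"
    using c nn_integral_affine[of "\<lambda>x. ennreal (norm (f x))" c b]
    by (auto simp: ennreal_mult_less_top zero_less_power)
  then show ?thesis by (simp add: integrable_iff_bounded)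
qed

lemma integral_affine:
  fixes f :: "'a::euclidean_space \<Rightarrow> real"
  assumes f: "integrable lborel f" and c: "c \<noteq> 0"
  shows "(\<integral>x. f x \<partial>lborel) = \<bar>c\<bar> ^ DIM('a) * (\<integral>x. f (b + c *\<^sub>R x) \<partial>lborel)"
proof -
  have [measurable]: "f \<in> borel_measurable borel" using f by auto
  show ?thesis
    by (subst lborel_affine[OF c, of b]) (simp add: integral_density integral_distr)
qed

lemma dird_affine:
  assumes "smooth \<psi>"
  shows "dird d (\<lambda>w. \<psi> (b + \<alpha> *\<^sub>R w)) = (\<lambda>w. \<alpha> * dird d \<psi> (b + \<alpha> *\<^sub>R w))"
proof
  fix w
  have "((\<lambda>w. b + \<alpha> *\<^sub>R w) has_derivative (\<lambda>h. \<alpha> *\<^sub>R h)) (at w)"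
    by (auto intro!: derivative_eq_intros)
  from has_derivative_compose[OF this smooth_has_derivative[OF assms]]
  have "dird d (\<lambda>w. \<psi> (b + \<alpha> *\<^sub>R w)) w = dird (\<alpha> *\<^sub>R d) \<psi> (b + \<alpha> *\<^sub>R w)"
    by (rule dird_eq)
  then show "dird d (\<lambda>w. \<psi> (b + \<alpha> *\<^sub>R w)) w = \<alpha> * dird d \<psi> (b + \<alpha> *\<^sub>R w)"
    by (simp add: dird_scaleR[OF assms])
qed

lemma smooth_affine:
  assumes "smooth \<psi>"
  shows "smooth (\<lambda>w. \<psi> (b + \<alpha> *\<^sub>R w))"
proof (rule smooth_coinduct[of _ "{\<lambda>w. c * \<psi> (b + \<alpha> *\<^sub>R w) | c \<psi>. smooth \<psi>}"])
  show "(\<lambda>w. \<psi> (b + \<alpha> *\<^sub>R w)) \<in> {\<lambda>w. c * \<psi> (b + \<alpha> *\<^sub>R w) |c \<psi>. smooth \<psi>}"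
    using assms by (auto intro!: exI[of _ 1])
next
  have diff: "(\<lambda>w. \<psi> (b + \<alpha> *\<^sub>R w)) differentiable (at w)" if "smooth \<psi>" for \<psi> w
  proof -
    have "((\<lambda>w. b + \<alpha> *\<^sub>R w) has_derivative (\<lambda>h. \<alpha> *\<^sub>R h)) (at w)"
      by (auto intro!: derivative_eq_intros)
    from has_derivative_compose[OF this smooth_has_derivative[OF that]]
    show ?thesis unfolding differentiable_def by blast
  qed
  fix g i x assume "g \<in> {\<lambda>w. c * \<psi> (b + \<alpha> *\<^sub>R w) |c \<psi>. smooth \<psi>}"
  then obtain c \<psi> where g: "g = (\<lambda>w. c * \<psi> (b + \<alpha> *\<^sub>R w))" and \<psi>: "smooth \<psi>" by auto
  show "g differentiable (at x)" unfolding g using diff[OF \<psi>] by simp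
  have "partial i g = (\<lambda>w. (c * \<alpha>) * dird (axis i 1) \<psi> (b + \<alpha> *\<^sub>R w))"
    unfolding g partial_eq_dird using diff[OF \<psi>]
    by (subst dird_mult) (auto simp: dird_affine[OF \<psi>] mult.assoc)
  then show "partial i g \<in> {\<lambda>w. c * \<psi> (b + \<alpha> *\<^sub>R w) |c \<psi>. smooth \<psi>}"
    using smooth_dird[OF \<psi>] by blast
qed

lemma dird_affine_funpow:
  assumes "smooth \<psi>"
  shows "(dird d ^^ n) (\<lambda>w. \<psi> (b + \<alpha> *\<^sub>R w)) = (\<lambda>w. \<alpha> ^ n * (dird d ^^ n) \<psi> (b + \<alpha> *\<^sub>R w))"
proof (induction n)
  case (Suc n)
  then show ?case
    using assms by (simp add: dird_smooth_cmult smooth_affine smooth_dird_funpow dird_affine mult_ac)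
qed simp

lemma multi_partial_affine:
  assumes "smooth \<psi>"
  shows "multi_partial \<delta> (\<lambda>w. \<psi> (b + \<alpha> *\<^sub>R w)) = (\<lambda>w. \<alpha> ^ mi_order \<delta> * multi_partial \<delta> \<psi> (b + \<alpha> *\<^sub>R w))"
  using assms
  by (simp add: multi_partial_eq dird_affine_funpow dird_funpow_cmult smooth_affine smooth_dird_funpow
      mi_order_def power_add mult_ac)

text \<open>The remainder bound is uniform in the base point \<open>z\<close>, because the second
  partial derivatives are bounded. Uniformity is what allows the expansion to be integrated against
  a merely integrable function.\<close>

lemma test_function_taylor:
  assumes \<psi>: "test_function \<Omega> \<psi>"
  obtains M where "0 \<le> M" "\<And>z k. \<bar>\<psi> (z + k) - \<psi> z - dird k \<psi> z\<bar> \<le> M * (norm k)\<^sup>2"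
proof -
  have s: "smooth \<psi>" by (rule test_function_smooth[OF \<psi>])
  have "\<exists>B. 0 \<le> B \<and> (\<forall>x. \<bar>partial i (partial j \<psi>) x\<bar> \<le> B)" for i j
    using test_function_bounded[OF test_function_dird[OF test_function_dird[OF \<psi>]]]
    unfolding partial_eq_dird by metis
  then obtain B where B: "\<And>i j. 0 \<le> B i j" "\<And>i j x. \<bar>partial i (partial j \<psi>) x\<bar> \<le> B i j" by metis
  define M where "M = B 1 1 + B 1 2 + B 2 1 + B 2 2"
  have M: "0 \<le> M" using B by (simp add: M_def)
  have dd: "\<bar>dird k (dird k \<psi>) x\<bar> \<le> M * (norm k)\<^sup>2" for k x
  proof -
    have e: "dird k (dird k \<psi>) x = k $ 1 * k $ 1 * partial 1 (partial 1 \<psi>) x + k $ 1 * k $ 2 * partial 1 (partial 2 \<psi>) x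
       + k $ 2 * k $ 1 * partial 2 (partial 1 \<psi>) x + k $ 2 * k $ 2 * partial 2 (partial 2 \<psi>) x"
    proof -
      have "dird k (dird k \<psi>) x = k $ 1 * partial 1 (dird k \<psi>) x + k $ 2 * partial 2 (dird k \<psi>) x"
        by (simp add: dird_coords[OF smooth_dird[OF s], of k])
      moreover have "partial i (dird k \<psi>) x = k $ 1 * partial i (partial 1 \<psi>) x + k $ 2 * partial i (partial 2 \<psi>) x" for i
        unfolding dird_coords[OF s, of k] partial_eq_dird
        by (subst dird_smooth_add) (auto intro!: smooth_cmult smooth_dird s simp: dird_smooth_cmult smooth_dird s)
      ultimately show ?thesis by (simp add: algebra_simps)
    qed
    have k: "\<bar>k $ i\<bar> \<le> norm k" for i using component_le_norm_cart by blast
    have "\<bar>k $ i * k $ j * partial i (partial j \<psi>) x\<bar> \<le> (norm k)\<^sup>2 * B i j" for i j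
      unfolding abs_mult power2_eq_square using k B by (intro mult_mono) auto
    from this[of 1 1] this[of 1 2] this[of 2 1] this[of 2 2] show ?thesis
      unfolding e M_def by (simp add: distrib_left mult.commute[of _ "(norm k)\<^sup>2"])
  qed
  have "\<bar>\<psi> (z + k) - \<psi> z - dird k \<psi> z\<bar> \<le> M * (norm k)\<^sup>2" for z k
  proof -
    obtain \<theta> where \<theta>: "0 < \<theta>" "\<theta> < 1" "\<psi> (z + 1 *\<^sub>R k) - \<psi> (z + 0 *\<^sub>R k) = (1 - 0) * dird k \<psi> (z + \<theta> *\<^sub>R k)"
      using MVT2[OF zero_less_one line_has_derivative[OF s]] by metis
    obtain \<theta>' where \<theta>': "dird k \<psi> (z + \<theta> *\<^sub>R k) - dird k \<psi> (z + 0 *\<^sub>R k) = (\<theta> - 0) * dird k (dird k \<psi>) (z + \<theta>' *\<^sub>R k)"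
      using MVT2[OF \<theta>(1) line_has_derivative[OF smooth_dird[OF s]]] by metis
    have "\<psi> (z + k) - \<psi> z - dird k \<psi> z = \<theta> * dird k (dird k \<psi>) (z + \<theta>' *\<^sub>R k)"
      using \<theta>(3) \<theta>' by simp
    also have "\<bar>\<dots>\<bar> \<le> 1 * (M * (norm k)\<^sup>2)"
      unfolding abs_mult using \<theta> dd by (intro mult_mono) auto
    finally show ?thesis by simp
  qed
  then show ?thesis using that M by blast
qed

lemma has_derivative_quadratic:
  fixes f :: "'a::real_normed_vector \<Rightarrow> real"
  assumes "bounded_linear f'" and "\<And>h. \<bar>f (x + h) - f x - f' h\<bar> \<le> K * (norm h)\<^sup>2"
  shows "(f has_derivative f') (at x)"
  unfolding has_derivative_at
proof
  show "bounded_linear f'" by fact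
  have b: "norm (norm (f (x + h) - f x - f' h) / norm h) \<le> \<bar>K\<bar> * norm h" for h
  proof (cases "h = 0")
    case False
    have "norm (f (x + h) - f x - f' h) \<le> (\<bar>K\<bar> * norm h) * norm h"
      using assms(2)[of h] mult_right_mono[OF abs_ge_self[of K], of "(norm h)\<^sup>2"] by (simp add: power2_eq_square mult.assoc)
    then show ?thesis using False by (simp add: divide_le_eq)
  qed simp
  have "((\<lambda>h::'a. \<bar>K\<bar> * norm h) \<longlongrightarrow> 0) (at 0)"
    using tendsto_mult_left[OF tendsto_norm[OF tendsto_ident_at[of "0::'a" UNIV]], of "\<bar>K\<bar>"] by simp
  from Lim_null_comparison[OF always_eventually[OF allI[OF b]] this]
  show "(\<lambda>h. norm (f (x + h) - f x - f' h) / norm h) \<midarrow>0\<rightarrow> 0" .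
qed

text \<open>Differentiation under the integral falls on \<open>\<psi>\<close>, so that \<open>g\<close> only needs to be integrable.\<close>

definition dilated_conv :: "real \<Rightarrow> real \<Rightarrow> (real^2 \<Rightarrow> real) \<Rightarrow> (real^2 \<Rightarrow> real) \<Rightarrow> real^2 \<Rightarrow> real" where
  "dilated_conv \<alpha> \<beta> g \<psi> x = (\<integral>w. g w * \<psi> (\<beta> *\<^sub>R x + \<alpha> *\<^sub>R w) \<partial>lborel)"

lemma dilated_conv_integrable:
  assumes g: "integrable lborel g" and \<psi>: "test_function \<Omega> \<psi>"
  shows "integrable lborel (\<lambda>w. g w * \<psi> (b + \<alpha> *\<^sub>R w))"
proof -
  obtain B where B: "0 \<le> B" "\<And>x. \<bar>\<psi> x\<bar> \<le> B" using test_function_bounded[OF \<psi>] by metis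
  have [measurable]: "g \<in> borel_measurable borel" "\<psi> \<in> borel_measurable borel" using g \<psi> by auto
  show ?thesis
  proof (rule Bochner_Integration.integrable_bound)
    show "integrable lborel (\<lambda>w. g w * B)" using g by simp
    show "AE w in lborel. norm (g w * \<psi> (b + \<alpha> *\<^sub>R w)) \<le> norm (g w * B)"
      using B by (auto simp: abs_mult intro!: mult_left_mono)
  qed measurable
qed

lemma dilated_conv_deriv:
  assumes g: "integrable lborel g" and \<psi>: "test_function \<Omega> \<psi>"
  shows "(dilated_conv \<alpha> \<beta> g \<psi> has_derivative (\<lambda>h. \<beta> * dilated_conv \<alpha> \<beta> g (dird h \<psi>) x)) (at x)"
proof -
  have s: "smooth \<psi>" by (rule test_function_smooth[OF \<psi>])
  obtain M where M: "0 \<le> M" "\<And>z k. \<bar>\<psi> (z + k) - \<psi> z - dird k \<psi> z\<bar> \<le> M * (norm k)\<^sup>2"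
    using test_function_taylor[OF \<psi>] by metis
  note int = dilated_conv_integrable[OF g \<psi>] dilated_conv_integrable[OF g test_function_dird[OF \<psi>]]
  let ?L = "\<lambda>h. \<beta> * dilated_conv \<alpha> \<beta> g (dird h \<psi>) x"
  have "?L = (\<lambda>h. h $ 1 * (\<beta> * dilated_conv \<alpha> \<beta> g (partial 1 \<psi>) x) + h $ 2 * (\<beta> * dilated_conv \<alpha> \<beta> g (partial 2 \<psi>) x))"
  proof
    fix h
    have "dilated_conv \<alpha> \<beta> g (dird h \<psi>) x = (\<integral>w. h $ 1 * (g w * partial 1 \<psi> (\<beta> *\<^sub>R x + \<alpha> *\<^sub>R w)) + h $ 2 * (g w * partial 2 \<psi> (\<beta> *\<^sub>R x + \<alpha> *\<^sub>R w)) \<partial>lborel)"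
      unfolding dilated_conv_def dird_coords[OF s, of h] by (simp add: algebra_simps)
    also have "\<dots> = h $ 1 * dilated_conv \<alpha> \<beta> g (partial 1 \<psi>) x + h $ 2 * dilated_conv \<alpha> \<beta> g (partial 2 \<psi>) x"
      unfolding dilated_conv_def partial_eq_dird by (simp add: int)
    finally show "?L h = h $ 1 * (\<beta> * dilated_conv \<alpha> \<beta> g (partial 1 \<psi>) x) + h $ 2 * (\<beta> * dilated_conv \<alpha> \<beta> g (partial 2 \<psi>) x)"
      by (simp add: algebra_simps)
  qed
  moreover have "bounded_linear (\<lambda>h::real^2. h $ 1 * a + h $ 2 * b)" for a b
    by (intro bounded_linear_add bounded_linear_mult_const bounded_linear_vec_nth)
  ultimately have bl: "bounded_linear ?L" by simp
  show ?thesis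
  proof (rule has_derivative_quadratic[OF bl])
    fix h
    let ?I = "\<integral>w. \<bar>g w\<bar> \<partial>lborel"
    have p: "\<beta> *\<^sub>R (x + h) + \<alpha> *\<^sub>R w = (\<beta> *\<^sub>R x + \<alpha> *\<^sub>R w) + \<beta> *\<^sub>R h" for w by (simp add: algebra_simps)
    have "dilated_conv \<alpha> \<beta> g \<psi> (x + h) - dilated_conv \<alpha> \<beta> g \<psi> x - ?L h
      = (\<integral>w. g w * \<psi> (\<beta> *\<^sub>R (x + h) + \<alpha> *\<^sub>R w) - g w * \<psi> (\<beta> *\<^sub>R x + \<alpha> *\<^sub>R w) - \<beta> * (g w * dird h \<psi> (\<beta> *\<^sub>R x + \<alpha> *\<^sub>R w)) \<partial>lborel)"
      unfolding dilated_conv_def by (simp add: int)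
    also have "\<dots> = (\<integral>w. g w * (\<psi> ((\<beta> *\<^sub>R x + \<alpha> *\<^sub>R w) + \<beta> *\<^sub>R h) - \<psi> (\<beta> *\<^sub>R x + \<alpha> *\<^sub>R w) - dird (\<beta> *\<^sub>R h) \<psi> (\<beta> *\<^sub>R x + \<alpha> *\<^sub>R w)) \<partial>lborel)"
      by (simp add: p dird_scaleR[OF s] algebra_simps)
    also have "\<bar>\<dots>\<bar> \<le> (\<integral>w. \<bar>g w\<bar> * (M * (norm (\<beta> *\<^sub>R h))\<^sup>2) \<partial>lborel)"
    proof (rule order.trans[OF integral_abs_bound integral_mono'])
      show "integrable lborel (\<lambda>w. \<bar>g w\<bar> * (M * (norm (\<beta> *\<^sub>R h))\<^sup>2))" using g by simp
      show "\<bar>g w * (\<psi> ((\<beta> *\<^sub>R x + \<alpha> *\<^sub>R w) + \<beta> *\<^sub>R h) - \<psi> (\<beta> *\<^sub>R x + \<alpha> *\<^sub>R w) - dird (\<beta> *\<^sub>R h) \<psi> (\<beta> *\<^sub>R x + \<alpha> *\<^sub>R w))\<bar>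
        \<le> \<bar>g w\<bar> * (M * (norm (\<beta> *\<^sub>R h))\<^sup>2)" for w
        unfolding abs_mult by (intro mult_left_mono M) auto
      show "0 \<le> \<bar>g w\<bar> * (M * (norm (\<beta> *\<^sub>R h))\<^sup>2)" for w using M by simp
    qed
    also have "\<dots> = (?I * M * \<beta>\<^sup>2) * (norm h)\<^sup>2" by (simp add: power_mult_distrib mult_ac)
    finally show "\<bar>dilated_conv \<alpha> \<beta> g \<psi> (x + h) - dilated_conv \<alpha> \<beta> g \<psi> x - ?L h\<bar> \<le> (?I * M * \<beta>\<^sup>2) * (norm h)\<^sup>2" .
  qed
qed

lemma dilated_conv_smooth:
  assumes g: "integrable lborel g" and \<psi>: "test_function \<Omega> \<psi>"
  shows "smooth (dilated_conv \<alpha> \<beta> g \<psi>)"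
proof (rule smooth_coinduct[of _ "{\<lambda>x. c * dilated_conv \<alpha> \<beta> g \<psi> x | c \<psi>. test_function \<Omega> \<psi>}"])
  show "dilated_conv \<alpha> \<beta> g \<psi> \<in> {\<lambda>x. c * dilated_conv \<alpha> \<beta> g \<psi> x |c \<psi>. test_function \<Omega> \<psi>}"
    using \<psi> by (auto intro!: exI[of _ 1])
next
  fix f i x assume "f \<in> {\<lambda>x. c * dilated_conv \<alpha> \<beta> g \<psi> x |c \<psi>. test_function \<Omega> \<psi>}"
  then obtain c \<psi> where f: "f = (\<lambda>x. c * dilated_conv \<alpha> \<beta> g \<psi> x)" and \<psi>: "test_function \<Omega> \<psi>" by auto
  have d: "(f has_derivative (\<lambda>h. c * (\<beta> * dilated_conv \<alpha> \<beta> g (dird h \<psi>) x))) (at x)" for x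
    unfolding f by (intro has_derivative_mult_right dilated_conv_deriv[OF g \<psi>])
  show "f differentiable (at x)" using d by (auto simp: differentiable_def)
  have "partial i f = (\<lambda>x. (c * \<beta>) * dilated_conv \<alpha> \<beta> g (dird (axis i 1) \<psi>) x)"
    unfolding partial_eq_dird by (rule ext) (simp add: dird_eq[OF d])
  then show "partial i f \<in> {\<lambda>x. c * dilated_conv \<alpha> \<beta> g \<psi> x |c \<psi>. test_function \<Omega> \<psi>}"
    using test_function_dird[OF \<psi>] by blast
qed

lemma dilated_conv_dird_funpow:
  assumes g: "integrable lborel g" and \<psi>: "test_function \<Omega> \<psi>"
  shows "(dird d ^^ n) (dilated_conv \<alpha> \<beta> g \<psi>) = (\<lambda>x. \<beta> ^ n * dilated_conv \<alpha> \<beta> g ((dird d ^^ n) \<psi>) x)"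
proof (induction n)
  case (Suc n)
  have "dird d (dilated_conv \<alpha> \<beta> g \<psi>) = (\<lambda>x. \<beta> * dilated_conv \<alpha> \<beta> g (dird d \<psi>) x)" if "test_function \<Omega> \<psi>" for \<psi>
    by (rule ext) (rule dird_eq[OF dilated_conv_deriv[OF g that]])
  then show ?case
    using Suc test_function_dird_funpow[OF \<psi>]
    by (simp add: dird_smooth_cmult dilated_conv_smooth[OF g test_function_dird_funpow[OF \<psi>]] mult_ac)
qed simp

lemma dilated_conv_multi_partial:
  assumes g: "integrable lborel g" and \<psi>: "test_function \<Omega> \<psi>"
  shows "multi_partial \<delta> (dilated_conv \<alpha> \<beta> g \<psi>) = (\<lambda>x. \<beta> ^ mi_order \<delta> * dilated_conv \<alpha> \<beta> g (multi_partial \<delta> \<psi>) x)"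
  by (simp add: multi_partial_eq dilated_conv_dird_funpow[OF g \<psi>] dird_funpow_cmult
      dilated_conv_smooth[OF g test_function_dird_funpow[OF \<psi>]]
      dilated_conv_dird_funpow[OF g test_function_dird_funpow[OF \<psi>]] mi_order_def power_add mult_ac)

text \<open>Test functions vanish outside \<open>\<Omega>\<close>, so the integrals may run over the
  whole plane and concern Borel functions and \<open>lborel\<close> only.\<close>

definition borel_weak_deriv ::
  "(real^2) set \<Rightarrow> nat \<times> nat \<Rightarrow> (real^2 \<Rightarrow> real) \<Rightarrow> (real^2 \<Rightarrow> real) \<Rightarrow> bool" where
  "borel_weak_deriv \<Omega> \<delta> f g \<longleftrightarrow> (\<forall>\<phi>. test_function \<Omega> \<phi> \<longrightarrow>
     (\<integral>x. f x * multi_partial \<delta> \<phi> x \<partial>lborel) = (- 1) ^ mi_order \<delta> * (\<integral>x. g x * \<phi> x \<partial>lborel))"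

lemma scaleR_combine:
  "a *\<^sub>R x + b *\<^sub>R (t *\<^sub>R x + c *\<^sub>R y) = (a + b * t) *\<^sub>R x + (b * c) *\<^sub>R (y::'a::real_vector)"
  by (simp add: scaleR_add_left scaleR_add_right)

locale mollifier =
  fixes \<Omega> :: "(real^2) set" and \<eta> :: "real^2 \<Rightarrow> real"
  assumes open_\<Omega>: "open \<Omega>" and convex_\<Omega>: "convex \<Omega>"
    and test_\<eta>: "test_function \<Omega> \<eta>" and \<eta>_nonneg: "\<And>x. 0 \<le> \<eta> x" and \<eta>_integral: "(\<integral>x. \<eta> x \<partial>lborel) = 1"
begin

text \<open>In contrast to an ordinary convolution, \<open>J t g\<close> uses only values of \<open>g\<close> on \<open>\<Omega>\<close>, even on the
  boundary of \<open>\<Omega>\<close>: it averages \<open>g\<close> over contractions towards the support of \<open>\<eta>\<close>.\<close>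

definition J :: "real \<Rightarrow> (real^2 \<Rightarrow> real) \<Rightarrow> real^2 \<Rightarrow> real" where
  "J t g x = (\<integral>y. g (t *\<^sub>R x + (1 - t) *\<^sub>R y) * \<eta> y \<partial>lborel)"

lemma \<eta>_borel [measurable]: "\<eta> \<in> borel_measurable borel"
  using test_\<eta> by simp

lemma \<eta>_integrable: "integrable lborel \<eta>"
  by (rule test_function_integrable[OF test_\<eta>])

text \<open>Substituting \<open>w = t x + (1 - t) y\<close> moves the variable \<open>x\<close> from
  \<open>g\<close> into the kernel; the prefactor is the Jacobian in dimension two.\<close>

lemma J_eq:
  assumes t: "0 < t" "t < 1" and g: "integrable lborel g"
  shows "J t g = (\<lambda>x. (1 / (1 - t))\<^sup>2 * dilated_conv (1 / (1 - t)) (- t / (1 - t)) g \<eta> x)"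
proof
  fix x
  let ?\<alpha> = "1 / (1 - t)"
  have "dilated_conv ?\<alpha> (- t / (1 - t)) g \<eta> x = \<bar>1 - t\<bar> ^ DIM(real^2) *
      (\<integral>y. g (t *\<^sub>R x + (1 - t) *\<^sub>R y) * \<eta> ((- t / (1 - t)) *\<^sub>R x + ?\<alpha> *\<^sub>R (t *\<^sub>R x + (1 - t) *\<^sub>R y)) \<partial>lborel)"
    unfolding dilated_conv_def using t
    by (intro integral_affine dilated_conv_integrable[OF g test_\<eta>]) auto
  also have "\<dots> = (1 - t)\<^sup>2 * J t g x"
  proof -
    have "(- t / (1 - t)) *\<^sub>R x + ?\<alpha> *\<^sub>R (t *\<^sub>R x + (1 - t) *\<^sub>R y) = y" for y
      unfolding scaleR_combine using t by simp
    then show ?thesis by (simp add: J_def)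
  qed
  finally show "J t g x = ?\<alpha>\<^sup>2 * dilated_conv ?\<alpha> (- t / (1 - t)) g \<eta> x"
    using t by (simp add: power_divide)
qed

lemma J_smooth:
  assumes t: "0 < t" "t < 1" and g: "integrable lborel g"
  shows "smooth (J t g)"
  unfolding J_eq[OF assms] by (intro smooth_cmult dilated_conv_smooth[OF g test_\<eta>])

lemma shrink_in_\<Omega>:
  assumes "x \<in> closure \<Omega>" "y \<in> \<Omega>" "0 < t" "t < 1"
  shows "t *\<^sub>R x + (1 - t) *\<^sub>R y \<in> \<Omega>"
proof -
  have "x - (1 - t) *\<^sub>R (x - y) \<in> interior \<Omega>"
    using assms open_\<Omega> by (intro mem_interior_closure_convex_shrink convex_\<Omega>) (auto simp: interior_open)
  then show ?thesis using open_\<Omega> by (simp add: interior_open algebra_simps)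
qed

text \<open>The support is the image of the support of \<open>\<eta>\<close> under a contraction
  towards \<open>x\<close>, hence a compact part of \<open>\<Omega>\<close> even if \<open>x\<close>
  lies on the boundary. So the weak derivative may be tested with this kernel up to the
  boundary.\<close>

lemma test_function_shrink:
  assumes x: "x \<in> closure \<Omega>" and t: "0 < t" "t < 1"
  shows "test_function \<Omega> (\<lambda>w. \<eta> ((- t / (1 - t)) *\<^sub>R x + (1 / (1 - t)) *\<^sub>R w))"
proof -
  obtain S where S: "compact S" "S \<subseteq> \<Omega>" "\<And>x. x \<notin> S \<Longrightarrow> \<eta> x = 0"
    using test_\<eta> by (auto simp: test_function_def)
  let ?S = "(\<lambda>y. t *\<^sub>R x + (1 - t) *\<^sub>R y) ` S"
  show ?thesis
    unfolding test_function_def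
  proof (intro conjI exI[of _ ?S] allI impI)
    show "smooth (\<lambda>w. \<eta> ((- t / (1 - t)) *\<^sub>R x + (1 / (1 - t)) *\<^sub>R w))"
      by (rule smooth_affine[OF test_function_smooth[OF test_\<eta>]])
    show "compact ?S" by (intro compact_continuous_image continuous_intros S)
    show "?S \<subseteq> \<Omega>" using shrink_in_\<Omega>[OF x] S(2) t by auto
    fix w assume w: "w \<notin> ?S"
    have "w = t *\<^sub>R x + (1 - t) *\<^sub>R ((- t / (1 - t)) *\<^sub>R x + (1 / (1 - t)) *\<^sub>R w)"
      unfolding scaleR_combine using t by simp
    then have "(- t / (1 - t)) *\<^sub>R x + (1 / (1 - t)) *\<^sub>R w \<notin> S" using w by blast
    then show "\<eta> ((- t / (1 - t)) *\<^sub>R x + (1 / (1 - t)) *\<^sub>R w) = 0" by (rule S(3))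
  qed
qed

text \<open>A derivative of the kernel in \<open>x\<close> is -t times its derivative in the
  variable of integration. Moving these derivatives to \<open>f\<close> weakly produces the same
  signs once more, which leaves the power of \<open>t\<close>.\<close>

lemma J_multi_partial:
  assumes t: "0 < t" "t < 1" and f: "integrable lborel f" and g: "integrable lborel g"
    and w: "borel_weak_deriv \<Omega> \<delta> f g" and x: "x \<in> closure \<Omega>"
  shows "multi_partial \<delta> (J t f) x = t ^ mi_order \<delta> * J t g x"
proof -
  let ?\<alpha> = "1 / (1 - t)" and ?\<beta> = "- t / (1 - t)"
  let ?n = "mi_order \<delta>"
  have s: "smooth \<eta>" by (rule test_function_smooth[OF test_\<eta>])
  have "multi_partial \<delta> (J t f) x = ?\<alpha>\<^sup>2 * multi_partial \<delta> (dilated_conv ?\<alpha> ?\<beta> f \<eta>) x"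
    unfolding J_eq[OF t f] multi_partial_eq
    by (simp add: dird_funpow_cmult dilated_conv_smooth[OF f test_\<eta>] smooth_dird_funpow)
  also have "\<dots> = ?\<alpha>\<^sup>2 * (?\<beta> ^ ?n * (\<integral>w. f w * multi_partial \<delta> \<eta> (?\<beta> *\<^sub>R x + ?\<alpha> *\<^sub>R w) \<partial>lborel))"
    unfolding dilated_conv_multi_partial[OF f test_\<eta>] by (simp only: dilated_conv_def)
  \<comment> \<open>The powers of \<open>?\<alpha>\<close> are split off because they convert the
    derivative of \<open>\<eta>\<close> into the derivative of the rescaled kernel.\<close>
  also have "?\<beta> ^ ?n = (- t) ^ ?n * ?\<alpha> ^ ?n" unfolding power_mult_distrib[symmetric] by simp
  also have "(- t) ^ ?n * ?\<alpha> ^ ?n * (\<integral>w. f w * multi_partial \<delta> \<eta> (?\<beta> *\<^sub>R x + ?\<alpha> *\<^sub>R w) \<partial>lborel)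
    = (- t) ^ ?n * (\<integral>w. f w * multi_partial \<delta> (\<lambda>w. \<eta> (?\<beta> *\<^sub>R x + ?\<alpha> *\<^sub>R w)) w \<partial>lborel)"
    unfolding multi_partial_affine[OF s]
    by (simp only: mult.assoc integral_mult_right_zero[symmetric] mult.left_commute)
  also have "\<dots> = (- t) ^ ?n * ((- 1) ^ ?n * (\<integral>w. g w * \<eta> (?\<beta> *\<^sub>R x + ?\<alpha> *\<^sub>R w) \<partial>lborel))"
    using w test_function_shrink[OF x t] unfolding borel_weak_deriv_def by simp
  also have "\<dots> = t ^ ?n * dilated_conv ?\<alpha> ?\<beta> g \<eta> x"
    unfolding dilated_conv_def mult.assoc[symmetric] power_mult_distrib[symmetric] by simp
  finally show ?thesis unfolding J_eq[OF t g] by (simp add: mult_ac)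
qed

lemma J_zero:
  assumes t: "0 < t" "t < 1" and f: "integrable lborel f" and x: "x \<in> closure \<Omega>"
    and z: "\<And>\<phi>. test_function \<Omega> \<phi> \<Longrightarrow> (\<integral>x. f x * \<phi> x \<partial>lborel) = 0"
  shows "J t f x = 0"
  using z[OF test_function_shrink[OF x t]] unfolding J_eq[OF t f] dilated_conv_def by simp

lemma affine_pair_measurable:
  assumes "f \<in> borel_measurable borel"
  shows "(\<lambda>z. f (t *\<^sub>R fst z + c *\<^sub>R snd z)) \<in> borel_measurable (borel \<Otimes>\<^sub>M borel :: ((real^2) \<times> (real^2)) measure)"
  by (rule measurable_compose[OF _ assms]) measurable

lemma prob_\<eta>: "emeasure (density lborel (\<lambda>x. ennreal (\<eta> x))) (space (density lborel (\<lambda>x. ennreal (\<eta> x)))) = 1"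
  using nn_integral_eq_integral[OF \<eta>_integrable] \<eta>_nonneg \<eta>_integral
  by (simp add: emeasure_density)

lemma qpow_J:
  assumes q: "1 \<le> q" and t: "0 < t" "t < 1" and g: "integrable lborel g"
  shows "qpow q (J t g x) \<le> (\<integral>\<^sup>+y. qpow q (g (t *\<^sub>R x + (1 - t) *\<^sub>R y)) * ennreal (\<eta> y) \<partial>lborel)"
proof -
  let ?M = "density lborel (\<lambda>x. ennreal (\<eta> x))"
  have [measurable]: "g \<in> borel_measurable borel" using g by auto
  have "(\<lambda>y. g (t *\<^sub>R x + (1 - t) *\<^sub>R y)) \<in> borel_measurable borel" by measurable
  have "integrable lborel (\<lambda>y. g (t *\<^sub>R x + (1 - t) *\<^sub>R y) * \<eta> (0 + 1 *\<^sub>R y))"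
    using t by (intro dilated_conv_integrable[OF _ test_\<eta>] integrable_affine[OF g]) auto
  then have "integrable ?M (\<lambda>y. g (t *\<^sub>R x + (1 - t) *\<^sub>R y))"
    by (subst integrable_density) (auto simp: \<eta>_nonneg mult.commute)
  moreover have "J t g x = (\<integral>y. g (t *\<^sub>R x + (1 - t) *\<^sub>R y) \<partial>?M)"
    unfolding J_def by (subst integral_density) (auto simp: \<eta>_nonneg mult.commute)
  ultimately have "qpow q (J t g x) \<le> (\<integral>\<^sup>+y. qpow q (g (t *\<^sub>R x + (1 - t) *\<^sub>R y)) \<partial>?M)"
    using qpow_integral_le[OF q, of ?M] prob_\<eta> by simp
  then show ?thesis by (simp add: nn_integral_density mult.commute)
qed

text \<open>Jensen for the probability density \<open>\<eta>\<close>, then Tonelli. For fixed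
  \<open>y\<close>, the substitution in \<open>x\<close> has Jacobian t^2, written on the left side
  to avoid a division.\<close>

lemma nn_integral_qpow_J:
  assumes q: "1 \<le> q" and t: "0 < t" "t < 1" and g: "integrable lborel g"
  shows "ennreal (t\<^sup>2) * (\<integral>\<^sup>+x. qpow q (J t g x) \<partial>lborel) \<le> (\<integral>\<^sup>+x. qpow q (g x) \<partial>lborel)"
proof -
  have [measurable]: "g \<in> borel_measurable borel" using g by auto
  let ?f = "\<lambda>z. qpow q (g (t *\<^sub>R fst z + (1 - t) *\<^sub>R snd z)) * ennreal (\<eta> (snd z))"
  have [measurable]: "(\<lambda>z. g (t *\<^sub>R fst z + (1 - t) *\<^sub>R snd z)) \<in> borel_measurable (borel \<Otimes>\<^sub>M borel)"
    by (rule affine_pair_measurable) simp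
  have "?f \<in> borel_measurable (borel \<Otimes>\<^sub>M borel)" by measurable
  then have m: "?f \<in> borel_measurable borel" by (simp add: borel_prod)
  have "(\<integral>\<^sup>+x. qpow q (J t g x) \<partial>lborel) \<le> (\<integral>\<^sup>+x. \<integral>\<^sup>+y. ?f (x, y) \<partial>lborel \<partial>lborel)"
    using qpow_J[OF q t g] by (intro nn_integral_mono) auto
  also have "\<dots> = (\<integral>\<^sup>+y. \<integral>\<^sup>+x. ?f (x, y) \<partial>lborel \<partial>lborel)"
    using tonelli_swap[OF m] by simp
  finally have "ennreal (t\<^sup>2) * (\<integral>\<^sup>+x. qpow q (J t g x) \<partial>lborel)
    \<le> ennreal (t\<^sup>2) * (\<integral>\<^sup>+y. \<integral>\<^sup>+x. ?f (x, y) \<partial>lborel \<partial>lborel)" by (rule mult_left_mono) simp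
  also have "\<dots> = (\<integral>\<^sup>+y. ennreal (t\<^sup>2) * (\<integral>\<^sup>+x. ?f (x, y) \<partial>lborel) \<partial>lborel)"
    using nn_inner_measurable(1)[OF m] by (subst nn_integral_cmult) auto
  also have "\<dots> = (\<integral>\<^sup>+y. (\<integral>\<^sup>+x. qpow q (g x) \<partial>lborel) * ennreal (\<eta> y) \<partial>lborel)"
  proof (rule nn_integral_cong)
    fix y
    have mm: "(\<lambda>x. qpow q (g (t *\<^sub>R x + (1 - t) *\<^sub>R y))) \<in> borel_measurable borel"
      by measurable
    have "ennreal (t\<^sup>2) * (\<integral>\<^sup>+x. ?f (x, y) \<partial>lborel)
      = ennreal (t\<^sup>2) * (\<integral>\<^sup>+x. qpow q (g ((1 - t) *\<^sub>R y + t *\<^sub>R x)) \<partial>lborel) * ennreal (\<eta> y)"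
      using mm by (simp add: nn_integral_multc mult.assoc add.commute)
    also have "ennreal (t\<^sup>2) * (\<integral>\<^sup>+x. qpow q (g ((1 - t) *\<^sub>R y + t *\<^sub>R x)) \<partial>lborel) = (\<integral>\<^sup>+x. qpow q (g x) \<partial>lborel)"
      using t by (subst nn_integral_affine[of "\<lambda>x. qpow q (g x)" t "(1 - t) *\<^sub>R y"]) auto
    finally show "ennreal (t\<^sup>2) * (\<integral>\<^sup>+x. ?f (x, y) \<partial>lborel) = (\<integral>\<^sup>+x. qpow q (g x) \<partial>lborel) * ennreal (\<eta> y)" .
  qed
  also have "\<dots> = (\<integral>\<^sup>+x. qpow q (g x) \<partial>lborel)"
    using nn_integral_eq_integral[OF \<eta>_integrable] \<eta>_nonneg \<eta>_integral
    by (subst nn_integral_cmult) auto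
  finally show ?thesis .
qed

end

section \<open>Continuity of integrable functions under contractions\<close>

definition shrink :: "real \<Rightarrow> real^2 \<Rightarrow> real^2 \<Rightarrow> real^2" where
  "shrink t y x = (1 - t) *\<^sub>R y + t *\<^sub>R x"

text \<open>The shift by 2 keeps the values at least 1/2, so that the inverse Jacobian of the
  contraction is bounded by 4.\<close>

definition tseq :: "nat \<Rightarrow> real" where
  "tseq n = 1 - 1 / real (n + 2)"

lemma tseq: "1/2 \<le> tseq n" "0 < tseq n" "tseq n < 1"
  by (auto simp: tseq_def field_simps)

lemma tseq_lim: "tseq \<longlonglongrightarrow> 1"
proof -
  have "(\<lambda>n. 1 - 1 / real (n + 2)) \<longlonglongrightarrow> 1 - 0"
    by (intro tendsto_diff tendsto_const LIMSEQ_ignore_initial_segment[OF lim_1_over_n])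
  then show ?thesis by (simp add: tseq_def[abs_def])
qed

lemma integrable_shrink:
  fixes f :: "real^2 \<Rightarrow> real"
  shows "integrable lborel f \<Longrightarrow> t \<noteq> 0 \<Longrightarrow> integrable lborel (\<lambda>x. f (shrink t y x))"
  unfolding shrink_def by (rule integrable_affine)

lemma integral_shrink:
  fixes f :: "real^2 \<Rightarrow> real"
  assumes "integrable lborel f" "t \<noteq> 0"
  shows "(\<integral>x. f (shrink t y x) \<partial>lborel) = (\<integral>x. f x \<partial>lborel) / t\<^sup>2"
  using integral_affine[OF assms, of "(1 - t) *\<^sub>R y"] assms(2) unfolding shrink_def by simp

definition shrink_dist :: "real^2 \<Rightarrow> (real^2 \<Rightarrow> real) \<Rightarrow> nat \<Rightarrow> real" where
  "shrink_dist y f n = (\<integral>x. \<bar>f (shrink (tseq n) y x) - f x\<bar> \<partial>lborel)"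

lemma shrink_dist_nonneg: "0 \<le> shrink_dist y f n"
  by (simp add: shrink_dist_def)

lemma tseq_inverse_square: "1 / (tseq n)\<^sup>2 \<le> 4"
proof -
  have "(1/2)\<^sup>2 \<le> (tseq n)\<^sup>2" using tseq[of n] by (intro power_mono) auto
  then have "1/4 \<le> (tseq n)\<^sup>2" by (simp add: power2_eq_square)
  then show ?thesis using tseq[of n] by (simp add: divide_le_eq)
qed

text \<open>The distance between \<open>f\<close> and \<open>g\<close> enters twice: once directly,
  and once after the contraction with the inverse Jacobian, at most 4.\<close>

lemma shrink_dist_approx:
  assumes f: "integrable lborel f" and g: "integrable lborel g"
  shows "shrink_dist y f n \<le> shrink_dist y g n + 5 * (\<integral>x. \<bar>f x - g x\<bar> \<partial>lborel)"
proof -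
  let ?S = "shrink (tseq n) y" and ?D = "\<integral>x. \<bar>f x - g x\<bar> \<partial>lborel"
  have t: "tseq n \<noteq> 0" using tseq(2)[of n] by simp
  note i = integrable_shrink[OF f t, of y] integrable_shrink[OF g t, of y]
  have fg: "integrable lborel (\<lambda>x. \<bar>f x - g x\<bar>)" using f g by simp
  have ifg: "integrable lborel (\<lambda>x. \<bar>f (?S x) - g (?S x)\<bar>)" using i by simp
  have "shrink_dist y f n \<le> (\<integral>x. \<bar>f (?S x) - g (?S x)\<bar> + \<bar>g (?S x) - g x\<bar> + \<bar>f x - g x\<bar> \<partial>lborel)"
    unfolding shrink_dist_def using f g i by (intro integral_mono) auto
  also have "\<dots> = (\<integral>x. \<bar>f (?S x) - g (?S x)\<bar> \<partial>lborel) + shrink_dist y g n + ?D"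
    unfolding shrink_dist_def using f g i by simp
  also have "(\<integral>x. \<bar>f (?S x) - g (?S x)\<bar> \<partial>lborel) = ?D / (tseq n)\<^sup>2"
    by (rule integral_shrink[OF fg t])
  also have "?D / (tseq n)\<^sup>2 \<le> ?D * 4"
    using mult_left_mono[OF tseq_inverse_square[of n], of ?D] by simp
  finally show ?thesis by simp
qed

lemma shrink_dist_tendsto_approx:
  assumes f: "integrable lborel f"
    and g: "\<And>e. 0 < e \<Longrightarrow> \<exists>g. integrable lborel g \<and> shrink_dist y g \<longlonglongrightarrow> 0 \<and> (\<integral>x. \<bar>f x - g x\<bar> \<partial>lborel) < e"
  shows "shrink_dist y f \<longlonglongrightarrow> 0"
proof (rule LIMSEQ_I)
  fix e :: real assume e: "0 < e"
  obtain g where g: "integrable lborel g" "shrink_dist y g \<longlonglongrightarrow> 0" "(\<integral>x. \<bar>f x - g x\<bar> \<partial>lborel) < e / 10"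
    using g[of "e / 10"] e by auto
  obtain N where N: "\<And>n. n \<ge> N \<Longrightarrow> norm (shrink_dist y g n - 0) < e / 2"
    using LIMSEQ_D[OF g(2), of "e / 2"] e by auto
  have "norm (shrink_dist y f n - 0) < e" if "n \<ge> N" for n
    using shrink_dist_approx[OF f g(1), of y n] N[OF that] g(3)
      shrink_dist_nonneg[of y f n] shrink_dist_nonneg[of y g n] by simp
  then show "\<exists>N. \<forall>n\<ge>N. norm (shrink_dist y f n - 0) < e" by blast
qed

lemma shrink_tendsto: "(\<lambda>n. shrink (tseq n) y x) \<longlonglongrightarrow> x"
proof -
  have "(\<lambda>n. (1 - tseq n) *\<^sub>R y + tseq n *\<^sub>R x) \<longlonglongrightarrow> (1 - 1) *\<^sub>R y + 1 *\<^sub>R x"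
    by (intro tendsto_intros tseq_lim)
  then show ?thesis by (simp add: shrink_def)
qed

text \<open>The function \<open>h n\<close> marks the points of \<open>U\<close> that the
  contraction moves out of \<open>U\<close>. It tends to 0 pointwise since \<open>U\<close> is open,
  and |a - b| = a - b + 2 b (1 - a) for indicator values leaves a signed part whose integral is
  known from scaling.\<close>

lemma shrink_dist_open:
  assumes U: "open U" "emeasure lborel U < \<infinity>"
  shows "shrink_dist y (indicator U) \<longlonglongrightarrow> 0"
proof -
  let ?f = "indicator U :: real^2 \<Rightarrow> real"
  have [measurable]: "U \<in> sets borel" using U by simp
  have f: "integrable lborel ?f" using U by (intro integrable_real_indicator) auto
  have t: "tseq n \<noteq> 0" for n using tseq(2)[of n] by simp
  define h where "h n x = ?f x * (1 - ?f (shrink (tseq n) y x))" for n x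
  have hb: "\<bar>h n x\<bar> \<le> ?f x" for n x by (auto simp: h_def split: split_indicator)
  have hi: "integrable lborel (h n)" for n
  proof (rule Bochner_Integration.integrable_bound[OF f])
    have "(\<lambda>x. ?f (shrink (tseq n) y x)) \<in> borel_measurable lborel"
      using integrable_shrink[OF f t] by (rule borel_measurable_integrable)
    then show "h n \<in> borel_measurable lborel" unfolding h_def[abs_def] by measurable
    show "AE x in lborel. norm (h n x) \<le> norm (?f x)" using hb by (auto intro!: AE_I2)
  qed
  have h0: "(\<lambda>n. \<integral>x. h n x \<partial>lborel) \<longlonglongrightarrow> (\<integral>(x::real^2). 0 \<partial>lborel)"
  proof (rule integral_dominated_convergence[where w="?f"])
    show "AE x in lborel. (\<lambda>n. h n x) \<longlonglongrightarrow> 0"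
    proof (rule AE_I2)
      fix x
      show "(\<lambda>n. h n x) \<longlonglongrightarrow> 0"
      proof (cases "x \<in> U")
        case True
        then have "eventually (\<lambda>n. shrink (tseq n) y x \<in> U) sequentially"
          using topological_tendstoD[OF shrink_tendsto U(1)] by blast
        then have "eventually (\<lambda>n. h n x = 0) sequentially"
          by eventually_elim (simp add: h_def)
        then show ?thesis by (rule tendsto_eventually)
      qed (simp add: h_def)
    qed
  qed (use hi f hb in \<open>auto intro!: AE_I2\<close>)
  have eq: "shrink_dist y ?f n = measure lborel U / (tseq n)\<^sup>2 - measure lborel U + 2 * (\<integral>x. h n x \<partial>lborel)" for n
  proof -
    have "shrink_dist y ?f n = (\<integral>x. ?f (shrink (tseq n) y x) - ?f x + 2 * h n x \<partial>lborel)"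
      unfolding shrink_dist_def h_def
      by (intro Bochner_Integration.integral_cong) (auto split: split_indicator)
    also have "\<dots> = (\<integral>x. ?f (shrink (tseq n) y x) \<partial>lborel) - (\<integral>x. ?f x \<partial>lborel) + 2 * (\<integral>x. h n x \<partial>lborel)"
      using integrable_shrink[OF f t] f hi by simp
    also have "(\<integral>x. ?f (shrink (tseq n) y x) \<partial>lborel) = (\<integral>x. ?f x \<partial>lborel) / (tseq n)\<^sup>2"
      by (rule integral_shrink[OF f t])
    finally show ?thesis by simp
  qed
  have "(\<lambda>n. measure lborel U / (tseq n)\<^sup>2 - measure lborel U + 2 * (\<integral>x. h n x \<partial>lborel))
     \<longlonglongrightarrow> measure lborel U / 1\<^sup>2 - measure lborel U + 2 * 0"
    using h0 by (intro tendsto_intros tseq_lim) auto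
  then show ?thesis by (simp add: eq[abs_def])
qed

text \<open>Indicators of measurable sets are approximated by those of open sets, by outer
  regularity. Sums follow from the triangle inequality and limits from
  \<open>shrink_dist_approx\<close>.\<close>

lemma shrink_dist_tendsto:
  assumes "integrable lborel f"
  shows "shrink_dist y f \<longlonglongrightarrow> 0"
  using assms
proof (induction rule: integrable_induct)
  case (base A c)
  have Ab: "A \<in> sets borel" using base by simp
  have Ai: "integrable lborel (indicator A :: real^2 \<Rightarrow> real)"
    using base by (intro integrable_real_indicator) auto
  have A: "shrink_dist y (indicator A) \<longlonglongrightarrow> 0"
  proof (rule shrink_dist_tendsto_approx[OF Ai])
    fix e :: real assume e: "0 < e"
    obtain U where U: "open U" "A \<subseteq> U" "emeasure lborel (U - A) < ennreal e"
      using outer_regular_lborel[OF Ab e] by metis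
    have [measurable]: "A \<in> sets borel" "U \<in> sets borel" using Ab U by auto
    have "emeasure lborel U \<le> emeasure lborel A + emeasure lborel (U - A)"
      using emeasure_subadditive[of A lborel "U - A"] U(2) by (simp add: Un_absorb1)
    also have "\<dots> < \<infinity>" using base U(3) less_trans[OF U(3) ennreal_less_top] by simp
    finally have Uf: "emeasure lborel U < \<infinity>" .
    have "(\<integral>x. \<bar>indicator A x - indicator U x :: real\<bar> \<partial>lborel) = (\<integral>x. indicator (U - A) x \<partial>lborel)"
      using U(2) by (intro Bochner_Integration.integral_cong) (auto split: split_indicator)
    also have "\<dots> = measure lborel (U - A)" by simp
    also have "\<dots> < e"
      using U(3) e by (cases "emeasure lborel (U - A)") (auto simp: measure_def ennreal_less_iff)
    finally show "\<exists>g. integrable lborel g \<and> shrink_dist y g \<longlonglongrightarrow> 0 \<and> (\<integral>x. \<bar>indicator A x - g x\<bar> \<partial>lborel) < e"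
      using shrink_dist_open[OF U(1) Uf] Uf
      by (intro exI[of _ "indicator U"]) (auto intro!: integrable_real_indicator)
  qed
  have "shrink_dist y (\<lambda>x. indicator A x *\<^sub>R c) = (\<lambda>n. \<bar>c\<bar> * shrink_dist y (indicator A) n)"
  proof
    fix n
    have "\<bar>indicator A (shrink (tseq n) y x) *\<^sub>R c - indicator A x *\<^sub>R c\<bar>
      = \<bar>c\<bar> * \<bar>indicator A (shrink (tseq n) y x) - indicator A x\<bar>" for x
      by (auto split: split_indicator)
    then show "shrink_dist y (\<lambda>x. indicator A x *\<^sub>R c) n = \<bar>c\<bar> * shrink_dist y (indicator A) n"
      by (simp only: shrink_dist_def integral_mult_right_zero)
  qed
  then show ?case using tendsto_mult_left[OF A, of "\<bar>c\<bar>"] by simp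
next
  case (add f g)
  show ?case
  proof (rule tendsto_sandwich[OF _ _ tendsto_const])
    have "(\<lambda>n. shrink_dist y f n + shrink_dist y g n) \<longlonglongrightarrow> 0 + 0" by (intro tendsto_add add)
    then show "(\<lambda>n. shrink_dist y f n + shrink_dist y g n) \<longlonglongrightarrow> 0" by simp
    have t: "tseq n \<noteq> 0" for n using tseq(2)[of n] by simp
    have "shrink_dist y (\<lambda>x. f x + g x) n \<le> shrink_dist y f n + shrink_dist y g n" for n
    proof -
      note i = integrable_shrink[OF \<open>integrable lborel f\<close> t[of n], of y] integrable_shrink[OF \<open>integrable lborel g\<close> t[of n], of y]
      have "shrink_dist y (\<lambda>x. f x + g x) n \<le> (\<integral>x. \<bar>f (shrink (tseq n) y x) - f x\<bar> + \<bar>g (shrink (tseq n) y x) - g x\<bar> \<partial>lborel)"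
        unfolding shrink_dist_def using i add by (intro integral_mono) auto
      also have "\<dots> = shrink_dist y f n + shrink_dist y g n"
        unfolding shrink_dist_def using i add by simp
      finally show ?thesis .
    qed
    then show "\<forall>\<^sub>F n in sequentially. shrink_dist y (\<lambda>x. f x + g x) n \<le> shrink_dist y f n + shrink_dist y g n"
      by simp
  qed (simp add: shrink_dist_nonneg)
next
  case (lim f s)
  have sconv: "(\<lambda>i. s i x) \<longlonglongrightarrow> f x" and sb: "norm (s i x) \<le> 2 * norm (f x)" for x i
    using lim.hyps by auto
  have l: "(\<lambda>i. \<integral>x. \<bar>f x - s i x\<bar> \<partial>lborel) \<longlonglongrightarrow> (\<integral>(x::real^2). 0 \<partial>lborel)"
  proof (rule integral_dominated_convergence[where w="\<lambda>x. 3 * \<bar>f x\<bar>"])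
    show "AE x in lborel. (\<lambda>i. \<bar>f x - s i x\<bar>) \<longlonglongrightarrow> 0"
    proof (rule AE_I2)
      fix x :: "real^2"
      have "(\<lambda>i. \<bar>f x - s i x\<bar>) \<longlonglongrightarrow> \<bar>f x - f x\<bar>"
        using sconv[of x] by (intro tendsto_intros)
      then show "(\<lambda>i. \<bar>f x - s i x\<bar>) \<longlonglongrightarrow> 0" by simp
    qed
    show "AE x in lborel. norm \<bar>f x - s i x\<bar> \<le> 3 * \<bar>f x\<bar>" for i
    proof (rule AE_I2)
      fix x :: "real^2"
      show "norm \<bar>f x - s i x\<bar> \<le> 3 * \<bar>f x\<bar>" using sb[of i x] by simp
    qed
  qed (use lim in auto)
  show ?case
  proof (rule shrink_dist_tendsto_approx[OF \<open>integrable lborel f\<close>])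
    fix e :: real assume "0 < e"
    then obtain i where "(\<integral>x. \<bar>f x - s i x\<bar> \<partial>lborel) < e"
      using LIMSEQ_D[OF l, of e] by auto
    then show "\<exists>g. integrable lborel g \<and> shrink_dist y g \<longlonglongrightarrow> 0 \<and> (\<integral>x. \<bar>f x - g x\<bar> \<partial>lborel) < e"
      using lim by blast
  qed
qed

section \<open>Convergence of the regularization in L^1\<close>

context mollifier
begin

lemma J_integrable:
  assumes t: "0 < t" "t < 1" and g: "integrable lborel g"
  shows "integrable lborel (J t g)"
proof -
  have [measurable]: "J t g \<in> borel_measurable borel"
    by (intro borel_measurable_continuous_onI smooth_continuous J_smooth[OF t g])
  have "ennreal (t\<^sup>2) * (\<integral>\<^sup>+x. qpow 1 (J t g x) \<partial>lborel) \<le> (\<integral>\<^sup>+x. qpow 1 (g x) \<partial>lborel)"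
    by (rule nn_integral_qpow_J[OF order.refl t g])
  also have "\<dots> < \<infinity>" using g by (simp add: qpow_def integrable_iff_bounded)
  finally have "(\<integral>\<^sup>+x. qpow 1 (J t g x) \<partial>lborel) < \<infinity>"
    using t by (auto simp: ennreal_mult_less_top)
  then show ?thesis by (simp add: qpow_def integrable_iff_bounded)
qed

text \<open>As \<open>\<eta>\<close> has integral 1, the difference \<open>J t g - g\<close> is an
  average over \<open>y\<close> of the differences under the contractions with centre
  \<open>y\<close>; Tonelli exchanges the two integrals.\<close>

lemma J_dist:
  assumes g: "integrable lborel g"
  shows "ennreal (\<integral>x. \<bar>J (tseq n) g x - g x\<bar> \<partial>lborel) \<le> (\<integral>\<^sup>+y. ennreal (shrink_dist y g n * \<eta> y) \<partial>lborel)"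
proof -
  let ?t = "tseq n"
  have t: "0 < ?t" "?t < 1" using tseq by auto
  have [measurable]: "g \<in> borel_measurable borel" using g by auto
  have Ji: "integrable lborel (J ?t g)" by (rule J_integrable[OF t g])
  have [measurable]: "(\<lambda>z. g (?t *\<^sub>R fst z + (1 - ?t) *\<^sub>R snd z)) \<in> borel_measurable (borel \<Otimes>\<^sub>M borel)"
    by (rule affine_pair_measurable) simp
  let ?f = "\<lambda>z. ennreal (\<bar>g (?t *\<^sub>R fst z + (1 - ?t) *\<^sub>R snd z) - g (fst z)\<bar> * \<eta> (snd z))"
  have "?f \<in> borel_measurable (borel \<Otimes>\<^sub>M borel)" by measurable
  then have m: "?f \<in> borel_measurable borel" by (simp add: borel_prod)
  have pw: "ennreal \<bar>J ?t g x - g x\<bar> \<le> (\<integral>\<^sup>+y. ?f (x, y) \<partial>lborel)" for x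
  proof -
    have i1: "integrable lborel (\<lambda>y. g (?t *\<^sub>R x + (1 - ?t) *\<^sub>R y) * \<eta> y)"
      using dilated_conv_integrable[OF integrable_affine[OF g, of "1 - ?t" "?t *\<^sub>R x"] test_\<eta>, of 0 1] t by simp
    have i2: "integrable lborel (\<lambda>y. g x * \<eta> y)" using \<eta>_integrable by simp
    have i: "integrable lborel (\<lambda>y. (g (?t *\<^sub>R x + (1 - ?t) *\<^sub>R y) - g x) * \<eta> y)"
      using Bochner_Integration.integrable_diff[OF i1 i2] by (simp add: left_diff_distrib)
    have "J ?t g x - g x = (\<integral>y. g (?t *\<^sub>R x + (1 - ?t) *\<^sub>R y) * \<eta> y - g x * \<eta> y \<partial>lborel)"
      using i1 i2 \<eta>_integral by (simp add: J_def)
    also have "\<dots> = (\<integral>y. (g (?t *\<^sub>R x + (1 - ?t) *\<^sub>R y) - g x) * \<eta> y \<partial>lborel)"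
      by (simp add: left_diff_distrib)
    also have "ennreal \<bar>\<dots>\<bar> \<le> (\<integral>\<^sup>+y. ennreal (norm ((g (?t *\<^sub>R x + (1 - ?t) *\<^sub>R y) - g x) * \<eta> y)) \<partial>lborel)"
      using integral_norm_bound_ennreal[OF i] by simp
    finally show ?thesis using \<eta>_nonneg by (simp add: abs_mult)
  qed
  have "ennreal (\<integral>x. \<bar>J ?t g x - g x\<bar> \<partial>lborel) = (\<integral>\<^sup>+x. ennreal \<bar>J ?t g x - g x\<bar> \<partial>lborel)"
    using Ji g by (intro nn_integral_eq_integral[symmetric]) auto
  also have "\<dots> \<le> (\<integral>\<^sup>+x. \<integral>\<^sup>+y. ?f (x, y) \<partial>lborel \<partial>lborel)"
    using pw by (intro nn_integral_mono) auto
  also have "\<dots> = (\<integral>\<^sup>+y. \<integral>\<^sup>+x. ?f (x, y) \<partial>lborel \<partial>lborel)"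
    using tonelli_swap[OF m] by simp
  also have "\<dots> = (\<integral>\<^sup>+y. ennreal (shrink_dist y g n * \<eta> y) \<partial>lborel)"
  proof (rule nn_integral_cong)
    fix y
    have "?t \<noteq> 0" using t by simp
    from integrable_shrink[OF g this, of y] g
    have "integrable lborel (\<lambda>x. \<bar>g (shrink ?t y x) - g x\<bar> * \<eta> y)" by simp
    then have "(\<integral>\<^sup>+x. ennreal (\<bar>g (shrink ?t y x) - g x\<bar> * \<eta> y) \<partial>lborel) = ennreal (\<integral>x. \<bar>g (shrink ?t y x) - g x\<bar> * \<eta> y \<partial>lborel)"
      using \<eta>_nonneg by (intro nn_integral_eq_integral) auto
    then show "(\<integral>\<^sup>+x. ?f (x, y) \<partial>lborel) = ennreal (shrink_dist y g n * \<eta> y)"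
      by (simp add: shrink_dist_def shrink_def add.commute)
  qed
  finally show ?thesis .
qed

lemma shrink_dist_measurable [measurable]:
  assumes g: "integrable lborel g"
  shows "(\<lambda>y. shrink_dist y g n) \<in> borel_measurable borel"
proof -
  let ?t = "tseq n"
  have [measurable]: "g \<in> borel_measurable borel" using g by auto
  have "(\<lambda>z. g ((1 - ?t) *\<^sub>R fst z + ?t *\<^sub>R snd z)) \<in> borel_measurable (borel \<Otimes>\<^sub>M borel)"
    by (rule affine_pair_measurable) simp
  then have "(\<lambda>(y, x). \<bar>g ((1 - ?t) *\<^sub>R y + ?t *\<^sub>R x) - g x\<bar>) \<in> borel_measurable (borel \<Otimes>\<^sub>M lborel)"
    unfolding case_prod_unfold by measurable
  from lborel.borel_measurable_lebesgue_integral[OF this]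
  show ?thesis unfolding shrink_dist_def shrink_def by simp
qed

text \<open>The contraction distance tends to 0 for every centre and is bounded by five times the
  L^1 norm of \<open>g\<close>, so dominated convergence against \<open>\<eta>\<close>
  applies.\<close>

lemma J_tendsto:
  assumes g: "integrable lborel g"
  shows "(\<lambda>n. \<integral>x. \<bar>J (tseq n) g x - g x\<bar> \<partial>lborel) \<longlonglongrightarrow> 0"
proof -
  let ?I = "\<integral>x. \<bar>g x\<bar> \<partial>lborel"
  have b: "shrink_dist y g n \<le> 5 * ?I" for y n
    using shrink_dist_approx[OF g, of "\<lambda>x. 0" y n] by (simp add: shrink_dist_def[of _ "\<lambda>x. 0"])
  have i: "integrable lborel (\<lambda>y. shrink_dist y g n * \<eta> y)" for n
  proof (rule Bochner_Integration.integrable_bound[where f="\<lambda>y. 5 * ?I * \<eta> y"])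
    show "integrable lborel (\<lambda>y. 5 * ?I * \<eta> y)" using \<eta>_integrable by simp
    show "(\<lambda>y. shrink_dist y g n * \<eta> y) \<in> borel_measurable lborel"
      using shrink_dist_measurable[OF g] by measurable
    show "AE y in lborel. norm (shrink_dist y g n * \<eta> y) \<le> norm (5 * ?I * \<eta> y)"
      using b shrink_dist_nonneg \<eta>_nonneg by (intro AE_I2) (auto simp: abs_mult intro!: mult_right_mono)
  qed
  have l: "(\<lambda>n. \<integral>y. shrink_dist y g n * \<eta> y \<partial>lborel) \<longlonglongrightarrow> (\<integral>(y::real^2). 0 \<partial>lborel)"
  proof (rule integral_dominated_convergence[where w="\<lambda>y. 5 * ?I * \<eta> y"])
    show "AE y in lborel. (\<lambda>n. shrink_dist y g n * \<eta> y) \<longlonglongrightarrow> 0"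
    proof (rule AE_I2)
      fix y
      show "(\<lambda>n. shrink_dist y g n * \<eta> y) \<longlonglongrightarrow> 0"
        using tendsto_mult_right[OF shrink_dist_tendsto[OF g, of y], of "\<eta> y"] by simp
    qed
    show "AE y in lborel. norm (shrink_dist y g n * \<eta> y) \<le> 5 * ?I * \<eta> y" for n
      using b shrink_dist_nonneg \<eta>_nonneg by (intro AE_I2) (auto simp: abs_mult intro!: mult_right_mono)
  qed (use i \<eta>_integrable in auto)
  show ?thesis
  proof (rule tendsto_sandwich[OF _ _ tendsto_const])
    show "(\<lambda>n. \<integral>y. shrink_dist y g n * \<eta> y \<partial>lborel) \<longlonglongrightarrow> 0" using l by simp
    have "(\<integral>x. \<bar>J (tseq n) g x - g x\<bar> \<partial>lborel) \<le> (\<integral>y. shrink_dist y g n * \<eta> y \<partial>lborel)" for n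
    proof -
      have p: "0 \<le> shrink_dist y g n * \<eta> y" for y using shrink_dist_nonneg \<eta>_nonneg by simp
      have "ennreal (\<integral>x. \<bar>J (tseq n) g x - g x\<bar> \<partial>lborel) \<le> ennreal (\<integral>y. shrink_dist y g n * \<eta> y \<partial>lborel)"
        using J_dist[OF g, of n] nn_integral_eq_integral[OF i[of n]] p by simp
      then show ?thesis using p by (simp add: ennreal_le_iff)
    qed
    then show "\<forall>\<^sub>F n in sequentially. (\<integral>x. \<bar>J (tseq n) g x - g x\<bar> \<partial>lborel) \<le> (\<integral>y. shrink_dist y g n * \<eta> y \<partial>lborel)"
      by simp
  qed simp
qed

text \<open>Du Bois-Reymond's lemma: on \<open>\<Omega>\<close> the averages \<open>J t f\<close>
  are integrals of \<open>f\<close> against test functions and vanish, while they converge to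
  \<open>f\<close> in L^1.\<close>

lemma zero_of_weak_zero:
  assumes f: "integrable lborel f"
    and z: "\<And>\<phi>. test_function \<Omega> \<phi> \<Longrightarrow> (\<integral>x. f x * \<phi> x \<partial>lborel) = 0"
  shows "AE x in lborel. x \<in> \<Omega> \<longrightarrow> f x = 0"
proof -
  have \<Omega>m [measurable]: "\<Omega> \<in> sets borel" using open_\<Omega> by simp
  have fi: "integrable lborel (\<lambda>x. indicator \<Omega> x * \<bar>f x\<bar>)"
    using integrable_mult_indicator[of \<Omega> lborel "\<lambda>x. \<bar>f x\<bar>"] f by simp
  have le: "(\<integral>x. indicator \<Omega> x * \<bar>f x\<bar> \<partial>lborel) \<le> (\<integral>x. \<bar>J (tseq n) f x - f x\<bar> \<partial>lborel)" for n
  proof (rule integral_mono[OF fi])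
    show "integrable lborel (\<lambda>x. \<bar>J (tseq n) f x - f x\<bar>)"
      using J_integrable[OF tseq(2,3) f] f by simp
    show "indicator \<Omega> x * \<bar>f x\<bar> \<le> \<bar>J (tseq n) f x - f x\<bar>" for x
      using J_zero[OF tseq(2,3) f _ z, of x n] closure_subset[of \<Omega>] by (auto split: split_indicator)
  qed
  have "(\<integral>x. indicator \<Omega> x * \<bar>f x\<bar> \<partial>lborel) \<le> 0"
    by (rule LIMSEQ_le_const[OF J_tendsto[OF f]]) (use le in auto)
  then have "(\<integral>x. indicator \<Omega> x * \<bar>f x\<bar> \<partial>lborel) = 0"
    by (intro order.antisym Bochner_Integration.integral_nonneg) auto
  then have "AE x in lborel. indicator \<Omega> x * \<bar>f x\<bar> = 0"
    using integral_nonneg_eq_0_iff_AE[OF fi] by simp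
  then show ?thesis by eventually_elim (auto split: split_indicator_asm)
qed

end

section \<open>Weak derivatives\<close>

text \<open>Replaces a Lebesgue measurable function that matters on \<open>S\<close> only by a Borel
  function on the plane. Extension by zero makes integrals over the plane integrals over
  \<open>S\<close>.\<close>

definition borel_version :: "(real^2) set \<Rightarrow> (real^2 \<Rightarrow> real) \<Rightarrow> (real^2 \<Rightarrow> real) \<Rightarrow> bool" where
  "borel_version S u f \<longleftrightarrow> integrable lborel f \<and> (AE x in lborel. x \<in> S \<longrightarrow> f x = u x) \<and> (\<forall>x. x \<notin> S \<longrightarrow> f x = 0)"

lemma exists_borel_version:
  assumes S [measurable]: "S \<in> sets borel" and u: "set_integrable lebesgue S u"
  shows "\<exists>f. borel_version S u f"
proof -
  have ui: "integrable lebesgue (\<lambda>x. indicator S x * u x)" using u by (simp add: set_integrable_def)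
  then obtain g where g [measurable]: "g \<in> borel_measurable lborel"
    and ae: "AE x in lborel. indicator S x * u x = g x"
    using completion_ex_borel_measurable_real[of "\<lambda>x. indicator S x * u x" lborel] by auto
  have "integrable lebesgue g"
    by (rule integrable_cong_AE_imp[OF ui]) (use ae in \<open>auto intro!: AE_completion measurable_completion simp: eq_commute\<close>)
  then have gi: "integrable lborel g" by (simp add: integrable_completion)
  show ?thesis
    unfolding borel_version_def
  proof (intro exI[of _ "\<lambda>x. indicator S x * g x"] conjI)
    show "integrable lborel (\<lambda>x. indicator S x * g x)"
      using integrable_mult_indicator[of S lborel g] gi by simp
    show "AE x in lborel. x \<in> S \<longrightarrow> indicator S x * g x = u x"
      using ae by eventually_elim (auto split: split_indicator_asm)
  qed auto
qed

lemma set_integral_borel_version: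
  assumes S: "S \<in> sets borel" and u: "set_integrable lebesgue S u"
    and f: "borel_version S u f" and [measurable]: "\<psi> \<in> borel_measurable borel"
  shows "(LINT x:S|lebesgue. u x * \<psi> x) = (\<integral>x. f x * \<psi> x \<partial>lborel)"
proof -
  have [measurable]: "f \<in> borel_measurable borel" using f by (auto simp: borel_version_def)
  have m1: "(\<lambda>x. indicator S x * u x) \<in> borel_measurable lebesgue"
    using u by (simp add: set_integrable_def)
  have m2: "\<psi> \<in> borel_measurable lebesgue" by (intro measurable_completion) simp
  have "(LINT x:S|lebesgue. u x * \<psi> x) = (\<integral>x. f x * \<psi> x \<partial>lebesgue)"
    unfolding set_lebesgue_integral_def
  proof (rule integral_cong_AE)
    show "(\<lambda>x. indicator S x *\<^sub>R (u x * \<psi> x)) \<in> borel_measurable lebesgue"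
      using borel_measurable_times[OF m1 m2] by (simp add: mult.assoc)
    show "(\<lambda>x. f x * \<psi> x) \<in> borel_measurable lebesgue" by (intro measurable_completion) simp
    have "AE x in lborel. x \<in> S \<longrightarrow> f x = u x" using f by (simp add: borel_version_def)
    then have "AE x in lborel. indicator S x *\<^sub>R (u x * \<psi> x) = f x * \<psi> x"
      by eventually_elim (use f in \<open>auto simp: borel_version_def split: split_indicator\<close>)
    then show "AE x in lebesgue. indicator S x *\<^sub>R (u x * \<psi> x) = f x * \<psi> x" by (rule AE_completion)
  qed
  then show ?thesis by (simp add: integral_completion)
qed

lemma has_weak_deriv_borel:
  assumes \<Omega>: "open \<Omega>" and w: "has_weak_deriv \<Omega> \<delta> u w"
    and u: "set_integrable lebesgue \<Omega> u" "set_integrable lebesgue \<Omega> w"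
    and f: "borel_version \<Omega> u f" "borel_version \<Omega> w g"
  shows "borel_weak_deriv \<Omega> \<delta> f g"
  unfolding borel_weak_deriv_def
proof (intro allI impI)
  fix \<phi> assume \<phi>: "test_function \<Omega> \<phi>"
  have \<Omega>b: "\<Omega> \<in> sets borel" using \<Omega> by simp
  have [measurable]: "\<phi> \<in> borel_measurable borel" "multi_partial \<delta> \<phi> \<in> borel_measurable borel"
    using \<phi> test_function_multi_partial[OF \<phi>] by (blast intro: test_function_borel)+
  show "(\<integral>x. f x * multi_partial \<delta> \<phi> x \<partial>lborel) = (- 1) ^ mi_order \<delta> * (\<integral>x. g x * \<phi> x \<partial>lborel)"
    using w \<phi> set_integral_borel_version[OF \<Omega>b u(1) f(1), of "multi_partial \<delta> \<phi>"]
      set_integral_borel_version[OF \<Omega>b u(2) f(2), of \<phi>]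
    unfolding has_weak_deriv_def by simp
qed

text \<open>Weak derivatives are only locally integrable, so they are compared on countably many
  compact boxes that cover \<open>\<Omega>\<close>. In the open box the difference vanishes weakly,
  and the faces form a null set.\<close>

lemma weak_deriv_unique:
  assumes \<Omega>: "open \<Omega>" and w1: "has_weak_deriv \<Omega> \<delta> u w1" and w2: "has_weak_deriv \<Omega> \<delta> u w2"
  shows "AE x in lborel. x \<in> \<Omega> \<longrightarrow> w1 x = w2 x"
proof -
  obtain \<D> where D: "countable \<D>" "\<D> \<subseteq> Pow \<Omega>" "\<And>X. X \<in> \<D> \<Longrightarrow> \<exists>a b. X = cbox a b" "\<Union>\<D> = \<Omega>"
    using open_countable_Union_open_cbox[OF \<Omega>] by metis
  have "AE x in lborel. x \<in> X \<longrightarrow> w1 x = w2 x" if X: "X \<in> \<D>" for X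
  proof -
    obtain a b where Xab: "X = cbox a b" using D(3)[OF X] by auto
    have sub: "cbox a b \<subseteq> \<Omega>" using X D(2) Xab by auto
    have "set_integrable lebesgue (cbox a b) w" if "has_weak_deriv \<Omega> \<delta> u w" for w
      using that sub compact_cbox[of a b] by (simp add: has_weak_deriv_def locally_integrable_def)
    then have "set_integrable lebesgue (cbox a b) w1" "set_integrable lebesgue (cbox a b) w2"
      using w1 w2 by simp_all
    note si = this
    have cb: "cbox a b \<in> sets borel" by simp
    obtain g1 g2 where g: "borel_version (cbox a b) w1 g1" "borel_version (cbox a b) w2 g2"
      using exists_borel_version[OF cb] si by metis
    have gi: "integrable lborel g1" "integrable lborel g2" using g by (auto simp: borel_version_def)
    have z: "(\<integral>x. (g1 x - g2 x) * \<phi> x \<partial>lborel) = 0" if \<phi>: "test_function (box a b) \<phi>" for \<phi>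
    proof -
      have \<phi>\<Omega>: "test_function \<Omega> \<phi>" by (rule test_function_mono[OF \<phi> order.trans[OF box_subset_cbox sub]])
      have [measurable]: "\<phi> \<in> borel_measurable borel" using \<phi> by (rule test_function_borel)
      have r: "(LINT x:\<Omega>|lebesgue. w x * \<phi> x) = (LINT x:cbox a b|lebesgue. w x * \<phi> x)" for w
        unfolding set_lebesgue_integral_def
      proof (rule Bochner_Integration.integral_cong)
        fix x
        show "indicat_real \<Omega> x *\<^sub>R (w x * \<phi> x) = indicat_real (cbox a b) x *\<^sub>R (w x * \<phi> x)"
          using sub test_function_zero[OF \<phi>, of x] box_subset_cbox[of a b] by (auto split: split_indicator)
      qed simp
      have e: "(- 1) ^ mi_order \<delta> * (LINT x:\<Omega>|lebesgue. w x * \<phi> x) = (LINT x:\<Omega>|lebesgue. u x * multi_partial \<delta> \<phi> x)"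
        if "has_weak_deriv \<Omega> \<delta> u w" for w
        using that \<phi>\<Omega> by (simp add: has_weak_deriv_def)
      have "(- 1) ^ mi_order \<delta> * (LINT x:\<Omega>|lebesgue. w1 x * \<phi> x) = (- 1) ^ mi_order \<delta> * (LINT x:\<Omega>|lebesgue. w2 x * \<phi> x)"
        using e[OF w1] e[OF w2] by (rule trans[OF _ sym])
      then have "(LINT x:\<Omega>|lebesgue. w1 x * \<phi> x) = (LINT x:\<Omega>|lebesgue. w2 x * \<phi> x)" by simp
      then have "(\<integral>x. g1 x * \<phi> x \<partial>lborel) = (\<integral>x. g2 x * \<phi> x \<partial>lborel)"
        unfolding r using set_integral_borel_version[OF cb si(1) g(1), of \<phi>]
          set_integral_borel_version[OF cb si(2) g(2), of \<phi>] by simp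
      moreover have "integrable lborel (\<lambda>x. g1 x * \<phi> (0 + 1 *\<^sub>R x))" "integrable lborel (\<lambda>x. g2 x * \<phi> (0 + 1 *\<^sub>R x))"
        by (intro dilated_conv_integrable[OF _ \<phi>] gi)+
      ultimately show ?thesis by (simp add: left_diff_distrib)
    qed
    have "AE x in lborel. x \<in> box a b \<longrightarrow> g1 x - g2 x = 0"
    proof (cases "box a b = {}")
      case False
      obtain \<eta> where "test_function (box a b) \<eta>" "\<And>x. 0 \<le> \<eta> x" "(\<integral>x. \<eta> x \<partial>lborel) = 1"
        using exists_mollifier[OF open_box False] by metis
      then interpret mollifier "box a b" \<eta> by unfold_locales (auto simp: convex_box open_box)
      show ?thesis
        by (rule zero_of_weak_zero) (use gi z in auto)
    qed simp
    moreover have "AE x in lborel. x \<notin> cbox a b - box a b"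
    proof -
      have "negligible (cbox a b - box a b)" by (rule negligible_frontier_interval)
      then have "cbox a b - box a b \<in> null_sets lebesgue" by (simp add: negligible_iff_null_sets)
      then have "AE x in lebesgue. x \<notin> cbox a b - box a b" by (rule AE_not_in)
      then show ?thesis by (simp only: AE_completion_iff)
    qed
    moreover have "AE x in lborel. x \<in> cbox a b \<longrightarrow> g1 x = w1 x" "AE x in lborel. x \<in> cbox a b \<longrightarrow> g2 x = w2 x"
      using g by (auto simp: borel_version_def)
    ultimately show ?thesis unfolding Xab by eventually_elim auto
  qed
  then have "AE x in lborel. \<forall>X\<in>\<D>. x \<in> X \<longrightarrow> w1 x = w2 x"
    by (subst AE_ball_countable[OF D(1)]) blast
  then show ?thesis by eventually_elim (use D(4) in blast)
qed

text \<open>By completeness of Lebesgue measure: the superlevel sets of \<open>f\<close> and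
  \<open>g\<close> differ by null sets only.\<close>

lemma borel_measurable_lebesgue_on_AE:
  fixes f g :: "real^2 \<Rightarrow> real"
  assumes \<Omega>: "\<Omega> \<in> sets borel" and f: "f \<in> borel_measurable (lebesgue_on \<Omega>)"
    and ae: "AE x in lborel. x \<in> \<Omega> \<longrightarrow> f x = g x"
  shows "g \<in> borel_measurable (lebesgue_on \<Omega>)"
proof -
  have \<Omega>l: "\<Omega> \<in> sets lebesgue" using \<Omega> by simp
  have F: "(\<lambda>x. indicator \<Omega> x *\<^sub>R f x) \<in> borel_measurable lebesgue"
    using f \<Omega>l by (simp add: borel_measurable_restrict_space_iff)
  have "(\<lambda>x. indicator \<Omega> x *\<^sub>R g x) \<in> borel_measurable lebesgue"
  proof (rule borel_measurableI_greater)
    fix a :: real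
    have A: "{x \<in> space lebesgue. a < indicator \<Omega> x *\<^sub>R f x} \<in> sets lebesgue"
      by (rule borel_measurable_less[OF borel_measurable_const F])
    have "AE x in lborel. x \<in> {x \<in> space lebesgue. a < indicator \<Omega> x *\<^sub>R f x} \<longleftrightarrow> x \<in> {x \<in> space lebesgue. a < indicator \<Omega> x *\<^sub>R g x}"
      using ae by eventually_elim (auto split: split_indicator)
    then have "AE x in lebesgue. x \<in> {x \<in> space lebesgue. a < indicator \<Omega> x *\<^sub>R f x} \<longleftrightarrow> x \<in> {x \<in> space lebesgue. a < indicator \<Omega> x *\<^sub>R g x}"
      by (rule AE_completion)
    from completion.in_sets_AE[OF this A] show "{x \<in> space lebesgue. a < indicator \<Omega> x *\<^sub>R g x} \<in> sets lebesgue"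
      by auto
  qed
  then show ?thesis using \<Omega>l by (simp add: borel_measurable_restrict_space_iff)
qed

lemma borel_version_measurable:
  assumes \<Omega>: "\<Omega> \<in> sets borel" and f: "borel_version \<Omega> u f"
  shows "u \<in> borel_measurable (lebesgue_on \<Omega>)"
proof (rule borel_measurable_lebesgue_on_AE[OF \<Omega>])
  have "f \<in> borel_measurable lborel" using f by (auto simp: borel_version_def)
  then show "f \<in> borel_measurable (lebesgue_on \<Omega>)"
    by (intro measurable_restrict_space1 measurable_completion) simp
  show "AE x in lborel. x \<in> \<Omega> \<longrightarrow> f x = u x" using f by (simp add: borel_version_def)
qed

lemma nn_integral_lebesgue_on:
  assumes "\<Omega> \<in> sets borel"
  shows "(\<integral>\<^sup>+x. \<phi> x \<partial>lebesgue_on \<Omega>) = (\<integral>\<^sup>+x. \<phi> x * indicator \<Omega> x \<partial>lborel)"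
  using assms by (simp add: nn_integral_restrict_space nn_integral_completion)

text \<open>On a set of finite measure, |y| <= 1 + |y|^q settles finite exponents and essential
  boundedness settles \<open>p = \<infinity>\<close>.\<close>

lemma Lp_set_integrable:
  assumes \<Omega>: "open \<Omega>" "bounded \<Omega>" and p: "1 \<le> p" and f: "f \<in> Lp_space p \<Omega>"
  shows "set_integrable lebesgue \<Omega> f"
proof -
  have \<Omega>l: "\<Omega> \<in> sets lebesgue" "\<Omega> \<in> sets borel" using \<Omega> by simp_all
  interpret finite_measure "lebesgue_on \<Omega>"
    using emeasure_bounded_finite[OF \<Omega>(2)] \<Omega>l
    by (intro finite_measureI) (auto simp: emeasure_restrict_space space_restrict_space)
  have fm: "f \<in> borel_measurable (lebesgue_on \<Omega>)" using f by (simp add: Lp_space_def)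
  have "integrable (lebesgue_on \<Omega>) f"
  proof (cases "p = \<infinity>")
    case True
    then have "esssup (lebesgue_on \<Omega>) (\<lambda>x. ereal \<bar>f x\<bar>) < \<infinity>" using f by (simp add: Lp_space_def)
    then obtain c :: real where c: "esssup (lebesgue_on \<Omega>) (\<lambda>x. ereal \<bar>f x\<bar>) \<le> ereal c"
      by (cases "esssup (lebesgue_on \<Omega>) (\<lambda>x. ereal \<bar>f x\<bar>)") auto
    have "AE x in lebesgue_on \<Omega>. ereal \<bar>f x\<bar> \<le> esssup (lebesgue_on \<Omega>) (\<lambda>x. ereal \<bar>f x\<bar>)"
      by (rule esssup_AE)
    then have "AE x in lebesgue_on \<Omega>. norm (f x) \<le> c"
      by eventually_elim (use c in \<open>auto dest: order.trans\<close>)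
    then show ?thesis using fm by (rule integrable_const_bound)
  next
    case False
    then obtain q where q: "p = ereal q" "1 \<le> q" using p by (cases p) auto
    have i: "integrable (lebesgue_on \<Omega>) (\<lambda>x. 1 + \<bar>f x\<bar> powr q)"
      using f q by (simp add: Lp_space_def)
    show ?thesis
    proof (rule Bochner_Integration.integrable_bound[OF i fm])
      have "\<bar>y\<bar> \<le> 1 + \<bar>y\<bar> powr q" for y :: real
      proof (cases "\<bar>y\<bar> \<le> 1")
        case False
        then show ?thesis using powr_mono[of 1 q "\<bar>y\<bar>"] q by simp
      qed (simp add: add_increasing2)
      then show "AE x in lebesgue_on \<Omega>. norm (f x) \<le> norm (1 + \<bar>f x\<bar> powr q)"
        by (auto intro!: AE_I2 simp: abs_of_nonneg add_nonneg_nonneg)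
    qed
  qed
  then show ?thesis using \<Omega>l by (simp add: set_integrable_def integrable_restrict_space)
qed

section \<open>Triangles\<close>

definition cross2 :: "real^2 \<Rightarrow> real^2 \<Rightarrow> real" where
  "cross2 u w = u $ 1 * w $ 2 - u $ 2 * w $ 1"

lemma norm_sq_2: "(norm (x::real^2))\<^sup>2 = (x $ 1)\<^sup>2 + (x $ 2)\<^sup>2"
  by (simp add: norm_vec_def L2_set_def sum_2)

lemma cross2_eq_0_imp:
  assumes z: "cross2 u w = 0" and u: "u \<noteq> 0"
  shows "\<exists>c. w = c *\<^sub>R u"
proof (cases "u $ 1 = 0")
  case True
  with u have "u $ 2 \<noteq> 0" by (auto simp: vec_eq_iff forall_2)
  then have "w = (w $ 2 / u $ 2) *\<^sub>R u"
    using z True by (auto simp: cross2_def vec_eq_iff forall_2)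
  then show ?thesis by blast
next
  case False
  then have "w = (w $ 1 / u $ 1) *\<^sub>R u"
    using z by (auto simp: cross2_def vec_eq_iff forall_2 field_simps)
  then show ?thesis by blast
qed

lemma cross2_nonzero:
  assumes "\<not> collinear {x1, x2, x3}"
  shows "cross2 (x2 - x1) (x3 - x1) \<noteq> 0"
proof
  let ?u = "x2 - x1" and ?w = "x3 - x1"
  assume z: "cross2 ?u ?w = 0"
  have "collinear {0, ?u, ?w}"
  proof (cases "?u = 0")
    case False
    then have "\<exists>c. ?w = c *\<^sub>R ?u" by (rule cross2_eq_0_imp[OF z])
    then show ?thesis by (simp add: collinear_lemma)
  qed simp
  then have "collinear {x2, x1, x3}" by (simp add: collinear_3[of x2 x1 x3])
  then show False using assms by (simp add: insert_commute)
qed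

lemma cross2_expand:
  assumes "cross2 u w \<noteq> 0"
  shows "x = (cross2 x w / cross2 u w) *\<^sub>R u + (cross2 u x / cross2 u w) *\<^sub>R w"
proof -
  let ?D = "cross2 u w"
  have "?D * x $ i = cross2 x w * u $ i + cross2 u x * w $ i" for i
    using exhaust_2[of i] by (auto simp: cross2_def algebra_simps)
  then have "x $ i = (cross2 x w * u $ i + cross2 u x * w $ i) / ?D" for i
    using assms by (simp add: nonzero_eq_divide_eq mult.commute)
  then show ?thesis by (simp add: vec_eq_iff add_divide_distrib)
qed

text \<open>Lagrange's identity: the squares of determinant and inner product add up to the squared
  product of the lengths.\<close>

lemma cross2_le: "\<bar>cross2 u w\<bar> \<le> norm u * norm w"
proof -
  have "(cross2 u w)\<^sup>2 \<le> (norm u * norm w)\<^sup>2"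
  proof -
    have "(norm u * norm w)\<^sup>2 = (cross2 u w)\<^sup>2 + (u $ 1 * w $ 1 + u $ 2 * w $ 2)\<^sup>2"
      by (simp add: power_mult_distrib norm_sq_2 cross2_def) (simp add: power2_eq_square algebra_simps)
    then show ?thesis by simp
  qed
  then show ?thesis by (rule abs_le_square_iff[THEN iffD2, of _ "norm u * norm w", simplified])
qed

text \<open>The formula R = abc / (4 area), where the determinant is twice the area up to sign. The
  computation also shows that exactly one radius qualifies, so that the definite description in
  \<open>circumradius\<close> has its intended value.\<close>

lemma circumradius_cross2:
  assumes "\<not> collinear {x1, x2, x3}"
  shows "0 < circumradius x1 x2 x3"
    and "2 * circumradius x1 x2 x3 * \<bar>cross2 (x2 - x1) (x3 - x1)\<bar> = norm (x2 - x1) * norm (x3 - x1) * dist x2 x3"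
proof -
  define u where "u = x2 - x1"
  define w where "w = x3 - x1"
  define D where "D = cross2 u w"
  have D: "D \<noteq> 0" using cross2_nonzero[OF assms] by (simp add: D_def u_def w_def)
  define U where "U = (norm u)\<^sup>2"
  define W where "W = (norm w)\<^sup>2"
  \<comment> \<open>The circumcentre relative to \<open>x1\<close>, obtained by Cramer's rule from
    the two linear equations stated in \<open>zu\<close>.\<close>
  define z :: "real^2" where "z = vector [(w $ 2 * U - u $ 2 * W) / (2 * D), (u $ 1 * W - w $ 1 * U) / (2 * D)]"
  have eqv: "dist (x1 + y) x1 = r \<and> dist (x1 + y) x2 = r \<and> dist (x1 + y) x3 = r \<longleftrightarrow>
      y = z \<and> r = norm z" for y r
  proof -
    have d: "dist (x1 + y) x1 = norm y" "dist (x1 + y) x2 = norm (y - u)" "dist (x1 + y) x3 = norm (y - w)"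
      by (simp_all add: dist_norm u_def w_def algebra_simps)
    \<comment> \<open>Having equal distance from 0 and from \<open>v\<close> is a linear condition,
      because the quadratic terms cancel.\<close>
    have n: "norm (y - v) = norm y \<longleftrightarrow> 2 * (v $ 1 * y $ 1 + v $ 2 * y $ 2) = (norm v)\<^sup>2" for v
    proof -
      have "norm (y - v) = norm y \<longleftrightarrow> (norm (y - v))\<^sup>2 = (norm y)\<^sup>2" by simp
      then show ?thesis unfolding norm_sq_2 by (auto simp: power2_eq_square algebra_simps)
    qed
    have z12: "z $ 1 = (w $ 2 * U - u $ 2 * W) / (2 * D)" "z $ 2 = (u $ 1 * W - w $ 1 * U) / (2 * D)"
      by (simp_all add: z_def)
    have zu: "2 * (u $ 1 * z $ 1 + u $ 2 * z $ 2) = U" "2 * (w $ 1 * z $ 1 + w $ 2 * z $ 2) = W"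
    proof -
      have "2 * (u $ 1 * z $ 1 + u $ 2 * z $ 2) = (u $ 1 * (w $ 2 * U - u $ 2 * W) + u $ 2 * (u $ 1 * W - w $ 1 * U)) / D"
        unfolding z12 using D by (simp add: field_simps)
      also have "u $ 1 * (w $ 2 * U - u $ 2 * W) + u $ 2 * (u $ 1 * W - w $ 1 * U) = U * D"
        by (simp add: D_def cross2_def algebra_simps)
      finally show "2 * (u $ 1 * z $ 1 + u $ 2 * z $ 2) = U" using D by simp
      have "2 * (w $ 1 * z $ 1 + w $ 2 * z $ 2) = (w $ 1 * (w $ 2 * U - u $ 2 * W) + w $ 2 * (u $ 1 * W - w $ 1 * U)) / D"
        unfolding z12 using D by (simp add: field_simps)
      also have "w $ 1 * (w $ 2 * U - u $ 2 * W) + w $ 2 * (u $ 1 * W - w $ 1 * U) = W * D"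
        by (simp add: D_def cross2_def algebra_simps)
      finally show "2 * (w $ 1 * z $ 1 + w $ 2 * z $ 2) = W" using D by simp
    qed
    have uniq: "y = z" if 1: "2 * (u $ 1 * y $ 1 + u $ 2 * y $ 2) = U" and 2: "2 * (w $ 1 * y $ 1 + w $ 2 * y $ 2) = W"
    proof -
      have "2 * D * y $ 1 = w $ 2 * U - u $ 2 * W" "2 * D * y $ 2 = u $ 1 * W - w $ 1 * U"
        unfolding 1[symmetric] 2[symmetric] D_def cross2_def by (simp_all add: algebra_simps)
      then have "y $ 1 = z $ 1" "y $ 2 = z $ 2" unfolding z12 using D by (simp_all add: field_simps)
      then show ?thesis by (simp add: vec_eq_iff forall_2)
    qed
    show ?thesis
    proof
      assume "dist (x1 + y) x1 = r \<and> dist (x1 + y) x2 = r \<and> dist (x1 + y) x3 = r"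
      then have "r = norm y" "norm (y - u) = norm y" "norm (y - w) = norm y" by (auto simp: d)
      then show "y = z \<and> r = norm z" using n[of u] n[of w] uniq by (auto simp: U_def W_def)
    next
      assume "y = z \<and> r = norm z"
      moreover then have "norm (y - u) = norm y" "norm (y - w) = norm y"
        using n[of u] n[of w] zu by (auto simp: U_def W_def)
      ultimately show "dist (x1 + y) x1 = r \<and> dist (x1 + y) x2 = r \<and> dist (x1 + y) x3 = r"
        unfolding d by simp
    qed
  qed
  have ex: "(\<exists>c. dist c x1 = r \<and> dist c x2 = r \<and> dist c x3 = r) \<longleftrightarrow> r = norm z" for r
  proof
    assume "\<exists>c. dist c x1 = r \<and> dist c x2 = r \<and> dist c x3 = r"
    then obtain c where "dist c x1 = r \<and> dist c x2 = r \<and> dist c x3 = r" by blast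
    then show "r = norm z" using eqv[of "c - x1" r] by simp
  next
    assume "r = norm z"
    then show "\<exists>c. dist c x1 = r \<and> dist c x2 = r \<and> dist c x3 = r" using eqv[of z r] by blast
  qed
  have R: "circumradius x1 x2 x3 = norm z"
    unfolding circumradius_def ex by simp
  have wu: "norm (u - w) = dist x2 x3" by (simp add: dist_norm u_def w_def)
  have "(2 * norm z * \<bar>D\<bar>)\<^sup>2 = (norm u * norm w * norm (u - w))\<^sup>2"
  proof -
    have "(2 * norm z * \<bar>D\<bar>)\<^sup>2 = (2 * D * z $ 1)\<^sup>2 + (2 * D * z $ 2)\<^sup>2"
      by (simp add: power_mult_distrib norm_sq_2 algebra_simps)
    also have "2 * D * z $ 1 = w $ 2 * U - u $ 2 * W" using D by (simp add: z_def)
    also have "2 * D * z $ 2 = u $ 1 * W - w $ 1 * U" using D by (simp add: z_def)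
    also have "(w $ 2 * U - u $ 2 * W)\<^sup>2 + (u $ 1 * W - w $ 1 * U)\<^sup>2
      = U\<^sup>2 * ((w $ 1)\<^sup>2 + (w $ 2)\<^sup>2) - 2 * U * W * (u $ 1 * w $ 1 + u $ 2 * w $ 2) + W\<^sup>2 * ((u $ 1)\<^sup>2 + (u $ 2)\<^sup>2)"
      by (simp add: power2_eq_square algebra_simps)
    also have "(w $ 1)\<^sup>2 + (w $ 2)\<^sup>2 = W" by (simp add: W_def norm_sq_2)
    also have "(u $ 1)\<^sup>2 + (u $ 2)\<^sup>2 = U" by (simp add: U_def norm_sq_2)
    also have "U\<^sup>2 * W - 2 * U * W * (u $ 1 * w $ 1 + u $ 2 * w $ 2) + W\<^sup>2 * U
      = U * W * (U - 2 * (u $ 1 * w $ 1 + u $ 2 * w $ 2) + W)"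
      by (simp add: power2_eq_square algebra_simps)
    also have "U - 2 * (u $ 1 * w $ 1 + u $ 2 * w $ 2) + W = (norm (u - w))\<^sup>2"
      unfolding U_def W_def norm_sq_2 by (simp add: power2_eq_square algebra_simps)
    finally show ?thesis by (simp add: U_def W_def power_mult_distrib)
  qed
  then have key: "2 * norm z * \<bar>D\<bar> = norm u * norm w * norm (u - w)"
    by (subst (asm) power2_eq_iff_nonneg) auto
  have "u \<noteq> 0" "w \<noteq> 0" "u \<noteq> w" using D by (auto simp: D_def cross2_def)
  then have "norm u * norm w * norm (u - w) > 0" by simp
  then have "norm z > 0" using key D by (smt (verit) mult_not_zero norm_ge_zero)
  then show "0 < circumradius x1 x2 x3" by (simp add: R)
  show "2 * circumradius x1 x2 x3 * \<bar>cross2 (x2 - x1) (x3 - x1)\<bar> = norm (x2 - x1) * norm (x3 - x1) * dist x2 x3"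
    using key unfolding R wu by (simp add: D_def u_def w_def)
qed

section \<open>Affine maps from the reference triangle and change of variables\<close>

definition tri_map :: "real^2 \<Rightarrow> real^2 \<Rightarrow> real^2 \<Rightarrow> real \<times> real \<Rightarrow> real^2" where
  "tri_map x u w z = x + fst z *\<^sub>R u + snd z *\<^sub>R w"

lemma tri_map_continuous: "continuous_on S (tri_map x u w)"
  unfolding tri_map_def by (intro continuous_intros)

lemma tri_map_measurable [measurable]: "tri_map x u w \<in> borel_measurable borel"
  by (intro borel_measurable_continuous_onI tri_map_continuous)

lemma tri_map_image: "tri_map x1 (x2 - x1) (x3 - x1) ` ref_triangle = closed_triangle x1 x2 x3"
  unfolding closed_triangle_def convex_hull_3_alt tri_map_def ref_triangle_def by force

lemma compact_ref_triangle: "compact ref_triangle"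
proof -
  have "closed ({x::real\<times>real. 0 \<le> fst x} \<inter> {x. 0 \<le> snd x} \<inter> {x. fst x + snd x \<le> 1})"
    by (intro closed_Int closed_Collect_le continuous_intros)
  moreover have "ref_triangle = {x::real\<times>real. 0 \<le> fst x} \<inter> {x. 0 \<le> snd x} \<inter> {x. fst x + snd x \<le> 1}"
    by (auto simp: ref_triangle_def)
  moreover have "ref_triangle \<subseteq> cbox (0, 0) (1, 1)" by (auto simp: ref_triangle_def cbox_Pair_eq)
  ultimately show ?thesis using bounded_subset[OF bounded_cbox] by (simp add: compact_eq_bounded_closed)
qed

text \<open>Links the two models of the plane: the Poincare estimates use pairs, while the
  determinant formula for linear images uses vectors.\<close>

lemma lborel_coordinates:
  "distr lborel borel (\<lambda>x::real^2. (x $ 1, x $ 2)) = (lborel :: (real \<times> real) measure)"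
proof (rule lborel_eqI[symmetric])
  have c: "continuous_on UNIV (\<lambda>x::real^2. (x $ 1, x $ 2))" by (intro continuous_intros)
  have m [measurable]: "(\<lambda>x::real^2. (x $ 1, x $ 2)) \<in> borel_measurable borel"
    by (rule borel_measurable_continuous_onI[OF c])
  fix l u :: "real \<times> real" assume lu: "\<And>b. b \<in> Basis \<Longrightarrow> l \<bullet> b \<le> u \<bullet> b"
  obtain l1 l2 u1 u2 where e: "l = (l1, l2)" "u = (u1, u2)" by fastforce
  have l12: "l1 \<le> u1" "l2 \<le> u2" using lu[of "(1, 0)"] lu[of "(0, 1)"] by (auto simp: e Basis_prod_def)
  have bp: "box (l1, l2) (u1, u2) = {l1<..<u1} \<times> {l2<..<u2}" by (auto simp: mem_box Basis_prod_def)
  have b: "(\<lambda>x::real^2. (x $ 1, x $ 2)) -` box l u = box (vector [l1, l2]) (vector [u1, u2])"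
    by (auto simp: e bp mem_box_cart forall_2)
  have lu': "\<forall>i. (vector [l1, l2] :: real^2) $ i \<le> (vector [u1, u2] :: real^2) $ i" using l12 by (simp add: forall_2)
  have "emeasure (distr lborel borel (\<lambda>x::real^2. (x $ 1, x $ 2))) (box l u) = emeasure lborel (box (vector [l1, l2] :: real^2) (vector [u1, u2]))"
    by (subst emeasure_distr) (auto simp: b)
  also have "\<dots> = ennreal (\<Prod>b\<in>Basis. ((vector [u1, u2] :: real^2) - vector [l1, l2]) \<bullet> b)"
    using lu' by (intro emeasure_lborel_box) (auto simp: Basis_vec_def inner_axis)
  also have "(\<Prod>b\<in>Basis. ((vector [u1, u2] :: real^2) - vector [l1, l2]) \<bullet> b) = (u1 - l1) * (u2 - l2)"
  proof -
    have B: "(Basis :: (real^2) set) = {axis 1 1, axis 2 1}"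
      by (simp add: Basis_vec_def UNIV_2 insert_commute)
    have "axis 1 (1::real) \<noteq> (axis 2 1 :: real^2)" by (simp add: axis_eq_axis)
    then show ?thesis unfolding B by (simp add: inner_axis)
  qed
  also have "(u1 - l1) * (u2 - l2) = (\<Prod>b\<in>Basis. (u - l) \<bullet> b)"
    by (simp add: e Basis_prod_def prod.union_disjoint prod.reindex)
  finally show "emeasure (distr lborel borel (\<lambda>x::real^2. (x $ 1, x $ 2))) (box l u) = ennreal (\<Prod>b\<in>Basis. (u - l) \<bullet> b)" .
qed simp

text \<open>The factor \<open>c\<close> stays implicit: in the interpolation estimate it multiplies
  both sides, and in the embedding it enters a constant that may depend on the triangle.\<close>

lemma lborel_linear_image:
  assumes D: "cross2 u w \<noteq> 0"
  shows "\<exists>c>0. lborel = density (distr lborel borel (\<lambda>x::real^2. (x $ 1) *\<^sub>R u + (x $ 2) *\<^sub>R (w::real^2))) (\<lambda>_. ennreal c)"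
proof -
  let ?A = "\<lambda>x::real^2. (x $ 1) *\<^sub>R u + (x $ 2) *\<^sub>R w"
  define B :: "real^2 \<Rightarrow> real^2" where "B x = vector [cross2 x w / cross2 u w, cross2 u x / cross2 u w]" for x
  have AB: "?A (B x) = x" for x using cross2_expand[OF D, of x] by (simp add: B_def)
  have BA: "B (?A x) = x" for x
  proof -
    have "cross2 (?A x) w = x $ 1 * cross2 u w" "cross2 u (?A x) = x $ 2 * cross2 u w"
      by (simp_all add: cross2_def algebra_simps)
    then show ?thesis using D by (simp add: B_def vec_eq_iff forall_2)
  qed
  have lB: "linear B"
    by (rule linearI) (auto simp: B_def vec_eq_iff forall_2 cross2_def algebra_simps add_divide_distrib diff_divide_distrib)
  have Am [measurable]: "?A \<in> borel_measurable borel"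
    by (intro borel_measurable_continuous_onI continuous_intros)
  define d where "d = \<bar>det (matrix B)\<bar>"
  have vi: "?A -` S = B ` S" for S using AB BA by (auto simp: image_iff) metis
  have em: "emeasure (distr lborel borel ?A) (box a b) = ennreal d * emeasure lborel (box a b)" for a b
  proof -
    have lm: "box a b \<in> lmeasurable" by simp
    have "emeasure (distr lborel borel ?A) (box a b) = emeasure lborel (B ` box a b)"
      by (subst emeasure_distr) (auto simp: vi)
    also have "\<dots> = emeasure lebesgue (B ` box a b)"
    proof -
      have "B ` box a b = ?A -` box a b \<inter> space borel" by (simp add: vi)
      also have "\<dots> \<in> sets borel" by (rule measurable_sets[OF Am]) simp
      finally show ?thesis by simp
    qed
    also have "\<dots> = ennreal (measure lebesgue (B ` box a b))"
      using measurable_linear_image[OF lB lm] by (simp add: emeasure_eq_measure2)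
    also have "measure lebesgue (B ` box a b) = d * measure lebesgue (box a b)"
      unfolding d_def by (rule measure_linear_image[OF lB lm])
    also have "ennreal (d * measure lebesgue (box a b)) = ennreal d * emeasure lborel (box a b)"
    proof -
      have "ennreal (measure lebesgue (box a b)) = emeasure lebesgue (box a b)"
        using lm by (simp add: emeasure_eq_measure2)
      then show ?thesis by (simp add: ennreal_mult d_def)
    qed
    finally show ?thesis .
  qed
  have d0: "d \<noteq> 0"
  proof
    assume "d = 0"
    then have "det (matrix B) = 0" by (simp add: d_def)
    moreover have "matrix ?A ** matrix B = mat 1"
    proof -
      have "linear ?A" by (rule linearI) (auto simp: algebra_simps)
      then have "matrix ?A ** matrix B = matrix (?A \<circ> B)" using lB by (simp add: matrix_compose)
      also have "?A \<circ> B = id" using AB by auto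
      also have "matrix (id :: real^2 \<Rightarrow> real^2) = mat 1" by (rule matrix_id_mat_1)
      finally show ?thesis .
    qed
    ultimately show False
      using det_mul[of "matrix ?A" "matrix B"] by simp
  qed
  then have d: "d > 0" by (simp add: d_def)
  have "lborel = density (distr lborel borel ?A) (\<lambda>_. ennreal (1 / d))"
  proof (rule lborel_eqI)
    fix l u :: "real^2" assume lu: "\<And>b. b \<in> Basis \<Longrightarrow> l \<bullet> b \<le> u \<bullet> b"
    have "emeasure (density (distr lborel borel ?A) (\<lambda>_. ennreal (1 / d))) (box l u)
      = ennreal (1 / d) * emeasure (distr lborel borel ?A) (box l u)"
      by (subst emeasure_density_const) auto
    also have "\<dots> = (ennreal (1 / d) * ennreal d) * emeasure lborel (box l u)"
      by (simp only: em mult.assoc)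
    also have "ennreal (1 / d) * ennreal d = 1"
      using d by (simp add: ennreal_mult[symmetric])
    finally show "emeasure (density (distr lborel borel ?A) (\<lambda>_. ennreal (1 / d))) (box l u) = ennreal (\<Prod>b\<in>Basis. (u - l) \<bullet> b)"
      using lu by simp
  qed simp
  then show ?thesis using d by (intro exI[of _ "1 / d"]) simp
qed

text \<open>The factor is chosen before the base point \<open>x\<close>. The embedding relies on
  this, since it uses translates of one small triangle.\<close>

lemma tri_map_change_of_variables:
  assumes D: "cross2 u w \<noteq> 0"
  shows "\<exists>c>0. \<forall>x. \<forall>\<phi>\<in>borel_measurable borel.
    (\<integral>\<^sup>+y. \<phi> y * indicator (tri_map x u w ` ref_triangle) y \<partial>lborel) = ennreal c * tri_int (\<lambda>z. \<phi> (tri_map x u w z))"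
proof -
  let ?A = "\<lambda>x::real^2. (x $ 1) *\<^sub>R u + (x $ 2) *\<^sub>R w"
  obtain c where c: "c > 0" "lborel = density (distr lborel borel ?A) (\<lambda>_. ennreal c)"
    using lborel_linear_image[OF D] by blast
  have Am [measurable]: "?A \<in> borel_measurable borel"
    by (intro borel_measurable_continuous_onI continuous_intros)
  have "continuous_on UNIV (\<lambda>x::real^2. (x $ 1, x $ 2))" by (intro continuous_intros)
  then have m [measurable]: "(\<lambda>x::real^2. (x $ 1, x $ 2)) \<in> borel_measurable borel"
    by (rule borel_measurable_continuous_onI)
  show ?thesis
  proof (intro exI[of _ c] conjI allI ballI)
    fix x and \<phi> :: "real^2 \<Rightarrow> ennreal" assume [measurable]: "\<phi> \<in> borel_measurable borel"
    have inj: "tri_map x u w z = tri_map x u w z' \<longleftrightarrow> z = z'" for z z'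
    proof
      assume "tri_map x u w z = tri_map x u w z'"
      then have e: "fst z *\<^sub>R u + snd z *\<^sub>R w = fst z' *\<^sub>R u + snd z' *\<^sub>R w" by (simp add: tri_map_def)
      have "fst z * cross2 u w = cross2 (fst z *\<^sub>R u + snd z *\<^sub>R w) w" "snd z * cross2 u w = cross2 u (fst z *\<^sub>R u + snd z *\<^sub>R w)"
        "fst z' * cross2 u w = cross2 (fst z' *\<^sub>R u + snd z' *\<^sub>R w) w" "snd z' * cross2 u w = cross2 u (fst z' *\<^sub>R u + snd z' *\<^sub>R w)"
        by (simp_all add: cross2_def algebra_simps)
      then have "fst z * cross2 u w = fst z' * cross2 u w" "snd z * cross2 u w = snd z' * cross2 u w" using e by simp_all
      then show "z = z'" using D by (simp add: prod_eq_iff)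
    qed simp
    have "compact (tri_map x u w ` ref_triangle)"
      by (intro compact_continuous_image tri_map_continuous compact_ref_triangle)
    then have [measurable]: "tri_map x u w ` ref_triangle \<in> sets borel" by (simp add: compact_imp_closed)
    let ?f = "\<lambda>y. \<phi> y * indicator (tri_map x u w ` ref_triangle) y"
    have "(\<integral>\<^sup>+y. ?f y \<partial>lborel) = (\<integral>\<^sup>+y. ?f (x + 1 *\<^sub>R y) \<partial>lborel)"
      by (subst nn_integral_affine[where c=1 and b=x]) auto
    also have "\<dots> = ennreal c * (\<integral>\<^sup>+y. ?f (x + ?A y) \<partial>lborel)"
      by (subst c(2)) (simp add: nn_integral_density nn_integral_distr nn_integral_cmult)
    also have "(\<integral>\<^sup>+y. ?f (x + ?A y) \<partial>lborel) = (\<integral>\<^sup>+(y::real^2). ?f (tri_map x u w (y $ 1, y $ 2)) \<partial>lborel)"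
      by (simp add: tri_map_def add.assoc)
    also have "\<dots> = (\<integral>\<^sup>+z. ?f (tri_map x u w z) \<partial>lborel)"
      by (subst lborel_coordinates[symmetric]) (simp add: nn_integral_distr)
    also have "\<dots> = (\<integral>\<^sup>+z. \<phi> (tri_map x u w z) * indicator ref_triangle z \<partial>lborel)"
      by (intro nn_integral_cong) (auto simp: inj image_iff split: split_indicator)
    also have "\<dots> = tri_int (\<lambda>z. \<phi> (tri_map x u w z))"
      by (intro iter_integral_eq_nn_integral[symmetric]) auto
    finally show "(\<integral>\<^sup>+y. ?f y \<partial>lborel) = ennreal c * tri_int (\<lambda>z. \<phi> (tri_map x u w z))" .
  qed (rule c)
qed

section \<open>Polynomials and Lagrange interpolation\<close>

lemma finite_mi_order_le [simp]: "finite {\<delta>. mi_order \<delta> \<le> k}"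
  by (rule finite_subset[of _ "{..k} \<times> {..k}"]) (auto simp: mi_order_def)

lemma poly_spaceI: "(\<And>x. q x = (\<Sum>\<delta> | mi_order \<delta> \<le> k. c \<delta> * (x $ 1) ^ fst \<delta> * (x $ 2) ^ snd \<delta>)) \<Longrightarrow> q \<in> poly_space k"
  unfolding poly_space_def by blast

lemma poly_space_add: "f \<in> poly_space k \<Longrightarrow> g \<in> poly_space k \<Longrightarrow> (\<lambda>x. f x + g x) \<in> poly_space k"
proof -
  assume "f \<in> poly_space k" "g \<in> poly_space k"
  then obtain c d where "\<And>x. f x = (\<Sum>\<delta> | mi_order \<delta> \<le> k. c \<delta> * (x $ 1) ^ fst \<delta> * (x $ 2) ^ snd \<delta>)"
    "\<And>x. g x = (\<Sum>\<delta> | mi_order \<delta> \<le> k. d \<delta> * (x $ 1) ^ fst \<delta> * (x $ 2) ^ snd \<delta>)"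
    unfolding poly_space_def by blast
  then show ?thesis
    by (intro poly_spaceI[where c="\<lambda>\<delta>. c \<delta> + d \<delta>"]) (simp add: sum.distrib[symmetric] distrib_right)
qed

lemma poly_space_cmult: "f \<in> poly_space k \<Longrightarrow> (\<lambda>x. a * f x) \<in> poly_space k"
proof -
  assume "f \<in> poly_space k"
  then obtain c where "\<And>x. f x = (\<Sum>\<delta> | mi_order \<delta> \<le> k. c \<delta> * (x $ 1) ^ fst \<delta> * (x $ 2) ^ snd \<delta>)"
    unfolding poly_space_def by blast
  then show ?thesis
    by (intro poly_spaceI[where c="\<lambda>\<delta>. a * c \<delta>"]) (simp add: sum_distrib_left mult.assoc)
qed

lemma poly_space_zero: "(\<lambda>x. 0) \<in> poly_space k"
  by (rule poly_spaceI[where c="\<lambda>_. 0"]) simp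

lemma poly_space_sum: "(\<And>i. i \<in> I \<Longrightarrow> f i \<in> poly_space k) \<Longrightarrow> (\<lambda>x. \<Sum>i\<in>I. f i x) \<in> poly_space k"
  by (induction I rule: infinite_finite_induct) (auto simp: poly_space_zero poly_space_add)

lemma poly_space_monomial:
  assumes "a + b \<le> k"
  shows "(\<lambda>x. (x $ 1) ^ a * (x $ 2) ^ b) \<in> poly_space k"
proof (rule poly_spaceI[where c="\<lambda>\<delta>. if \<delta> = (a, b) then 1 else 0"])
  fix x :: "real^2"
  have "(\<Sum>\<delta> | mi_order \<delta> \<le> k. (if \<delta> = (a, b) then 1 else 0) * (x $ 1) ^ fst \<delta> * (x $ 2) ^ snd \<delta>)
    = (\<Sum>\<delta> | mi_order \<delta> \<le> k. if \<delta> = (a, b) then (x $ 1) ^ a * (x $ 2) ^ b else 0)"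
    by (intro sum.cong) auto
  also have "\<dots> = (x $ 1) ^ a * (x $ 2) ^ b" using assms by (subst sum.delta[OF finite_mi_order_le]) (simp add: mi_order_def)
  finally show "(x $ 1) ^ a * (x $ 2) ^ b = (\<Sum>\<delta> | mi_order \<delta> \<le> k. (if \<delta> = (a, b) then 1 else 0) * (x $ 1) ^ fst \<delta> * (x $ 2) ^ snd \<delta>)"
    by simp
qed

lemma poly_space_expand:
  assumes "f \<in> poly_space k"
  obtains c where "f = (\<lambda>x. \<Sum>\<delta> | mi_order \<delta> \<le> k. c \<delta> * ((x $ 1) ^ fst \<delta> * (x $ 2) ^ snd \<delta>))"
  using assms unfolding poly_space_def by (auto simp: mult.assoc fun_eq_iff)

lemma poly_space_affine_mult:
  assumes "f \<in> poly_space k"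
  shows "(\<lambda>x. (a + b * x $ 1 + c * x $ 2) * f x) \<in> poly_space (Suc k)"
proof -
  obtain d where f: "f = (\<lambda>x. \<Sum>\<delta> | mi_order \<delta> \<le> k. d \<delta> * ((x $ 1) ^ fst \<delta> * (x $ 2) ^ snd \<delta>))"
    using poly_space_expand[OF assms] .
  have "(\<lambda>x. \<Sum>\<delta> | mi_order \<delta> \<le> k. (a * d \<delta>) * ((x $ 1) ^ fst \<delta> * (x $ 2) ^ snd \<delta>)
    + (b * d \<delta>) * ((x $ 1) ^ Suc (fst \<delta>) * (x $ 2) ^ snd \<delta>)
    + (c * d \<delta>) * ((x $ 1) ^ fst \<delta> * (x $ 2) ^ Suc (snd \<delta>))) \<in> poly_space (Suc k)"
    by (intro poly_space_sum poly_space_add poly_space_cmult poly_space_monomial) (auto simp: mi_order_def)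
  also have "(\<lambda>x. \<Sum>\<delta> | mi_order \<delta> \<le> k. (a * d \<delta>) * ((x $ 1) ^ fst \<delta> * (x $ 2) ^ snd \<delta>)
    + (b * d \<delta>) * ((x $ 1) ^ Suc (fst \<delta>) * (x $ 2) ^ snd \<delta>)
    + (c * d \<delta>) * ((x $ 1) ^ fst \<delta> * (x $ 2) ^ Suc (snd \<delta>))) = (\<lambda>x. (a + b * x $ 1 + c * x $ 2) * f x)"
    unfolding f by (auto simp: fun_eq_iff sum_distrib_left intro!: sum.cong) (simp add: algebra_simps)
  finally show ?thesis .
qed

lemma smooth_monomial: "smooth (\<lambda>x. (x $ 1) ^ a * (x $ 2) ^ b)"
  by (intro smooth_mult smooth_power smooth_component)

lemma poly_space_smooth:
  assumes "f \<in> poly_space k"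
  shows "smooth f"
proof -
  obtain c where f: "f = (\<lambda>x. \<Sum>\<delta> | mi_order \<delta> \<le> k. c \<delta> * ((x $ 1) ^ fst \<delta> * (x $ 2) ^ snd \<delta>))"
    using poly_space_expand[OF assms] .
  show ?thesis unfolding f by (intro smooth_sum smooth_cmult smooth_monomial)
qed

lemma dird_monomial:
  "dird d (\<lambda>x. (x $ 1) ^ a * (x $ 2) ^ b) =
    (\<lambda>x. (real a * d $ 1) * ((x $ 1) ^ (a - 1) * (x $ 2) ^ b) + (real b * d $ 2) * ((x $ 1) ^ a * (x $ 2) ^ (b - 1)))"
proof
  fix x :: "real^2"
  have "((\<lambda>x::real^2. (x $ 1) ^ a * (x $ 2) ^ b) has_derivative
    (\<lambda>h. (real a * h $ 1) * ((x $ 1) ^ (a - 1) * (x $ 2) ^ b) + (real b * h $ 2) * ((x $ 1) ^ a * (x $ 2) ^ (b - 1)))) (at x)"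
    by (auto intro!: derivative_eq_intros bounded_linear_imp_has_derivative bounded_linear_vec_nth simp: algebra_simps)
  then show "dird d (\<lambda>x. (x $ 1) ^ a * (x $ 2) ^ b) x =
    (real a * d $ 1) * ((x $ 1) ^ (a - 1) * (x $ 2) ^ b) + (real b * d $ 2) * ((x $ 1) ^ a * (x $ 2) ^ (b - 1))"
    by (rule dird_eq)
qed

lemma poly_space_dird:
  assumes "f \<in> poly_space (Suc k)"
  shows "dird d f \<in> poly_space k"
proof -
  obtain c where f: "f = (\<lambda>x. \<Sum>\<delta> | mi_order \<delta> \<le> Suc k. c \<delta> * ((x $ 1) ^ fst \<delta> * (x $ 2) ^ snd \<delta>))"
    using poly_space_expand[OF assms] .
  have "dird d f = (\<lambda>x. \<Sum>\<delta> | mi_order \<delta> \<le> Suc k. c \<delta> * dird d (\<lambda>x. (x $ 1) ^ fst \<delta> * (x $ 2) ^ snd \<delta>) x)"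
    unfolding f by (subst dird_smooth_sum) (auto intro!: smooth_cmult smooth_monomial simp: dird_smooth_cmult[OF smooth_monomial])
  also have "\<dots> \<in> poly_space k"
  proof (intro poly_space_sum poly_space_cmult)
    fix \<delta> assume "\<delta> \<in> {\<delta>. mi_order \<delta> \<le> Suc k}"
    then have le: "fst \<delta> + snd \<delta> \<le> Suc k" by (simp add: mi_order_def)
    have "(\<lambda>x. (real (fst \<delta>) * d $ 1) * ((x $ 1) ^ (fst \<delta> - 1) * (x $ 2) ^ snd \<delta>)) \<in> poly_space k"
      using le by (cases "fst \<delta>") (auto intro!: poly_space_cmult poly_space_monomial simp: poly_space_zero)
    moreover have "(\<lambda>x. (real (snd \<delta>) * d $ 2) * ((x $ 1) ^ fst \<delta> * (x $ 2) ^ (snd \<delta> - 1))) \<in> poly_space k"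
      using le by (cases "snd \<delta>") (auto intro!: poly_space_cmult poly_space_monomial simp: poly_space_zero)
    ultimately show "dird d (\<lambda>x. (x $ 1) ^ fst \<delta> * (x $ 2) ^ snd \<delta>) \<in> poly_space k"
      unfolding dird_monomial by (rule poly_space_add)
  qed
  finally show ?thesis .
qed

lemma poly_space_dird_0: "f \<in> poly_space 0 \<Longrightarrow> dird d f = (\<lambda>x. 0)"
proof -
  assume f: "f \<in> poly_space 0"
  have "{\<delta>. mi_order \<delta> \<le> 0} = {(0, 0)}" by (auto simp: mi_order_def)
  then obtain c where "f = (\<lambda>x. c)" using f by (auto simp: poly_space_def fun_eq_iff)
  then show ?thesis by simp
qed

lemma poly_space_foldr_dird: "f \<in> poly_space (length ds + k) \<Longrightarrow> foldr dird ds f \<in> poly_space k"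
proof (induction ds arbitrary: k)
  case (Cons d ds)
  then have "foldr dird ds f \<in> poly_space (Suc k)" by simp
  then show ?case by (simp add: poly_space_dird)
qed simp

lemma foldr_dird_replicate: "foldr dird (replicate a u @ replicate b w) f = (dird u ^^ a) ((dird w ^^ b) f)"
proof -
  have "foldr dird (replicate n v) g = (dird v ^^ n) g" for n v g by (induction n) auto
  then show ?thesis by simp
qed

lemma poly_space_dird_vanish:
  assumes f: "f \<in> poly_space k" and ab: "a + b = Suc k"
  shows "(dird u ^^ a) ((dird w ^^ b) f) = (\<lambda>x. 0)"
proof -
  obtain d ds where ds: "replicate a u @ replicate b w = d # ds"
    using ab by (cases "replicate a u @ replicate b w") auto
  have "length (replicate a u @ replicate b w) = Suc k" using ab by simp
  then have "length ds = k" unfolding ds by simp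
  then have "foldr dird ds f \<in> poly_space 0" using f by (intro poly_space_foldr_dird) simp
  then have "foldr dird (d # ds) f = (\<lambda>x. 0)" by (simp add: poly_space_dird_0)
  then show ?thesis unfolding ds[symmetric] foldr_dird_replicate .
qed

text \<open>The chain rule for the affine map. Commuting \<open>w\<close> past the derivatives along
  \<open>u\<close> is what closes the family under both partial derivatives.\<close>

lemma dird_family_deriv:
  assumes f: "smooth f"
  shows "((\<lambda>z. (dird u ^^ a) ((dird w ^^ b) f) (tri_map x u w z)) has_derivative
    (\<lambda>h. fst h * (dird u ^^ Suc a) ((dird w ^^ b) f) (tri_map x u w z) +
         snd h * (dird u ^^ a) ((dird w ^^ Suc b) f) (tri_map x u w z))) (at z)"
proof -
  let ?g = "(dird u ^^ a) ((dird w ^^ b) f)"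
  have g: "smooth ?g" using f by auto
  have "(tri_map x u w has_derivative (\<lambda>h. fst h *\<^sub>R u + snd h *\<^sub>R w)) (at z)"
    unfolding tri_map_def[abs_def] by (auto intro!: derivative_eq_intros)
  from has_derivative_compose[OF this smooth_has_derivative[OF g]]
  have "((\<lambda>z. ?g (tri_map x u w z)) has_derivative (\<lambda>h. dird (fst h *\<^sub>R u + snd h *\<^sub>R w) ?g (tri_map x u w z))) (at z)" .
  moreover have "dird w ?g = (dird u ^^ a) ((dird w ^^ Suc b) f)"
    using f by (simp add: dird_funpow_commute smooth_dird_funpow)
  ultimately show ?thesis by (simp add: dird_linear[OF g])
qed

lemma tri_map_bary: "tri_map x1 (x2 - x1) (x3 - x1) (s, r) = (1 - s - r) *\<^sub>R x1 + s *\<^sub>R x2 + r *\<^sub>R x3"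
  by (simp add: tri_map_def algebra_simps)

text \<open>The lattice point with numerators \<open>i\<close> and \<open>j\<close> is the Lagrange
  node whose first barycentric numerator is \<open>k - i - j\<close>.\<close>

lemma deriv_family_dird:
  assumes f: "smooth f" and k: "1 \<le> k"
    and z: "\<And>y. y \<in> lagrange_nodes k x1 x2 x3 \<Longrightarrow> f y = 0"
  shows "deriv_family (\<lambda>a b z. (dird (x2 - x1) ^^ a) ((dird (x3 - x1) ^^ b) f) (tri_map x1 (x2 - x1) (x3 - x1) z)) k"
proof
  show "1 \<le> k" by (rule k)
  fix i j assume ij: "i + j \<le> k"
  have "tri_map x1 (x2 - x1) (x3 - x1) (real i / real k, real j / real k)
    = (real (k - i - j) / real k) *\<^sub>R x1 + (real i / real k) *\<^sub>R x2 + (real j / real k) *\<^sub>R x3"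
  proof -
    have "real (k - i - j) / real k = 1 - real i / real k - real j / real k"
      using ij k by (simp add: field_simps of_nat_diff)
    then show ?thesis by (simp only: tri_map_bary)
  qed
  moreover have "\<dots> \<in> lagrange_nodes k x1 x2 x3"
    unfolding lagrange_nodes_def
    by (rule CollectI, rule exI[of _ "k - i - j"], rule exI[of _ i], rule exI[of _ j]) (use ij in simp)
  ultimately show "(dird (x2 - x1) ^^ 0) ((dird (x3 - x1) ^^ 0) f) (tri_map x1 (x2 - x1) (x3 - x1) (real i / real k, real j / real k)) = 0"
    using z by simp
qed (rule dird_family_deriv[OF f])

text \<open>The argument behind the error estimate also gives unisolvence: the derivatives of order
  k + 1 of a polynomial of degree k vanish, and \<open>zero_of_top_zero\<close> descends from
  there.\<close>

lemma lagrange_unique: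
  assumes nc: "\<not> collinear {x1, x2, x3}" and k: "1 \<le> k" and f: "f \<in> poly_space k"
    and z: "\<And>y. y \<in> lagrange_nodes k x1 x2 x3 \<Longrightarrow> f y = 0"
  shows "f = (\<lambda>x. 0)"
proof
  fix x
  let ?u = "x2 - x1" and ?w = "x3 - x1"
  interpret deriv_family "\<lambda>a b z. (dird ?u ^^ a) ((dird ?w ^^ b) f) (tri_map x1 ?u ?w z)" k
    by (rule deriv_family_dird[OF poly_space_smooth[OF f] k z])
  have "\<exists>y. x = tri_map x1 ?u ?w y"
    using cross2_expand[OF cross2_nonzero[OF nc], of "x - x1"]
    by (intro exI[of _ "(cross2 (x - x1) ?w / cross2 ?u ?w, cross2 ?u (x - x1) / cross2 ?u ?w)"])
       (simp add: tri_map_def algebra_simps)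
  then obtain y where y: "x = tri_map x1 ?u ?w y" by blast
  show "f x = 0"
    using zero_of_top_zero[of 0 0 "Suc k" y] poly_space_dird_vanish[OF f] y by simp
qed

section \<open>Barycentric coordinates and the Lagrange basis\<close>

definition bary :: "real^2 \<Rightarrow> real^2 \<Rightarrow> real^2 \<Rightarrow> nat \<Rightarrow> real^2 \<Rightarrow> real" where
  "bary x1 x2 x3 i x = (let D = cross2 (x2 - x1) (x3 - x1) in
     if i = 0 then cross2 (x2 - x) (x3 - x) / D
     else if i = 1 then cross2 (x - x1) (x3 - x1) / D else cross2 (x2 - x1) (x - x1) / D)"

lemma bary_affine: "\<exists>a b c. \<forall>x. bary x1 x2 x3 i x = a + b * x $ 1 + c * x $ 2"
proof -
  let ?D = "cross2 (x2 - x1) (x3 - x1)"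
  have aff: "\<exists>a b c. \<forall>x. f x / ?D = a + b * x $ 1 + c * x $ 2"
    if "\<And>x. f x = a0 + b0 * x $ 1 + c0 * x $ 2" for f :: "real^2 \<Rightarrow> real" and a0 b0 c0
    using that by (intro exI[of _ "a0 / ?D"] exI[of _ "b0 / ?D"] exI[of _ "c0 / ?D"]) (simp add: add_divide_distrib)
  have "cross2 (x2 - x) (x3 - x) = (x2 $ 1 * x3 $ 2 - x2 $ 2 * x3 $ 1) + (x2 $ 2 - x3 $ 2) * x $ 1 + (x3 $ 1 - x2 $ 1) * x $ 2" for x
    by (simp add: cross2_def algebra_simps)
  note 0 = aff[OF this]
  have "cross2 (x - x1) (x3 - x1) = (x1 $ 2 * (x3 $ 1 - x1 $ 1) - x1 $ 1 * (x3 $ 2 - x1 $ 2)) + (x3 $ 2 - x1 $ 2) * x $ 1 + (x1 $ 1 - x3 $ 1) * x $ 2" for x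
    by (simp add: cross2_def algebra_simps)
  note 1 = aff[OF this]
  have "cross2 (x2 - x1) (x - x1) = (x1 $ 1 * (x2 $ 2 - x1 $ 2) - x1 $ 2 * (x2 $ 1 - x1 $ 1)) + (x1 $ 2 - x2 $ 2) * x $ 1 + (x2 $ 1 - x1 $ 1) * x $ 2" for x
    by (simp add: cross2_def algebra_simps)
  note 2 = aff[OF this]
  show ?thesis using 0 1 2 unfolding bary_def Let_def by (cases "i = 0"; cases "i = 1") auto
qed

lemma bary_eq:
  assumes D: "cross2 (x2 - x1) (x3 - x1) \<noteq> 0" and s: "a + b + c = 1"
  shows "bary x1 x2 x3 0 (a *\<^sub>R x1 + b *\<^sub>R x2 + c *\<^sub>R x3) = a"
    "bary x1 x2 x3 1 (a *\<^sub>R x1 + b *\<^sub>R x2 + c *\<^sub>R x3) = b"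
    "bary x1 x2 x3 2 (a *\<^sub>R x1 + b *\<^sub>R x2 + c *\<^sub>R x3) = c"
proof -
  have a: "a = 1 - b - c" using s by simp
  let ?x = "a *\<^sub>R x1 + b *\<^sub>R x2 + c *\<^sub>R x3" and ?D = "cross2 (x2 - x1) (x3 - x1)"
  have "cross2 (x2 - ?x) (x3 - ?x) = a * ?D" "cross2 (?x - x1) (x3 - x1) = b * ?D" "cross2 (x2 - x1) (?x - x1) = c * ?D"
    unfolding a by (simp_all add: cross2_def algebra_simps)
  then show "bary x1 x2 x3 0 ?x = a" "bary x1 x2 x3 1 ?x = b" "bary x1 x2 x3 2 ?x = c"
    using D by (simp_all add: bary_def)
qed

text \<open>The one-dimensional Lagrange factor of degree \<open>a\<close>: it vanishes at 0, 1/k,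
  ..., (a - 1)/k and is normalized at a/k.\<close>

definition node_factor :: "nat \<Rightarrow> nat \<Rightarrow> real \<Rightarrow> real" where
  "node_factor k a l = (\<Prod>j<a. (real k * l - real j) / (real a - real j))"

lemma node_factor_self: "k \<ge> 1 \<Longrightarrow> node_factor k a (real a / real k) = 1"
  unfolding node_factor_def by (intro prod.neutral) auto

lemma node_factor_zero: "k \<ge> 1 \<Longrightarrow> b < a \<Longrightarrow> node_factor k a (real b / real k) = 0"
  unfolding node_factor_def by (intro prod_zero) auto

lemma poly_space_node_factor:
  assumes "f \<in> poly_space n"
  shows "(\<lambda>x. node_factor k a (bary x1 x2 x3 i x) * f x) \<in> poly_space (a + n)"
proof -
  obtain \<alpha> \<beta> \<gamma> where ab: "\<And>x. bary x1 x2 x3 i x = \<alpha> + \<beta> * x $ 1 + \<gamma> * x $ 2"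
    using bary_affine by metis
  have "(\<lambda>x. (\<Prod>j<m. (real k * bary x1 x2 x3 i x - real j) / (real a - real j)) * f x) \<in> poly_space (m + n)" for m
  proof (induction m)
    case (Suc m)
    have "(\<lambda>x. ((real k * \<alpha> - real m) / (real a - real m) + (real k * \<beta> / (real a - real m)) * x $ 1 + (real k * \<gamma> / (real a - real m)) * x $ 2) *
       ((\<Prod>j<m. (real k * bary x1 x2 x3 i x - real j) / (real a - real j)) * f x)) \<in> poly_space (Suc (m + n))"
      by (rule poly_space_affine_mult[OF Suc])
    moreover have "(real k * \<alpha> - real m) / (real a - real m) + (real k * \<beta> / (real a - real m)) * x $ 1 + (real k * \<gamma> / (real a - real m)) * x $ 2
       = (real k * bary x1 x2 x3 i x - real m) / (real a - real m)" for x :: "real^2"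
      unfolding ab by (simp add: add_divide_distrib[symmetric] algebra_simps)
    ultimately show ?case by (simp add: mult_ac)
  qed (use assms in simp)
  then show ?thesis unfolding node_factor_def .
qed

text \<open>One factor for each barycentric coordinate; the degrees add up to \<open>k\<close>. Two
  different nodes have the same sum of numerators, so at the other node some numerator is smaller
  and its factor vanishes.\<close>

lemma lagrange_basis:
  assumes nc: "\<not> collinear {x1, x2, x3}" and k: "1 \<le> k" and y: "y \<in> lagrange_nodes k x1 x2 x3"
  shows "\<exists>l\<in>poly_space k. l y = 1 \<and> (\<forall>y'\<in>lagrange_nodes k x1 x2 x3. y' \<noteq> y \<longrightarrow> l y' = 0)"
proof -
  have D: "cross2 (x2 - x1) (x3 - x1) \<noteq> 0" by (rule cross2_nonzero[OF nc])
  let ?p = "\<lambda>a1 a2 a3. (real a1 / real k) *\<^sub>R x1 + (real a2 / real k) *\<^sub>R x2 + (real a3 / real k) *\<^sub>R x3"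
  obtain a1 a2 a3 where y_eq: "y = ?p a1 a2 a3" and a: "a1 + a2 + a3 = k"
    using y unfolding lagrange_nodes_def by blast
  have s: "real b1 / real k + real b2 / real k + real b3 / real k = 1" if "b1 + b2 + b3 = k" for b1 b2 b3
  proof -
    have "real b1 + real b2 + real b3 = real k" using that by linarith
    then show ?thesis using k by (simp add: add_divide_distrib[symmetric])
  qed
  define l where "l x = node_factor k a1 (bary x1 x2 x3 0 x) * (node_factor k a2 (bary x1 x2 x3 1 x) * (node_factor k a3 (bary x1 x2 x3 2 x) * 1))" for x
  have "(\<lambda>x. 1) \<in> poly_space 0" using poly_space_monomial[of 0 0 0] by simp
  then have "(\<lambda>x. node_factor k a1 (bary x1 x2 x3 0 x) * (node_factor k a2 (bary x1 x2 x3 1 x) * (node_factor k a3 (bary x1 x2 x3 2 x) * 1))) \<in> poly_space (a1 + (a2 + (a3 + 0)))"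
    by (intro poly_space_node_factor)
  then have "l \<in> poly_space k" using a by (simp add: l_def[abs_def] add.assoc)
  moreover have "l y = 1"
    unfolding l_def y_eq bary_eq[OF D s[OF a]] using k by (simp add: node_factor_self)
  moreover have "l y' = 0" if y': "y' \<in> lagrange_nodes k x1 x2 x3" "y' \<noteq> y" for y'
  proof -
    obtain b1 b2 b3 where b: "y' = ?p b1 b2 b3" "b1 + b2 + b3 = k"
      using y'(1) unfolding lagrange_nodes_def by blast
    have "b1 < a1 \<or> b2 < a2 \<or> b3 < a3"
    proof (rule ccontr)
      assume "\<not> ?thesis"
      then have "b1 = a1" "b2 = a2" "b3 = a3" using a b(2) by auto
      then show False using b(1) y'(2) y_eq by simp
    qed
    then show ?thesis
      unfolding l_def b(1) bary_eq[OF D s[OF b(2)]] using k by (auto simp: node_factor_zero)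
  qed
  ultimately show ?thesis by blast
qed

lemma finite_lagrange_nodes: "finite (lagrange_nodes k x1 x2 x3)"
proof -
  have "lagrange_nodes k x1 x2 x3 \<subseteq> (\<lambda>(a1, a2, a3). (real a1 / real k) *\<^sub>R x1 + (real a2 / real k) *\<^sub>R x2 + (real a3 / real k) *\<^sub>R x3) ` ({..k} \<times> {..k} \<times> {..k})"
  proof
    fix y assume "y \<in> lagrange_nodes k x1 x2 x3"
    then obtain a1 a2 a3 where y: "y = (real a1 / real k) *\<^sub>R x1 + (real a2 / real k) *\<^sub>R x2 + (real a3 / real k) *\<^sub>R x3"
      and a: "a1 + a2 + a3 = k"
      unfolding lagrange_nodes_def by blast
    show "y \<in> (\<lambda>(a1, a2, a3). (real a1 / real k) *\<^sub>R x1 + (real a2 / real k) *\<^sub>R x2 + (real a3 / real k) *\<^sub>R x3) ` ({..k} \<times> {..k} \<times> {..k})"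
      unfolding y by (rule image_eqI[of _ _ "(a1, a2, a3)"]) (use a in auto)
  qed
  then show ?thesis by (rule finite_subset) auto
qed

lemma lagrange_nodes_subset:
  assumes "1 \<le> k"
  shows "lagrange_nodes k x1 x2 x3 \<subseteq> closed_triangle x1 x2 x3"
proof
  fix y assume "y \<in> lagrange_nodes k x1 x2 x3"
  then obtain a b c where y: "y = (real a / real k) *\<^sub>R x1 + (real b / real k) *\<^sub>R x2 + (real c / real k) *\<^sub>R x3" "a + b + c = k"
    unfolding lagrange_nodes_def by blast
  have "real a + real b + real c = real k" using y(2) by linarith
  then have "real a / real k + real b / real k + real c / real k = 1"
    using assms by (simp add: add_divide_distrib[symmetric])
  then show "y \<in> closed_triangle x1 x2 x3"
    unfolding closed_triangle_def convex_hull_3 y(1)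
    by (intro CollectI exI[of _ "real a / real k"] exI[of _ "real b / real k"] exI[of _ "real c / real k"]) auto
qed

text \<open>The basis is chosen independently of \<open>f\<close>. Hence interpolants depend
  linearly on finitely many values, and they converge with all their derivatives when the node
  values converge.\<close>

lemma lagrange_interp_basis:
  assumes nc: "\<not> collinear {x1, x2, x3}" and k: "1 \<le> k"
  shows "\<exists>l. (\<forall>y\<in>lagrange_nodes k x1 x2 x3. l y \<in> poly_space k) \<and>
    (\<forall>f. lagrange_interp k x1 x2 x3 f = (\<lambda>x. \<Sum>y\<in>lagrange_nodes k x1 x2 x3. f y * l y x) \<and>
      (\<forall>y\<in>lagrange_nodes k x1 x2 x3. lagrange_interp k x1 x2 x3 f y = f y))"
proof -
  let ?N = "lagrange_nodes k x1 x2 x3"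
  have "\<forall>y\<in>?N. \<exists>l. l \<in> poly_space k \<and> l y = 1 \<and> (\<forall>y'\<in>?N. y' \<noteq> y \<longrightarrow> l y' = 0)"
    using lagrange_basis[OF nc k] by blast
  from bchoice[OF this] obtain l where
    "\<forall>y\<in>?N. l y \<in> poly_space k \<and> l y y = 1 \<and> (\<forall>y'\<in>?N. y' \<noteq> y \<longrightarrow> l y y' = 0)" ..
  then have l: "\<And>y. y \<in> ?N \<Longrightarrow> l y \<in> poly_space k" "\<And>y. y \<in> ?N \<Longrightarrow> l y y = 1"
    "\<And>y y'. y \<in> ?N \<Longrightarrow> y' \<in> ?N \<Longrightarrow> y' \<noteq> y \<Longrightarrow> l y y' = 0"
    by simp_all
  have "lagrange_interp k x1 x2 x3 f = (\<lambda>x. \<Sum>y\<in>?N. f y * l y x) \<and> (\<forall>y\<in>?N. lagrange_interp k x1 x2 x3 f y = f y)" for f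
  proof -
    let ?q = "\<lambda>x. \<Sum>y\<in>?N. f y * l y x"
    have q: "?q \<in> poly_space k" by (intro poly_space_sum poly_space_cmult l)
    have qy: "?q y' = f y'" if "y' \<in> ?N" for y'
    proof -
      have "?q y' = (\<Sum>y\<in>?N. if y = y' then f y else 0)"
        using l(2,3) that by (intro sum.cong) auto
      then show ?thesis using that finite_lagrange_nodes by simp
    qed
    have "lagrange_interp k x1 x2 x3 f = ?q"
      unfolding lagrange_interp_def
    proof (rule the_equality)
      show "?q \<in> poly_space k \<and> (\<forall>x\<in>?N. ?q x = f x)" using q qy by blast
      fix r assume r: "r \<in> poly_space k \<and> (\<forall>x\<in>?N. r x = f x)"
      have "(\<lambda>x. r x + (-1) * ?q x) \<in> poly_space k"
        by (intro poly_space_add poly_space_cmult q) (use r in blast)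
      then have "(\<lambda>x. r x + (-1) * ?q x) = (\<lambda>x. 0)"
        by (rule lagrange_unique[OF nc k]) (use r qy in simp)
      then show "r = ?q" by (simp add: fun_eq_iff)
    qed
    then show ?thesis using qy by simp
  qed
  then show ?thesis using l(1) by blast
qed

section \<open>The estimate for smooth functions\<close>

lemma qpow_0 [simp]: "qpow q 0 = 0"
  by (simp add: qpow_def)

lemma qpow_sum:
  assumes q: "1 \<le> q" and J: "finite J"
  shows "qpow q (\<Sum>j\<in>J. x j) \<le> qpow q (real (card J)) * (\<Sum>j\<in>J. qpow q (x j))"
proof (cases "J = {}")
  case False
  define m where "m = Max ((\<lambda>j. \<bar>x j\<bar>) ` J)"
  have "m \<in> (\<lambda>j. \<bar>x j\<bar>) ` J" unfolding m_def using J False by (intro Max_in) auto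
  then obtain i where i: "i \<in> J" "m = \<bar>x i\<bar>" by auto
  have "\<bar>\<Sum>j\<in>J. x j\<bar> \<le> (\<Sum>j\<in>J. \<bar>x j\<bar>)" by (rule sum_abs)
  also have "\<dots> \<le> (\<Sum>j\<in>J. m)" unfolding m_def using J by (intro sum_mono Max_ge) auto
  also have "\<dots> = \<bar>real (card J) * x i\<bar>" using i by (simp add: abs_mult)
  finally have "qpow q (\<Sum>j\<in>J. x j) \<le> qpow q (real (card J) * x i)" using q by (intro qpow_mono) auto
  also have "\<dots> = qpow q (real (card J)) * qpow q (x i)" by (rule qpow_mult)
  also have "\<dots> \<le> qpow q (real (card J)) * (\<Sum>j\<in>J. qpow q (x j))"
    using J i by (intro mult_left_mono member_le_sum) auto
  finally show ?thesis .
qed simp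

lemma word_qpow:
  assumes q: "1 \<le> q" and M: "0 \<le> M" and f: "smooth f"
    and ds: "\<And>d. d \<in> set ds \<Longrightarrow> \<exists>a b. d = a *\<^sub>R u + b *\<^sub>R w \<and> \<bar>a\<bar> \<le> M \<and> \<bar>b\<bar> \<le> M"
  shows "qpow q (foldr dird ds f y) \<le> qpow q (real (Suc (length ds)) * (2 * M) ^ length ds) *
    (\<Sum>j\<le>length ds. qpow q ((dird u ^^ j) ((dird w ^^ (length ds - j)) f) y))"
proof -
  let ?n = "length ds"
  let ?T = "\<lambda>j. (dird u ^^ j) ((dird w ^^ (?n - j)) f) y"
  obtain c where c: "\<And>j. \<bar>c j\<bar> \<le> (2 * M) ^ ?n" "foldr dird ds f = (\<lambda>x. \<Sum>j\<le>?n. c j * (dird u ^^ j) ((dird w ^^ (?n - j)) f) x)"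
    using word_expansion[OF f ds] by auto
  have "qpow q (foldr dird ds f y) \<le> qpow q (real (card {..?n})) * (\<Sum>j\<le>?n. qpow q (c j * ?T j))"
    unfolding c(2) by (rule qpow_sum[OF q]) simp
  also have "\<dots> \<le> qpow q (real (card {..?n})) * (\<Sum>j\<le>?n. qpow q ((2 * M) ^ ?n) * qpow q (?T j))"
    unfolding qpow_mult using c(1) q M by (intro mult_left_mono sum_mono mult_right_mono qpow_mono) auto
  also have "\<dots> = qpow q (real (Suc ?n) * (2 * M) ^ ?n) * (\<Sum>j\<le>?n. qpow q (?T j))"
    by (simp only: sum_distrib_left[symmetric] qpow_mult mult.assoc card_atMost)
  finally show ?thesis .
qed

lemma iter_integral_sum:
  assumes "\<And>j. j \<in> J \<Longrightarrow> f j \<in> borel_measurable borel" "A \<in> sets borel"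
  shows "iter_integral A (\<lambda>x. \<Sum>j\<in>J. f j x) = (\<Sum>j\<in>J. iter_integral A (f j))"
  using assms
  by (induction J rule: infinite_finite_induct)
     (auto simp: iter_integral_add borel_measurable_sum iter_integral_def[of _ "\<lambda>_. 0"])

lemma smooth_borel [intro]: "smooth f \<Longrightarrow> f \<in> borel_measurable borel"
  by (intro borel_measurable_continuous_onI smooth_continuous)

lemma smooth_qpow_tri_map:
  assumes "smooth f"
  shows "(\<lambda>z. qpow q (f (tri_map x u w z))) \<in> borel_measurable borel"
proof -
  have [measurable]: "f \<in> borel_measurable borel" using assms by (rule smooth_borel)
  show ?thesis by measurable
qed

definition top_sum :: "nat \<Rightarrow> (nat \<times> nat \<Rightarrow> ennreal) \<Rightarrow> ennreal" where
  "top_sum n E = (\<Sum>\<gamma> | mi_order \<gamma> = n. E \<gamma>)"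

lemma mi_order_eq_image: "{\<gamma>. mi_order \<gamma> = n} = (\<lambda>i. (i, n - i)) ` {..n}"
  by (auto simp: mi_order_def image_iff)

lemma finite_mi_order_eq [simp]: "finite {\<gamma>. mi_order \<gamma> = n}"
  by (simp add: mi_order_eq_image)

lemma card_mi_order_eq: "card {\<gamma>. mi_order \<gamma> = n} = Suc n"
  unfolding mi_order_eq_image by (subst card_image) (auto simp: inj_on_def)

lemma top_sum_eq: "top_sum n E = (\<Sum>i\<le>n. E (i, n - i))"
  unfolding top_sum_def mi_order_eq_image by (subst sum.reindex) (auto simp: inj_on_def)

lemma word_tri_int:
  assumes q: "1 \<le> q" and M: "0 \<le> M" and f: "smooth f"
    and ds: "\<And>d. d \<in> set ds \<Longrightarrow> \<exists>a b. d = a *\<^sub>R p + b *\<^sub>R r \<and> \<bar>a\<bar> \<le> M \<and> \<bar>b\<bar> \<le> M"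
  shows "tri_int (\<lambda>z. qpow q (foldr dird ds f (tri_map x u w z))) \<le>
    qpow q (real (Suc (length ds)) * (2 * M) ^ length ds) *
    (\<Sum>j\<le>length ds. tri_int (\<lambda>z. qpow q ((dird p ^^ j) ((dird r ^^ (length ds - j)) f) (tri_map x u w z))))"
proof -
  let ?n = "length ds"
  let ?c = "qpow q (real (Suc ?n) * (2 * M) ^ ?n)"
  let ?T = "\<lambda>j z. qpow q ((dird p ^^ j) ((dird r ^^ (?n - j)) f) (tri_map x u w z))"
  have m: "?T j \<in> borel_measurable borel" for j
    by (intro smooth_qpow_tri_map smooth_dird_funpow f)
  have "tri_int (\<lambda>z. qpow q (foldr dird ds f (tri_map x u w z))) \<le> tri_int (\<lambda>z. ?c * (\<Sum>j\<le>?n. ?T j z))"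
    by (intro iter_integral_mono word_qpow[OF q M f ds])
  also have "\<dots> = ?c * (\<Sum>j\<le>?n. tri_int (?T j))"
    using m by (subst iter_integral_cmult) (auto simp: iter_integral_sum)
  finally show ?thesis .
qed

lemma axis_expand: "d = (d $ 1) *\<^sub>R axis 1 1 + (d $ 2) *\<^sub>R (axis 2 1 :: real^2)"
  by (simp add: vec_eq_iff forall_2 axis_def)

text \<open>The axis components of a vector are bounded by its length, so words in arbitrary vectors
  cost only a power of the bound on their lengths.\<close>

lemma word_tri_int_partial:
  assumes q: "1 \<le> q" and M: "0 \<le> M" and f: "smooth f" and ds: "\<And>d. d \<in> set ds \<Longrightarrow> norm d \<le> M"
  shows "tri_int (\<lambda>z. qpow q (foldr dird ds f (tri_map x u w z))) \<le>
    qpow q (real (Suc (length ds)) * (2 * M) ^ length ds) *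
    top_sum (length ds) (\<lambda>\<gamma>. tri_int (\<lambda>z. qpow q (multi_partial \<gamma> f (tri_map x u w z))))"
proof -
  have "\<exists>a b. d = a *\<^sub>R axis 1 1 + b *\<^sub>R axis 2 1 \<and> \<bar>a\<bar> \<le> M \<and> \<bar>b\<bar> \<le> M" if "d \<in> set ds" for d
    using axis_expand[of d] ds[OF that] component_le_norm_cart[of d 1] component_le_norm_cart[of d 2]
    by (intro exI[of _ "d $ 1"] exI[of _ "d $ 2"]) auto
  then have "tri_int (\<lambda>z. qpow q (foldr dird ds f (tri_map x u w z))) \<le>
    qpow q (real (Suc (length ds)) * (2 * M) ^ length ds) *
    (\<Sum>j\<le>length ds. tri_int (\<lambda>z. qpow q ((dird (axis 1 1) ^^ j) ((dird (axis 2 1) ^^ (length ds - j)) f) (tri_map x u w z))))"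
    by (rule word_tri_int[OF q M f])
  then show ?thesis by (simp add: top_sum_eq multi_partial_eq)
qed

text \<open>The Poincare inequality contributes \<open>4 * (288 * (64 * k * k))\<close> for each of at most \<open>k + 1\<close>
  steps; the remaining factors count the terms of sums and the \<open>2\<close>'s from \<open>M = 2 R / h\<close> and from
  \<open>word_expansion\<close>.\<close>

definition interp_const :: "nat \<Rightarrow> real" where
  "interp_const k = (real (Suc k))\<^sup>2 * 4 ^ k * (4 * (288 * (64 * (real k * real k)))) ^ Suc k * (real (Suc (Suc k)))\<^sup>2 * 2 ^ Suc k"

text \<open>Directions are changed twice, at different costs. From the axes to the unit vectors
  along \<open>u\<close> and \<open>w\<close>, the change concerns the \<open>m\<close> derivatives
  of the error and costs a multiple of \<open>M = 2 * (R / H)\<close> for each. Back to the axes, it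
  concerns \<open>k + 1\<close> derivatives of \<open>F\<close>; unit vectors have components at
  most 1, so no shape factor arises.\<close>

lemma smooth_estimate:
  assumes q: "1 \<le> q" and k: "1 \<le> k" and nc: "\<not> collinear {x1, x2, x3}"
    and h: "dist x1 x2 \<le> dist x2 x3" "dist x3 x1 \<le> dist x2 x3"
    and F: "smooth F" and P: "P \<in> poly_space k"
    and nodes: "\<And>y. y \<in> lagrange_nodes k x1 x2 x3 \<Longrightarrow> P y = F y"
    and m: "mi_order \<delta> = m" "m \<le> k"
  shows "tri_int (\<lambda>z. qpow q (multi_partial \<delta> (\<lambda>x. F x - P x) (tri_map x1 (x2 - x1) (x3 - x1) z)))
    \<le> qpow q (interp_const k * (circumradius x1 x2 x3 / dist x2 x3) ^ m * dist x2 x3 ^ (k + 1 - m)) *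
      top_sum (k + 1) (\<lambda>\<gamma>. tri_int (\<lambda>z. qpow q (multi_partial \<gamma> F (tri_map x1 (x2 - x1) (x3 - x1) z))))"
proof -
  define u where "u = x2 - x1"
  define w where "w = x3 - x1"
  define H where "H = dist x2 x3"
  define R where "R = circumradius x1 x2 x3"
  define e where "e x = F x - P x" for x
  let ?\<Phi> = "tri_map x1 u w"
  let ?I = "\<lambda>f. tri_int (\<lambda>z. qpow q (f (?\<Phi> z)))"
  have D: "cross2 u w \<noteq> 0" using cross2_nonzero[OF nc] by (simp add: u_def w_def)
  have u0: "0 < norm u" and w0: "0 < norm w" using D by (auto simp: cross2_def)
  have uH: "norm u \<le> H" and wH: "norm w \<le> H"
    using h by (simp_all add: u_def w_def H_def dist_norm norm_minus_commute)
  have H0: "0 < H" using u0 uH by linarith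
  have R0: "0 < R" using circumradius_cross2(1)[OF nc] by (simp add: R_def)
  have RD: "2 * R * \<bar>cross2 u w\<bar> = norm u * norm w * H"
    using circumradius_cross2(2)[OF nc] by (simp add: R_def H_def u_def w_def)
  define M where "M = 2 * (R / H)"
  have M: "norm u * norm w / \<bar>cross2 u w\<bar> = M"
    using RD D H0 by (simp add: M_def field_simps)
  have M0: "0 \<le> M" using R0 H0 by (simp add: M_def)
  have sP: "smooth P" by (rule poly_space_smooth[OF P])
  have se: "smooth e" unfolding e_def[abs_def] by (intro smooth_minus F sP)
  let ?pu = "(1 / norm u) *\<^sub>R u" and ?pw = "(1 / norm w) *\<^sub>R w"
  let ?C0 = "(4 * (288 * (64 * (real k * real k)))) ^ Suc k"
  have kk: "1 \<le> 4 * (288 * (64 * (real k * real k)))" using k mult_mono[of 1 "real k" 1 "real k"] by simp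
  have C0: "0 \<le> ?C0" using kk by simp
  interpret d: deriv_family "\<lambda>a b z. (dird u ^^ a) ((dird w ^^ b) e) (?\<Phi> z)" k
    unfolding u_def w_def by (rule deriv_family_dird[OF se k]) (simp add: e_def nodes)
  have norm_form: "(dird ?pu ^^ a) ((dird ?pw ^^ b) f) = (\<lambda>y. ((1 / norm u) ^ a * (1 / norm w) ^ b) * (dird u ^^ a) ((dird w ^^ b) f) y)"
    if "smooth f" for a b f
    unfolding dird_scaleR_funpow[OF that] dird_funpow_cmult[OF smooth_dird_funpow[OF that]]
      dird_scaleR_funpow[OF smooth_dird_funpow[OF that]]
    by (simp only: mult_ac)
  have unit_form: "?I ((dird ?pu ^^ a) ((dird ?pw ^^ b) f)) = qpow q ((1 / norm u) ^ a * (1 / norm w) ^ b) * ?I ((dird u ^^ a) ((dird w ^^ b) f))"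
    if "smooth f" for a b f
    unfolding norm_form[OF that] qpow_mult[of q "(1 / norm u) ^ a * (1 / norm w) ^ b"]
    by (intro iter_integral_cmult smooth_qpow_tri_map smooth_dird_funpow that) simp
  define S where "S = top_sum (k + 1) (\<lambda>\<gamma>. ?I (multi_partial \<gamma> F))"
  have stepC: "?I ((dird ?pu ^^ a) ((dird ?pw ^^ b) F)) \<le> qpow q (real (Suc (Suc k)) * 2 ^ Suc k) * S" if "a + b = Suc k" for a b
  proof -
    let ?ds = "replicate a ?pu @ replicate b ?pw"
    have l: "length ?ds = Suc k" using that by simp
    have "norm d \<le> 1" if "d \<in> set ?ds" for d using that u0 w0 by (auto split: if_splits)
    then have "?I (foldr dird ?ds F) \<le> qpow q (real (Suc (length ?ds)) * (2 * 1) ^ length ?ds) *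
        top_sum (length ?ds) (\<lambda>\<gamma>. ?I (multi_partial \<gamma> F))"
      by (rule word_tri_int_partial[OF q zero_le_one F])
    then show ?thesis unfolding l foldr_dird_replicate S_def by simp
  qed
  \<comment> \<open>The descent runs in the unnormalized directions \<open>u\<close> and
    \<open>w\<close>, which the pullback turns into the coordinate directions of the reference
    triangle. The normalization \<open>?\<kappa>\<close> is multiplied in afterwards.\<close>
  have stepB: "?I ((dird ?pu ^^ j) ((dird ?pw ^^ (m - j)) e)) \<le>
     qpow q (?C0 * H ^ (k + 1 - m) * real (Suc (Suc k)) * (real (Suc (Suc k)) * 2 ^ Suc k)) * S" if j: "j \<le> m" for j
  proof -
    let ?A = "{(x, y). j \<le> x \<and> m - j \<le> y \<and> x + y = Suc k}"
    have finA: "finite ?A" by (rule finite_subset[of _ "{..Suc k} \<times> {..Suc k}"]) auto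
    have cardA: "card ?A \<le> Suc (Suc k)"
    proof -
      have "?A \<subseteq> {\<gamma>. mi_order \<gamma> = Suc k}" by (auto simp: mi_order_def)
      then have "card ?A \<le> card {\<gamma>. mi_order \<gamma> = Suc k}" by (intro card_mono) auto
      then show ?thesis by (simp add: card_mi_order_eq)
    qed
    let ?\<kappa> = "(1 / norm u) ^ j * (1 / norm w) ^ (m - j)"
    have "?I ((dird u ^^ j) ((dird w ^^ (m - j)) e)) = d.energy q j (m - j)"
      by (simp add: d.energy_def)
    also have "\<dots> \<le> qpow q ((4 * (288 * (64 * (real k * real k)))) ^ (Suc k - m)) * d.top_energy q j (m - j)"
      using j m(2) by (intro d.energy_le_top_energy[OF q]) simp
    also have "\<dots> \<le> qpow q ?C0 * d.top_energy q j (m - j)"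
    proof (intro mult_right_mono qpow_mono)
      have "(4 * (288 * (64 * (real k * real k)))) ^ (Suc k - m) \<le> ?C0" by (intro power_increasing kk) simp
      then show "\<bar>(4 * (288 * (64 * (real k * real k)))) ^ (Suc k - m)\<bar> \<le> \<bar>?C0\<bar>" using C0 kk
        by (simp only: abs_of_nonneg zero_le_power order.trans[OF zero_le_one])
    qed (use q in auto)
    finally have 1: "?I ((dird u ^^ j) ((dird w ^^ (m - j)) e)) \<le> qpow q ?C0 * d.top_energy q j (m - j)" .
    have t: "qpow q ?\<kappa> * d.energy q x y \<le> qpow q (H ^ (k + 1 - m)) * (qpow q (real (Suc (Suc k)) * 2 ^ Suc k) * S)"
      if xy: "(x, y) \<in> ?A" for x y
    proof -
      have xy': "j \<le> x" "m - j \<le> y" "x + y = Suc k" using xy by auto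
      \<comment> \<open>At order k + 1 the interpolating polynomial has no derivatives left.\<close>
      have top: "(dird u ^^ x) ((dird w ^^ y) e) = (dird u ^^ x) ((dird w ^^ y) F)"
        unfolding e_def[abs_def] using poly_space_dird_vanish[OF P xy'(3), of u w]
        by (simp add: dird_funpow_minus F sP smooth_dird_funpow)
      have "d.energy q x y = ?I ((dird u ^^ x) ((dird w ^^ y) F))"
        by (simp add: d.energy_def top)
      also have "\<dots> = qpow q (norm u ^ x * norm w ^ y) * (qpow q ((1 / norm u) ^ x * (1 / norm w) ^ y) * ?I ((dird u ^^ x) ((dird w ^^ y) F)))"
      proof -
        have "norm u ^ x * norm w ^ y * ((1 / norm u) ^ x * (1 / norm w) ^ y) = 1"
          using u0 w0 by (simp add: power_one_over)
        then have "qpow q (norm u ^ x * norm w ^ y) * qpow q ((1 / norm u) ^ x * (1 / norm w) ^ y) = 1"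
          unfolding qpow_mult[symmetric] by (simp only: qpow_def) simp
        then show ?thesis by (simp add: mult.assoc[symmetric])
      qed
      also have "\<dots> = qpow q (norm u ^ x * norm w ^ y) * ?I ((dird ?pu ^^ x) ((dird ?pw ^^ y) F))"
        by (simp only: unit_form[OF F])
      finally have "qpow q ?\<kappa> * d.energy q x y = qpow q (?\<kappa> * (norm u ^ x * norm w ^ y)) * ?I ((dird ?pu ^^ x) ((dird ?pw ^^ y) F))"
        by (simp add: qpow_mult mult.assoc)
      \<comment> \<open>Here the restriction on orders pays off: \<open>x\<close> and
        \<open>y\<close> are at least \<open>j\<close> and \<open>m - j\<close>, so only nonnegative
        exponents remain, with sum \<open>k + 1 - m\<close>.\<close>
      also have "?\<kappa> * (norm u ^ x * norm w ^ y) = norm u ^ (x - j) * norm w ^ (y - (m - j))"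
        using u0 w0 xy' by (simp add: power_diff power_one_over)
      also have "qpow q (norm u ^ (x - j) * norm w ^ (y - (m - j))) * ?I ((dird ?pu ^^ x) ((dird ?pw ^^ y) F))
        \<le> qpow q (H ^ (k + 1 - m)) * (qpow q (real (Suc (Suc k)) * 2 ^ Suc k) * S)"
      proof (intro mult_mono qpow_mono stepC xy')
        have "norm u ^ (x - j) * norm w ^ (y - (m - j)) \<le> H ^ (x - j) * H ^ (y - (m - j))"
          using uH wH H0 by (intro mult_mono power_mono) auto
        also have "\<dots> = H ^ (k + 1 - m)"
          using xy' j m(2) by (simp add: power_add[symmetric])
        finally show "\<bar>norm u ^ (x - j) * norm w ^ (y - (m - j))\<bar> \<le> \<bar>H ^ (k + 1 - m)\<bar>"
          using H0 by simp
      qed (use q in auto)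
      finally show ?thesis .
    qed
    have "?I ((dird ?pu ^^ j) ((dird ?pw ^^ (m - j)) e)) = qpow q ?\<kappa> * ?I ((dird u ^^ j) ((dird w ^^ (m - j)) e))"
      by (rule unit_form[OF se])
    also have "\<dots> \<le> qpow q ?\<kappa> * (qpow q ?C0 * d.top_energy q j (m - j))"
      by (intro mult_left_mono 1) simp
    also have "\<dots> = qpow q ?C0 * (\<Sum>(x, y)\<in>?A. qpow q ?\<kappa> * d.energy q x y)"
      unfolding d.top_energy_def
      by (simp only: mult.left_commute[of "qpow q ?\<kappa>"] sum_distrib_left case_prod_unfold)
    also have "\<dots> \<le> qpow q ?C0 * (\<Sum>(x, y)\<in>?A. qpow q (H ^ (k + 1 - m)) * (qpow q (real (Suc (Suc k)) * 2 ^ Suc k) * S))"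
      by (intro mult_left_mono sum_mono) (use t in auto)
    also have "\<dots> = qpow q ?C0 * (of_nat (card ?A) * (qpow q (H ^ (k + 1 - m)) * (qpow q (real (Suc (Suc k)) * 2 ^ Suc k) * S)))"
      by (simp add: case_prod_unfold)
    also have "\<dots> \<le> qpow q ?C0 * (qpow q (real (Suc (Suc k))) * (qpow q (H ^ (k + 1 - m)) * (qpow q (real (Suc (Suc k)) * 2 ^ Suc k) * S)))"
    proof (intro mult_left_mono mult_right_mono)
      have "(of_nat (card ?A) :: ennreal) \<le> of_nat (Suc (Suc k))" using cardA by (rule of_nat_mono)
      also have "\<dots> = ennreal (real (Suc (Suc k)))" by (rule ennreal_of_nat_eq_real_of_nat)
      also have "\<dots> \<le> qpow q (real (Suc (Suc k)))" using q by (intro qpow_le_self) auto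
      finally show "(of_nat (card ?A) :: ennreal) \<le> qpow q (real (Suc (Suc k)))" .
    qed auto
    also have "\<dots> = qpow q (?C0 * H ^ (k + 1 - m) * real (Suc (Suc k)) * (real (Suc (Suc k)) * 2 ^ Suc k)) * S"
      by (simp only: qpow_mult mult_ac)
    finally show ?thesis .
  qed
  let ?B = "?C0 * H ^ (k + 1 - m) * real (Suc (Suc k)) * (real (Suc (Suc k)) * 2 ^ Suc k)"
  \<comment> \<open>Cramer's rule: the numerator determinant is at most the length of one edge and
    the normalization contributes the other length, so the coefficient is bounded by
    \<open>M\<close>.\<close>
  have axes: "\<exists>a b. v = a *\<^sub>R ?pu + b *\<^sub>R ?pw \<and> \<bar>a\<bar> \<le> M \<and> \<bar>b\<bar> \<le> M" if v: "norm v = 1" for v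
  proof (intro exI conjI)
    show "v = (cross2 v w / cross2 u w * norm u) *\<^sub>R ?pu + (cross2 u v / cross2 u w * norm w) *\<^sub>R ?pw"
      using cross2_expand[OF D, of v] u0 w0 by simp
    have "\<bar>cross2 v w\<bar> * norm u \<le> norm w * norm u" "\<bar>cross2 u v\<bar> * norm w \<le> norm u * norm w"
      using cross2_le[of v w] cross2_le[of u v] v by (auto intro!: mult_right_mono)
    then have "\<bar>cross2 v w\<bar> * norm u / \<bar>cross2 u w\<bar> \<le> norm u * norm w / \<bar>cross2 u w\<bar>"
      "\<bar>cross2 u v\<bar> * norm w / \<bar>cross2 u w\<bar> \<le> norm u * norm w / \<bar>cross2 u w\<bar>"
      by (auto intro!: divide_right_mono simp: mult.commute)
    then show "\<bar>cross2 v w / cross2 u w * norm u\<bar> \<le> M" "\<bar>cross2 u v / cross2 u w * norm w\<bar> \<le> M"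
      unfolding M by (simp_all add: abs_mult)
  qed
  let ?ds = "replicate (fst \<delta>) (axis 1 1) @ replicate (snd \<delta>) (axis 2 1 :: real^2)"
  have l: "length ?ds = m" using m(1) by (simp add: mi_order_def)
  have "norm (v :: real^2) = 1" if "v \<in> set ?ds" for v using that by (auto split: if_splits simp: norm_axis_1)
  then have ds: "\<exists>a b. v = a *\<^sub>R ?pu + b *\<^sub>R ?pw \<and> \<bar>a\<bar> \<le> M \<and> \<bar>b\<bar> \<le> M" if "v \<in> set ?ds" for v
    using axes that by blast
  have "?I (multi_partial \<delta> e) \<le> qpow q (real (Suc m) * (2 * M) ^ m) * (\<Sum>j\<le>m. ?I ((dird ?pu ^^ j) ((dird ?pw ^^ (m - j)) e)))"
  proof -
    have "?I (foldr dird ?ds e) \<le> qpow q (real (Suc (length ?ds)) * (2 * M) ^ length ?ds) *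
        (\<Sum>j\<le>length ?ds. ?I ((dird ?pu ^^ j) ((dird ?pw ^^ (length ?ds - j)) e)))"
      by (rule word_tri_int[OF q M0 se]) (rule ds)
    then show ?thesis unfolding l foldr_dird_replicate multi_partial_eq[symmetric] .
  qed
  also have "\<dots> \<le> qpow q (real (Suc m) * (2 * M) ^ m) * (\<Sum>j\<le>m. qpow q ?B * S)"
    by (intro mult_left_mono sum_mono stepB) auto
  also have "\<dots> = qpow q (real (Suc m) * (2 * M) ^ m) * (of_nat (Suc m) * (qpow q ?B * S))"
    by simp
  also have "\<dots> \<le> qpow q (real (Suc m) * (2 * M) ^ m) * (qpow q (real (Suc m)) * (qpow q ?B * S))"
  proof (intro mult_left_mono mult_right_mono)
    have "(of_nat (Suc m) :: ennreal) = ennreal (real (Suc m))" by (rule ennreal_of_nat_eq_real_of_nat)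
    also have "\<dots> \<le> qpow q (real (Suc m))" using q by (intro qpow_le_self) auto
    finally show "(of_nat (Suc m) :: ennreal) \<le> qpow q (real (Suc m))" .
  qed auto
  also have "\<dots> = qpow q ((real (Suc m) * (2 * M) ^ m) * (real (Suc m) * ?B)) * S"
    by (simp only: qpow_mult mult.assoc)
  also have "\<dots> \<le> qpow q (interp_const k * (R / H) ^ m * H ^ (k + 1 - m)) * S"
  proof (intro mult_right_mono qpow_mono)
    have RH: "0 \<le> R / H" using R0 H0 by simp
    let ?X = "(R / H) ^ m * (?C0 * H ^ (k + 1 - m) * real (Suc (Suc k)) * (real (Suc (Suc k)) * 2 ^ Suc k))"
    have X: "0 \<le> ?X" using RH C0 H0 by (intro mult_nonneg_nonneg zero_le_power) auto
    have "(real (Suc m) * (2 * M) ^ m) * (real (Suc m) * ?B) = ((real (Suc m))\<^sup>2 * 4 ^ m) * ?X"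
    proof -
      have "2 * M = 4 * (R / H)" by (simp add: M_def)
      then have "(2 * M) ^ m = 4 ^ m * (R / H) ^ m" by (simp only: power_mult_distrib)
      then show ?thesis by (simp only: power2_eq_square mult_ac)
    qed
    also have "\<dots> \<le> ((real (Suc k))\<^sup>2 * 4 ^ k) * ?X"
      using m(2) by (intro mult_right_mono[OF _ X] mult_mono power_mono power_increasing) auto
    also have "\<dots> = interp_const k * (R / H) ^ m * H ^ (k + 1 - m)"
      by (simp add: interp_const_def power2_eq_square mult_ac)
    finally have le: "(real (Suc m) * (2 * M) ^ m) * (real (Suc m) * ?B) \<le> interp_const k * (R / H) ^ m * H ^ (k + 1 - m)" .
    have "0 \<le> (real (Suc m) * (2 * M) ^ m) * (real (Suc m) * ?B)"
      using M0 C0 H0 by (intro mult_nonneg_nonneg zero_le_power) auto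
    then show "\<bar>(real (Suc m) * (2 * M) ^ m) * (real (Suc m) * ?B)\<bar> \<le> \<bar>interp_const k * (R / H) ^ m * H ^ (k + 1 - m)\<bar>"
      using le by linarith
  qed (use q in auto)
  finally show ?thesis unfolding S_def e_def[abs_def] u_def w_def R_def H_def .
qed

section \<open>Sobolev embedding on a triangle\<close>

lemma closed_triangle_rotate: "closed_triangle x2 x3 x1 = closed_triangle x1 x2 x3"
proof -
  have "{x2, x3, x1} = {x1, x2, x3}" by auto
  then show ?thesis by (simp only: closed_triangle_def)
qed

lemma closed_triangle_props:
  assumes nc: "\<not> collinear {x1, x2, x3}"
  shows "compact (closed_triangle x1 x2 x3)" "convex (closed_triangle x1 x2 x3)"
    "interior (closed_triangle x1 x2 x3) \<noteq> {}" "closure (interior (closed_triangle x1 x2 x3)) = closed_triangle x1 x2 x3"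
proof -
  show c: "compact (closed_triangle x1 x2 x3)"
    unfolding closed_triangle_def by (intro compact_convex_hull finite_imp_compact) simp
  show v: "convex (closed_triangle x1 x2 x3)"
    unfolding closed_triangle_def by (rule convex_convex_hull)
  show n: "interior (closed_triangle x1 x2 x3) \<noteq> {}"
  proof -
    have "(1/3) *\<^sub>R x1 + (1/3) *\<^sub>R x2 + (1/3) *\<^sub>R x3 \<in> interior (closed_triangle x1 x2 x3)"
      unfolding closed_triangle_def using nc
      by (subst interior_convex_hull_3_minimal) (auto intro!: exI[of _ "1/3::real"])
    then show ?thesis by blast
  qed
  show "closure (interior (closed_triangle x1 x2 x3)) = closed_triangle x1 x2 x3"
    using convex_closure_interior[OF v n] compact_imp_closed[OF c] by simp
qed

definition tri_integral :: "real^2 \<Rightarrow> real^2 \<Rightarrow> real^2 \<Rightarrow> (real^2 \<Rightarrow> ennreal) \<Rightarrow> ennreal" where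
  "tri_integral x1 x2 x3 \<phi> = (\<integral>\<^sup>+x. \<phi> x * indicator (closed_triangle x1 x2 x3) x \<partial>lborel)"

definition low_sum :: "nat \<Rightarrow> (nat \<times> nat \<Rightarrow> ennreal) \<Rightarrow> ennreal" where
  "low_sum n E = (\<Sum>\<gamma> | mi_order \<gamma> \<le> n. E \<gamma>)"

lemma top_sum_le_low_sum: "n \<le> m \<Longrightarrow> top_sum n E \<le> low_sum m E"
  unfolding top_sum_def low_sum_def by (intro sum_mono2) auto

text \<open>In the plane two integrable derivatives control point values; \<open>point_bound\<close>
  is applied at the vertex \<open>y\<close>. Five terms with the constant 64 give 320, and the
  remaining factor majorizes the cost of all words of length at most 2.\<close>

lemma point_bound_smooth:
  assumes M: "norm u \<le> M" "norm w \<le> M" "1 \<le> M" and F: "smooth F"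
  shows "qpow 1 (F y) \<le> ennreal (320 * (3 * (2 * M)\<^sup>2)) *
    low_sum 2 (\<lambda>\<gamma>. tri_int (\<lambda>z. qpow 1 (multi_partial \<gamma> F (tri_map y u w z))))"
proof -
  let ?S = "low_sum 2 (\<lambda>\<gamma>. tri_int (\<lambda>z. qpow 1 (multi_partial \<gamma> F (tri_map y u w z))))"
  let ?d = "\<lambda>a b z. (dird u ^^ a) ((dird w ^^ b) F) (tri_map y u w z)"
  let ?B = "ennreal (3 * (2 * M)\<^sup>2)"
  have c: "continuous_on UNIV (?d a b)" for a b
    using dird_family_deriv[OF F] by (meson continuous_at_imp_continuous_on has_derivative_continuous)
  have C1: "C1_plane (?d a b) (?d (Suc a) b) (?d a (Suc b))" for a b
    by unfold_locales (rule dird_family_deriv[OF F] c)+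
  have b: "tri_int (\<lambda>z. qpow 1 (?d a b z)) \<le> ?B * ?S" if ab: "a + b \<le> 2" for a b
  proof -
    let ?ds = "replicate a u @ replicate b w"
    have l: "length ?ds = a + b" by simp
    have "tri_int (\<lambda>z. qpow 1 (foldr dird ?ds F (tri_map y u w z))) \<le>
      qpow 1 (real (Suc (length ?ds)) * (2 * M) ^ length ?ds) *
      top_sum (length ?ds) (\<lambda>\<gamma>. tri_int (\<lambda>z. qpow 1 (multi_partial \<gamma> F (tri_map y u w z))))"
      by (rule word_tri_int_partial) (use M F in \<open>auto split: if_splits\<close>)
    also have "\<dots> \<le> ?B * ?S"
    proof (intro mult_mono top_sum_le_low_sum)
      have "real (Suc (a + b)) * (2 * M) ^ (a + b) \<le> 3 * (2 * M)\<^sup>2"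
        using ab M by (intro mult_mono power_increasing) auto
      then show "qpow 1 (real (Suc (length ?ds)) * (2 * M) ^ length ?ds) \<le> ?B"
        unfolding l qpow_def using M by (intro ennreal_leI) auto
    qed (use ab in auto)
    finally show ?thesis by (simp add: foldr_dird_replicate)
  qed
  have "qpow 1 (?d 0 0 (0, 0)) \<le> qpow 1 64 * (tri_int (\<lambda>z. qpow 1 (?d 0 0 z)) +
    (tri_int (\<lambda>z. qpow 1 (?d (Suc 0) 0 z)) + tri_int (\<lambda>z. qpow 1 (?d 0 (Suc 0) z)) +
     (tri_int (\<lambda>z. qpow 1 (?d (Suc (Suc 0)) 0 z)) + tri_int (\<lambda>z. qpow 1 (?d (Suc 0) (Suc 0) z)))))"
    by (rule point_bound[OF order.refl C1 C1])
  also have "\<dots> \<le> qpow 1 64 * (?B * ?S + (?B * ?S + ?B * ?S + (?B * ?S + ?B * ?S)))"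
    by (intro mult_left_mono add_mono b) auto
  also have "\<dots> = (ennreal 64 * 5 * ?B) * ?S"
  proof -
    have "x + (x + x + (x + x)) = 5 * x" for x :: ennreal
    proof -
      have "5 * x = (1 + (1 + 1 + (1 + 1))) * x" by simp
      also have "\<dots> = x + (x + x + (x + x))" by (simp only: distrib_right mult_1)
      finally show ?thesis by simp
    qed
    then show ?thesis by (simp add: qpow_def mult.assoc)
  qed
  also have "ennreal 64 * 5 * ?B = ennreal (320 * (3 * (2 * M)\<^sup>2))"
  proof -
    have 1: "ennreal 64 * 5 = ennreal 320"
      by (simp add: ennreal_numeral[symmetric] ennreal_mult[symmetric] del: ennreal_numeral)
    have "ennreal 320 * ?B = ennreal (320 * (3 * (2 * M)\<^sup>2))"
      by (intro ennreal_mult[symmetric]) auto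
    then show ?thesis by (simp only: 1)
  qed
  finally show ?thesis by (simp add: tri_map_def)
qed

text \<open>If the first barycentric coordinate of a point is at least 1/3, the triangle with this
  vertex and one third of the edge vectors at \<open>x1\<close> stays inside. These small triangles
  are translates of each other, so one constant serves for all such points.\<close>

lemma sup_bound_vertex:
  assumes nc: "\<not> collinear {x1, x2, x3}"
  shows "\<exists>C\<ge>0. \<forall>F l1 l2 l3. smooth F \<longrightarrow> 1/3 \<le> l1 \<longrightarrow> 0 \<le> l2 \<longrightarrow> 0 \<le> l3 \<longrightarrow> l1 + l2 + l3 = 1 \<longrightarrow>
    qpow 1 (F (l1 *\<^sub>R x1 + l2 *\<^sub>R x2 + l3 *\<^sub>R x3)) \<le> ennreal C * low_sum 2 (\<lambda>\<gamma>. tri_integral x1 x2 x3 (\<lambda>x. qpow 1 (multi_partial \<gamma> F x)))"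
proof -
  define u where "u = (1/3) *\<^sub>R (x2 - x1)"
  define w where "w = (1/3) *\<^sub>R (x3 - x1)"
  have "cross2 u w = (1/9) * cross2 (x2 - x1) (x3 - x1)" by (simp add: u_def w_def cross2_def algebra_simps)
  then have D: "cross2 u w \<noteq> 0" using cross2_nonzero[OF nc] by simp
  obtain c where c: "c > 0" "\<And>x \<phi>. \<phi> \<in> borel_measurable borel \<Longrightarrow>
    (\<integral>\<^sup>+y. \<phi> y * indicator (tri_map x u w ` ref_triangle) y \<partial>lborel) = ennreal c * tri_int (\<lambda>z. \<phi> (tri_map x u w z))"
    using tri_map_change_of_variables[OF D] by blast
  define M where "M = 1 + norm u + norm w"
  have M: "norm u \<le> M" "norm w \<le> M" "1 \<le> M" by (auto simp: M_def)
  let ?C = "320 * (3 * (2 * M)\<^sup>2)"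
  show ?thesis
  proof (intro exI[of _ "?C * (1 / c)"] conjI allI impI)
    show "0 \<le> ?C * (1 / c)" using c M by simp
    fix F and l1 l2 l3 :: real assume F: "smooth F" and l: "1/3 \<le> l1" "0 \<le> l2" "0 \<le> l3" "l1 + l2 + l3 = 1"
    define y where "y = l1 *\<^sub>R x1 + l2 *\<^sub>R x2 + l3 *\<^sub>R x3"
    have sub: "tri_map y u w ` ref_triangle \<subseteq> closed_triangle x1 x2 x3"
    proof
      fix p assume "p \<in> tri_map y u w ` ref_triangle"
      then obtain s r where sr: "0 \<le> s" "0 \<le> r" "s + r \<le> 1" "p = tri_map y u w (s, r)"
        by (auto simp: ref_triangle_def)
      have "p = (l1 - s/3 - r/3) *\<^sub>R x1 + (l2 + s/3) *\<^sub>R x2 + (l3 + r/3) *\<^sub>R x3"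
        unfolding sr(4) tri_map_def y_def u_def w_def by (simp add: algebra_simps)
      then show "p \<in> closed_triangle x1 x2 x3"
        unfolding closed_triangle_def convex_hull_3 using l sr(1-3)
        by (intro CollectI exI[of _ "l1 - s/3 - r/3"] exI[of _ "l2 + s/3"] exI[of _ "l3 + r/3"]) auto
    qed
    have b: "tri_int (\<lambda>z. qpow 1 (multi_partial \<gamma> F (tri_map y u w z)))
      \<le> ennreal (1 / c) * tri_integral x1 x2 x3 (\<lambda>x. qpow 1 (multi_partial \<gamma> F x))" for \<gamma>
    proof -
      have [measurable]: "multi_partial \<gamma> F \<in> borel_measurable borel"
        by (intro smooth_borel smooth_multi_partial F)
      have "tri_int (\<lambda>z. qpow 1 (multi_partial \<gamma> F (tri_map y u w z)))
        = ennreal (1 / c) * (ennreal c * tri_int (\<lambda>z. qpow 1 (multi_partial \<gamma> F (tri_map y u w z))))"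
        using c(1) by (simp add: mult.assoc[symmetric] ennreal_mult[symmetric])
      also have "\<dots> = ennreal (1 / c) * (\<integral>\<^sup>+x. qpow 1 (multi_partial \<gamma> F x) * indicator (tri_map y u w ` ref_triangle) x \<partial>lborel)"
        by (subst c(2)) auto
      also have "\<dots> \<le> ennreal (1 / c) * tri_integral x1 x2 x3 (\<lambda>x. qpow 1 (multi_partial \<gamma> F x))"
        unfolding tri_integral_def
        by (intro mult_left_mono nn_integral_mono) (use sub in \<open>auto split: split_indicator\<close>)
      finally show ?thesis .
    qed
    have "qpow 1 (F y) \<le> ennreal ?C * low_sum 2 (\<lambda>\<gamma>. tri_int (\<lambda>z. qpow 1 (multi_partial \<gamma> F (tri_map y u w z))))"
      by (rule point_bound_smooth[OF M F])
    also have "\<dots> \<le> ennreal ?C * low_sum 2 (\<lambda>\<gamma>. ennreal (1 / c) * tri_integral x1 x2 x3 (\<lambda>x. qpow 1 (multi_partial \<gamma> F x)))"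
      unfolding low_sum_def by (intro mult_left_mono sum_mono b) auto
    also have "\<dots> = ennreal (?C * (1 / c)) * low_sum 2 (\<lambda>\<gamma>. tri_integral x1 x2 x3 (\<lambda>x. qpow 1 (multi_partial \<gamma> F x)))"
    proof -
      have e: "ennreal ?C * ennreal (1 / c) = ennreal (?C * (1 / c))"
        by (intro ennreal_mult[symmetric]) (use c(1) in auto)
      show ?thesis unfolding low_sum_def sum_distrib_left[symmetric] e[symmetric]
        by (rule mult.assoc[symmetric])
    qed
    finally show "qpow 1 (F (l1 *\<^sub>R x1 + l2 *\<^sub>R x2 + l3 *\<^sub>R x3)) \<le> ennreal (?C * (1 / c)) * low_sum 2 (\<lambda>\<gamma>. tri_integral x1 x2 x3 (\<lambda>x. qpow 1 (multi_partial \<gamma> F x)))"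
      unfolding y_def .
  qed
qed

lemma not_collinear_rotate: "\<not> collinear {x1, x2, x3} \<Longrightarrow> \<not> collinear {x2, x3, x1}"
proof -
  have "{x2, x3, x1} = {x1, x2, x3}" by auto
  then show "\<not> collinear {x1, x2, x3} \<Longrightarrow> \<not> collinear {x2, x3, x1}" by simp
qed

lemma tri_integral_rotate: "tri_integral x2 x3 x1 = tri_integral x1 x2 x3"
  unfolding tri_integral_def[abs_def] closed_triangle_rotate[of x2 x3 x1] ..

text \<open>Some barycentric coordinate is at least 1/3; the three cases differ by a rotation of the
  vertices.\<close>

lemma sup_bound:
  assumes nc: "\<not> collinear {x1, x2, x3}"
  obtains C where "0 \<le> C" "\<And>F y. smooth F \<Longrightarrow> y \<in> closed_triangle x1 x2 x3 \<Longrightarrow>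
    qpow 1 (F y) \<le> ennreal C * low_sum 2 (\<lambda>\<gamma>. tri_integral x1 x2 x3 (\<lambda>x. qpow 1 (multi_partial \<gamma> F x)))"
proof -
  let ?S = "\<lambda>F. low_sum 2 (\<lambda>\<gamma>. tri_integral x1 x2 x3 (\<lambda>x. qpow 1 (multi_partial \<gamma> F x)))"
  note nc2 = not_collinear_rotate[OF nc]
  note nc3 = not_collinear_rotate[OF nc2]
  obtain A where A: "0 \<le> A" "\<And>F l1 l2 l3. smooth F \<Longrightarrow> 1/3 \<le> l1 \<Longrightarrow> 0 \<le> l2 \<Longrightarrow> 0 \<le> l3 \<Longrightarrow> l1 + l2 + l3 = 1 \<Longrightarrow>
    qpow 1 (F (l1 *\<^sub>R x1 + l2 *\<^sub>R x2 + l3 *\<^sub>R x3)) \<le> ennreal A * ?S F"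
    using sup_bound_vertex[OF nc] by blast
  obtain B where B: "0 \<le> B" "\<And>F l1 l2 l3. smooth F \<Longrightarrow> 1/3 \<le> l1 \<Longrightarrow> 0 \<le> l2 \<Longrightarrow> 0 \<le> l3 \<Longrightarrow> l1 + l2 + l3 = 1 \<Longrightarrow>
    qpow 1 (F (l1 *\<^sub>R x2 + l2 *\<^sub>R x3 + l3 *\<^sub>R x1)) \<le> ennreal B * ?S F"
    using sup_bound_vertex[OF nc2] unfolding tri_integral_rotate[of x2 x3 x1] by blast
  obtain C where C: "0 \<le> C" "\<And>F l1 l2 l3. smooth F \<Longrightarrow> 1/3 \<le> l1 \<Longrightarrow> 0 \<le> l2 \<Longrightarrow> 0 \<le> l3 \<Longrightarrow> l1 + l2 + l3 = 1 \<Longrightarrow>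
    qpow 1 (F (l1 *\<^sub>R x3 + l2 *\<^sub>R x1 + l3 *\<^sub>R x2)) \<le> ennreal C * ?S F"
    using sup_bound_vertex[OF nc3] unfolding tri_integral_rotate[of x3 x1 x2] tri_integral_rotate[of x2 x3 x1] by blast
  show ?thesis
  proof (rule that[of "A + B + C"])
    show "0 \<le> A + B + C" using A B C by simp
    fix F y assume F: "smooth F" and y: "y \<in> closed_triangle x1 x2 x3"
    obtain a b c where abc: "0 \<le> a" "0 \<le> b" "0 \<le> c" "a + b + c = 1" "y = a *\<^sub>R x1 + b *\<^sub>R x2 + c *\<^sub>R x3"
      using y unfolding closed_triangle_def convex_hull_3 by blast
    have up: "ennreal X * ?S F \<le> ennreal (A + B + C) * ?S F" if "X \<le> A + B + C" for X
      using that by (intro mult_right_mono ennreal_leI) auto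
    consider "1/3 \<le> a" | "1/3 \<le> b" | "1/3 \<le> c" using abc by linarith
    then show "qpow 1 (F y) \<le> ennreal (A + B + C) * ?S F"
    proof cases
      case 1
      then have "qpow 1 (F y) \<le> ennreal A * ?S F" unfolding abc(5) using abc by (intro A F) auto
      then show ?thesis by (rule order.trans[OF _ up]) (use A(1) B(1) C(1) in simp)
    next
      case 2
      have "y = b *\<^sub>R x2 + c *\<^sub>R x3 + a *\<^sub>R x1" unfolding abc(5) by (simp add: algebra_simps)
      then have "qpow 1 (F y) \<le> ennreal B * ?S F" using abc 2 by (simp only:) (intro B F, auto)
      then show ?thesis by (rule order.trans[OF _ up]) (use A(1) B(1) C(1) in simp)
    next
      case 3
      have "y = c *\<^sub>R x3 + a *\<^sub>R x1 + b *\<^sub>R x2" unfolding abc(5) by (simp add: algebra_simps)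
      then have "qpow 1 (F y) \<le> ennreal C * ?S F" using abc 3 by (simp only:) (intro C F, auto)
      then show ?thesis by (rule order.trans[OF _ up]) (use A(1) B(1) C(1) in simp)
    qed
  qed
qed

section \<open>Passage to the limit\<close>

text \<open>\<open>G \<gamma>\<close> is a Borel version of the weak derivative of order \<open>\<gamma>\<close>, defined on the whole plane.\<close>

locale sobolev_data =
  fixes x1 x2 x3 :: "real^2" and k :: nat and G :: "nat \<times> nat \<Rightarrow> real^2 \<Rightarrow> real"
    and \<eta> :: "real^2 \<Rightarrow> real"
  assumes nc: "\<not> collinear {x1, x2, x3}" and k: "1 \<le> k"
    and G: "\<And>\<gamma>. mi_order \<gamma> \<le> k + 1 \<Longrightarrow> integrable lborel (G \<gamma>)"
    and weak: "\<And>\<gamma>. mi_order \<gamma> \<le> k + 1 \<Longrightarrow> borel_weak_deriv (interior (closed_triangle x1 x2 x3)) \<gamma> (G (0, 0)) (G \<gamma>)"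
    and mollifier: "mollifier (interior (closed_triangle x1 x2 x3)) \<eta>"
begin

abbreviation "K \<equiv> closed_triangle x1 x2 x3"
abbreviation "\<Omega> \<equiv> interior K"

sublocale mollifier \<Omega> \<eta> by (rule mollifier)

definition V :: "nat \<Rightarrow> real^2 \<Rightarrow> real" where
  "V n = J (tseq n) (G (0, 0))"

text \<open>The power of \<open>tseq n\<close> comes from \<open>J_multi_partial\<close>. The
  identification with derivatives of \<open>V n\<close> is available on \<open>K\<close> only,
  whereas \<open>W n\<close> is defined and integrable on the plane.\<close>

definition W :: "nat \<Rightarrow> nat \<times> nat \<Rightarrow> real^2 \<Rightarrow> real" where
  "W n \<gamma> x = tseq n ^ mi_order \<gamma> * J (tseq n) (G \<gamma>) x"

lemma G0: "integrable lborel (G (0, 0))"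
  using G[of "(0, 0)"] by (simp add: mi_order_def)

lemma V_smooth: "smooth (V n)"
  unfolding V_def by (rule J_smooth[OF tseq(2,3) G0])

lemma K_closure: "x \<in> K \<Longrightarrow> x \<in> closure \<Omega>"
  using closed_triangle_props(4)[OF nc] by simp

lemma V_partial: "mi_order \<gamma> \<le> k + 1 \<Longrightarrow> x \<in> K \<Longrightarrow> multi_partial \<gamma> (V n) x = W n \<gamma> x"
  unfolding V_def W_def by (intro J_multi_partial[OF tseq(2,3) G0 G weak] K_closure)

lemma W_integrable: "mi_order \<gamma> \<le> k + 1 \<Longrightarrow> integrable lborel (W n \<gamma>)"
  unfolding W_def[abs_def] using J_integrable[OF tseq(2,3) G] by simp

lemma W_tendsto:
  assumes \<gamma>: "mi_order \<gamma> \<le> k + 1"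
  shows "(\<lambda>n. \<integral>x. \<bar>W n \<gamma> x - G \<gamma> x\<bar> \<partial>lborel) \<longlonglongrightarrow> 0"
proof (rule tendsto_sandwich[OF _ _ tendsto_const])
  let ?j = "mi_order \<gamma>"
  let ?I = "\<integral>x. \<bar>G \<gamma> x\<bar> \<partial>lborel"
  have "(\<lambda>n. (\<integral>x. \<bar>J (tseq n) (G \<gamma>) x - G \<gamma> x\<bar> \<partial>lborel) + (1 - tseq n ^ ?j) * ?I) \<longlonglongrightarrow> 0 + (1 - 1 ^ ?j) * ?I"
    by (intro tendsto_intros J_tendsto[OF G[OF \<gamma>]] tseq_lim)
  then show "(\<lambda>n. (\<integral>x. \<bar>J (tseq n) (G \<gamma>) x - G \<gamma> x\<bar> \<partial>lborel) + (1 - tseq n ^ ?j) * ?I) \<longlonglongrightarrow> 0" by simp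
  have "(\<integral>x. \<bar>W n \<gamma> x - G \<gamma> x\<bar> \<partial>lborel) \<le> (\<integral>x. \<bar>J (tseq n) (G \<gamma>) x - G \<gamma> x\<bar> \<partial>lborel) + (1 - tseq n ^ ?j) * ?I" for n
  proof -
    let ?t = "tseq n ^ ?j"
    have t: "0 \<le> ?t" "?t \<le> 1" using tseq[of n] by (auto intro: power_le_one)
    note i = J_integrable[OF tseq(2,3) G[OF \<gamma>], of n] G[OF \<gamma>]
    have "(\<integral>x. \<bar>W n \<gamma> x - G \<gamma> x\<bar> \<partial>lborel) \<le> (\<integral>x. \<bar>J (tseq n) (G \<gamma>) x - G \<gamma> x\<bar> + (1 - ?t) * \<bar>G \<gamma> x\<bar> \<partial>lborel)"
    proof (rule integral_mono)
      show "integrable lborel (\<lambda>x. \<bar>W n \<gamma> x - G \<gamma> x\<bar>)" using W_integrable[OF \<gamma>, of n] i by simp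
      show "integrable lborel (\<lambda>x. \<bar>J (tseq n) (G \<gamma>) x - G \<gamma> x\<bar> + (1 - ?t) * \<bar>G \<gamma> x\<bar>)" using i by simp
      fix x
      have "W n \<gamma> x - G \<gamma> x = ?t * (J (tseq n) (G \<gamma>) x - G \<gamma> x) - (1 - ?t) * G \<gamma> x"
        by (simp add: W_def algebra_simps)
      then have "\<bar>W n \<gamma> x - G \<gamma> x\<bar> \<le> \<bar>?t * (J (tseq n) (G \<gamma>) x - G \<gamma> x)\<bar> + \<bar>(1 - ?t) * G \<gamma> x\<bar>"
        using abs_triangle_ineq4[of "?t * (J (tseq n) (G \<gamma>) x - G \<gamma> x)" "(1 - ?t) * G \<gamma> x"] by simp
      also have "\<dots> \<le> \<bar>J (tseq n) (G \<gamma>) x - G \<gamma> x\<bar> + (1 - ?t) * \<bar>G \<gamma> x\<bar>"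
        using t by (simp add: abs_mult mult_left_le_one_le)
      finally show "\<bar>W n \<gamma> x - G \<gamma> x\<bar> \<le> \<bar>J (tseq n) (G \<gamma>) x - G \<gamma> x\<bar> + (1 - ?t) * \<bar>G \<gamma> x\<bar>" .
    qed
    also have "\<dots> = (\<integral>x. \<bar>J (tseq n) (G \<gamma>) x - G \<gamma> x\<bar> \<partial>lborel) + (1 - ?t) * ?I" using i by simp
    finally show ?thesis .
  qed
  then show "\<forall>\<^sub>F n in sequentially. (\<integral>x. \<bar>W n \<gamma> x - G \<gamma> x\<bar> \<partial>lborel) \<le> (\<integral>x. \<bar>J (tseq n) (G \<gamma>) x - G \<gamma> x\<bar> \<partial>lborel) + (1 - tseq n ^ ?j) * ?I"
    by simp
qed simp

lemma W_subseq:
  assumes \<gamma>: "mi_order \<gamma> \<le> k + 1"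
  obtains r where "strict_mono r" "AE x in lborel. (\<lambda>n. W (r n) \<gamma> x) \<longlonglongrightarrow> G \<gamma> x"
proof -
  have i: "integrable lborel (\<lambda>x. W n \<gamma> x - G \<gamma> x)" for n using W_integrable[OF \<gamma>] G[OF \<gamma>] by simp
  have l: "(\<lambda>n. \<integral>x. norm (W n \<gamma> x - G \<gamma> x) \<partial>lborel) \<longlonglongrightarrow> 0" using W_tendsto[OF \<gamma>] by simp
  obtain r :: "nat \<Rightarrow> nat" where r: "strict_mono r" "AE x in lborel. (\<lambda>n. W (r n) \<gamma> x - G \<gamma> x) \<longlonglongrightarrow> 0"
    using tendsto_L1_AE_subseq[OF i l] by blast
  have "AE x in lborel. (\<lambda>n. W (r n) \<gamma> x) \<longlonglongrightarrow> G \<gamma> x"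
    using r(2) by eventually_elim (simp add: LIM_zero_cancel)
  then show ?thesis using that r(1) by blast
qed

lemma K_measurable [measurable]: "K \<in> sets borel" "\<Omega> \<in> sets borel"
  using compact_imp_closed[OF closed_triangle_props(1)[OF nc]] by (auto simp: borel_closed)

text \<open>Since k + 1 is at least 2, all derivatives of order at most 2 converge in L^1 after
  regularization; the embedding turns this into a bound uniform on \<open>K\<close>.\<close>

lemma V_Cauchy_bound:
  "\<exists>A. A \<longlonglongrightarrow> 0 \<and> (\<forall>n m. \<forall>y\<in>K. \<bar>V n y - V m y\<bar> \<le> A n + A m)"
proof -
  obtain C where C: "0 \<le> C" "\<And>F y. smooth F \<Longrightarrow> y \<in> K \<Longrightarrow>
    qpow 1 (F y) \<le> ennreal C * low_sum 2 (\<lambda>\<gamma>. tri_integral x1 x2 x3 (\<lambda>x. qpow 1 (multi_partial \<gamma> F x)))"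
    using sup_bound[OF nc] by blast
  define a where "a n \<gamma> = (\<integral>x. \<bar>W n \<gamma> x - G \<gamma> x\<bar> \<partial>lborel)" for n \<gamma>
  have a0: "0 \<le> a n \<gamma>" for n \<gamma> by (simp add: a_def)
  let ?L = "{\<gamma>. mi_order \<gamma> \<le> 2}"
  define A where "A n = C * (\<Sum>\<gamma>\<in>?L. a n \<gamma>)" for n
  have le2: "mi_order \<gamma> \<le> k + 1" if "\<gamma> \<in> ?L" for \<gamma> using that k by simp
  have "A \<longlonglongrightarrow> C * (\<Sum>\<gamma>\<in>?L. 0)"
    unfolding A_def[abs_def] a_def by (intro tendsto_intros W_tendsto le2)
  then have A: "A \<longlonglongrightarrow> 0" by simp
  have "\<bar>V n y - V m y\<bar> \<le> A n + A m" if y: "y \<in> K" for n m y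
  proof -
    have s: "smooth (\<lambda>x. V n x - V m x)" by (intro smooth_minus V_smooth)
    have b: "tri_integral x1 x2 x3 (\<lambda>x. qpow 1 (multi_partial \<gamma> (\<lambda>x. V n x - V m x) x)) \<le> ennreal (a n \<gamma> + a m \<gamma>)"
      if \<gamma>: "\<gamma> \<in> ?L" for \<gamma>
    proof -
      note i = W_integrable[OF le2[OF \<gamma>]] G[OF le2[OF \<gamma>]]
      have "multi_partial \<gamma> (\<lambda>x. V n x - V m x) x = W n \<gamma> x - W m \<gamma> x" if "x \<in> K" for x
      proof -
        have "multi_partial \<gamma> (\<lambda>x. V n x - V m x) x = multi_partial \<gamma> (V n) x - multi_partial \<gamma> (V m) x"
          by (simp add: multi_partial_eq dird_funpow_minus V_smooth smooth_dird_funpow)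
        then show ?thesis using V_partial[OF le2[OF \<gamma>] that] by simp
      qed
      then have "tri_integral x1 x2 x3 (\<lambda>x. qpow 1 (multi_partial \<gamma> (\<lambda>x. V n x - V m x) x))
         \<le> (\<integral>\<^sup>+x. ennreal (\<bar>W n \<gamma> x - G \<gamma> x\<bar> + \<bar>W m \<gamma> x - G \<gamma> x\<bar>) \<partial>lborel)"
        unfolding tri_integral_def qpow_def
        by (intro nn_integral_mono) (auto split: split_indicator intro!: ennreal_leI simp del: ennreal_plus)
      also have "\<dots> = ennreal (\<integral>x. \<bar>W n \<gamma> x - G \<gamma> x\<bar> + \<bar>W m \<gamma> x - G \<gamma> x\<bar> \<partial>lborel)"
        using i by (intro nn_integral_eq_integral) auto
      also have "\<dots> = ennreal (a n \<gamma> + a m \<gamma>)" unfolding a_def using i by simp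
      finally show ?thesis .
    qed
    have "qpow 1 (V n y - V m y) \<le> ennreal C * low_sum 2 (\<lambda>\<gamma>. tri_integral x1 x2 x3 (\<lambda>x. qpow 1 (multi_partial \<gamma> (\<lambda>x. V n x - V m x) x)))"
      using C(2)[OF s y] .
    also have "\<dots> \<le> ennreal C * (\<Sum>\<gamma>\<in>?L. ennreal (a n \<gamma> + a m \<gamma>))"
      unfolding low_sum_def by (intro mult_left_mono sum_mono b) auto
    also have "\<dots> = ennreal C * ennreal (\<Sum>\<gamma>\<in>?L. a n \<gamma> + a m \<gamma>)"
      using a0 by (subst sum_ennreal) auto
    also have "\<dots> = ennreal (C * (\<Sum>\<gamma>\<in>?L. a n \<gamma> + a m \<gamma>))"
      using C(1) a0 by (intro ennreal_mult[symmetric] sum_nonneg) auto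
    also have "C * (\<Sum>\<gamma>\<in>?L. a n \<gamma> + a m \<gamma>) = A n + A m"
      by (simp add: A_def sum.distrib distrib_left)
    finally have "ennreal \<bar>V n y - V m y\<bar> \<le> ennreal (A n + A m)" by (simp add: qpow_def)
    moreover have "0 \<le> A n + A m" unfolding A_def using C(1) a0 by (intro add_nonneg_nonneg mult_nonneg_nonneg sum_nonneg) auto
    ultimately show ?thesis by (simp add: ennreal_le_iff)
  qed
  then show ?thesis using A by blast
qed

text \<open>The regularizations are uniformly Cauchy on the closed triangle, so their limit is
  continuous up to the boundary. A subsequence converging almost everywhere identifies it with
  \<open>G (0, 0)\<close>.\<close>

lemma continuous_limit:
  "\<exists>u. continuous_on K u \<and> (AE x in lborel. x \<in> \<Omega> \<longrightarrow> u x = G (0, 0) x) \<and> (\<forall>y\<in>K. (\<lambda>n. V n y) \<longlonglongrightarrow> u y)"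
proof -
  obtain A where A: "A \<longlonglongrightarrow> 0" "\<And>n m y. y \<in> K \<Longrightarrow> \<bar>V n y - V m y\<bar> \<le> A n + A m"
    using V_Cauchy_bound by blast
  have "Cauchy (\<lambda>n. V n y)" if y: "y \<in> K" for y
  proof (rule metric_CauchyI)
    fix e :: real assume "0 < e"
    then obtain N where N: "\<And>n. n \<ge> N \<Longrightarrow> norm (A n - 0) < e / 2"
      using LIMSEQ_D[OF A(1), of "e / 2"] by auto
    have "dist (V m y) (V n y) < e" if "m \<ge> N" "n \<ge> N" for m n
      using A(2)[OF y, of m n] N[OF that(1)] N[OF that(2)] by (simp add: dist_real_def)
    then show "\<exists>M. \<forall>m\<ge>M. \<forall>n\<ge>M. dist (V m y) (V n y) < e" by blast
  qed
  then have "\<forall>y\<in>K. \<exists>l. (\<lambda>n. V n y) \<longlonglongrightarrow> l"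
    by (simp add: Cauchy_convergent_iff convergent_def)
  from bchoice[OF this] obtain u where u: "\<And>y. y \<in> K \<Longrightarrow> (\<lambda>n. V n y) \<longlonglongrightarrow> u y" by blast
  have unif: "uniform_limit K V u sequentially"
    unfolding uniform_limit_sequentially_iff
  proof (intro allI impI)
    fix e :: real assume "0 < e"
    then obtain N where N: "\<And>n. n \<ge> N \<Longrightarrow> norm (A n - 0) < e"
      using LIMSEQ_D[OF A(1), of e] by auto
    have "dist (V n y) (u y) < e" if n: "n \<ge> N" and y: "y \<in> K" for n y
    proof -
      have "(\<lambda>m. \<bar>V n y - V m y\<bar>) \<longlonglongrightarrow> \<bar>V n y - u y\<bar>" by (intro tendsto_intros u y)
      moreover have "(\<lambda>m. A n + A m) \<longlonglongrightarrow> A n + 0" by (intro tendsto_intros A)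
      ultimately have "\<bar>V n y - u y\<bar> \<le> A n + 0"
        by (rule LIMSEQ_le) (use A(2)[OF y] in auto)
      then show ?thesis using N[OF n] by (simp add: dist_real_def)
    qed
    then show "\<exists>N. \<forall>n\<ge>N. \<forall>x\<in>K. dist (V n x) (u x) < e" by blast
  qed
  have cont: "continuous_on K u"
    by (rule uniform_limit_theorem[OF _ unif]) (auto intro!: always_eventually smooth_continuous V_smooth)
  have o0: "mi_order (0, 0) \<le> k + 1" by (simp add: mi_order_def)
  obtain r where r: "strict_mono r" "AE x in lborel. (\<lambda>n. W (r n) (0, 0) x) \<longlonglongrightarrow> G (0, 0) x"
    using W_subseq[OF o0] by blast
  have "AE x in lborel. x \<in> \<Omega> \<longrightarrow> u x = G (0, 0) x"
    using r(2)
  proof eventually_elim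
    case (elim x)
    show ?case
    proof
      assume "x \<in> \<Omega>"
      then have x: "x \<in> K" using interior_subset by blast
      have "(\<lambda>n. V (r n) x) \<longlonglongrightarrow> u x"
        using LIMSEQ_subseq_LIMSEQ[OF u[OF x] r(1)] by (simp add: comp_def)
      moreover have "V (r n) x = W (r n) (0, 0) x" for n by (simp add: V_def W_def mi_order_def)
      ultimately show "u x = G (0, 0) x" using elim LIMSEQ_unique by simp
    qed
  qed
  then show ?thesis using cont u by blast
qed

lemma qpow_tendsto:
  assumes "1 \<le> q" "f \<longlonglongrightarrow> a"
  shows "(\<lambda>n. qpow q (f n)) \<longlonglongrightarrow> qpow q a"
  unfolding qpow_def using assms
  by (intro tendsto_ennrealI tendsto_powr' tendsto_rabs tendsto_const) auto

text \<open>On the right side of the estimate it is enough to bound the regularized derivatives by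
  the original ones. Jensen gives this up to the Jacobian, which tends to 1.\<close>

lemma W_qpow_bound:
  assumes q: "1 \<le> q" and \<gamma>: "mi_order \<gamma> \<le> k + 1"
  shows "ennreal ((tseq n)\<^sup>2) * tri_integral x1 x2 x3 (\<lambda>x. qpow q (multi_partial \<gamma> (V n) x)) \<le> (\<integral>\<^sup>+x. qpow q (G \<gamma> x) \<partial>lborel)"
proof -
  have "tri_integral x1 x2 x3 (\<lambda>x. qpow q (multi_partial \<gamma> (V n) x)) \<le> (\<integral>\<^sup>+x. qpow q (J (tseq n) (G \<gamma>) x) \<partial>lborel)"
    unfolding tri_integral_def
  proof (rule nn_integral_mono)
    fix x
    show "qpow q (multi_partial \<gamma> (V n) x) * indicator K x \<le> qpow q (J (tseq n) (G \<gamma>) x)"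
    proof (cases "x \<in> K")
      case True
      have "\<bar>W n \<gamma> x\<bar> \<le> \<bar>J (tseq n) (G \<gamma>) x\<bar>"
        unfolding W_def abs_mult using tseq[of n]
        by (intro mult_left_le_one_le) (auto intro: power_le_one)
      then have "qpow q (W n \<gamma> x) \<le> qpow q (J (tseq n) (G \<gamma>) x)" using q by (intro qpow_mono) auto
      then show ?thesis using V_partial[OF \<gamma> True] True by simp
    qed simp
  qed
  then have "ennreal ((tseq n)\<^sup>2) * tri_integral x1 x2 x3 (\<lambda>x. qpow q (multi_partial \<gamma> (V n) x))
    \<le> ennreal ((tseq n)\<^sup>2) * (\<integral>\<^sup>+x. qpow q (J (tseq n) (G \<gamma>) x) \<partial>lborel)" by (rule mult_left_mono) simp
  also have "\<dots> \<le> (\<integral>\<^sup>+x. qpow q (G \<gamma> x) \<partial>lborel)"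
    by (rule nn_integral_qpow_J[OF q tseq(2,3) G[OF \<gamma>]])
  finally show ?thesis .
qed

lemma multi_partial_minus: "smooth f \<Longrightarrow> smooth g \<Longrightarrow> multi_partial \<gamma> (\<lambda>x. f x - g x) = (\<lambda>x. multi_partial \<gamma> f x - multi_partial \<gamma> g x)"
  by (simp add: multi_partial_eq dird_funpow_minus smooth_dird_funpow)

text \<open>Fatou's lemma on the left side and \<open>W_qpow_bound\<close> on the right, so
  convergence in L^q does not have to be shown. The polynomials converge because their node values
  do.\<close>

lemma estimate_normalized:
  assumes h: "dist x1 x2 \<le> dist x2 x3" "dist x3 x1 \<le> dist x2 x3" and q: "1 \<le> q"
    and u: "\<And>y. y \<in> K \<Longrightarrow> (\<lambda>n. V n y) \<longlonglongrightarrow> u y"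
    and \<delta>: "mi_order \<delta> = m" "m \<le> k"
  shows "(\<integral>\<^sup>+x. qpow q (G \<delta> x - multi_partial \<delta> (lagrange_interp k x1 x2 x3 u) x) * indicator \<Omega> x \<partial>lborel)
    \<le> qpow q (interp_const k * (circumradius x1 x2 x3 / dist x2 x3) ^ m * dist x2 x3 ^ (k + 1 - m)) *
      top_sum (k + 1) (\<lambda>\<gamma>. \<integral>\<^sup>+x. qpow q (G \<gamma> x) \<partial>lborel)"
proof -
  let ?Q = "qpow q (interp_const k * (circumradius x1 x2 x3 / dist x2 x3) ^ m * dist x2 x3 ^ (k + 1 - m))"
  let ?N = "lagrange_nodes k x1 x2 x3"
  let ?P = "lagrange_interp k x1 x2 x3"
  have \<delta>k: "mi_order \<delta> \<le> k + 1" using \<delta> by simp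
  obtain l where l: "\<And>y. y \<in> ?N \<Longrightarrow> l y \<in> poly_space k"
    "\<And>f. ?P f = (\<lambda>x. \<Sum>y\<in>?N. f y * l y x)" "\<And>f y. y \<in> ?N \<Longrightarrow> ?P f y = f y"
    using lagrange_interp_basis[OF nc k] by blast
  have Ppoly: "?P f \<in> poly_space k" for f unfolding l(2) by (intro poly_space_sum poly_space_cmult l(1))
  have Psm: "smooth (?P f)" for f by (rule poly_space_smooth[OF Ppoly])
  have Pd: "multi_partial \<delta> (?P f) x = (\<Sum>y\<in>?N. f y * multi_partial \<delta> (l y) x)" for f x
  proof -
    have s: "smooth (l y)" if "y \<in> ?N" for y by (rule poly_space_smooth[OF l(1)[OF that]])
    show ?thesis
      unfolding l(2) multi_partial_eq
      using s by (simp add: dird_funpow_sum dird_funpow_cmult smooth_dird_funpow smooth_cmult cong: sum.cong)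
  qed
  have Plim: "(\<lambda>n. multi_partial \<delta> (?P (V n)) x) \<longlonglongrightarrow> multi_partial \<delta> (?P u) x" for x
    unfolding Pd using lagrange_nodes_subset[OF k, of x1 x2 x3]
    by (intro tendsto_sum tendsto_mult u tendsto_const) auto
  obtain r where r: "strict_mono r" "AE x in lborel. (\<lambda>n. W (r n) \<delta> x) \<longlonglongrightarrow> G \<delta> x"
    using W_subseq[OF \<delta>k] by blast
  \<comment> \<open>The squared \<open>tseq\<close> compensates the Jacobian in
    \<open>W_qpow_bound\<close>; it tends to 1 and leaves the limit unchanged.\<close>
  define f where "f n x = ennreal ((tseq (r n))\<^sup>2) * (qpow q (multi_partial \<delta> (\<lambda>x. V (r n) x - ?P (V (r n)) x) x) * indicator \<Omega> x)" for n x
  have sm: "smooth (\<lambda>x. V n x - ?P (V n) x)" for n by (intro smooth_minus V_smooth Psm)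
  have fm [measurable]: "f n \<in> borel_measurable lborel" for n
  proof -
    have [measurable]: "multi_partial \<delta> (\<lambda>x. V (r n) x - ?P (V (r n)) x) \<in> borel_measurable borel"
      by (intro smooth_borel smooth_multi_partial sm)
    show ?thesis unfolding f_def[abs_def] by measurable
  qed
  have tr: "(\<lambda>n. tseq (r n)) \<longlonglongrightarrow> 1"
    using LIMSEQ_subseq_LIMSEQ[OF tseq_lim r(1)] by (simp add: comp_def)
  have lim: "AE x in lborel. (\<lambda>n. f n x) \<longlonglongrightarrow> qpow q (G \<delta> x - multi_partial \<delta> (?P u) x) * indicator \<Omega> x"
    using r(2)
  proof eventually_elim
    case (elim x)
    show ?case
    proof (cases "x \<in> \<Omega>")
      case True
      then have x: "x \<in> K" using interior_subset by blast
      have "multi_partial \<delta> (\<lambda>x. V (r n) x - ?P (V (r n)) x) x = W (r n) \<delta> x - multi_partial \<delta> (?P (V (r n))) x" for n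
        using V_partial[OF \<delta>k x] by (simp add: multi_partial_minus[OF V_smooth Psm])
      moreover have "(\<lambda>n. multi_partial \<delta> (?P (V (r n))) x) \<longlonglongrightarrow> multi_partial \<delta> (?P u) x"
        using LIMSEQ_subseq_LIMSEQ[OF Plim r(1)] by (simp add: comp_def)
      ultimately have "(\<lambda>n. multi_partial \<delta> (\<lambda>x. V (r n) x - ?P (V (r n)) x) x) \<longlonglongrightarrow> G \<delta> x - multi_partial \<delta> (?P u) x"
        using elim by (simp add: tendsto_diff)
      from qpow_tendsto[OF q this]
      have 1: "(\<lambda>n. qpow q (multi_partial \<delta> (\<lambda>x. V (r n) x - ?P (V (r n)) x) x)) \<longlonglongrightarrow> qpow q (G \<delta> x - multi_partial \<delta> (?P u) x)" .
      have "(\<lambda>n. (tseq (r n))\<^sup>2) \<longlonglongrightarrow> 1\<^sup>2" by (intro tendsto_intros tr)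
      then have 2: "(\<lambda>n. ennreal ((tseq (r n))\<^sup>2)) \<longlonglongrightarrow> ennreal (1\<^sup>2)" by (rule tendsto_ennrealI)
      have "(\<lambda>n. ennreal ((tseq (r n))\<^sup>2) * qpow q (multi_partial \<delta> (\<lambda>x. V (r n) x - ?P (V (r n)) x) x))
         \<longlonglongrightarrow> ennreal (1\<^sup>2) * qpow q (G \<delta> x - multi_partial \<delta> (?P u) x)"
        by (rule tendsto_mult_ennreal[OF 2 1]) (simp add: qpow_def)
      then show ?thesis using True by (simp add: f_def)
    qed (simp add: f_def)
  qed
  have cross: "cross2 (x2 - x1) (x3 - x1) \<noteq> 0" by (rule cross2_nonzero[OF nc])
  obtain c where c: "c > 0" "\<And>\<phi>. \<phi> \<in> borel_measurable borel \<Longrightarrow>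
      tri_integral x1 x2 x3 \<phi> = ennreal c * tri_int (\<lambda>z. \<phi> (tri_map x1 (x2 - x1) (x3 - x1) z))"
    using tri_map_change_of_variables[OF cross] unfolding tri_integral_def tri_map_image[symmetric] by blast
  have sc: "tri_integral x1 x2 x3 (\<lambda>x. qpow q (g x)) = ennreal c * tri_int (\<lambda>z. qpow q (g (tri_map x1 (x2 - x1) (x3 - x1) z)))"
    if "smooth g" for g
  proof -
    have [measurable]: "g \<in> borel_measurable borel" using that by (rule smooth_borel)
    show ?thesis by (rule c(2)) measurable
  qed
  have fint: "(\<integral>\<^sup>+x. f n x \<partial>lborel) \<le> ?Q * top_sum (k + 1) (\<lambda>\<gamma>. \<integral>\<^sup>+x. qpow q (G \<gamma> x) \<partial>lborel)" for n
  proof -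
    let ?n = "r n"
    let ?e = "\<lambda>x. V ?n x - ?P (V ?n) x"
    have [measurable]: "multi_partial \<delta> ?e \<in> borel_measurable borel"
      by (intro smooth_borel smooth_multi_partial sm)
    have "(\<integral>\<^sup>+x. f n x \<partial>lborel) = ennreal ((tseq ?n)\<^sup>2) * (\<integral>\<^sup>+x. qpow q (multi_partial \<delta> ?e x) * indicator \<Omega> x \<partial>lborel)"
      unfolding f_def by (rule nn_integral_cmult) measurable
    also have "\<dots> \<le> ennreal ((tseq ?n)\<^sup>2) * tri_integral x1 x2 x3 (\<lambda>x. qpow q (multi_partial \<delta> ?e x))"
      unfolding tri_integral_def using interior_subset[of K]
      by (intro mult_left_mono nn_integral_mono) (auto split: split_indicator)
    also have "\<dots> \<le> ennreal ((tseq ?n)\<^sup>2) * (?Q * top_sum (k + 1) (\<lambda>\<gamma>. tri_integral x1 x2 x3 (\<lambda>x. qpow q (multi_partial \<gamma> (V ?n) x))))"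
    proof (rule mult_left_mono)
      \<comment> \<open>The Jacobian \<open>c\<close> is pulled out on both sides of the estimate on
        the reference triangle.\<close>
      have "tri_integral x1 x2 x3 (\<lambda>x. qpow q (multi_partial \<delta> ?e x))
        = ennreal c * tri_int (\<lambda>z. qpow q (multi_partial \<delta> ?e (tri_map x1 (x2 - x1) (x3 - x1) z)))"
        by (intro sc smooth_multi_partial sm)
      also have "\<dots> \<le> ennreal c * (?Q * top_sum (k + 1) (\<lambda>\<gamma>. tri_int (\<lambda>z. qpow q (multi_partial \<gamma> (V ?n) (tri_map x1 (x2 - x1) (x3 - x1) z)))))"
        by (intro mult_left_mono smooth_estimate[OF q k nc h V_smooth Ppoly l(3) \<delta>]) auto
      also have "\<dots> = ?Q * top_sum (k + 1) (\<lambda>\<gamma>. tri_integral x1 x2 x3 (\<lambda>x. qpow q (multi_partial \<gamma> (V ?n) x)))"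
        by (simp only: sc[OF smooth_multi_partial[OF V_smooth]] top_sum_def sum_distrib_left mult.left_commute)
      finally show "tri_integral x1 x2 x3 (\<lambda>x. qpow q (multi_partial \<delta> ?e x))
        \<le> ?Q * top_sum (k + 1) (\<lambda>\<gamma>. tri_integral x1 x2 x3 (\<lambda>x. qpow q (multi_partial \<gamma> (V ?n) x)))" .
    qed simp
    also have "\<dots> = ?Q * top_sum (k + 1) (\<lambda>\<gamma>. ennreal ((tseq ?n)\<^sup>2) * tri_integral x1 x2 x3 (\<lambda>x. qpow q (multi_partial \<gamma> (V ?n) x)))"
      by (simp only: top_sum_def sum_distrib_left mult.left_commute)
    also have "\<dots> \<le> ?Q * top_sum (k + 1) (\<lambda>\<gamma>. \<integral>\<^sup>+x. qpow q (G \<gamma> x) \<partial>lborel)"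
      unfolding top_sum_def by (intro mult_left_mono sum_mono W_qpow_bound q) auto
    finally show ?thesis .
  qed
  have "(\<integral>\<^sup>+x. qpow q (G \<delta> x - multi_partial \<delta> (?P u) x) * indicator \<Omega> x \<partial>lborel) = (\<integral>\<^sup>+x. liminf (\<lambda>n. f n x) \<partial>lborel)"
  proof (rule nn_integral_cong_AE)
    show "AE x in lborel. qpow q (G \<delta> x - multi_partial \<delta> (?P u) x) * indicator \<Omega> x = liminf (\<lambda>n. f n x)"
      using lim by eventually_elim (simp add: lim_imp_Liminf)
  qed
  also have "\<dots> \<le> liminf (\<lambda>n. \<integral>\<^sup>+x. f n x \<partial>lborel)"
    by (rule nn_integral_liminf) (rule fm)
  also have "\<dots> \<le> liminf (\<lambda>n. ?Q * top_sum (k + 1) (\<lambda>\<gamma>. \<integral>\<^sup>+x. qpow q (G \<gamma> x) \<partial>lborel))"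
    by (rule Liminf_mono) (use fint in auto)
  also have "\<dots> = ?Q * top_sum (k + 1) (\<lambda>\<gamma>. \<integral>\<^sup>+x. qpow q (G \<gamma> x) \<partial>lborel)"
    by (rule Liminf_const) simp
  finally show ?thesis .
qed

end

section \<open>Independence of the numbering of the vertices\<close>

lemma insert3_rotate: "{x2, x3, x1} = {x1, x2, x3}"
  by auto

lemma circumradius_rotate: "circumradius x2 x3 x1 = circumradius x1 x2 x3"
proof -
  have "(\<exists>c. dist c x2 = r \<and> dist c x3 = r \<and> dist c x1 = r) \<longleftrightarrow> (\<exists>c. dist c x1 = r \<and> dist c x2 = r \<and> dist c x3 = r)" for r
    by (simp only: conj_ac)
  then show ?thesis by (simp only: circumradius_def)
qed

lemma lagrange_nodes_rotate: "lagrange_nodes k x2 x3 x1 = lagrange_nodes k x1 x2 x3"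
proof -
  have sub: "lagrange_nodes k y2 y3 y1 \<subseteq> lagrange_nodes k y1 y2 y3" for y1 y2 y3
  proof
    fix x assume "x \<in> lagrange_nodes k y2 y3 y1"
    then obtain a b c where x: "x = (real a / real k) *\<^sub>R y2 + (real b / real k) *\<^sub>R y3 + (real c / real k) *\<^sub>R y1"
      and s: "a + b + c = k" unfolding lagrange_nodes_def by blast
    show "x \<in> lagrange_nodes k y1 y2 y3"
      unfolding lagrange_nodes_def x
      by (rule CollectI, rule exI[of _ c], rule exI[of _ a], rule exI[of _ b]) (use s in simp)
  qed
  show ?thesis
    by (rule subset_antisym[OF sub order.trans[OF sub sub]])
qed

lemma lagrange_interp_rotate: "lagrange_interp k x2 x3 x1 f = lagrange_interp k x1 x2 x3 f"
  unfolding lagrange_interp_def lagrange_nodes_rotate[of k x2 x3 x1] ..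

lemma longest_edge_rotate: "longest_edge x2 x3 x1 = longest_edge x1 x2 x3"
  unfolding longest_edge_def insert3_rotate[of "dist x2 x3" "dist x3 x1" "dist x1 x2"] ..

lemma longest_edge_eq:
  "dist x1 x2 \<le> dist x2 x3 \<Longrightarrow> dist x3 x1 \<le> dist x2 x3 \<Longrightarrow> longest_edge x1 x2 x3 = dist x2 x3"
  by (simp add: longest_edge_def)

lemma (in sobolev_data) rotate: "sobolev_data x2 x3 x1 k G \<eta>"
proof (rule sobolev_data.intro, unfold closed_triangle_rotate[of x2 x3 x1] closed_triangle_rotate[of x3 x1 x2])
  show "\<not> collinear {x2, x3, x1}" by (rule not_collinear_rotate[OF nc])
  show "1 \<le> k" by (rule k)
  show "integrable lborel (G \<gamma>)" if "mi_order \<gamma> \<le> k + 1" for \<gamma> by (rule G[OF that])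
  show "borel_weak_deriv \<Omega> \<gamma> (G (0, 0)) (G \<gamma>)" if "mi_order \<gamma> \<le> k + 1" for \<gamma> by (rule weak[OF that])
  show "mollifier \<Omega> \<eta>" by (rule mollifier)
qed

text \<open>The regularizations depend on \<open>G\<close> and \<open>\<eta>\<close> only, so they
  stay the same under a rotation of the vertices. The normalized estimate can be used for the
  rotation that puts the first vertex opposite to the longest edge.\<close>

lemma (in sobolev_data) estimate:
  assumes q: "1 \<le> q"
    and u: "\<And>y. y \<in> K \<Longrightarrow> (\<lambda>n. V n y) \<longlonglongrightarrow> u y"
    and \<delta>: "mi_order \<delta> = m" "m \<le> k"
  shows "(\<integral>\<^sup>+x. qpow q (G \<delta> x - multi_partial \<delta> (lagrange_interp k x1 x2 x3 u) x) * indicator \<Omega> x \<partial>lborel)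
    \<le> qpow q (interp_const k * (circumradius x1 x2 x3 / longest_edge x1 x2 x3) ^ m * longest_edge x1 x2 x3 ^ (k + 1 - m)) *
      top_sum (k + 1) (\<lambda>\<gamma>. \<integral>\<^sup>+x. qpow q (G \<gamma> x) \<partial>lborel)"
proof -
  interpret r1: sobolev_data x2 x3 x1 k G \<eta> by (rule rotate)
  interpret r2: sobolev_data x3 x1 x2 k G \<eta> by (rule r1.rotate)
  have K1: "closed_triangle x2 x3 x1 = K" by (rule closed_triangle_rotate)
  have K2: "closed_triangle x3 x1 x2 = K" unfolding closed_triangle_rotate[of x3 x1 x2] by (rule K1)
  have c1: "circumradius x2 x3 x1 = circumradius x1 x2 x3" by (rule circumradius_rotate)
  have c2: "circumradius x3 x1 x2 = circumradius x1 x2 x3" unfolding circumradius_rotate[of x3 x1 x2] by (rule c1)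
  have l1: "longest_edge x2 x3 x1 = longest_edge x1 x2 x3" by (rule longest_edge_rotate)
  have l2: "longest_edge x3 x1 x2 = longest_edge x1 x2 x3" unfolding longest_edge_rotate[of x3 x1 x2] by (rule l1)
  have i1: "lagrange_interp k x2 x3 x1 u = lagrange_interp k x1 x2 x3 u" by (rule lagrange_interp_rotate)
  have i2: "lagrange_interp k x3 x1 x2 u = lagrange_interp k x1 x2 x3 u" unfolding lagrange_interp_rotate[of k x3 x1 x2] by (rule i1)
  consider "dist x1 x2 \<le> dist x2 x3" "dist x3 x1 \<le> dist x2 x3"
    | "dist x2 x3 \<le> dist x3 x1" "dist x1 x2 \<le> dist x3 x1"
    | "dist x3 x1 \<le> dist x1 x2" "dist x2 x3 \<le> dist x1 x2"
    by linarith
  then show ?thesis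
  proof cases
    case 1
    show ?thesis unfolding longest_edge_eq[OF 1] by (rule estimate_normalized[OF 1 q u \<delta>])
  next
    case 2
    have e: "longest_edge x1 x2 x3 = dist x3 x1" using longest_edge_eq[OF 2] l1 by simp
    show ?thesis
      unfolding e using r1.estimate_normalized[OF 2 q _ \<delta>, of u] u unfolding K1 c1 i1 by blast
  next
    case 3
    have e: "longest_edge x1 x2 x3 = dist x1 x2" using longest_edge_eq[OF 3] l2 by simp
    show ?thesis
      unfolding e using r2.estimate_normalized[OF 3 q _ \<delta>, of u] u unfolding K2 c2 i2 by blast
  qed
qed

section \<open>Sobolev functions and their norms\<close>

lemma borel_version_integrable:
  assumes \<Omega>: "\<Omega> \<in> sets borel" and f: "borel_version \<Omega> u f"
  shows "set_integrable lebesgue \<Omega> u"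
proof -
  have \<Omega>l: "\<Omega> \<in> sets lebesgue" using \<Omega> by simp
  have fi: "integrable lborel f" using f by (simp add: borel_version_def)
  then have fb: "f \<in> borel_measurable lborel" by simp
  have fl: "integrable lebesgue f" using fi by (simp add: integrable_completion)
  have um: "(\<lambda>x. indicator \<Omega> x *\<^sub>R u x) \<in> borel_measurable lebesgue"
    using borel_version_measurable[OF \<Omega> f] \<Omega>l by (simp add: borel_measurable_restrict_space_iff)
  have "AE x in lborel. x \<in> \<Omega> \<longrightarrow> f x = u x" using f by (simp add: borel_version_def)
  then have "AE x in lborel. f x = indicator \<Omega> x *\<^sub>R u x"
    by eventually_elim (use f in \<open>auto simp: borel_version_def split: split_indicator\<close>)
  then have "AE x in lebesgue. f x = indicator \<Omega> x *\<^sub>R u x" by (rule AE_completion)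
  then have "integrable lebesgue (\<lambda>x. indicator \<Omega> x *\<^sub>R u x)"
    by (rule integrable_cong_AE_imp[OF fl um, rotated])
  then show ?thesis by (simp add: set_integrable_def)
qed

lemma set_integrable_imp_locally_integrable:
  assumes "set_integrable lebesgue \<Omega> u"
  shows "locally_integrable \<Omega> u"
  unfolding locally_integrable_def
proof (intro allI impI)
  fix S assume S: "compact S \<and> S \<subseteq> \<Omega>"
  then have "S \<in> sets lebesgue" by (simp add: compact_imp_closed borel_closed)
  then show "set_integrable lebesgue S u" using assms S set_integrable_subset by blast
qed

lemma borel_version_smooth:
  assumes \<Omega>: "open \<Omega>" "bounded \<Omega>" and P: "smooth P"
  shows "borel_version \<Omega> P (\<lambda>x. indicator \<Omega> x * P x)"
proof -
  have c: "compact (closure \<Omega>)" using \<Omega>(2) by (simp add: compact_closure)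
  have i: "integrable lborel (\<lambda>x. indicator (closure \<Omega>) x *\<^sub>R P x)"
    by (rule borel_integrable_compact[OF c smooth_continuous[OF P]])
  have "integrable lborel (\<lambda>x. indicator \<Omega> x *\<^sub>R (indicator (closure \<Omega>) x *\<^sub>R P x))"
    by (rule integrable_mult_indicator[OF _ i]) (use \<Omega> in simp)
  also have "(\<lambda>x. indicator \<Omega> x *\<^sub>R (indicator (closure \<Omega>) x *\<^sub>R P x)) = (\<lambda>x. indicator \<Omega> x * P x)"
    using closure_subset[of \<Omega>] by (auto simp: fun_eq_iff split: split_indicator)
  finally show ?thesis by (auto simp: borel_version_def)
qed

lemma borel_version_minus:
  assumes "borel_version \<Omega> u f" "borel_version \<Omega> w g"
  shows "borel_version \<Omega> (\<lambda>x. u x - w x) (\<lambda>x. f x - g x)"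
proof -
  have "AE x in lborel. x \<in> \<Omega> \<longrightarrow> f x = u x" "AE x in lborel. x \<in> \<Omega> \<longrightarrow> g x = w x"
    using assms by (auto simp: borel_version_def)
  then have "AE x in lborel. x \<in> \<Omega> \<longrightarrow> f x - g x = u x - w x" by eventually_elim auto
  then show ?thesis using assms by (simp add: borel_version_def)
qed

lemma has_weak_deriv_minus_smooth:
  assumes \<Omega>: "open \<Omega>" "bounded \<Omega>" and P: "smooth P"
    and f: "borel_version \<Omega> v f" and g: "borel_version \<Omega> w g" and fg: "borel_weak_deriv \<Omega> \<delta> f g"
  shows "has_weak_deriv \<Omega> \<delta> (\<lambda>x. v x - P x) (\<lambda>x. w x - multi_partial \<delta> P x)"
proof -
  have \<Omega>b: "\<Omega> \<in> sets borel" using \<Omega> by simp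
  note PB = borel_version_smooth[OF \<Omega> P] and DB = borel_version_smooth[OF \<Omega> smooth_multi_partial[OF P, of \<delta>]]
  note B1 = borel_version_minus[OF f PB] and B2 = borel_version_minus[OF g DB]
  note I1 = borel_version_integrable[OF \<Omega>b B1] and I2 = borel_version_integrable[OF \<Omega>b B2]
  have fi: "integrable lborel f" "integrable lborel g"
    using f g by (auto simp: borel_version_def)
  show ?thesis
    unfolding has_weak_deriv_def
  proof (intro conjI allI impI set_integrable_imp_locally_integrable I1 I2)
    fix \<phi> assume \<phi>: "test_function \<Omega> \<phi>"
    note \<phi>d = test_function_multi_partial[OF \<phi>, of \<delta>]
    have ti: "integrable lborel (\<lambda>x. h x * \<psi> x)" if "integrable lborel h" "test_function \<Omega> \<psi>" for h \<psi>
      using dilated_conv_integrable[OF that, of 0 1] by simp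
    have cut: "(\<lambda>x. (h x - indicator \<Omega> x * Q x) * \<psi> x) = (\<lambda>x. h x * \<psi> x - Q x * \<psi> x)" if "test_function \<Omega> \<psi>" for h Q \<psi> :: "real^2 \<Rightarrow> real"
      using test_function_zero[OF that] by (auto simp: fun_eq_iff algebra_simps split: split_indicator)
    have "(LINT x:\<Omega>|lebesgue. (v x - P x) * multi_partial \<delta> \<phi> x) = (\<integral>x. (f x - indicator \<Omega> x * P x) * multi_partial \<delta> \<phi> x \<partial>lborel)"
      by (rule set_integral_borel_version[OF \<Omega>b I1 B1 test_function_borel[OF \<phi>d]])
    also have "\<dots> = (\<integral>x. f x * multi_partial \<delta> \<phi> x \<partial>lborel) - (\<integral>x. P x * multi_partial \<delta> \<phi> x \<partial>lborel)"
      unfolding cut[OF \<phi>d]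
      by (rule Bochner_Integration.integral_diff[OF ti[OF fi(1) \<phi>d] test_function_integrable[OF test_function_smooth_mult[OF P \<phi>d]]])
    also have "\<dots> = (- 1) ^ mi_order \<delta> * (\<integral>x. g x * \<phi> x \<partial>lborel) - (- 1) ^ mi_order \<delta> * (\<integral>x. multi_partial \<delta> P x * \<phi> x \<partial>lborel)"
      using fg \<phi> unfolding borel_weak_deriv_def integration_by_parts_multi[OF P \<phi>] by simp
    also have "\<dots> = (- 1) ^ mi_order \<delta> * (\<integral>x. g x * \<phi> x - multi_partial \<delta> P x * \<phi> x \<partial>lborel)"
      using Bochner_Integration.integral_diff[OF ti[OF fi(2) \<phi>] test_function_integrable[OF test_function_smooth_mult[OF smooth_multi_partial[OF P, of \<delta>] \<phi>]]]
      by (simp add: right_diff_distrib)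
    also have "(\<integral>x. g x * \<phi> x - multi_partial \<delta> P x * \<phi> x \<partial>lborel) = (\<integral>x. (g x - indicator \<Omega> x * multi_partial \<delta> P x) * \<phi> x \<partial>lborel)"
      by (simp only: cut[OF \<phi>])
    also have "\<dots> = (LINT x:\<Omega>|lebesgue. (w x - multi_partial \<delta> P x) * \<phi> x)"
      by (rule set_integral_borel_version[OF \<Omega>b I2 B2 test_function_borel[OF \<phi>], symmetric])
    finally show "(LINT x:\<Omega>|lebesgue. (v x - P x) * multi_partial \<delta> \<phi> x) = (- 1) ^ mi_order \<delta> * (LINT x:\<Omega>|lebesgue. (w x - multi_partial \<delta> P x) * \<phi> x)" .
  qed
qed

lemma weak_deriv_AE:
  assumes \<Omega>: "open \<Omega>" and w: "has_weak_deriv \<Omega> \<delta> u w"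
  shows "AE x in lborel. x \<in> \<Omega> \<longrightarrow> weak_deriv \<Omega> \<delta> u x = w x"
proof -
  have "has_weak_deriv \<Omega> \<delta> u (weak_deriv \<Omega> \<delta> u)" unfolding weak_deriv_def by (rule someI[where P = "has_weak_deriv \<Omega> \<delta> u", OF w])
  then show ?thesis by (rule weak_deriv_unique[OF \<Omega> _ w])
qed

lemma sobolev_borel_derivs:
  assumes \<Omega>: "open \<Omega>" "bounded \<Omega>" and p: "1 \<le> p" and v: "v \<in> sobolev_space n p \<Omega>"
  obtains G w where "borel_version \<Omega> v (G (0, 0))"
    "\<And>\<gamma>. mi_order \<gamma> \<le> n \<Longrightarrow> w \<gamma> \<in> Lp_space p \<Omega>"
    "\<And>\<gamma>. mi_order \<gamma> \<le> n \<Longrightarrow> borel_version \<Omega> (w \<gamma>) (G \<gamma>)"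
    "\<And>\<gamma>. mi_order \<gamma> \<le> n \<Longrightarrow> borel_weak_deriv \<Omega> \<gamma> (G (0, 0)) (G \<gamma>)"
    "\<And>\<gamma>. mi_order \<gamma> \<le> n \<Longrightarrow> has_weak_deriv \<Omega> \<gamma> v (w \<gamma>)"
proof -
  have \<Omega>b: "\<Omega> \<in> sets borel" using \<Omega> by simp
  have "\<forall>\<gamma>\<in>{\<gamma>. mi_order \<gamma> \<le> n}. \<exists>w. w \<in> Lp_space p \<Omega> \<and> has_weak_deriv \<Omega> \<gamma> v w"
    using v unfolding sobolev_space_def by blast
  from bchoice[OF this] obtain w where w: "\<And>\<gamma>. mi_order \<gamma> \<le> n \<Longrightarrow> w \<gamma> \<in> Lp_space p \<Omega>"
    "\<And>\<gamma>. mi_order \<gamma> \<le> n \<Longrightarrow> has_weak_deriv \<Omega> \<gamma> v (w \<gamma>)" by blast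
  have vL: "v \<in> Lp_space p \<Omega>" using v unfolding sobolev_space_def by blast
  have vi: "set_integrable lebesgue \<Omega> v" by (rule Lp_set_integrable[OF \<Omega> p vL])
  have wi: "set_integrable lebesgue \<Omega> (w \<gamma>)" if "mi_order \<gamma> \<le> n" for \<gamma>
    by (rule Lp_set_integrable[OF \<Omega> p w(1)[OF that]])
  have "\<forall>\<gamma>\<in>{\<gamma>. mi_order \<gamma> \<le> n}. \<exists>g. borel_version \<Omega> (w \<gamma>) g"
    using exists_borel_version[OF \<Omega>b wi] by blast
  from bchoice[OF this] obtain G where G: "\<And>\<gamma>. mi_order \<gamma> \<le> n \<Longrightarrow> borel_version \<Omega> (w \<gamma>) (G \<gamma>)" by blast
  have o0: "mi_order (0, 0) \<le> n" by (simp add: mi_order_def)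
  \<comment> \<open>The derivative \<open>w (0, 0)\<close> of order zero was chosen arbitrarily;
    uniqueness shows that its Borel version is also one of \<open>v\<close>.\<close>
  have "has_weak_deriv \<Omega> (0, 0) v v"
    using w(2)[OF o0] by (simp add: has_weak_deriv_def mi_order_def multi_partial_def)
  then have ae: "AE x in lborel. x \<in> \<Omega> \<longrightarrow> w (0, 0) x = v x"
    by (rule weak_deriv_unique[OF \<Omega>(1) w(2)[OF o0]])
  have G0: "borel_version \<Omega> v (G (0, 0))"
  proof -
    have "AE x in lborel. x \<in> \<Omega> \<longrightarrow> G (0, 0) x = w (0, 0) x" using G[OF o0] by (simp add: borel_version_def)
    with ae have "AE x in lborel. x \<in> \<Omega> \<longrightarrow> G (0, 0) x = v x" by eventually_elim auto
    then show ?thesis using G[OF o0] by (simp add: borel_version_def)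
  qed
  have "borel_weak_deriv \<Omega> \<gamma> (G (0, 0)) (G \<gamma>)" if "mi_order \<gamma> \<le> n" for \<gamma>
    by (rule has_weak_deriv_borel[OF \<Omega>(1) w(2)[OF that] vi wi[OF that] G0 G[OF that]])
  then show ?thesis using that[of G w] G0 w G by blast
qed

section \<open>Norms computed from Borel versions\<close>

lemma Lp_norm_finite:
  assumes \<Omega>: "\<Omega> \<in> sets borel" and q: "1 \<le> q" and g: "g \<in> borel_measurable borel"
    and ae: "AE x in lborel. x \<in> \<Omega> \<longrightarrow> g x = f x"
  shows "Lp_norm (ereal q) \<Omega> f powr q = enn2real (\<integral>\<^sup>+x. qpow q (g x) * indicator \<Omega> x \<partial>lborel)"
proof -
  have gl: "g \<in> borel_measurable (lebesgue_on \<Omega>)"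
    by (intro measurable_restrict_space1 measurable_completion) (use g in simp)
  have fm [measurable]: "f \<in> borel_measurable (lebesgue_on \<Omega>)"
    by (rule borel_measurable_lebesgue_on_AE[OF \<Omega> gl ae])
  \<comment> \<open>This holds without integrability: a divergent Bochner integral has the default
    value 0, and so has \<open>enn2real\<close> at infinity.\<close>
  have "(LINT x|lebesgue_on \<Omega>. \<bar>f x\<bar> powr q) = enn2real (\<integral>\<^sup>+x. qpow q (f x) \<partial>lebesgue_on \<Omega>)"
    unfolding qpow_def by (rule integral_eq_nn_integral) auto
  also have "(\<integral>\<^sup>+x. qpow q (f x) \<partial>lebesgue_on \<Omega>) = (\<integral>\<^sup>+x. qpow q (f x) * indicator \<Omega> x \<partial>lborel)"
    by (rule nn_integral_lebesgue_on[OF \<Omega>])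
  also have "\<dots> = (\<integral>\<^sup>+x. qpow q (g x) * indicator \<Omega> x \<partial>lborel)"
    using ae by (intro nn_integral_cong_AE) (auto elim!: AE_mp split: split_indicator)
  finally have "(LINT x|lebesgue_on \<Omega>. \<bar>f x\<bar> powr q) = enn2real (\<integral>\<^sup>+x. qpow q (g x) * indicator \<Omega> x \<partial>lborel)" .
  then show ?thesis using q by (simp add: Lp_norm_def powr_powr)
qed

lemma AE_lebesgue_on_iff:
  assumes "\<Omega> \<in> sets borel"
  shows "(AE x in lebesgue_on \<Omega>. P x) \<longleftrightarrow> (AE x in lborel. x \<in> \<Omega> \<longrightarrow> P x)"
  using assms by (subst AE_restrict_space_iff) (auto simp: AE_completion_iff)

text \<open>Positive measure makes the essential supremum of a nonnegative function nonnegative, and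
  membership of \<open>f\<close> makes it finite, so the conversion to a real number loses
  nothing.\<close>

lemma Lp_norm_infinity:
  assumes \<Omega>: "\<Omega> \<in> sets borel" and pos: "emeasure lborel \<Omega> \<noteq> 0" and f: "f \<in> Lp_space \<infinity> \<Omega>"
    and ae: "AE x in lborel. x \<in> \<Omega> \<longrightarrow> f x = g x"
  shows "0 \<le> Lp_norm \<infinity> \<Omega> g" "AE x in lborel. x \<in> \<Omega> \<longrightarrow> \<bar>g x\<bar> \<le> Lp_norm \<infinity> \<Omega> g"
proof -
  let ?M = "lebesgue_on \<Omega>"
  let ?E = "esssup ?M (\<lambda>x. ereal \<bar>g x\<bar>)"
  have fm: "f \<in> borel_measurable ?M" using f by (simp add: Lp_space_def)
  have gm [measurable]: "g \<in> borel_measurable ?M"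
    by (rule borel_measurable_lebesgue_on_AE[OF \<Omega> fm ae])
  have "AE x in ?M. ereal \<bar>f x\<bar> = ereal \<bar>g x\<bar>"
    unfolding AE_lebesgue_on_iff[OF \<Omega>] using ae by eventually_elim auto
  then have "esssup ?M (\<lambda>x. ereal \<bar>f x\<bar>) = ?E" using fm gm by (intro esssup_AE_cong) auto
  then have fin: "?E < \<infinity>" using f by (simp add: Lp_space_def)
  have M0: "emeasure ?M (space ?M) \<noteq> 0"
    using pos \<Omega> by (simp add: emeasure_restrict_space space_restrict_space)
  have "esssup ?M (\<lambda>x. ereal 0) \<le> ?E" by (intro esssup_mono) auto
  then have E0: "0 \<le> ?E" by (simp add: esssup_const[OF M0] zero_ereal_def)
  then show "0 \<le> Lp_norm \<infinity> \<Omega> g" by (simp add: Lp_norm_def real_of_ereal_pos)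
  have E: "ereal (real_of_ereal ?E) = ?E" using fin E0 by (cases ?E) auto
  have "AE x in ?M. \<bar>g x\<bar> \<le> real_of_ereal ?E"
    using esssup_AE[of "\<lambda>x. ereal \<bar>g x\<bar>" ?M] by eventually_elim (metis E ereal_less_eq(3))
  then show "AE x in lborel. x \<in> \<Omega> \<longrightarrow> \<bar>g x\<bar> \<le> Lp_norm \<infinity> \<Omega> g"
    unfolding AE_lebesgue_on_iff[OF \<Omega>] by (simp add: Lp_norm_def)
qed

lemma Lp_norm_infinity_le:
  assumes \<Omega>: "\<Omega> \<in> sets borel" and g: "g \<in> borel_measurable (lebesgue_on \<Omega>)" and L: "0 \<le> L"
    and ae: "AE x in lborel. x \<in> \<Omega> \<longrightarrow> \<bar>g x\<bar> \<le> L"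
  shows "Lp_norm \<infinity> \<Omega> g \<le> L"
proof -
  have "esssup (lebesgue_on \<Omega>) (\<lambda>x. ereal \<bar>g x\<bar>) \<le> ereal L"
  proof (rule esssup_I)
    show "(\<lambda>x. ereal \<bar>g x\<bar>) \<in> borel_measurable (lebesgue_on \<Omega>)" using g by measurable
    show "AE x in lebesgue_on \<Omega>. ereal \<bar>g x\<bar> \<le> ereal L"
      unfolding AE_lebesgue_on_iff[OF \<Omega>] using ae by simp
  qed
  then show ?thesis using L
    by (cases "esssup (lebesgue_on \<Omega>) (\<lambda>x. ereal \<bar>g x\<bar>)") (auto simp: Lp_norm_def)
qed

text \<open>Chebyshev's inequality with exponent \<open>q \<rightarrow> \<infinity>\<close>: this is where it matters that the constants of the
  \<open>L\<^sup>q\<close> estimates are \<open>q\<close>-th powers.\<close>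

lemma AE_le_of_qpow_bounds:
  fixes H :: "real^2 \<Rightarrow> real"
  assumes \<Omega> [measurable]: "\<Omega> \<in> sets borel" and H [measurable]: "H \<in> borel_measurable borel" and L: "0 \<le> L" and c: "0 \<le> c"
    and b: "\<And>q. 1 \<le> q \<Longrightarrow> (\<integral>\<^sup>+x. qpow q (H x) * indicator \<Omega> x \<partial>lborel) \<le> ennreal c * qpow q L"
  shows "AE x in lborel. x \<in> \<Omega> \<longrightarrow> \<bar>H x\<bar> \<le> L"
proof -
  have e: "AE x in lborel. x \<in> \<Omega> \<longrightarrow> \<bar>H x\<bar> \<le> L + e" if e: "0 < e" for e
  proof -
    define A where "A = {x \<in> space lborel. x \<in> \<Omega> \<and> L + e < \<bar>H x\<bar>}"
    have [measurable]: "A \<in> sets borel" unfolding A_def by measurable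
    have le: "emeasure lborel A \<le> ennreal (c * (L / (L + e)) ^ Suc n)" for n
    proof -
      let ?q = "real (Suc n)"
      have q: "1 \<le> ?q" by simp
      have pos: "0 < (L + e) powr ?q" using L e by simp
      have "ennreal ((L + e) powr ?q) * emeasure lborel A = (\<integral>\<^sup>+x. ennreal ((L + e) powr ?q) * indicator A x \<partial>lborel)"
        by (simp add: nn_integral_cmult_indicator)
      also have "\<dots> \<le> (\<integral>\<^sup>+x. qpow ?q (H x) * indicator \<Omega> x \<partial>lborel)"
        unfolding qpow_def using L e
        by (intro nn_integral_mono) (auto simp: A_def split: split_indicator intro!: ennreal_leI powr_mono2)
      also have "\<dots> \<le> ennreal c * qpow ?q L" by (rule b[OF q])
      finally have 1: "ennreal ((L + e) powr ?q) * emeasure lborel A \<le> ennreal c * qpow ?q L" .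
      have "emeasure lborel A = ennreal (1 / (L + e) powr ?q) * (ennreal ((L + e) powr ?q) * emeasure lborel A)"
        using pos by (simp add: mult.assoc[symmetric] ennreal_mult[symmetric])
      also have "\<dots> \<le> ennreal (1 / (L + e) powr ?q) * (ennreal c * qpow ?q L)"
        by (intro mult_left_mono 1) simp
      also have "ennreal c * qpow ?q L = ennreal (c * L powr ?q)"
        using L c by (simp only: qpow_def abs_of_nonneg ennreal_mult[OF c powr_ge_zero])
      also have "ennreal (1 / (L + e) powr ?q) * ennreal (c * L powr ?q) = ennreal (1 / (L + e) powr ?q * (c * L powr ?q))"
        using c by (intro ennreal_mult[symmetric]) auto
      also have "1 / (L + e) powr ?q * (c * L powr ?q) = c * (L / (L + e)) ^ Suc n"
        using L e by (simp add: powr_realpow' power_divide del: of_nat_Suc power_Suc)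
      finally show ?thesis .
    qed
    have "(\<lambda>n. (L / (L + e)) ^ n) \<longlonglongrightarrow> 0" using L e by (intro LIMSEQ_realpow_zero) auto
    then have "(\<lambda>n. c * (L / (L + e)) ^ Suc n) \<longlonglongrightarrow> c * 0"
      by (intro tendsto_mult tendsto_const LIMSEQ_Suc)
    then have "(\<lambda>n. ennreal (c * (L / (L + e)) ^ Suc n)) \<longlonglongrightarrow> ennreal (c * 0)" by (rule tendsto_ennrealI)
    then have "emeasure lborel A \<le> ennreal (c * 0)"
      by (rule LIMSEQ_le_const) (use le in blast)
    then have "A \<in> null_sets lborel" by (simp add: null_sets_def)
    then have "AE x in lborel. x \<notin> A" by (rule AE_not_in)
    then show ?thesis by eventually_elim (auto simp: A_def)
  qed
  have "AE x in lborel. \<forall>n. x \<in> \<Omega> \<longrightarrow> \<bar>H x\<bar> \<le> L + inverse (real (Suc n))"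
    unfolding AE_all_countable by (intro allI e) simp
  then show ?thesis
  proof eventually_elim
    case (elim x)
    show ?case
    proof
      assume x: "x \<in> \<Omega>"
      have "(\<lambda>n. L + inverse (real (Suc n))) \<longlonglongrightarrow> L + 0"
        by (intro tendsto_add tendsto_const LIMSEQ_inverse_real_of_nat)
      then have "\<bar>H x\<bar> \<le> L + 0" by (rule LIMSEQ_le_const) (use elim x in blast)
      then show "\<bar>H x\<bar> \<le> L" by simp
    qed
  qed
qed

text \<open>In the interior the set where the functions differ is open and null, hence empty;
  continuity extends the equality to the closure, which is the whole triangle.\<close>

lemma continuous_AE_unique:
  fixes u u' :: "real^2 \<Rightarrow> real"
  assumes nc: "\<not> collinear {x1, x2, x3}"
    and u: "continuous_on (closed_triangle x1 x2 x3) u" "continuous_on (closed_triangle x1 x2 x3) u'"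
    and ae: "AE x in lborel. x \<in> interior (closed_triangle x1 x2 x3) \<longrightarrow> u x = u' x"
    and y: "y \<in> closed_triangle x1 x2 x3"
  shows "u y = u' y"
proof -
  let ?K = "closed_triangle x1 x2 x3"
  let ?\<Omega> = "interior ?K"
  let ?d = "\<lambda>x. u x - u' x"
  have cd: "continuous_on ?K ?d" by (intro continuous_intros u)
  have cl: "closure ?\<Omega> = ?K" by (rule closed_triangle_props(4)[OF nc])
  define A where "A = ?\<Omega> \<inter> ?d -` (- {0})"
  have opA: "open A"
    unfolding A_def by (rule continuous_open_preimage[OF continuous_on_subset[OF cd interior_subset]]) auto
  have "A = {}"
  proof (rule ccontr)
    assume "A \<noteq> {}"
    then have "\<not> negligible A" by (rule open_not_negligible[OF opA])
    moreover have "AE x in lborel. x \<notin> A" using ae by eventually_elim (auto simp: A_def)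
    then have "A \<in> null_sets lborel" using opA by (simp add: AE_iff_null_sets)
    then have "negligible A" by (simp add: negligible_iff_null_sets null_sets_completionI)
    ultimately show False by simp
  qed
  then have z: "\<And>x. x \<in> ?\<Omega> \<Longrightarrow> ?d x = 0" by (auto simp: A_def)
  have "?d y = 0"
    by (rule continuous_constant_on_closure[of ?\<Omega> ?d 0 y]) (use cd z y cl in auto)
  then show ?thesis by simp
qed

lemma borel_version_nn_integral:
  assumes q: "1 \<le> q" and g: "borel_version \<Omega> w g"
  shows "(\<integral>\<^sup>+x. qpow q (g x) \<partial>lborel) = (\<integral>\<^sup>+x. qpow q (w x) * indicator \<Omega> x \<partial>lborel)"
proof (rule nn_integral_cong_AE)
  have "AE x in lborel. x \<in> \<Omega> \<longrightarrow> g x = w x" using g by (simp add: borel_version_def)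
  then show "AE x in lborel. qpow q (g x) = qpow q (w x) * indicator \<Omega> x"
    by eventually_elim (use g q in \<open>auto simp: borel_version_def qpow_def split: split_indicator\<close>)
qed

text \<open>The bound holds for each multi-index of order \<open>m\<close> separately; the factor
  \<open>Suc m\<close> is the number of these multi-indices.\<close>

lemma sobolev_seminorm_finite_le:
  assumes \<Omega>: "\<Omega> \<in> sets borel" and q: "1 \<le> q" and L: "0 \<le> L"
    and E: "\<And>\<delta>. mi_order \<delta> = m \<Longrightarrow> E \<delta> \<in> borel_measurable borel"
      "\<And>\<delta>. mi_order \<delta> = m \<Longrightarrow> AE x in lborel. x \<in> \<Omega> \<longrightarrow> E \<delta> x = weak_deriv \<Omega> \<delta> u x"
    and G: "\<And>\<gamma>. mi_order \<gamma> = n \<Longrightarrow> borel_version \<Omega> (w \<gamma>) (G \<gamma>)"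
      "\<And>\<gamma>. mi_order \<gamma> = n \<Longrightarrow> w \<gamma> \<in> Lp_space (ereal q) \<Omega>"
      "\<And>\<gamma>. mi_order \<gamma> = n \<Longrightarrow> AE x in lborel. x \<in> \<Omega> \<longrightarrow> G \<gamma> x = weak_deriv \<Omega> \<gamma> v x"
    and b: "\<And>\<delta>. mi_order \<delta> = m \<Longrightarrow>
      (\<integral>\<^sup>+x. qpow q (E \<delta> x) * indicator \<Omega> x \<partial>lborel) \<le> qpow q L * top_sum n (\<lambda>\<gamma>. \<integral>\<^sup>+x. qpow q (G \<gamma> x) \<partial>lborel)"
  shows "sobolev_seminorm m (ereal q) \<Omega> u \<le> real (Suc m) * L * sobolev_seminorm n (ereal q) \<Omega> v"
proof -
  let ?I = "\<lambda>\<gamma>. \<integral>\<^sup>+x. qpow q (G \<gamma> x) \<partial>lborel"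
  let ?s = "sobolev_seminorm n (ereal q) \<Omega> v"
  have fin: "?I \<gamma> < \<infinity>" if \<gamma>: "mi_order \<gamma> = n" for \<gamma>
  proof -
    have "integrable (lebesgue_on \<Omega>) (\<lambda>x. \<bar>w \<gamma> x\<bar> powr q)" using G(2)[OF \<gamma>] by (simp add: Lp_space_def)
    then have "(\<integral>\<^sup>+x. ennreal (norm (\<bar>w \<gamma> x\<bar> powr q)) \<partial>lebesgue_on \<Omega>) < \<infinity>"
      by (simp only: integrable_iff_bounded)
    then show ?thesis
      unfolding borel_version_nn_integral[OF q G(1)[OF \<gamma>]] nn_integral_lebesgue_on[OF \<Omega>, symmetric] by (simp add: qpow_def)
  qed
  have norm_v: "Lp_norm (ereal q) \<Omega> (weak_deriv \<Omega> \<gamma> v) powr q = enn2real (?I \<gamma>)" if \<gamma>: "mi_order \<gamma> = n" for \<gamma>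
  proof -
    have "(\<integral>\<^sup>+x. qpow q (G \<gamma> x) * indicator \<Omega> x \<partial>lborel) = ?I \<gamma>"
      using G(1)[OF \<gamma>] q by (intro nn_integral_cong) (auto simp: borel_version_def qpow_def split: split_indicator)
    moreover have "G \<gamma> \<in> borel_measurable borel" using G(1)[OF \<gamma>] by (auto simp: borel_version_def)
    ultimately show ?thesis using Lp_norm_finite[OF \<Omega> q _ G(3)[OF \<gamma>]] by simp
  qed
  define S where "S = (\<Sum>\<gamma> | mi_order \<gamma> = n. enn2real (?I \<gamma>))"
  have S0: "0 \<le> S" unfolding S_def by (intro sum_nonneg) simp
  have topS: "top_sum n ?I = ennreal S"
    unfolding top_sum_def S_def using fin by (subst sum_ennreal[symmetric]) auto
  have s: "?s = S powr (1 / q)"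
    unfolding sobolev_seminorm_def S_def by (simp add: norm_v)
  then have sq: "?s powr q = S" using S0 q by (simp add: powr_powr)
  have s0: "0 \<le> ?s" using s by simp
  have norm_u: "Lp_norm (ereal q) \<Omega> (weak_deriv \<Omega> \<delta> u) powr q \<le> (L * ?s) powr q" if \<delta>: "mi_order \<delta> = m" for \<delta>
  proof -
    have "(\<integral>\<^sup>+x. qpow q (E \<delta> x) * indicator \<Omega> x \<partial>lborel) \<le> ennreal (L powr q) * ennreal S"
      using b[OF \<delta>] unfolding topS using L by (simp add: qpow_def)
    also have "\<dots> = ennreal ((L * ?s) powr q)"
      using L s0 S0 by (simp add: ennreal_mult[symmetric] powr_mult sq)
    finally have "enn2real (\<integral>\<^sup>+x. qpow q (E \<delta> x) * indicator \<Omega> x \<partial>lborel) \<le> (L * ?s) powr q"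
      by (intro enn2real_leI) auto
    then show ?thesis using Lp_norm_finite[OF \<Omega> q E[OF \<delta>]] by simp
  qed
  have "(\<Sum>\<delta> | mi_order \<delta> = m. Lp_norm (ereal q) \<Omega> (weak_deriv \<Omega> \<delta> u) powr q) \<le> (\<Sum>\<delta> | mi_order \<delta> = m. (L * ?s) powr q)"
    by (intro sum_mono norm_u) simp
  also have "\<dots> = real (Suc m) * (L * ?s) powr q" by (simp add: card_mi_order_eq)
  \<comment> \<open>The number of multi-indices is at most its own \<open>q\<close>-th power, which
    keeps the factor independent of \<open>q\<close> after the root is taken.\<close>
  also have "\<dots> \<le> real (Suc m) powr q * (L * ?s) powr q"
    using powr_mono[OF q, of "real (Suc m)"] by (intro mult_right_mono) auto
  also have "\<dots> = (real (Suc m) * L * ?s) powr q"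
    using L s0 by (simp add: powr_mult mult.assoc)
  finally have "(\<Sum>\<delta> | mi_order \<delta> = m. Lp_norm (ereal q) \<Omega> (weak_deriv \<Omega> \<delta> u) powr q) powr (1 / q) \<le> ((real (Suc m) * L * ?s) powr q) powr (1 / q)"
    using q by (intro powr_mono2 sum_nonneg) auto
  also have "\<dots> = real (Suc m) * L * ?s"
    using q L s0 by (simp add: powr_powr)
  finally show ?thesis by (simp add: sobolev_seminorm_def)
qed

text \<open>The sum of the top integrals is at most \<open>c\<close> times the \<open>q\<close>-th
  power of the maximum seminorm, where \<open>c\<close> is the number of multi-indices times the
  area. Standing outside the power, \<open>c\<close> is lost as \<open>q\<close> grows.\<close>

lemma sobolev_seminorm_infinity_le:
  assumes \<Omega>: "\<Omega> \<in> sets borel" and pos: "emeasure lborel \<Omega> \<noteq> 0" "emeasure lborel \<Omega> < \<infinity>" and L: "0 \<le> L"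
    and E: "\<And>\<delta>. mi_order \<delta> = m \<Longrightarrow> E \<delta> \<in> borel_measurable borel"
      "\<And>\<delta>. mi_order \<delta> = m \<Longrightarrow> AE x in lborel. x \<in> \<Omega> \<longrightarrow> E \<delta> x = weak_deriv \<Omega> \<delta> u x"
    and G: "\<And>\<gamma>. mi_order \<gamma> = n \<Longrightarrow> borel_version \<Omega> (w \<gamma>) (G \<gamma>)"
      "\<And>\<gamma>. mi_order \<gamma> = n \<Longrightarrow> w \<gamma> \<in> Lp_space \<infinity> \<Omega>"
      "\<And>\<gamma>. mi_order \<gamma> = n \<Longrightarrow> AE x in lborel. x \<in> \<Omega> \<longrightarrow> G \<gamma> x = weak_deriv \<Omega> \<gamma> v x"
    and b: "\<And>\<delta> q. mi_order \<delta> = m \<Longrightarrow> 1 \<le> q \<Longrightarrow>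
      (\<integral>\<^sup>+x. qpow q (E \<delta> x) * indicator \<Omega> x \<partial>lborel) \<le> qpow q L * top_sum n (\<lambda>\<gamma>. \<integral>\<^sup>+x. qpow q (G \<gamma> x) \<partial>lborel)"
  shows "sobolev_seminorm m \<infinity> \<Omega> u \<le> L * sobolev_seminorm n \<infinity> \<Omega> v"
    and "0 \<le> sobolev_seminorm n \<infinity> \<Omega> v"
proof -
  let ?B = "sobolev_seminorm n \<infinity> \<Omega> v"
  have ne: "{\<gamma>. mi_order \<gamma> = j} \<noteq> {}" for j by (simp add: mi_order_eq_image)
  have wv: "AE x in lborel. x \<in> \<Omega> \<longrightarrow> w \<gamma> x = weak_deriv \<Omega> \<gamma> v x" if \<gamma>: "mi_order \<gamma> = n" for \<gamma>
  proof -
    have "AE x in lborel. x \<in> \<Omega> \<longrightarrow> G \<gamma> x = w \<gamma> x" using G(1)[OF \<gamma>] by (simp add: borel_version_def)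
    with G(3)[OF \<gamma>] show ?thesis by eventually_elim auto
  qed
  note inf = Lp_norm_infinity[OF \<Omega> pos(1) G(2) wv]
  have le_B: "Lp_norm \<infinity> \<Omega> (weak_deriv \<Omega> \<gamma> v) \<le> ?B" if "mi_order \<gamma> = n" for \<gamma>
    unfolding sobolev_seminorm_def using that by (auto intro: Max_ge)
  show B0: "0 \<le> ?B"
    using inf(1)[of "(n, 0)"] le_B[of "(n, 0)"] by (simp add: mi_order_def)
  define c where "c = real (Suc n) * measure lborel \<Omega>"
  have c0: "0 \<le> c" by (simp add: c_def)
  have top: "top_sum n (\<lambda>\<gamma>. \<integral>\<^sup>+x. qpow q (G \<gamma> x) \<partial>lborel) \<le> ennreal c * qpow q ?B" if q: "1 \<le> q" for q
  proof -
    have "(\<integral>\<^sup>+x. qpow q (G \<gamma> x) \<partial>lborel) \<le> qpow q ?B * emeasure lborel \<Omega>" if \<gamma>: "mi_order \<gamma> = n" for \<gamma>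
    proof -
      have "AE x in lborel. qpow q (G \<gamma> x) \<le> qpow q ?B * indicator \<Omega> x"
        using G(3)[OF \<gamma>] inf(2)[OF \<gamma> \<gamma>]
      proof eventually_elim
        case (elim x)
        show ?case
        proof (cases "x \<in> \<Omega>")
          case True
          then have "\<bar>G \<gamma> x\<bar> \<le> \<bar>?B\<bar>" using elim le_B[OF \<gamma>] B0 by auto
          then show ?thesis using True q by (simp add: qpow_mono)
        next
          case False
          then show ?thesis using G(1)[OF \<gamma>] q by (simp add: borel_version_def qpow_def)
        qed
      qed
      then have "(\<integral>\<^sup>+x. qpow q (G \<gamma> x) \<partial>lborel) \<le> (\<integral>\<^sup>+x. qpow q ?B * indicator \<Omega> x \<partial>lborel)"
        by (rule nn_integral_mono_AE)
      also have "\<dots> = qpow q ?B * emeasure lborel \<Omega>" using \<Omega> by (simp add: nn_integral_cmult_indicator)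
      finally show ?thesis .
    qed
    then have "top_sum n (\<lambda>\<gamma>. \<integral>\<^sup>+x. qpow q (G \<gamma> x) \<partial>lborel) \<le> (\<Sum>\<gamma> | mi_order \<gamma> = n. qpow q ?B * emeasure lborel \<Omega>)"
      unfolding top_sum_def by (intro sum_mono) simp
    also have "\<dots> = of_nat (Suc n) * (qpow q ?B * emeasure lborel \<Omega>)" by (simp add: card_mi_order_eq)
    also have "\<dots> = ennreal (real (Suc n)) * ennreal (measure lborel \<Omega>) * qpow q ?B"
      unfolding emeasure_eq_ennreal_measure[OF pos(2)[unfolded infinity_ennreal_def less_top[symmetric]]]
        ennreal_of_nat_eq_real_of_nat by (simp only: ac_simps)
    also have "ennreal (real (Suc n)) * ennreal (measure lborel \<Omega>) = ennreal c"
      unfolding c_def by (intro ennreal_mult[symmetric]) auto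
    finally show ?thesis .
  qed
  have "Lp_norm \<infinity> \<Omega> (weak_deriv \<Omega> \<delta> u) \<le> L * ?B" if \<delta>: "mi_order \<delta> = m" for \<delta>
  proof (rule Lp_norm_infinity_le[OF \<Omega>])
    have El: "E \<delta> \<in> borel_measurable (lebesgue_on \<Omega>)"
      by (intro measurable_restrict_space1 measurable_completion) (use E(1)[OF \<delta>] in simp)
    show "weak_deriv \<Omega> \<delta> u \<in> borel_measurable (lebesgue_on \<Omega>)"
      by (rule borel_measurable_lebesgue_on_AE[OF \<Omega> El E(2)[OF \<delta>]])
    show LB: "0 \<le> L * ?B" using L B0 by simp
    have "AE x in lborel. x \<in> \<Omega> \<longrightarrow> \<bar>E \<delta> x\<bar> \<le> L * ?B"
    proof (rule AE_le_of_qpow_bounds[OF \<Omega> E(1)[OF \<delta>] LB c0])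
      fix q :: real assume q: "1 \<le> q"
      have "(\<integral>\<^sup>+x. qpow q (E \<delta> x) * indicator \<Omega> x \<partial>lborel) \<le> qpow q L * (ennreal c * qpow q ?B)"
        by (rule order.trans[OF b[OF \<delta> q] mult_left_mono[OF top[OF q]]]) simp
      also have "\<dots> = ennreal c * (qpow q L * qpow q ?B)" by (simp only: mult.left_commute)
      also have "qpow q L * qpow q ?B = qpow q (L * ?B)"
        by (simp add: qpow_def abs_mult powr_mult ennreal_mult[symmetric])
      finally show "(\<integral>\<^sup>+x. qpow q (E \<delta> x) * indicator \<Omega> x \<partial>lborel) \<le> ennreal c * qpow q (L * ?B)" .
    qed
    with E(2)[OF \<delta>] show "AE x in lborel. x \<in> \<Omega> \<longrightarrow> \<bar>weak_deriv \<Omega> \<delta> u x\<bar> \<le> L * ?B" by eventually_elim auto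
  qed
  then show "sobolev_seminorm m \<infinity> \<Omega> u \<le> L * ?B"
    unfolding sobolev_seminorm_def[of m] using ne[of m] by simp
qed

text \<open>Collects what the seminorms need. The integral estimate is provided for every finite
  \<open>q\<close>, whatever \<open>p\<close> is, because the case \<open>p = \<infinity>\<close>
  uses all of them.\<close>

lemma interpolation_error_data:
  assumes nc: "\<not> collinear {x1, x2, x3}" and k: "1 \<le> k" and p: "1 \<le> p"
    and v: "v \<in> sobolev_space (k + 1) p (interior (closed_triangle x1 x2 x3))"
  obtains G w where
    "\<And>\<gamma>. mi_order \<gamma> \<le> k + 1 \<Longrightarrow> borel_version (interior (closed_triangle x1 x2 x3)) (w \<gamma>) (G \<gamma>)"
    "\<And>\<gamma>. mi_order \<gamma> \<le> k + 1 \<Longrightarrow> w \<gamma> \<in> Lp_space p (interior (closed_triangle x1 x2 x3))"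
    "\<And>\<gamma>. mi_order \<gamma> \<le> k + 1 \<Longrightarrow> AE x in lborel. x \<in> interior (closed_triangle x1 x2 x3) \<longrightarrow>
       G \<gamma> x = weak_deriv (interior (closed_triangle x1 x2 x3)) \<gamma> v x"
    "smooth (sobolev_interp k x1 x2 x3 v)"
    "\<And>\<delta>. mi_order \<delta> \<le> k \<Longrightarrow> AE x in lborel. x \<in> interior (closed_triangle x1 x2 x3) \<longrightarrow>
       G \<delta> x - multi_partial \<delta> (sobolev_interp k x1 x2 x3 v) x
         = weak_deriv (interior (closed_triangle x1 x2 x3)) \<delta> (\<lambda>x. v x - sobolev_interp k x1 x2 x3 v x) x"
    "\<And>\<delta> q. mi_order \<delta> \<le> k \<Longrightarrow> 1 \<le> q \<Longrightarrow>
      (\<integral>\<^sup>+x. qpow q (G \<delta> x - multi_partial \<delta> (sobolev_interp k x1 x2 x3 v) x)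
         * indicator (interior (closed_triangle x1 x2 x3)) x \<partial>lborel)
      \<le> qpow q (interp_const k * (circumradius x1 x2 x3 / longest_edge x1 x2 x3) ^ mi_order \<delta>
           * longest_edge x1 x2 x3 ^ (k + 1 - mi_order \<delta>))
         * top_sum (k + 1) (\<lambda>\<gamma>. \<integral>\<^sup>+x. qpow q (G \<gamma> x) \<partial>lborel)"
proof -
  let ?K = "closed_triangle x1 x2 x3"
  let ?\<Omega> = "interior ?K"
  let ?P = "sobolev_interp k x1 x2 x3 v"
  note tri = closed_triangle_props[OF nc]
  have op: "open ?\<Omega>" by simp
  have bd: "bounded ?\<Omega>" by (rule bounded_subset[OF compact_imp_bounded[OF tri(1)] interior_subset])
  have \<Omega>b: "?\<Omega> \<in> sets borel" by simp
  obtain \<eta> where \<eta>: "test_function ?\<Omega> \<eta>" "\<And>x. 0 \<le> \<eta> x" "(\<integral>x. \<eta> x \<partial>lborel) = 1"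
    using exists_mollifier[OF op tri(3)] by blast
  have mol: "mollifier ?\<Omega> \<eta>"
    by (rule mollifier.intro[OF op convex_interior[OF tri(2)] \<eta>])
  obtain G w where bv: "borel_version ?\<Omega> v (G (0, 0))"
    and wL: "\<And>\<gamma>. mi_order \<gamma> \<le> k + 1 \<Longrightarrow> w \<gamma> \<in> Lp_space p ?\<Omega>"
    and bG: "\<And>\<gamma>. mi_order \<gamma> \<le> k + 1 \<Longrightarrow> borel_version ?\<Omega> (w \<gamma>) (G \<gamma>)"
    and bw: "\<And>\<gamma>. mi_order \<gamma> \<le> k + 1 \<Longrightarrow> borel_weak_deriv ?\<Omega> \<gamma> (G (0, 0)) (G \<gamma>)"
    and hw: "\<And>\<gamma>. mi_order \<gamma> \<le> k + 1 \<Longrightarrow> has_weak_deriv ?\<Omega> \<gamma> v (w \<gamma>)"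
    using sobolev_borel_derivs[OF op bd p v] by metis
  have Gi: "integrable lborel (G \<gamma>)" if "mi_order \<gamma> \<le> k + 1" for \<gamma>
    using bG[OF that] by (simp add: borel_version_def)
  interpret sobolev_data x1 x2 x3 k G \<eta>
    by (rule sobolev_data.intro[OF nc k Gi bw mol])
  obtain u where u: "continuous_on ?K u" "AE x in lborel. x \<in> ?\<Omega> \<longrightarrow> u x = G (0, 0) x"
      "\<And>y. y \<in> ?K \<Longrightarrow> (\<lambda>n. V n y) \<longlonglongrightarrow> u y"
    using continuous_limit by blast
  have G0v: "AE x in lborel. x \<in> ?\<Omega> \<longrightarrow> G (0, 0) x = v x" using bv by (simp add: borel_version_def)
  have uv: "AE x in lborel. x \<in> ?\<Omega> \<longrightarrow> u x = v x" using u(2) G0v by eventually_elim auto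
  let ?r = "continuous_rep ?K v"
  have "continuous_on ?K u \<and> (AE x in lebesgue_on ?\<Omega>. u x = v x)"
    using u(1) uv unfolding AE_lebesgue_on_iff[OF \<Omega>b] by blast
  then have rep: "continuous_on ?K ?r \<and> (AE x in lebesgue_on ?\<Omega>. ?r x = v x)"
    unfolding continuous_rep_def by (rule someI[where P = "\<lambda>u. continuous_on ?K u \<and> (AE x in lebesgue_on ?\<Omega>. u x = v x)"])
  then have "AE x in lborel. x \<in> ?\<Omega> \<longrightarrow> ?r x = v x"
    unfolding AE_lebesgue_on_iff[OF \<Omega>b] by blast
  with uv have "AE x in lborel. x \<in> ?\<Omega> \<longrightarrow> u x = ?r x" by eventually_elim auto
  \<comment> \<open>\<open>continuous_rep\<close> is some continuous function equal to
    \<open>v\<close> almost everywhere; on \<open>K\<close> it must coincide with the limit of the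
    regularizations and therefore has the same node values.\<close>
  from continuous_AE_unique[OF nc u(1) conjunct1[OF rep] this]
  have V_lim: "(\<lambda>n. V n y) \<longlonglongrightarrow> ?r y" if "y \<in> ?K" for y using u(3)[OF that] that by simp
  have "?P \<in> poly_space k"
  proof -
    obtain l where l: "\<And>y. y \<in> lagrange_nodes k x1 x2 x3 \<Longrightarrow> l y \<in> poly_space k"
      "\<And>f. lagrange_interp k x1 x2 x3 f = (\<lambda>x. \<Sum>y\<in>lagrange_nodes k x1 x2 x3. f y * l y x)"
      using lagrange_interp_basis[OF nc k] by blast
    show ?thesis unfolding sobolev_interp_def l(2) by (intro poly_space_sum poly_space_cmult l(1))
  qed
  then have sm: "smooth ?P" by (rule poly_space_smooth)
  have wG: "AE x in lborel. x \<in> ?\<Omega> \<longrightarrow> G \<gamma> x = w \<gamma> x" if "mi_order \<gamma> \<le> k + 1" for \<gamma>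
    using bG[OF that] by (simp add: borel_version_def)
  have 3: "AE x in lborel. x \<in> ?\<Omega> \<longrightarrow> G \<gamma> x = weak_deriv ?\<Omega> \<gamma> v x" if \<gamma>: "mi_order \<gamma> \<le> k + 1" for \<gamma>
    using wG[OF \<gamma>] weak_deriv_AE[OF op hw[OF \<gamma>]] by eventually_elim auto
  have 5: "AE x in lborel. x \<in> ?\<Omega> \<longrightarrow> G \<delta> x - multi_partial \<delta> ?P x = weak_deriv ?\<Omega> \<delta> (\<lambda>x. v x - ?P x) x"
    if "mi_order \<delta> \<le> k" for \<delta>
  proof -
    have \<delta>: "mi_order \<delta> \<le> k + 1" using that by simp
    show ?thesis
      using wG[OF \<delta>] weak_deriv_AE[OF op has_weak_deriv_minus_smooth[OF op bd sm bv bG[OF \<delta>] bw[OF \<delta>]]]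
      by eventually_elim auto
  qed
  have 6: "(\<integral>\<^sup>+x. qpow q (G \<delta> x - multi_partial \<delta> ?P x) * indicator ?\<Omega> x \<partial>lborel)
      \<le> qpow q (interp_const k * (circumradius x1 x2 x3 / longest_edge x1 x2 x3) ^ mi_order \<delta>
           * longest_edge x1 x2 x3 ^ (k + 1 - mi_order \<delta>))
         * top_sum (k + 1) (\<lambda>\<gamma>. \<integral>\<^sup>+x. qpow q (G \<gamma> x) \<partial>lborel)"
    if "mi_order \<delta> \<le> k" "1 \<le> q" for \<delta> q
    unfolding sobolev_interp_def by (rule estimate[OF that(2) V_lim refl that(1)])
  show ?thesis by (rule that[OF bG wL 3 sm 5 6])
qed

lemma interp_const_nonneg: "0 \<le> interp_const k"
  by (simp add: interp_const_def)

lemma longest_edge_pos: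
  assumes "\<not> collinear {x1, x2, x3}"
  shows "0 < longest_edge x1 x2 x3"
proof -
  have "x1 \<noteq> x2" using assms by auto
  then have "0 < dist x1 x2" by simp
  also have "\<dots> \<le> longest_edge x1 x2 x3" by (simp add: longest_edge_def)
  finally show ?thesis .
qed

theorem theorem1p1:
  fixes p :: ereal and k :: nat
  assumes "1 \<le> p" and "1 \<le> k"
  shows "\<exists>C::real. \<forall>m::nat. m \<le> k \<longrightarrow>
    (\<forall>x1 x2 x3 :: real^2. \<not> collinear {x1, x2, x3} \<longrightarrow>
      (let \<Omega> = interior (closed_triangle x1 x2 x3);
           h = longest_edge x1 x2 x3;
           R = circumradius x1 x2 x3
       in \<forall>v \<in> sobolev_space (k + 1) p \<Omega>.
            sobolev_seminorm m p \<Omega> (\<lambda>x. v x - sobolev_interp k x1 x2 x3 v x)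
              \<le> C * (R / h) ^ m * h ^ (k + 1 - m) * sobolev_seminorm (k + 1) p \<Omega> v
          \<and> C * (R / h) ^ m * h ^ (k + 1 - m) * sobolev_seminorm (k + 1) p \<Omega> v
              = C * R ^ m * h powi (int k + 1 - 2 * int m) * sobolev_seminorm (k + 1) p \<Omega> v))"
proof (unfold Let_def, intro exI[of _ "real (Suc k) * interp_const k"] allI impI ballI conjI)
  fix m and x1 x2 x3 :: "real^2" and v
  assume m: "m \<le> k" and nc: "\<not> collinear {x1, x2, x3}"
  let ?\<Omega> = "interior (closed_triangle x1 x2 x3)"
  let ?h = "longest_edge x1 x2 x3"
  let ?R = "circumradius x1 x2 x3"
  \<comment> \<open>The factor \<open>Suc k\<close> majorizes the number \<open>Suc m\<close> of
    multi-indices for all \<open>m \<le> k\<close>, so one constant serves for every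
    \<open>m\<close>.\<close>
  let ?C = "real (Suc k) * interp_const k"
  let ?s = "sobolev_seminorm (k + 1) p ?\<Omega> v"
  assume v: "v \<in> sobolev_space (k + 1) p ?\<Omega>"
  have h: "0 < ?h" by (rule longest_edge_pos[OF nc])
  have R: "0 < ?R" by (rule circumradius_cross2(1)[OF nc])
  note tri = closed_triangle_props[OF nc]
  let ?L = "interp_const k * (?R / ?h) ^ m * ?h ^ (k + 1 - m)"
  have L: "0 \<le> ?L" using h R interp_const_nonneg[of k] by simp
  have \<Omega>: "?\<Omega> \<in> sets borel" by simp
  obtain G w where
    G: "\<And>\<gamma>. mi_order \<gamma> \<le> k + 1 \<Longrightarrow> borel_version ?\<Omega> (w \<gamma>) (G \<gamma>)"
    and w: "\<And>\<gamma>. mi_order \<gamma> \<le> k + 1 \<Longrightarrow> w \<gamma> \<in> Lp_space p ?\<Omega>"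
    and GD: "\<And>\<gamma>. mi_order \<gamma> \<le> k + 1 \<Longrightarrow> AE x in lborel. x \<in> ?\<Omega> \<longrightarrow> G \<gamma> x = weak_deriv ?\<Omega> \<gamma> v x"
    and sm: "smooth (sobolev_interp k x1 x2 x3 v)"
    and ED: "\<And>\<delta>. mi_order \<delta> \<le> k \<Longrightarrow> AE x in lborel. x \<in> ?\<Omega> \<longrightarrow>
       G \<delta> x - multi_partial \<delta> (sobolev_interp k x1 x2 x3 v) x
         = weak_deriv ?\<Omega> \<delta> (\<lambda>x. v x - sobolev_interp k x1 x2 x3 v x) x"
    and b: "\<And>\<delta> q. mi_order \<delta> \<le> k \<Longrightarrow> 1 \<le> q \<Longrightarrow>
      (\<integral>\<^sup>+x. qpow q (G \<delta> x - multi_partial \<delta> (sobolev_interp k x1 x2 x3 v) x) * indicator ?\<Omega> x \<partial>lborel)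
      \<le> qpow q (interp_const k * (?R / ?h) ^ mi_order \<delta> * ?h ^ (k + 1 - mi_order \<delta>))
         * top_sum (k + 1) (\<lambda>\<gamma>. \<integral>\<^sup>+x. qpow q (G \<gamma> x) \<partial>lborel)"
    proof (rule interpolation_error_data[OF nc assms(2,1) v], goal_cases)
    case (1 G w)
    from 1(2-) show ?case by (rule 1(1))
  qed
  let ?E = "\<lambda>\<delta> x. G \<delta> x - multi_partial \<delta> (sobolev_interp k x1 x2 x3 v) x"
  have E: "?E \<delta> \<in> borel_measurable borel" if "mi_order \<delta> = m" for \<delta>
  proof -
    have "integrable lborel (G \<delta>)" using G[of \<delta>] that m by (simp add: borel_version_def)
    then have [measurable]: "G \<delta> \<in> borel_measurable borel" by auto
    have [measurable]: "multi_partial \<delta> (sobolev_interp k x1 x2 x3 v) \<in> borel_measurable borel"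
      by (intro smooth_borel smooth_multi_partial sm)
    show ?thesis by measurable
  qed
  have bm: "(\<integral>\<^sup>+x. qpow q (?E \<delta> x) * indicator ?\<Omega> x \<partial>lborel) \<le> qpow q ?L * top_sum (k + 1) (\<lambda>\<gamma>. \<integral>\<^sup>+x. qpow q (G \<gamma> x) \<partial>lborel)"
    if "mi_order \<delta> = m" "1 \<le> q" for \<delta> q
    using b[of \<delta> q] that m by simp
  have EDm: "AE x in lborel. x \<in> ?\<Omega> \<longrightarrow> ?E \<delta> x = weak_deriv ?\<Omega> \<delta> (\<lambda>x. v x - sobolev_interp k x1 x2 x3 v x) x"
    if "mi_order \<delta> = m" for \<delta> using ED that m by simp
  have top: "mi_order \<gamma> = k + 1 \<Longrightarrow> mi_order \<gamma> \<le> k + 1" for \<gamma> by simp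
  have "sobolev_seminorm m p ?\<Omega> (\<lambda>x. v x - sobolev_interp k x1 x2 x3 v x) \<le> real (Suc m) * ?L * ?s \<and> 0 \<le> ?s"
  proof (cases "p = \<infinity>")
    case True
    have pos: "emeasure lborel ?\<Omega> \<noteq> 0"
    proof
      assume "emeasure lborel ?\<Omega> = 0"
      then have "negligible ?\<Omega>" by (simp add: negligible_iff_null_sets null_sets_completionI null_setsI)
      then show False using open_not_negligible[OF open_interior tri(3)] by blast
    qed
    have fin: "emeasure lborel ?\<Omega> < \<infinity>"
      using emeasure_bounded_finite[OF bounded_subset[OF compact_imp_bounded[OF tri(1)] interior_subset]] by simp
    note inf = sobolev_seminorm_infinity_le[OF \<Omega> pos fin L E EDm G[OF top] w[OF top, unfolded True] GD[OF top] bm]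
    \<comment> \<open>The maximum norm produces no counting factor; the bound is enlarged by
      \<open>Suc m\<close> so that both cases end in the same inequality.\<close>
    have "sobolev_seminorm m p ?\<Omega> (\<lambda>x. v x - sobolev_interp k x1 x2 x3 v x) \<le> 1 * ?L * ?s"
      using inf(1) unfolding True by simp
    also have "\<dots> \<le> real (Suc m) * ?L * ?s"
      using inf(2) L unfolding True by (intro mult_right_mono) auto
    finally show ?thesis using inf(2) unfolding True by blast
  next
    case False
    then obtain q where pq: "p = ereal q" and q: "1 \<le> q"
      using assms(1) by (cases p) (auto simp: one_ereal_def)
    have "0 \<le> ?s" by (simp add: sobolev_seminorm_def pq)
    then show ?thesis
      using sobolev_seminorm_finite_le[OF \<Omega> q L E EDm G[OF top] w[OF top, unfolded pq] GD[OF top] bm[OF _ q]]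
      unfolding pq by blast
  qed
  then have le: "sobolev_seminorm m p ?\<Omega> (\<lambda>x. v x - sobolev_interp k x1 x2 x3 v x) \<le> real (Suc m) * ?L * ?s" and s0: "0 \<le> ?s"
    by auto
  note le
  also have "real (Suc m) * ?L * ?s \<le> real (Suc k) * ?L * ?s"
    using m L s0 by (intro mult_right_mono) auto
  finally show "sobolev_seminorm m p ?\<Omega> (\<lambda>x. v x - sobolev_interp k x1 x2 x3 v x)
      \<le> ?C * (?R / ?h) ^ m * ?h ^ (k + 1 - m) * ?s" by (simp only: mult.assoc)
  \<comment> \<open>An integer power is required because the exponent k + 1 - 2 m may be negative;
    it is split into a natural power divided by h^m.\<close>
  have "?h powi (int k + 1 - 2 * int m) = ?h powi (int (k + 1 - m) - int m)"
    using m by (simp add: of_nat_diff algebra_simps)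
  also have "\<dots> = ?h ^ (k + 1 - m) / ?h ^ m"
    using h by (simp add: power_int_diff del: of_nat_diff)
  finally show "?C * (?R / ?h) ^ m * ?h ^ (k + 1 - m) * ?s = ?C * ?R ^ m * ?h powi (int k + 1 - 2 * int m) * ?s"
    by (simp add: power_divide)
qed

end
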